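(* Consider an observation-driven model of order $(p,q)$, $p,q\ge1$, at a fixed parameter value $\theta$ (dropped from the notation), with the notation and Conditions (A-3)–(A-8) written out in the context. Conditions (A-3), (A-4), (A-5), (A-6), (A-7) and (A-8) imply that there exists a unique probability distribution $\pi$ on $\mathsf{Z}$ (initial distribution of $Z_0$) which makes $\mathbb{P}_\pi$ shift invariant. Moreover it satisfies $\mathbb{E}_\pi[V_{\mathsf X}(X_0)]<\infty$. Hence, if these assumptions hold at each $\theta\in\Theta$ (with a function $V_{\mathsf X}$ common to all $\theta$), then for all $\theta\in\Theta$ there exists a unique (in law) stationary solution of the model equations, and for all $\theta\in\Theta$, $\pi^\theta_{\mathsf X}(V_{\mathsf X})<\infty$, where $\pi^\theta_{\mathsf X}$ is the law of $X_0$ under the stationary solution.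
   Context: Model. $(\mathsf X,\mathcal X)$, $(\mathsf Y,\mathcal Y)$, $(\mathsf U,\mathcal U)$ are measurable spaces, $\Theta$ a compact metric space, $\Upsilon:\mathsf Y\to\mathsf U$ measurable. For each $\theta\in\Theta$: $(x_{1:p},u_{1:q})\mapsto\tilde\psi^\theta_{u_{1:q}}(x_{1:p})$ is a measurable map $\mathsf X^p\times\mathsf U^q\to\mathsf X$, and $G^\theta$ is a probability kernel on $\mathsf X\times\mathcal Y$ with density $g^\theta(x;y)$ with respect to a $\sigma$-finite measure $\nu$ on $\mathsf Y$. The model is: for $k\ge0$, with $U_j=\Upsilon(Y_j)$ and $\mathcal F_k=\sigma(X_{(-p+1):k},Y_{(-q+1):(k-1)})$, $$Y_k\mid\mathcal F_k\sim G^\theta(X_k;\cdot),\qquad X_{k+1}=\tilde\psi^\theta_{U_{(k-q+1):k}}(X_{(k-p+1):k}).$$ Put $\mathsf Z=\mathsf X^p\times\mathsf U^{q-1}$ with the product $\sigma$-field and $Z_k=(X_{(k-p+1):k},U_{(k-q+1):(k-1)})\in\mathsf Z$; $\Pi_j(z)$ is the $j$-th entry of $z\in\mathsf Z$, $1\le j\le p+q-1$; $\Pi_j^{\otimes2}(z,z')=(\Pi_j(z),\Pi_j(z'))$. $\mathbb P_\xi$ (expectation $\mathbb E_\xi$) is the law of the process with $Z_0\sim\xi$; $\mathbb P_z=\mathbb P_{\delta_z}$. The superscript $\theta$ is dropped below. For $n\ge1$, $u_{0:(n-1)}\in\mathsf U^n$ and $z\in\mathsf Z$, $\tilde\psi\langle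 u_{0:(n-1)}\rangle(z):=x_n$, where $x_k=\Pi_{p+k}(z)$ for $-p<k\le0$, $u_k=\Pi_{p+q+k}(z)$ for $-q<k\le-1$, and $x_k=\tilde\psi_{u_{(k-q):(k-1)}}(x_{(k-p):(k-1)})$ for $1\le k\le n$. For $V\ge0$ on a set, $|f|_V=\sup|f|/V$ (with $0/0=0$), and $f\lesssim V$ means $|f|_V<\infty$. A kernel is strong (resp. weak) Feller if it maps bounded measurable (resp. bounded continuous) functions to bounded continuous functions. Where the weak Feller property of $G$ or compactness of a subset of $\mathsf Y$ is invoked below, it is understood with respect to a given topology on $\mathsf Y$ whose open sets belong to $\mathcal Y$. (A-3) $\mathcal X$ and $\mathcal U$ are the Borel $\sigma$-fields of $(\mathsf X,\delta_{\mathsf X})$ and $(\mathsf U,\delta_{\mathsf U})$, both complete separable metric spaces. For $v=(z,z')\in\mathsf Z^2$ set $\delta_{\mathsf Z}(v)=\max_{1\le k\le p}\delta_{\mathsf X}(\Pi_k^{\otimes2}(v))\vee\max_{p<k<p+q}\delta_{\mathsf U}(\Pi_k^{\otimes2}(v))$, and $\mathrm{Lip}_n=\sup\{\delta_{\mathsf X}(\tilde\psi\langle u\rangle(z),\tilde\psi\langle u\rangle(z'))/\delta_{\mathsf Z}(z,z'):(z,z',u)\in\mathsf Z^2\times\mathsf U^n\}$. (A-4) $\mathrm{Lip}_1<\infty$ and $\mathrm{Lip}_n\to0$ as $n\to\infty$. (A-5) $(\mathsf X,\delta_{\mathsf X})$ is locally compact and, if $q>1$, so is $(\mathsf U,\delta_{\mathsf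 U})$. For all $x\in\mathsf X$ there is $\delta>0$ with $\int\sup\{g(x';y):x'\in\mathsf X,\ \delta_{\mathsf X}(x',x)<\delta\}\,\nu(\mathrm dy)<\infty$. Moreover one of the following holds: (a) $G$ is strong Feller; (b) $G$ is weak Feller and $u\mapsto\tilde\psi\langle u\rangle(z)$ is continuous on $\mathsf U$ for all $z\in\mathsf Z$. (A-6) There exist measurable $V_{\mathsf X}:\mathsf X\to[0,\infty)$ and $V_{\mathsf U}:\mathsf U\to[0,\infty)$ such that, with $V_{\mathsf Y}=V_{\mathsf U}\circ\Upsilon$: $GV_{\mathsf Y}\lesssim V_{\mathsf X}$; $\{V_{\mathsf X}\le M\}$ is compact for any $M>0$, and so is $\{V_{\mathsf Y}\le M\}$ if $q>1$; and $$\lim_{n\to\infty}\lim_{M\to\infty}\sup_{z\in\mathsf Z}\frac{\mathbb E_z[V_{\mathsf X}(X_n)]}{M+V(z)}=0,\qquad V(z)=\max_{1\le k\le p,\ p<\ell<p+q}\Big\{V_{\mathsf X}(\Pi_k(z)),\frac{V_{\mathsf U}(\Pi_\ell(z))}{|GV_{\mathsf Y}|_{V_{\mathsf X}}}\Big\}$$ (if $q=1$ the terms in $\ell$ are absent). (A-7) $g(x;y)>0$ for all $(x,y)\in\mathsf X\times\mathsf Y$, and one of the following holds: (a) there is $y_0\in\mathsf Y$ with $\nu(\{y_0\})>0$; (b) $(x,u)\mapsto\tilde\psi_u(x)$ is continuous on $\mathsf X^p\times\mathsf U^q$. (A-8) There exist measurable $\alpha:\mathsf X^2\to[0,1]$,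 $W_{\mathsf X}:\mathsf X^2\to[1,\infty)$, $W_{\mathsf U}:\mathsf U\to[0,\infty)$ and a Markov kernel $\underline G$ on $\mathsf X^2\times\mathcal Y$ with density $\underline g(x,x';y)$ with respect to $\nu$ such that, with $W_{\mathsf Y}=W_{\mathsf U}\circ\Upsilon$, $\underline GW_{\mathsf Y}\lesssim W_{\mathsf X}$ and: (i) $\min\{g(x;y),g(x';y)\}\ge\alpha(x,x')\,\underline g(x,x';y)$ for all $x,x'\in\mathsf X$, $y\in\mathsf Y$; (ii) $W_{\mathsf X}$ is symmetric, $W_{\mathsf X}(x,\cdot)$ is locally bounded for all $x\in\mathsf X$, and $W_{\mathsf U}$ is locally bounded; (iii) $1-\alpha\le\delta_{\mathsf X}\times W_{\mathsf X}$ on $\mathsf X^2$; and, defining for $v=(z,z')\in\mathsf Z^2$ $$W(v)=\max\Big\{W_{\mathsf X}(\Pi_k^{\otimes2}(v)),\ \frac{W_{\mathsf U}(\Pi_\ell(\tilde z))}{|\underline GW_{\mathsf Y}|_{W_{\mathsf X}}}:1\le k\le p,\ \tilde z\in\{z,z'\},\ p<\ell<p+q\Big\},$$ one of the following holds: (iv) $\displaystyle\lim_{\zeta\to\infty}\limsup_{n\to\infty}\frac1n\ln\sup_{v\in\mathsf Z^2}\frac{\hat{\mathbb E}_v[W_{\mathsf X}(X_n,X_n')]}{W^\zeta(v)}\le0$; (v) $\displaystyle\lim_{n\to\infty}\lim_{M\to\infty}\sup_{v\in\mathsf Z^2}\frac{\hat{\mathbb E}_v[W_{\mathsf X}(X_n,X_n')]}{M+W(v)}=0$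 and, for all $r=1,2,\dots$, there is $\tau\ge1$ with $\sup_{v\in\mathsf Z^2}\hat{\mathbb E}_v[W_{\mathsf X}(X_r,X'_r)]/W^\tau(v)<\infty$. Here, for $v=(z,z')\in\mathsf Z^2$, $\hat{\mathbb E}_v$ is the expectation under the law of $\{X_k,X'_k,U_{k'},U'_{k'}:k>-p,k'>-q\}$ with $(X_{(-p+1):0},U_{(-q+1):-1})=z$, $(X'_{(-p+1):0},U'_{(-q+1):-1})=z'$ and, for all $k\ge0$: $Y_k\mid\mathcal F'_k\sim\underline G(X_k,X'_k;\cdot)$, $Y'_k=Y_k$, $U_k=\Upsilon(Y_k)$, $U'_k=\Upsilon(Y'_k)$, $X_{k+1}=\tilde\psi_{U_{(k-q+1):k}}(X_{(k-p+1):k})$, $X'_{k+1}=\tilde\psi_{U'_{(k-q+1):k}}(X'_{(k-p+1):k})$, where $\mathcal F'_k=\sigma(X_{(-p+1):k},U_{(-q+1):(k-1)},X'_{(-p+1):k},U'_{(-q+1):(k-1)})$. *)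

theory Defs
  imports "HOL-Probability.Probability"
begin

text \<open>
  Conventions.  The state space and the space of reduced observations are complete separable
  metric spaces with their Borel sets, given as types of class \<^class>\<open>polish_space\<close>.  The
  observation space with its \<open>\<sigma>\<close>-field is the measurable space underlying the dominating
  measure \<open>\<nu>\<close>; \<open>TY\<close> is a topology on it.
  A vector \<open>x\<^sub>1, \<dots>, x\<^sub>n\<close> is an extensional function on \<open>{1..n}\<close>, and processes are indexed by
  half-lines of integers, so that time indices may be negative.
  Quantities that are formed with suprema and quotients live in \<^typ>\<open>ennreal\<close>, where
  \<open>0 / 0 = 0\<close> and \<open>c / 0 = \<infinity>\<close> for \<open>c \<noteq> 0\<close>.
\<close>

type_synonym ('x, 'u) vec2 = "(nat \<Rightarrow> 'x) \<times> (nat \<Rightarrow> 'u)"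
type_synonym ('x, 'u) upd = "(nat \<Rightarrow> 'u) \<Rightarrow> (nat \<Rightarrow> 'x) \<Rightarrow> 'x"


subsection \<open>General notions\<close>

definition rel_sup :: "('s \<Rightarrow> ennreal) \<Rightarrow> ('s \<Rightarrow> real) \<Rightarrow> ennreal" where
  "rel_sup f V = (SUP s. f s / ennreal (V s))"

definition dkernel :: "'y measure \<Rightarrow> ('s \<Rightarrow> 'y \<Rightarrow> real) \<Rightarrow> 's \<Rightarrow> 'y measure" where
  "dkernel \<nu> g s = density \<nu> (\<lambda>y. ennreal (g s y))"

definition is_dkernel :: "'s measure \<Rightarrow> 'y measure \<Rightarrow> ('s \<Rightarrow> 'y \<Rightarrow> real) \<Rightarrow> bool" where
  "is_dkernel S \<nu> g \<longleftrightarrow>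
     (\<forall>s\<in>space S. g s \<in> borel_measurable \<nu> \<and> (\<forall>y\<in>space \<nu>. 0 \<le> g s y)) \<and>
     dkernel \<nu> g \<in> S \<rightarrow>\<^sub>M prob_algebra \<nu>"

definition strong_feller :: "'y measure \<Rightarrow> ('x::topological_space \<Rightarrow> 'y measure) \<Rightarrow> bool" where
  "strong_feller N K \<longleftrightarrow>
     (\<forall>f\<in>borel_measurable N. bounded (f ` space N) \<longrightarrow>
        continuous_on UNIV (\<lambda>x. \<integral>y. f y \<partial>K x) \<and> bounded (range (\<lambda>x. \<integral>y. (f y :: real) \<partial>K x)))"

definition weak_feller :: "'y topology \<Rightarrow> ('x::topological_space \<Rightarrow> 'y measure) \<Rightarrow> bool" where
  "weak_feller T K \<longleftrightarrow>
     (\<forall>f. continuous_map T euclideanreal f \<and> bounded (f ` topspace T) \<longrightarrow>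
        continuous_on UNIV (\<lambda>x. \<integral>y. f y \<partial>K x) \<and> bounded (range (\<lambda>x. \<integral>y. f y \<partial>K x)))"

definition locally_bdd :: "('a::metric_space \<Rightarrow> real) \<Rightarrow> bool" where
  "locally_bdd f \<longleftrightarrow> (\<forall>x. \<exists>e>0. bounded (f ` ball x e))"

definition epow :: "ennreal \<Rightarrow> real \<Rightarrow> ennreal" \<comment> \<open>only used for positive exponents\<close> where
  "epow a t = (if a = \<infinity> then \<infinity> else ennreal (enn2real a powr t))"

definition eln :: "ennreal \<Rightarrow> ereal" where
  "eln a = (if a = 0 then -\<infinity> else if a = \<infinity> then \<infinity> else ereal (ln (enn2real a)))"

text \<open>The conditional distribution of \<open>Y\<close> given the \<open>\<sigma>\<close>-field \<open>F\<close> is the random measure \<open>\<kappa>\<close>.\<close>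

definition cond_distr ::
  "'w measure \<Rightarrow> 'w measure \<Rightarrow> ('w \<Rightarrow> 'y) \<Rightarrow> 'y measure \<Rightarrow> ('w \<Rightarrow> 'y measure) \<Rightarrow> bool" where
  "cond_distr P F Y N \<kappa> \<longleftrightarrow>
     (\<forall>B\<in>sets N. AE \<omega> in P.
        nn_cond_exp P F (indicator (Y -` B \<inter> space P)) \<omega> = emeasure (\<kappa> \<omega>) B)"


subsection \<open>The model and the iterated update map\<close>

definition Zsp :: "nat \<Rightarrow> nat \<Rightarrow> ('x::polish_space, 'u::polish_space) vec2 measure" where
  "Zsp p q = PiM {1..p} (\<lambda>_. borel) \<Otimes>\<^sub>M PiM {1..<q} (\<lambda>_. borel)"

definition od_model ::
  "nat \<Rightarrow> nat \<Rightarrow> 'y measure \<Rightarrow> ('y \<Rightarrow> 'u) \<Rightarrow> ('x::polish_space, 'u::polish_space) upd \<Rightarrow>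
   ('x \<Rightarrow> 'y \<Rightarrow> real) \<Rightarrow> bool" where
  "od_model p q \<nu> \<Upsilon> \<psi> g \<longleftrightarrow>
     sigma_finite_measure \<nu> \<and>
     \<Upsilon> \<in> \<nu> \<rightarrow>\<^sub>M borel \<and>
     (\<lambda>(x, u). \<psi> u x) \<in> PiM {1..p} (\<lambda>_. borel) \<Otimes>\<^sub>M PiM {1..q} (\<lambda>_. borel) \<rightarrow>\<^sub>M borel \<and>
     is_dkernel borel \<nu> g"

definition compatible_topology :: "'y measure \<Rightarrow> 'y topology \<Rightarrow> bool" where
  "compatible_topology N T \<longleftrightarrow> topspace T = space N \<and> (\<forall>S. openin T S \<longrightarrow> S \<in> sets N)"

text \<open>The vector \<open>s\<^sub>a\<^sub>+\<^sub>1, \<dots>, s\<^sub>a\<^sub>+\<^sub>n\<close> of entries of a sequence \<open>s\<close> indexed by the integers.\<close>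

definition window :: "(int \<Rightarrow> 'a) \<Rightarrow> int \<Rightarrow> nat set \<Rightarrow> nat \<Rightarrow> 'a" where
  "window s a I = (\<lambda>i\<in>I. s (a + int i))"

lemma window_cong [fundef_cong]:
  "a = a' \<Longrightarrow> I = I' \<Longrightarrow> (\<And>i. i \<in> I' \<Longrightarrow> s (a' + int i) = s' (a' + int i)) \<Longrightarrow>
   window s a I = window s' a' I'"
  by (auto simp: window_def)

definition ext_inputs :: "nat \<Rightarrow> ('x, 'u) vec2 \<Rightarrow> (nat \<Rightarrow> 'u) \<Rightarrow> int \<Rightarrow> 'u" where
  "ext_inputs q z u k = (if k < 0 then snd z (nat (int q + k)) else u (nat k))"

function traj ::
  "nat \<Rightarrow> nat \<Rightarrow> ('x, 'u) upd \<Rightarrow> ('x, 'u) vec2 \<Rightarrow> (nat \<Rightarrow> 'u) \<Rightarrow> int \<Rightarrow> 'x" where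
  "traj p q \<psi> z u k =
     (if k \<le> 0 then fst z (nat (int p + k))
      else \<psi> (window (ext_inputs q z u) (k - int q - 1) {1..q})
             (window (traj p q \<psi> z u) (k - int p - 1) {1..p}))"
  by pat_completeness auto
termination
  by (relation "Wellfounded.measure (\<lambda>(p, q, \<psi>, z, u, k). nat k)") auto

declare traj.simps [simp del]

definition psi_iter ::
  "nat \<Rightarrow> nat \<Rightarrow> ('x, 'u) upd \<Rightarrow> nat \<Rightarrow> (nat \<Rightarrow> 'u) \<Rightarrow> ('x, 'u) vec2 \<Rightarrow> 'x" where
  "psi_iter p q \<psi> n u z = traj p q \<psi> z u (int n)"


subsection \<open>The law of the process with a given initial distribution\<close>

text \<open>
  Paths are triples \<open>(X, U, Y)\<close> with \<open>X\<close> indexed by \<open>k > -p\<close>, \<open>U\<close> by \<open>k > -q\<close> and \<open>Y\<close> by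
  \<open>k \<ge> 0\<close>.  The initial state only carries the reduced observations \<open>U\<close> at negative times,
  which need not be in the range of \<open>\<Upsilon>\<close>.
\<close>

type_synonym ('x, 'u, 'y) path = "(int \<Rightarrow> 'x) \<times> (int \<Rightarrow> 'u) \<times> (int \<Rightarrow> 'y)"

definition path_space ::
  "nat \<Rightarrow> nat \<Rightarrow> 'y measure \<Rightarrow> ('x::polish_space, 'u::polish_space, 'y) path measure" where
  "path_space p q \<nu> =
     PiM {- int p<..} (\<lambda>_. borel) \<Otimes>\<^sub>M PiM {- int q<..} (\<lambda>_. borel) \<Otimes>\<^sub>M PiM {0..} (\<lambda>_. \<nu>)"

definition state_at :: "nat \<Rightarrow> nat \<Rightarrow> int \<Rightarrow> (int \<Rightarrow> 'x) \<Rightarrow> (int \<Rightarrow> 'u) \<Rightarrow> ('x, 'u) vec2" where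
  "state_at p q k X U = (window X (k - int p) {1..p}, window U (k - int q) {1..<q})"

definition past ::
  "nat \<Rightarrow> nat \<Rightarrow> 'y measure \<Rightarrow> int \<Rightarrow> ('x::polish_space, 'u::polish_space, 'y) path measure" where
  "past p q \<nu> k =
     vimage_algebra (space (path_space p q \<nu>))
       (\<lambda>(X, U, Y). (restrict X {- int p<..k}, restrict U {- int q<..<k}, restrict Y {0..<k}))
       (PiM {- int p<..k} (\<lambda>_. borel) \<Otimes>\<^sub>M PiM {- int q<..<k} (\<lambda>_. borel) \<Otimes>\<^sub>M
        PiM {0..<k} (\<lambda>_. \<nu>))"

definition is_model_law ::
  "nat \<Rightarrow> nat \<Rightarrow> 'y measure \<Rightarrow> ('y \<Rightarrow> 'u) \<Rightarrow> ('x::polish_space, 'u::polish_space) upd \<Rightarrow>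
   ('x \<Rightarrow> 'y \<Rightarrow> real) \<Rightarrow> ('x, 'u) vec2 measure \<Rightarrow> ('x, 'u, 'y) path measure \<Rightarrow> bool" where
  "is_model_law p q \<nu> \<Upsilon> \<psi> g \<xi> P \<longleftrightarrow>
     P \<in> space (prob_algebra (path_space p q \<nu>)) \<and>
     distr P (Zsp p q) (\<lambda>(X, U, Y). state_at p q 0 X U) = \<xi> \<and>
     (\<forall>k\<ge>0.
        cond_distr P (past p q \<nu> k) (\<lambda>(X, U, Y). Y k) \<nu> (\<lambda>(X, U, Y). dkernel \<nu> g (X k)) \<and>
        (AE (X, U, Y) in P. U k = \<Upsilon> (Y k)) \<and>
        (AE (X, U, Y) in P.
           X (k + 1) = \<psi> (window U (k - int q) {1..q}) (window X (k - int p) {1..p})))"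

text \<open>By the theorem of Ionescu Tulcea the description picks exactly one measure.\<close>

definition model_law ::
  "nat \<Rightarrow> nat \<Rightarrow> 'y measure \<Rightarrow> ('y \<Rightarrow> 'u) \<Rightarrow> ('x::polish_space, 'u::polish_space) upd \<Rightarrow>
   ('x \<Rightarrow> 'y \<Rightarrow> real) \<Rightarrow> ('x, 'u) vec2 measure \<Rightarrow> ('x, 'u, 'y) path measure" where
  "model_law p q \<nu> \<Upsilon> \<psi> g \<xi> = (THE P. is_model_law p q \<nu> \<Upsilon> \<psi> g \<xi> P)"

definition path_shift :: "nat \<Rightarrow> nat \<Rightarrow> ('x, 'u, 'y) path \<Rightarrow> ('x, 'u, 'y) path" where
  "path_shift p q = (\<lambda>(X, U, Y).
     (\<lambda>k\<in>{- int p<..}. X (k + 1), \<lambda>k\<in>{- int q<..}. U (k + 1), \<lambda>k\<in>{0..}. Y (k + 1)))"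

definition shift_invariant ::
  "nat \<Rightarrow> nat \<Rightarrow> 'y measure \<Rightarrow> ('x::polish_space, 'u::polish_space, 'y) path measure \<Rightarrow> bool" where
  "shift_invariant p q \<nu> P \<longleftrightarrow> distr P (path_space p q \<nu>) (path_shift p q) = P"

definition expect_from ::
  "nat \<Rightarrow> nat \<Rightarrow> 'y measure \<Rightarrow> ('y \<Rightarrow> 'u) \<Rightarrow> ('x::polish_space, 'u::polish_space) upd \<Rightarrow>
   ('x \<Rightarrow> 'y \<Rightarrow> real) \<Rightarrow> ('x, 'u) vec2 measure \<Rightarrow> ('x \<Rightarrow> real) \<Rightarrow> nat \<Rightarrow> ennreal" where
  "expect_from p q \<nu> \<Upsilon> \<psi> g \<xi> f n =
     (\<integral>\<^sup>+(X, U, Y). ennreal (f (X (int n))) \<partial>model_law p q \<nu> \<Upsilon> \<psi> g \<xi>)"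


subsection \<open>Stationary solutions of the model equations\<close>

text \<open>Here the observations \<open>Y\<close> are themselves indexed by \<open>k > -q\<close>.\<close>

definition xy_space ::
  "nat \<Rightarrow> nat \<Rightarrow> 'y measure \<Rightarrow> ((int \<Rightarrow> 'x::polish_space) \<times> (int \<Rightarrow> 'y)) measure" where
  "xy_space p q \<nu> = PiM {- int p<..} (\<lambda>_. borel) \<Otimes>\<^sub>M PiM {- int q<..} (\<lambda>_. \<nu>)"

definition xy_past ::
  "nat \<Rightarrow> nat \<Rightarrow> 'y measure \<Rightarrow> int \<Rightarrow> ((int \<Rightarrow> 'x::polish_space) \<times> (int \<Rightarrow> 'y)) measure" where
  "xy_past p q \<nu> k =
     vimage_algebra (space (xy_space p q \<nu>))
       (\<lambda>(X, Y). (restrict X {- int p<..k}, restrict Y {- int q<..<k}))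
       (PiM {- int p<..k} (\<lambda>_. borel) \<Otimes>\<^sub>M PiM {- int q<..<k} (\<lambda>_. \<nu>))"

definition is_solution_law ::
  "nat \<Rightarrow> nat \<Rightarrow> 'y measure \<Rightarrow> ('y \<Rightarrow> 'u) \<Rightarrow> ('x::polish_space, 'u::polish_space) upd \<Rightarrow>
   ('x \<Rightarrow> 'y \<Rightarrow> real) \<Rightarrow> ((int \<Rightarrow> 'x) \<times> (int \<Rightarrow> 'y)) measure \<Rightarrow> bool" where
  "is_solution_law p q \<nu> \<Upsilon> \<psi> g P \<longleftrightarrow>
     P \<in> space (prob_algebra (xy_space p q \<nu>)) \<and>
     (\<forall>k\<ge>0.
        cond_distr P (xy_past p q \<nu> k) (\<lambda>(X, Y). Y k) \<nu> (\<lambda>(X, Y). dkernel \<nu> g (X k)) \<and>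
        (AE (X, Y) in P.
           X (k + 1) = \<psi> (window (\<lambda>j. \<Upsilon> (Y j)) (k - int q) {1..q}) (window X (k - int p) {1..p})))"

definition xy_shift ::
  "nat \<Rightarrow> nat \<Rightarrow> (int \<Rightarrow> 'x) \<times> (int \<Rightarrow> 'y) \<Rightarrow> (int \<Rightarrow> 'x) \<times> (int \<Rightarrow> 'y)" where
  "xy_shift p q = (\<lambda>(X, Y). (\<lambda>k\<in>{- int p<..}. X (k + 1), \<lambda>k\<in>{- int q<..}. Y (k + 1)))"

definition is_stationary_solution_law ::
  "nat \<Rightarrow> nat \<Rightarrow> 'y measure \<Rightarrow> ('y \<Rightarrow> 'u) \<Rightarrow> ('x::polish_space, 'u::polish_space) upd \<Rightarrow>
   ('x \<Rightarrow> 'y \<Rightarrow> real) \<Rightarrow> ((int \<Rightarrow> 'x) \<times> (int \<Rightarrow> 'y)) measure \<Rightarrow> bool" where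
  "is_stationary_solution_law p q \<nu> \<Upsilon> \<psi> g P \<longleftrightarrow>
     is_solution_law p q \<nu> \<Upsilon> \<psi> g P \<and> distr P (xy_space p q \<nu>) (xy_shift p q) = P"

definition law_X0 :: "((int \<Rightarrow> 'x::polish_space) \<times> (int \<Rightarrow> 'y)) measure \<Rightarrow> 'x measure" where
  "law_X0 P = distr P borel (\<lambda>(X, Y). X 0)"


subsection \<open>The coupled process\<close>

type_synonym ('x, 'u, 'y) cpath =
  "((int \<Rightarrow> 'x) \<times> (int \<Rightarrow> 'x) \<times> (int \<Rightarrow> 'u) \<times> (int \<Rightarrow> 'u)) \<times> (int \<Rightarrow> 'y)"

definition xxuu_space :: "nat \<Rightarrow> nat \<Rightarrow>
    ((int \<Rightarrow> 'x::polish_space) \<times> (int \<Rightarrow> 'x) \<times> (int \<Rightarrow> 'u::polish_space) \<times> (int \<Rightarrow> 'u)) measure" where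
  "xxuu_space p q =
     PiM {- int p<..} (\<lambda>_. borel) \<Otimes>\<^sub>M PiM {- int p<..} (\<lambda>_. borel) \<Otimes>\<^sub>M
     PiM {- int q<..} (\<lambda>_. borel) \<Otimes>\<^sub>M PiM {- int q<..} (\<lambda>_. borel)"

definition cpath_space ::
  "nat \<Rightarrow> nat \<Rightarrow> 'y measure \<Rightarrow> ('x::polish_space, 'u::polish_space, 'y) cpath measure" where
  "cpath_space p q \<nu> = xxuu_space p q \<Otimes>\<^sub>M PiM {0..} (\<lambda>_. \<nu>)"

definition cpast ::
  "nat \<Rightarrow> nat \<Rightarrow> 'y measure \<Rightarrow> int \<Rightarrow> ('x::polish_space, 'u::polish_space, 'y) cpath measure" where
  "cpast p q \<nu> k =
     vimage_algebra (space (cpath_space p q \<nu>))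
       (\<lambda>((X, X', U, U'), Y).
          (restrict X {- int p<..k}, restrict X' {- int p<..k},
           restrict U {- int q<..<k}, restrict U' {- int q<..<k}))
       (PiM {- int p<..k} (\<lambda>_. borel) \<Otimes>\<^sub>M PiM {- int p<..k} (\<lambda>_. borel) \<Otimes>\<^sub>M
        PiM {- int q<..<k} (\<lambda>_. borel) \<Otimes>\<^sub>M PiM {- int q<..<k} (\<lambda>_. borel))"

definition is_coupled_model ::
  "nat \<Rightarrow> nat \<Rightarrow> 'y measure \<Rightarrow> ('y \<Rightarrow> 'u) \<Rightarrow> ('x::polish_space, 'u::polish_space) upd \<Rightarrow>
   ('x \<times> 'x \<Rightarrow> 'y \<Rightarrow> real) \<Rightarrow> ('x, 'u) vec2 \<times> ('x, 'u) vec2 \<Rightarrow> ('x, 'u, 'y) cpath measure \<Rightarrow> bool" where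
  "is_coupled_model p q \<nu> \<Upsilon> \<psi> h v P \<longleftrightarrow>
     P \<in> space (prob_algebra (cpath_space p q \<nu>)) \<and>
     (AE ((X, X', U, U'), Y) in P. state_at p q 0 X U = fst v \<and> state_at p q 0 X' U' = snd v) \<and>
     (\<forall>k\<ge>0.
        cond_distr P (cpast p q \<nu> k) (\<lambda>((X, X', U, U'), Y). Y k) \<nu>
          (\<lambda>((X, X', U, U'), Y). dkernel \<nu> h (X k, X' k)) \<and>
        (AE ((X, X', U, U'), Y) in P. U k = \<Upsilon> (Y k) \<and> U' k = \<Upsilon> (Y k)) \<and>
        (AE ((X, X', U, U'), Y) in P.
           X (k + 1) = \<psi> (window U (k - int q) {1..q}) (window X (k - int p) {1..p}) \<and>
           X' (k + 1) = \<psi> (window U' (k - int q) {1..q}) (window X' (k - int p) {1..p})))"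

text \<open>
  The conditioning \<open>\<sigma>\<close>-field does not contain the past of \<open>Y\<close>, so only the law of
  \<open>(X, X', U, U')\<close>, and not the joint law with \<open>Y\<close>, is determined by the equations.
\<close>

definition coupled_law ::
  "nat \<Rightarrow> nat \<Rightarrow> 'y measure \<Rightarrow> ('y \<Rightarrow> 'u) \<Rightarrow> ('x::polish_space, 'u::polish_space) upd \<Rightarrow>
   ('x \<times> 'x \<Rightarrow> 'y \<Rightarrow> real) \<Rightarrow> ('x, 'u) vec2 \<times> ('x, 'u) vec2 \<Rightarrow>
   ((int \<Rightarrow> 'x) \<times> (int \<Rightarrow> 'x) \<times> (int \<Rightarrow> 'u) \<times> (int \<Rightarrow> 'u)) measure" where
  "coupled_law p q \<nu> \<Upsilon> \<psi> h v =
     (THE R. \<exists>P. is_coupled_model p q \<nu> \<Upsilon> \<psi> h v P \<and> R = distr P (xxuu_space p q) fst)"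

definition coupled_expect ::
  "nat \<Rightarrow> nat \<Rightarrow> 'y measure \<Rightarrow> ('y \<Rightarrow> 'u) \<Rightarrow> ('x::polish_space, 'u::polish_space) upd \<Rightarrow>
   ('x \<times> 'x \<Rightarrow> 'y \<Rightarrow> real) \<Rightarrow> ('x, 'u) vec2 \<times> ('x, 'u) vec2 \<Rightarrow> ('x \<times> 'x \<Rightarrow> real) \<Rightarrow> nat \<Rightarrow> ennreal" where
  "coupled_expect p q \<nu> \<Upsilon> \<psi> h v f n =
     (\<integral>\<^sup>+(X, X', U, U'). ennreal (f (X (int n), X' (int n))) \<partial>coupled_law p q \<nu> \<Upsilon> \<psi> h v)"


subsection \<open>The conditions\<close>

definition dist_Z ::
  "nat \<Rightarrow> nat \<Rightarrow> ('x::metric_space, 'u::metric_space) vec2 \<Rightarrow> ('x, 'u) vec2 \<Rightarrow> real" where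
  "dist_Z p q z z' =
     Max ((\<lambda>k. dist (fst z k) (fst z' k)) ` {1..p} \<union> (\<lambda>l. dist (snd z l) (snd z' l)) ` {1..<q})"

definition Lip ::
  "nat \<Rightarrow> nat \<Rightarrow> ('x::polish_space, 'u::polish_space) upd \<Rightarrow> nat \<Rightarrow> ennreal" where
  "Lip p q \<psi> n =
     (SUP (z, z', u) \<in> space (Zsp p q) \<times> space (Zsp p q) \<times> ({..<n} \<rightarrow>\<^sub>E UNIV).
        ennreal (dist (psi_iter p q \<psi> n u z) (psi_iter p q \<psi> n u z')) / ennreal (dist_Z p q z z'))"

definition cond_A4 :: "nat \<Rightarrow> nat \<Rightarrow> ('x::polish_space, 'u::polish_space) upd \<Rightarrow> bool" where
  "cond_A4 p q \<psi> \<longleftrightarrow> Lip p q \<psi> 1 < \<infinity> \<and> Lip p q \<psi> \<longlonglongrightarrow> 0"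

definition cond_A5 ::
  "nat \<Rightarrow> nat \<Rightarrow> 'y measure \<Rightarrow> 'y topology \<Rightarrow> ('x::polish_space, 'u::polish_space) upd \<Rightarrow>
   ('x \<Rightarrow> 'y \<Rightarrow> real) \<Rightarrow> bool" where
  "cond_A5 p q \<nu> TY \<psi> g \<longleftrightarrow>
     locally_compact_space (euclidean :: 'x topology) \<and>
     (q > 1 \<longrightarrow> locally_compact_space (euclidean :: 'u topology)) \<and>
     (\<forall>x. \<exists>\<delta>>0. (\<integral>\<^sup>+y. (SUP x'\<in>{x'. dist x' x < \<delta>}. ennreal (g x' y)) \<partial>\<nu>) < \<infinity>) \<and>
     (strong_feller \<nu> (dkernel \<nu> g) \<or>
      weak_feller TY (dkernel \<nu> g) \<and>
      (\<forall>z\<in>space (Zsp p q). continuous_on UNIV (\<lambda>u. psi_iter p q \<psi> 1 (\<lambda>_. u) z)))"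

definition V_Z ::
  "nat \<Rightarrow> nat \<Rightarrow> ('x \<Rightarrow> real) \<Rightarrow> ('u \<Rightarrow> real) \<Rightarrow> ennreal \<Rightarrow> ('x, 'u) vec2 \<Rightarrow> ennreal" where
  "V_Z p q VX VU c z =
     Max ((\<lambda>k. ennreal (VX (fst z k))) ` {1..p} \<union> (\<lambda>l. ennreal (VU (snd z l)) / c) ` {1..<q})"

text \<open>
  For fixed \<open>n\<close> the supremum is nonincreasing in \<open>M\<close>, so \<open>L n\<close> always exists.
\<close>

definition cond_A6 ::
  "nat \<Rightarrow> nat \<Rightarrow> 'y measure \<Rightarrow> 'y topology \<Rightarrow> ('y \<Rightarrow> 'u) \<Rightarrow>
   ('x::polish_space, 'u::polish_space) upd \<Rightarrow> ('x \<Rightarrow> 'y \<Rightarrow> real) \<Rightarrow> ('x \<Rightarrow> real) \<Rightarrow> bool" where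
  "cond_A6 p q \<nu> TY \<Upsilon> \<psi> g VX \<longleftrightarrow>
     VX \<in> borel_measurable borel \<and> (\<forall>x. 0 \<le> VX x) \<and> (\<forall>M>0. compact {x. VX x \<le> M}) \<and>
     (\<exists>VU \<in> borel_measurable borel. (\<forall>u. 0 \<le> VU u) \<and>
        (q > 1 \<longrightarrow> (\<forall>M>0. compactin TY {y \<in> space \<nu>. VU (\<Upsilon> y) \<le> M})) \<and>
        (let c = rel_sup (\<lambda>x. \<integral>\<^sup>+y. ennreal (VU (\<Upsilon> y)) \<partial>dkernel \<nu> g x) VX in
           c < \<infinity> \<and>
           (\<exists>L. (\<forall>n. ((\<lambda>M::real. SUP z\<in>space (Zsp p q).
                      expect_from p q \<nu> \<Upsilon> \<psi> g (return (Zsp p q) z) VX n /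
                      (ennreal M + V_Z p q VX VU c z)) \<longlongrightarrow> L n) at_top) \<and>
                L \<longlonglongrightarrow> 0)))"

definition cond_A7 ::
  "nat \<Rightarrow> nat \<Rightarrow> 'y measure \<Rightarrow> ('x::polish_space, 'u::polish_space) upd \<Rightarrow>
   ('x \<Rightarrow> 'y \<Rightarrow> real) \<Rightarrow> bool" where
  "cond_A7 p q \<nu> \<psi> g \<longleftrightarrow>
     (\<forall>x. \<forall>y\<in>space \<nu>. 0 < g x y) \<and>
     ((\<exists>y0\<in>space \<nu>. {y0} \<in> sets \<nu> \<and> 0 < emeasure \<nu> {y0}) \<or>
      continuous_map
        (prod_topology (product_topology (\<lambda>_. euclidean) {1..p})
                       (product_topology (\<lambda>_. euclidean) {1..q}))
        euclidean (\<lambda>(x, u). \<psi> u x))"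

definition W_Z ::
  "nat \<Rightarrow> nat \<Rightarrow> ('x \<times> 'x \<Rightarrow> real) \<Rightarrow> ('u \<Rightarrow> real) \<Rightarrow> ennreal \<Rightarrow>
   ('x, 'u) vec2 \<times> ('x, 'u) vec2 \<Rightarrow> ennreal" where
  "W_Z p q WX WU c = (\<lambda>(z, z').
     Max ((\<lambda>k. ennreal (WX (fst z k, fst z' k))) ` {1..p} \<union>
          (\<lambda>(zt, l). ennreal (WU (snd zt l)) / c) ` ({z, z'} \<times> {1..<q})))"

text \<open>
  In the first alternative the expression is nonincreasing in \<open>\<zeta>\<close>, since \<open>W \<ge> 1\<close>, so the
  limit \<open>l\<close> always exists.
\<close>

definition cond_A8 ::
  "nat \<Rightarrow> nat \<Rightarrow> 'y measure \<Rightarrow> ('y \<Rightarrow> 'u) \<Rightarrow> ('x::polish_space, 'u::polish_space) upd \<Rightarrow>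
   ('x \<Rightarrow> 'y \<Rightarrow> real) \<Rightarrow> bool" where
  "cond_A8 p q \<nu> \<Upsilon> \<psi> g \<longleftrightarrow>
     (\<exists>(\<alpha> :: 'x \<times> 'x \<Rightarrow> real) \<in> borel_measurable (borel \<Otimes>\<^sub>M borel).
      \<exists>(WX :: 'x \<times> 'x \<Rightarrow> real) \<in> borel_measurable (borel \<Otimes>\<^sub>M borel).
      \<exists>(WU :: 'u \<Rightarrow> real) \<in> borel_measurable borel.
      \<exists>h :: 'x \<times> 'x \<Rightarrow> 'y \<Rightarrow> real.
        (\<forall>w. 0 \<le> \<alpha> w \<and> \<alpha> w \<le> 1) \<and> (\<forall>w. 1 \<le> WX w) \<and> (\<forall>u. 0 \<le> WU u) \<and>
        is_dkernel (borel \<Otimes>\<^sub>M borel) \<nu> h \<and>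
        (\<forall>x x'. \<forall>y\<in>space \<nu>. min (g x y) (g x' y) \<ge> \<alpha> (x, x') * h (x, x') y) \<and>
        (\<forall>x x'. WX (x, x') = WX (x', x)) \<and> (\<forall>x. locally_bdd (\<lambda>x'. WX (x, x'))) \<and>
        locally_bdd WU \<and>
        (\<forall>x x'. 1 - \<alpha> (x, x') \<le> dist x x' * WX (x, x')) \<and>
        (let c = rel_sup (\<lambda>w. \<integral>\<^sup>+y. ennreal (WU (\<Upsilon> y)) \<partial>dkernel \<nu> h w) WX;
             W = W_Z p q WX WU c;
             E = (\<lambda>v n. coupled_expect p q \<nu> \<Upsilon> \<psi> h v WX n);
             Z2 = space (Zsp p q) \<times> space (Zsp p q)
         in c < \<infinity> \<and>
            ((\<exists>l\<le>0. ((\<lambda>\<zeta>::real. limsup (\<lambda>n. ereal (1 / real n) *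
                        eln (SUP v\<in>Z2. E v n / epow (W v) \<zeta>))) \<longlongrightarrow> l) at_top) \<or>
             (\<exists>L. (\<forall>n. ((\<lambda>M::real. SUP v\<in>Z2. E v n / (ennreal M + W v)) \<longlongrightarrow> L n) at_top) \<and>
                  L \<longlonglongrightarrow> 0) \<and>
             (\<forall>r\<ge>1. \<exists>\<tau>\<ge>1. (SUP v\<in>Z2. E v r / epow (W v) \<tau>) < \<infinity>))))"

definition model_conditions ::
  "nat \<Rightarrow> nat \<Rightarrow> 'y measure \<Rightarrow> 'y topology \<Rightarrow> ('y \<Rightarrow> 'u) \<Rightarrow>
   ('x::polish_space, 'u::polish_space) upd \<Rightarrow> ('x \<Rightarrow> 'y \<Rightarrow> real) \<Rightarrow> ('x \<Rightarrow> real) \<Rightarrow> bool" where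
  "model_conditions p q \<nu> TY \<Upsilon> \<psi> g VX \<longleftrightarrow>
     cond_A4 p q \<psi> \<and> cond_A5 p q \<nu> TY \<psi> g \<and> cond_A6 p q \<nu> TY \<Upsilon> \<psi> g VX \<and>
     cond_A7 p q \<nu> \<psi> g \<and> cond_A8 p q \<nu> \<Upsilon> \<psi> g"

end

theory Submission
 imports Defs
begin

text \<open>
  Let \<open>R\<close> be the transition operator of \<open>(Z\<^sub>k)\<close>.  By (A-8)(i) two copies of the chain can be driven by
  common observations, with failure probability at most \<open>1 - \<alpha>\<close> in each step.  While they are, they
  merge geometrically by (A-4), so that (A-8)(iii) and the moment bounds make the total failure
  probability \<open>\<Phi>(z, z')\<close> vanish as \<open>z' \<longlonglongrightarrow> z\<close>.  Thus \<open>G\<close> is continuous in total variation and the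
  asymptotic distance \<open>D \<le> \<Phi>\<close> of the laws of the chain started at \<open>z\<close> and \<open>z'\<close> is a continuous
  pseudometric.

  Existence: the drift in (A-6) makes the laws of the chain tight, and the Feller property follows
  from the coupling, so the theorem of Krylov and Bogoliubov applies.

  Uniqueness: as \<open>g > 0\<close>, the common part of \<open>G(x)\<close> and \<open>G(x')\<close> is equivalent to both, so that
  \<open>D = 1\<close> persists along common observations.  These bring the two copies close together near a
  compact set, where \<open>D < 1\<close>; hence \<open>D < 1\<close> wherever \<open>V < \<infinity>\<close>.  If \<open>P\<close> and \<open>N\<close> are the positive and
  negative parts, of mass \<open>\<kappa>\<close>, of the difference of two invariant laws, then \<open>\<kappa>\<^sup>2 \<le> \<integral>\<integral> D dP dN\<close>,
  which forces \<open>\<kappa> = 0\<close>.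
\<close>

text \<open>Under common observations the two copies only approach each other and need not meet, so
  their laws are compared on Lipschitz functions with values in [0, 1] and not in total variation.
  The failure probability is the series of \<open>(S ^^ k) ab\<close>, where \<open>S\<close> is the
  sub-Markov operator of a successful common step and \<open>ab\<close> the failure probability of
  the next one. Its k-th term is at most a distance of order \<open>\<rho> ^ k\<close> times a
  moment of \<open>WX\<close>, and (A-8) keeps the growth rate of these moments below
  \<open>1 / \<rho>\<close>. The obstacle is the weight of the inputs stored in the initial states:
  they may differ between the copies, may have infinite weight, and leave the state only after
  \<open>q - 1\<close> steps. Continuity of \<open>\<Phi>\<close> is therefore shown for pairs with
  equal stored inputs and carried back from there step by step. In this the observations are drawn
  from the law of one copy, which stays fixed along the approximating sequence. The same one-sided
  device, the operator \<open>B\<close>, makes tightness of a single copy suffice in the uniqueness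
  proof.\<close>

abbreviation (input) bm :: "'a measure => ('a => 'b::topological_space) set" where "bm M \<equiv> borel_measurable M"

lemmas mcomp = measurable_compose and mcoord = measurable_component_singleton and mcong = measurable_cong_sets

subsection \<open>Functionals on bounded continuous functions\<close>

definition bcont :: "('a::metric_space => real) set" where
 "bcont = {f. continuous_on UNIV f & bounded (range f)}"

lemma bcontI: "continuous_on UNIV f ==> (!!x. \<bar>f x\<bar> <= B) ==> f \<in> bcont"
 by (auto simp: bcont_def bounded_iff)

lemma bcontD: assumes "f \<in> bcont" shows "continuous_on UNIV f" "\<exists>B. \<forall>x. \<bar>f x\<bar> <= B"
 using assms by (auto simp: bcont_def bounded_iff)

lemma bcont_const [simp]: "(%_. c) \<in> bcont"
 by (rule bcontI[where B="\<bar>c\<bar>"]) auto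

lemma bcont_add: "f \<in> bcont ==> g \<in> bcont ==> (%x. f x + g x) \<in> bcont"
 by (auto simp: bcont_def intro!: continuous_on_add bounded_plus_comp)

lemma bcont_diff: "f \<in> bcont ==> g \<in> bcont ==> (%x. f x - g x) \<in> bcont"
 by (auto simp: bcont_def intro!: continuous_on_diff bounded_minus_comp)

lemma bcont_cmult: assumes "f \<in> bcont" shows "(%x. c * f x) \<in> bcont"
proof -
 obtain B where "\<forall>x. \<bar>f x\<bar> <= B" using bcontD[OF assms] by auto
 then show ?thesis using bcontD(1)[OF assms]
  by (intro bcontI[where B="\<bar>c\<bar> * B"])
   (auto intro!: continuous_on_mult continuous_on_const simp: abs_mult mult_left_mono)
qed

lemma bcont_max: assumes "f \<in> bcont" "g \<in> bcont" shows "(%x. max (f x) (g x)) \<in> bcont"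
proof -
 obtain B C where B: "!!x. \<bar>f x\<bar> <= B" and C: "!!x. \<bar>g x\<bar> <= C" using bcontD assms by metis
 show ?thesis
 proof (rule bcontI[where B="max B C"])
  show "continuous_on UNIV (%x. max (f x) (g x))"
   using bcontD(1)[OF assms(1)] bcontD(1)[OF assms(2)] by (rule continuous_on_max)
  show "\<bar>max (f x) (g x)\<bar> <= max B C" for x
   using B[of x] C[of x] by linarith
 qed
qed

lemma bcont_min: assumes "f \<in> bcont" "g \<in> bcont" shows "(%x. min (f x) (g x)) \<in> bcont"
proof -
 obtain B C where B: "!!x. \<bar>f x\<bar> <= B" and C: "!!x. \<bar>g x\<bar> <= C" using bcontD assms by metis
 show ?thesis
 proof (rule bcontI[where B="max B C"])
  show "continuous_on UNIV (%x. min (f x) (g x))"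
   using bcontD(1)[OF assms(1)] bcontD(1)[OF assms(2)] by (rule continuous_on_min)
  show "\<bar>min (f x) (g x)\<bar> <= max B C" for x
   using B[of x] C[of x] by linarith
 qed
qed

lemma bcont_sum: "finite I ==> (!!i. i \<in> I ==> f i \<in> bcont) ==> (%x. \<Sum>i\<in>I. f i x) \<in> bcont"
 by (induction I rule: finite_induct) (auto intro!: bcont_add)

lemma bcont_measurable: "f \<in> bcont ==> f \<in> bm borel"
 by (auto simp: bcont_def intro: borel_measurable_continuous_onI)

text \<open>Increases with \<open>n\<close> to the indicator of an open \<open>G\<close>. The case
  \<open>G = UNIV\<close> is set apart because \<open>infdist\<close> to the empty set is 0 by
  convention.\<close>

definition open_approx :: "'a::metric_space set => nat => 'a => real" where
 "open_approx G n x = (if G = UNIV then 1 else min 1 (real n * infdist x (- G)))"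

lemma open_approx_bcont: "open_approx G n \<in> bcont"
 unfolding open_approx_def
 by (cases "G = UNIV")
  (auto intro!: bcontI[where B=1] continuous_intros simp: infdist_nonneg)

lemma open_approx_nonneg: "0 <= open_approx G n x"
 by (auto simp: open_approx_def infdist_nonneg)

lemma open_approx_le: "open_approx G n x <= indicator G x"
 by (auto simp: open_approx_def indicator_def)

lemma open_approx_mono: "m <= n ==> open_approx G m x <= open_approx G n x"
 by (auto simp: open_approx_def min_def infdist_nonneg intro: mult_right_mono order_trans)
   (meson infdist_nonneg le_less_linear mult_right_mono of_nat_mono order.trans not_le)+

lemma open_approx_eventually_1:
 assumes "open G" "x \<in> G" shows "\<forall>\<^sub>F n in sequentially. open_approx G n x = 1"
proof (cases "G = UNIV")
 case False
 then have "0 < infdist x (- G)"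
  using assms by (intro infdist_pos_not_in_closed) (auto simp: closed_Compl)
 moreover obtain N where "1 / infdist x (-G) < real N" using reals_Archimedean2 by blast
 ultimately have "open_approx G n x = 1" if "n \<ge> N" for n
 proof -
  have "1 <= real N * infdist x (- G)" using \<open>0 < _\<close> \<open>_ < real N\<close> by (simp add: field_simps)
  also have "... <= real n * infdist x (- G)" using that by (intro mult_right_mono) (auto simp: infdist_nonneg)
  finally show ?thesis using False by (simp add: open_approx_def)
 qed
 then show ?thesis by (auto simp: eventually_sequentially)
qed (simp add: open_approx_def)

text \<open>Positivity and linearity alone yield only a finitely additive set function on a space
  that is not compact. Continuity along sequences decreasing to 0 is what \<open>daniell\<close>
  adds; it takes the place of the local compactness in Riesz's theorem.\<close>

locale daniell_functional =
 fixes \<Lambda> :: "('a::metric_space => real) => real"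
 assumes add: "f \<in> bcont ==> g \<in> bcont ==> \<Lambda> (%x. f x + g x) = \<Lambda> f + \<Lambda> g"
  and cmult: "f \<in> bcont ==> \<Lambda> (%x. c * f x) = c * \<Lambda> f"
  and nonneg: "f \<in> bcont ==> (!!x. 0 <= f x) ==> 0 <= \<Lambda> f"
  and one: "\<Lambda> (%_. 1) = 1"
  and daniell: "(!!n. F n \<in> bcont) ==> (!!n x. 0 <= F n x) ==> (!!n x. F (Suc n) x <= F n x) ==>
   (!!x. (%n. F n x) \<longlonglongrightarrow> 0) ==> (%n. \<Lambda> (F n)) \<longlonglongrightarrow> 0"
begin

lemma diff: "f \<in> bcont ==> g \<in> bcont ==> \<Lambda> (%x. f x - g x) = \<Lambda> f - \<Lambda> g"
 using add[of "%x. f x - g x" g] bcont_diff[of f g] by simp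

lemma mono: "f \<in> bcont ==> g \<in> bcont ==> (!!x. f x <= g x) ==> \<Lambda> f <= \<Lambda> g"
 using nonneg[of "%x. g x - f x"] diff[of g f] bcont_diff by fastforce

lemma const: "\<Lambda> (%_. c) = c"
 using cmult[of "%_. 1" c] one by simp

lemma sum: "finite I ==> (!!i. i \<in> I ==> f i \<in> bcont) ==> \<Lambda> (%x. \<Sum>i\<in>I. f i x) = (\<Sum>i\<in>I. \<Lambda> (f i))"
 by (induction I rule: finite_induct) (auto simp: add bcont_sum const)

definition below :: "'a set => ('a => real) set" where
 "below G = {f \<in> bcont. \<forall>x. 0 <= f x & f x <= indicator G x}"

definition content :: "'a set => ennreal" where
 "content G = (SUP f\<in>below G. ennreal (\<Lambda> f))"

text \<open>Caratheodory's construction with a functional as the source: open sets are measured from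
  inside by functions, arbitrary sets from outside by open sets.\<close>

definition outer :: "'a set => ennreal" where
 "outer A = (INF G\<in>{G. open G & A \<subseteq> G}. content G)"

lemma below_zero: "(%_. 0) \<in> below G"
 by (auto simp: below_def indicator_def)

lemma belowD:
 assumes "f \<in> below G"
 shows "f \<in> bcont" "0 <= f x" "f x <= 1" "f x <= indicator G x" "x \<notin> G ==> f x = 0"
proof -
 show "f \<in> bcont" and *: "0 <= f x" "f x <= indicator G x" using assms by (auto simp: below_def)
 show "f x <= 1" using *(2) by (rule order_trans) (rule indicator_le_1)
 show "f x = 0" if "x \<notin> G" using * that by (simp add: indicator_def)
qed

lemma below_nonneg: "f \<in> below G ==> 0 <= \<Lambda> f"
 by (auto simp: below_def intro: nonneg)

lemma content_upper: "f \<in> below G ==> ennreal (\<Lambda> f) <= content G"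
 unfolding content_def by (rule SUP_upper)

lemma content_mono: "G \<subseteq> H ==> content G <= content H"
 unfolding content_def below_def
 by (intro SUP_subset_mono) (auto simp: indicator_def split: if_splits; meson order_trans zero_le_one)+

lemma content_le_1: "content G <= 1"
 unfolding content_def
proof (rule SUP_least)
 fix f assume "f \<in> below G"
 then have "\<Lambda> f <= \<Lambda> (%_. 1)"
  by (intro mono) (auto simp: below_def intro: order_trans[OF _ indicator_le_1])
 then show "ennreal (\<Lambda> f) <= 1" using one by (simp flip: ennreal_1)
qed

lemma content_UNIV: "content UNIV = 1"
 using content_upper[of "%_. 1" UNIV] content_le_1[of UNIV] one by (auto simp: below_def)

lemma content_empty: "content {} = 0"
proof -
 have "below {} = {%_. 0}" by (auto simp: below_def fun_eq_iff intro: order_antisym)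
 then show ?thesis by (simp add: content_def const)
qed

text \<open>The part of \<open>f\<close> that the approximations of the first \<open>n\<close> sets
  leave uncovered decreases to 0 pointwise, so \<open>daniell\<close> makes its value vanish; the
  covered part is bounded term by term. This is the only use of \<open>daniell\<close> in the
  construction.\<close>

lemma content_UN:
 fixes G :: "nat => 'a set" assumes "!!i. open (G i)"
 shows "content (\<Union>i. G i) <= (\<Sum>i. content (G i))"
 unfolding content_def[of "\<Union>i. G i"]
proof (rule SUP_least)
 fix f assume f: "f \<in> below (\<Union>i. G i)"
 then have fb: "f \<in> bcont" by (simp add: below_def)
 \<comment> \<open>The index \<open>n\<close> serves twice, as the number of sets and as the
   sharpness of each approximation, so that a single limit suffices.\<close>
 define s where "s n x = (\<Sum>j<n. open_approx (G j) n x)" for n x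
 have sb: "s n \<in> bcont" for n unfolding s_def by (intro bcont_sum open_approx_bcont) auto
 have smono: "s n x <= s (Suc n) x" for n x
 proof -
  have "s n x <= (\<Sum>j<n. open_approx (G j) (Suc n) x)"
   unfolding s_def by (intro sum_mono open_approx_mono) auto
  also have "... <= s (Suc n) x" unfolding s_def by (simp add: open_approx_nonneg)
  finally show ?thesis .
 qed
 define F where "F n x = max 0 (f x - s n x)" for n x
 have Fb: "F n \<in> bcont" for n unfolding F_def by (intro bcont_max bcont_diff fb sb) simp
 have "(%n. F n x) \<longlonglongrightarrow> 0" for x
 proof (cases "x \<in> (\<Union>i. G i)")
  case True
  then obtain i where i: "x \<in> G i" by auto
  have "\<forall>\<^sub>F n in sequentially. F n x = 0"
   using open_approx_eventually_1[OF assms i] eventually_gt_at_top[of i]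
  proof eventually_elim
   case (elim n)
   have "open_approx (G i) n x <= s n x"
    unfolding s_def using elim by (intro member_le_sum) (auto simp: open_approx_nonneg)
   moreover have "f x <= 1" using f by (rule belowD)
   ultimately show ?case using elim by (simp add: F_def)
  qed
  then show ?thesis by (rule tendsto_eventually)
 next
  case False
  then have "f x = 0" using f belowD(5) by blast
  then have "F n x = 0" for n by (simp add: F_def s_def sum_nonneg open_approx_nonneg)
  then show ?thesis by simp
 qed
 moreover have "F (Suc n) x <= F n x" for n x using smono[of n x] by (simp add: F_def)
 ultimately have "(%n. \<Lambda> (F n)) \<longlonglongrightarrow> 0"
  by (intro daniell Fb) (auto simp: F_def)
 then have lim: "(%n. ennreal (\<Lambda> (F n)) + (\<Sum>i. content (G i))) \<longlonglongrightarrow> 0 + (\<Sum>i. content (G i))"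
  by (intro tendsto_add tendsto_const) (simp flip: ennreal_0)
 have "ennreal (\<Lambda> f) <= ennreal (\<Lambda> (F n)) + (\<Sum>i. content (G i))" for n
 proof -
  have "\<Lambda> f <= \<Lambda> (%x. F n x + s n x)"
   by (intro mono fb bcont_add Fb sb) (simp add: F_def)
  also have "... = \<Lambda> (F n) + (\<Sum>j<n. \<Lambda> (open_approx (G j) n))"
   unfolding s_def using Fb open_approx_bcont by (subst add) (auto simp: sum intro!: bcont_sum)
  finally have "ennreal (\<Lambda> f) <= ennreal (\<Lambda> (F n) + (\<Sum>j<n. \<Lambda> (open_approx (G j) n)))"
   by (rule ennreal_leI)
  also have "... = ennreal (\<Lambda> (F n)) + (\<Sum>j<n. ennreal (\<Lambda> (open_approx (G j) n)))"
  proof -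
   have "0 <= \<Lambda> (open_approx (G j) n)" for j by (intro nonneg open_approx_bcont open_approx_nonneg)
   then show ?thesis using nonneg[OF Fb[of n]]
    by (subst ennreal_plus) (auto simp: F_def sum_nonneg sum_ennreal)
  qed
  also have "(\<Sum>j<n. ennreal (\<Lambda> (open_approx (G j) n))) <= (\<Sum>j<n. content (G j))"
   by (intro sum_mono content_upper)
    (auto simp: below_def open_approx_bcont open_approx_nonneg open_approx_le)
  also have "... <= (\<Sum>i. content (G i))" by (rule sum_le_suminf) auto
  finally show ?thesis by simp
 qed
 from LIMSEQ_le_const[OF lim] this show "ennreal (\<Lambda> f) <= (\<Sum>i. content (G i))" by auto
qed

lemma outer_open: "open G ==> outer G = content G"
 unfolding outer_def by (intro antisym INF_lower INF_greatest) (auto intro: content_mono)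

lemma outer_le_content: "open G ==> A \<subseteq> G ==> outer A <= content G"
 unfolding outer_def by (intro INF_lower) auto

lemma outer_mono: "A \<subseteq> B ==> outer A <= outer B"
 unfolding outer_def by (intro INF_superset_mono) auto

lemma outer_le_1: "outer A <= 1"
 using outer_le_content[of UNIV A] content_UNIV by auto

lemma outer_UN:
 fixes A :: "nat => 'a set" shows "outer (\<Union>i. A i) <= (\<Sum>i. outer (A i))"
proof (rule ennreal_le_epsilon)
 fix e :: real assume "0 < e" "(\<Sum>i. outer (A i)) < top"
 have "\<exists>G. open G & A n \<subseteq> G & content G < outer (A n) + ennreal (e * (1/2)^Suc n)" for n
 proof -
  have "outer (A n) ~= \<infinity>" using outer_le_1[of "A n"] by (auto simp: top_unique)
  then show ?thesis
   using INF_approx_ennreal[OF _ outer_def, of "e * (1/2)^Suc n"] \<open>0 < e\<close> by auto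
 qed
 then obtain G where G: "!!n. open (G n)" "!!n. A n \<subseteq> G n"
   "!!n. content (G n) < outer (A n) + ennreal (e * (1/2)^Suc n)" by metis
 have "outer (\<Union>i. A i) <= content (\<Union>i. G i)"
  using G by (intro outer_le_content) auto
 also have "... <= (\<Sum>i. content (G i))" by (rule content_UN) (rule G)
 also have "... <= (\<Sum>n. outer (A n) + ennreal (e * (1/2)^Suc n))"
  by (intro suminf_le allI less_imp_le G) auto
 also have "... = (\<Sum>n. outer (A n)) + (\<Sum>n. ennreal e * ennreal ((1/2) ^ Suc n))"
  using \<open>0 < e\<close> by (subst suminf_add[symmetric]) (auto simp: ennreal_mult[symmetric] simp del: ennreal_suminf_cmult)
 also have "... = (\<Sum>n. outer (A n)) + e"
  unfolding ennreal_suminf_cmult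
  by (subst suminf_ennreal_eq[OF zero_le_power power_half_series]) auto
 finally show "outer (\<Union>i. A i) <= (\<Sum>i. outer (A i)) + ennreal e" .
qed

lemma outer_measure_space_outer: "outer_measure_space UNIV outer"
 unfolding outer_measure_space_def
 by (auto simp: positive_def increasing_def countably_subadditive_def outer_open content_empty
   outer_mono outer_UN)

text \<open>Cutting \<open>f\<close> at height \<open>e\<close> separates supports:
  \<open>G - S\<close> lies in \<open>G'\<close>, where \<open>f\<close> is below \<open>e\<close>,
  and the excess \<open>k\<close> of \<open>f\<close> over \<open>e\<close> vanishes there. Any
  function below \<open>G'\<close> can therefore be added to \<open>k\<close> without leaving
  \<open>below G\<close>.\<close>

lemma outer_split_open:
 assumes "open G" "open S" shows "content (G \<inter> S) + outer (G - S) <= content G"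
proof (rule ennreal_le_epsilon)
 fix e :: real assume e: "0 < e" and "content G < top"
 have "ennreal (\<Lambda> f) + outer (G - S) <= content G + ennreal e" if f: "f \<in> below (G \<inter> S)" for f
 proof -
  have fb: "f \<in> bcont" using f by (simp add: below_def)
  have f01: "0 <= f x" "f x <= indicator G x" "x \<notin> S ==> f x = 0" for x :: 'a
  proof -
   show "0 <= f x" by (rule belowD(2)[OF f])
   show "f x <= indicator G x"
    by (rule order_trans[OF belowD(4)[OF f]]) (simp add: indicator_def)
   show "f x = 0" if "x \<notin> S" using belowD(5)[OF f, of x] that by blast
  qed
  define G' where "G' = G \<inter> {x. f x < e}"
  have "open {x. f x < e}"
   using bcontD(1)[OF fb] by (intro open_Collect_less continuous_on_const)
  then have oG': "open G'" using assms by (auto simp: G'_def)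
  have sub: "G - S \<subseteq> G'" using f01 e by (auto simp: G'_def)
  define k where "k x = max 0 (f x - e)" for x
  have kb: "k \<in> bcont" unfolding k_def by (intro bcont_max bcont_diff fb) auto
  have k0: "0 <= \<Lambda> k" by (intro nonneg kb) (simp add: k_def)
  have "ennreal (\<Lambda> h) + ennreal (\<Lambda> k) <= content G" if h: "h \<in> below G'" for h
  proof -
   have hb: "h \<in> bcont" using h by (simp add: below_def)
   have "(%x. h x + k x) \<in> below G"
    unfolding below_def
   proof (intro CollectI conjI allI bcont_add hb kb)
    fix x
    have h': "0 <= h x" "h x <= indicator G' x" using h by (auto simp: below_def)
    then show "0 <= h x + k x" by (simp add: k_def)
    show "h x + k x <= indicator G x"
     using h' f01(1,2)[of x] e by (cases "x \<in> G"; cases "f x < e") (auto simp: k_def G'_def)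
   qed
   from content_upper[OF this] show ?thesis
    using below_nonneg[OF h] k0 by (simp add: add hb kb flip: ennreal_plus)
  qed
  then have "content G' + ennreal (\<Lambda> k) <= content G"
   unfolding content_def[of G'] using below_zero by (subst ennreal_SUP_add_left[symmetric]) (auto intro!: SUP_least)
  moreover have "\<Lambda> f <= \<Lambda> k + e"
  proof -
   have "\<Lambda> f <= \<Lambda> (%x. k x + e)" by (intro mono fb bcont_add kb) (auto simp: k_def)
   then show ?thesis by (simp add: add kb const)
  qed
  then have "ennreal (\<Lambda> f) <= ennreal (\<Lambda> k) + ennreal e"
   using nonneg[OF kb] e by (simp add: k_def ennreal_leI flip: ennreal_plus)
  ultimately show ?thesis
  proof -
   assume k: "content G' + ennreal (\<Lambda> k) <= content G" and f: "ennreal (\<Lambda> f) <= ennreal (\<Lambda> k) + ennreal e"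
   have "ennreal (\<Lambda> f) + outer (G - S) <= (ennreal (\<Lambda> k) + ennreal e) + content G'"
    by (intro add_mono f outer_le_content oG' sub)
   also have "... = (content G' + ennreal (\<Lambda> k)) + ennreal e" by (simp add: ac_simps)
   also have "... <= content G + ennreal e" by (intro add_right_mono k)
   finally show ?thesis .
  qed
 qed
 then show "content (G \<inter> S) + outer (G - S) <= content G + ennreal e"
  unfolding content_def[of "G \<inter> S"] using below_zero by (subst ennreal_SUP_add_left[symmetric]) (auto intro!: SUP_least)
qed

lemma open_lambda_system: assumes "open S" shows "S \<in> lambda_system UNIV UNIV outer"
proof -
 have "outer (A \<inter> S) + outer (A - S) = outer A" for A
 proof (rule antisym)
  show "outer (A \<inter> S) + outer (A - S) <= outer A"
   unfolding outer_def[of A]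
  proof (rule INF_greatest, clarify)
   fix G assume G: "open G" "A \<subseteq> G"
   have "outer (A \<inter> S) + outer (A - S) <= content (G \<inter> S) + outer (G - S)"
    using G assms by (intro add_mono outer_le_content outer_mono) auto
   also have "... <= content G" by (rule outer_split_open) fact+
   finally show "outer (A \<inter> S) + outer (A - S) <= content G" .
  qed
  \<comment> \<open>The two pieces are padded with empty sets to make countable subadditivity
    applicable.\<close>
  define B where "B n = (if n = 0 then A \<inter> S else if n = 1 then A - S else {})" for n :: nat
  have "outer A = outer (\<Union>n. B n)" by (rule arg_cong[of _ _ outer]) (auto simp: B_def split: if_splits)
  also have "... <= (\<Sum>n. outer (B n))" by (rule outer_UN)
  also have "... = (\<Sum>n\<in>{0,1}. outer (B n))"
   by (rule suminf_finite) (auto simp: B_def outer_open content_empty)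
  finally show "outer A <= outer (A \<inter> S) + outer (A - S)" by (simp add: B_def)
 qed
 then show ?thesis
  by (auto simp: algebra.lambda_system_eq[OF sigma_algebra.axioms(1)[OF sigma_algebra_Pow[of UNIV, simplified]], simplified])
qed

text \<open>A layer-cake decomposition of \<open>f\<close> into \<open>N\<close> slices bounds
  \<open>\<Lambda> f\<close> by the integral up to \<open>1 / N\<close>. The same bound for
  \<open>1 - f\<close> turns the inequality into an equality, since the values for \<open>f\<close>
  and \<open>1 - f\<close> add up to 1 on both sides.\<close>

theorem representation:
 "\<exists>M. prob_space M & sets M = sets borel &
   (\<forall>f\<in>bcont. (\<forall>x. 0 <= f x & f x <= 1) --> (\<integral>\<^sup>+x. ennreal (f x) \<partial>M) = ennreal (\<Lambda> f))"
proof -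
 have sa: "sigma_algebra (UNIV::'a set) UNIV" using sigma_algebra_Pow[of UNIV] by simp
 have ms: "measure_space UNIV (lambda_system UNIV UNIV outer) outer"
  using sigma_algebra.caratheodory_lemma[OF sa outer_measure_space_outer] .
 then have ls: "sigma_algebra UNIV (lambda_system UNIV UNIV outer)"
  by (simp add: measure_space_def)
 have sub: "sets borel \<subseteq> lambda_system UNIV UNIV outer"
  unfolding borel_def using open_lambda_system
  by (simp, intro sigma_algebra.sigma_sets_subset[OF ls]) auto
 define M where "M = measure_of UNIV (sets borel) outer"
 have ms': "measure_space UNIV (sets borel) outer"
  using ms sub sets.sigma_algebra_axioms[of borel]
  by (auto simp: measure_space_def positive_def countably_additive_def)
 have setsM[measurable_cong]: "sets M = sets borel" unfolding M_def
  using sets.sigma_sets_eq[of borel] by (simp add: sets_measure_of_conv)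
 have spaceM: "space M = UNIV" using sets_eq_imp_space_eq[OF setsM] by simp
 have emM: "emeasure M A = outer A" if "A \<in> sets borel" for A
  unfolding M_def using ms' that
  by (intro emeasure_measure_of_sigma) (auto simp: measure_space_def)
 have prob: "prob_space M"
  by (intro prob_spaceI) (simp add: spaceM emM outer_open content_UNIV)
 have le: "ennreal (\<Lambda> f) <= (\<integral>\<^sup>+x. ennreal (f x) \<partial>M)" if fb: "f \<in> bcont" and f01: "!!x. 0 <= f x & f x <= 1" for f
 proof (rule ennreal_le_epsilon)
  fix e :: real assume "0 < e"
  then obtain N where N: "1 / e < real N" using reals_Archimedean2 by blast
  with \<open>0 < e\<close> have N0: "0 < N" by (metis divide_pos_pos less_trans of_nat_0_less_iff zero_less_one)
  have Ne: "1 / real N <= e" using N N0 \<open>0 < e\<close> by (simp add: field_simps)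
  \<comment> \<open>The slice of \<open>N * f\<close> between the heights \<open>i\<close> and
    \<open>i + 1\<close>. It is below the open set where \<open>f > i / N\<close>, and the
    \<open>N\<close> slices add up to \<open>N * f\<close>.\<close>
  define g where "g i x = min 1 (max 0 (real N * f x - real i))" for i x
  have gb: "g i \<in> bcont" for i unfolding g_def by (intro bcont_min bcont_max bcont_diff bcont_cmult fb) auto
  have fm[measurable]: "f \<in> bm borel" by (rule bcont_measurable[OF fb])
  have g01: "0 <= g i x" "g i x <= 1" for i x by (auto simp: g_def)
  have gsum: "(\<Sum>i<n. g i x) = min (real n) (real N * f x)" for n x
   by (induction n) (use f01[of x] in \<open>auto simp: g_def min_def max_def\<close>)
  have "f x = (1 / real N) * (\<Sum>i<N. g i x)" for x
   using f01[of x] N0 by (simp add: gsum min_def mult_le_cancel_left1)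
  then have "\<Lambda> f = \<Lambda> (%x. (1 / real N) * (\<Sum>i<N. g i x))" by presburger
  also have "... = (1 / real N) * (\<Sum>i<N. \<Lambda> (g i))"
   using gb by (subst cmult) (auto intro!: bcont_sum simp: sum)
  finally have "\<Lambda> f = (1 / real N) * (\<Sum>i<N. \<Lambda> (g i))" .
  then have "ennreal (\<Lambda> f) = ennreal (1 / real N) * (\<Sum>i<N. ennreal (\<Lambda> (g i)))"
   using nonneg[OF gb] g01 by (subst sum_ennreal) (auto simp: ennreal_mult[symmetric] sum_nonneg)
  also have "... <= ennreal (1 / real N) * (\<Sum>i<N. emeasure M {x. real i / real N < f x})"
  proof (intro mult_left_mono sum_mono)
   fix i
   have op: "open {x. real i / real N < f x}"
    using bcontD(1)[OF fb] by (intro open_Collect_less continuous_on_const)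
   have "ennreal (\<Lambda> (g i)) <= content {x. real i / real N < f x}"
    using N0 gb by (intro content_upper) (auto simp: below_def g_def indicator_def field_simps)
   then show "ennreal (\<Lambda> (g i)) <= emeasure M {x. real i / real N < f x}"
    using op by (simp add: emM outer_open)
  qed auto
  also have "... = (\<integral>\<^sup>+x. ennreal (1 / real N) * (\<Sum>i<N. indicator {x. real i / real N < f x} x) \<partial>M)"
   by (subst nn_integral_cmult, measurable) (subst nn_integral_sum, auto simp: setsM)
  also have "... <= (\<integral>\<^sup>+x. ennreal (f x) + ennreal (1 / real N) \<partial>M)"
  proof (intro nn_integral_mono)
   fix x
   \<comment> \<open>Fewer than \<open>N * f x + 1\<close> indices \<open>i\<close> satisfy
     \<open>i / N < f x\<close>, whence the error \<open>1 / N\<close>.\<close>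
   have "(\<Sum>i<n. indicator {x. real i / real N < f x} x) <= min (real n) (real N * f x + 1)" for n
    by (induction n) (use f01[of x] N0 in \<open>auto simp: indicator_def field_simps\<close>)
   note this[of N]
   then have "1 / real N * (\<Sum>i<N. indicator {x. real i / real N < f x} x) <= f x + 1 / real N"
    using N0 by (simp add: field_simps)
   moreover have "(\<Sum>i<N. indicator {x. real i / real N < f x} x :: ennreal) = ennreal (\<Sum>i<N. indicator {x. real i / real N < f x} x)"
    by (subst sum_ennreal[symmetric])
     (auto simp: indicator_def ennreal_of_nat_eq_real_of_nat intro!: sum.cong)
   ultimately show "ennreal (1 / real N) * (\<Sum>i<N. indicator {x. real i / real N < f x} x) <= ennreal (f x) + ennreal (1 / real N)"
    using f01[of x] by (simp add: ennreal_mult[symmetric] sum_nonneg ennreal_leI flip: ennreal_plus)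
  qed
  also have "... = (\<integral>\<^sup>+x. ennreal (f x) \<partial>M) + ennreal (1 / real N)"
   using prob by (subst nn_integral_add) (auto simp: prob_space.emeasure_space_1)
  also have "... <= (\<integral>\<^sup>+x. ennreal (f x) \<partial>M) + ennreal e"
   using Ne by (intro add_left_mono ennreal_leI)
  finally show "ennreal (\<Lambda> f) <= (\<integral>\<^sup>+x. ennreal (f x) \<partial>M) + ennreal e" .
 qed
 have "(\<integral>\<^sup>+x. ennreal (f x) \<partial>M) = ennreal (\<Lambda> f)" if fb: "f \<in> bcont" and f01: "!!x. 0 <= f x & f x <= 1" for f
 proof -
  have fm[measurable]: "f \<in> bm borel" by (rule bcont_measurable[OF fb])
  have f01': "0 <= f x" "f x <= 1" for x using f01 by auto
  have L: "0 <= \<Lambda> f" "\<Lambda> f <= 1" using nonneg[OF fb] mono[OF fb, of "%_. 1"] one f01' by auto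
  have "ennreal (1 - \<Lambda> f) <= (\<integral>\<^sup>+x. ennreal (1 - f x) \<partial>M)"
   using le[of "%x. 1 - f x"] f01' by (simp add: bcont_diff fb diff one)
  moreover have "(\<integral>\<^sup>+x. ennreal (f x) \<partial>M) + (\<integral>\<^sup>+x. ennreal (1 - f x) \<partial>M) = 1"
   using prob f01' by (subst nn_integral_add[symmetric]) (auto simp flip: ennreal_plus simp: prob_space.emeasure_space_1)
  ultimately show ?thesis
   using le[OF fb f01] L
   by (cases "\<integral>\<^sup>+x. ennreal (f x) \<partial>M"; cases "\<integral>\<^sup>+x. ennreal (1 - f x) \<partial>M")
    (simp_all flip: ennreal_plus ennreal_1)
 qed
 with prob setsM show ?thesis by blast
qed

end

section \<open>Measures as limits of averages along a filter\<close>

lemma open_approx_SUP: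
 fixes M :: "'a::metric_space measure"
 assumes [measurable_cong]: "sets M = sets borel" and "open G"
 shows "(SUP n. \<integral>\<^sup>+x. ennreal (open_approx G n x) \<partial>M) = emeasure M G"
proof -
 have [measurable]: "open_approx G n \<in> bm borel" for n
  by (rule bcont_measurable[OF open_approx_bcont])
 have [measurable]: "G \<in> sets borel" using assms by auto
 have "(SUP n. \<integral>\<^sup>+x. ennreal (open_approx G n x) \<partial>M) = (\<integral>\<^sup>+x. (SUP n. ennreal (open_approx G n x)) \<partial>M)"
  by (rule nn_integral_monotone_convergence_SUP[symmetric])
   (auto simp: incseq_def le_fun_def intro!: ennreal_leI open_approx_mono)
 also have "... = (\<integral>\<^sup>+x. indicator G x \<partial>M)"
 proof (rule nn_integral_cong, rule antisym)
  fix x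
  show "(SUP n. ennreal (open_approx G n x)) <= indicator G x"
   by (rule SUP_least) (metis ennreal_indicator ennreal_leI open_approx_le)
  show "indicator G x <= (SUP n. ennreal (open_approx G n x))"
  proof (cases "x \<in> G")
   case True
   then obtain n where "open_approx G n x = 1"
    using open_approx_eventually_1[OF assms(2)] by (meson eventually_happens' sequentially_bot)
   then show ?thesis using True SUP_upper[of n UNIV "%n. ennreal (open_approx G n x)"] by simp
  qed simp
 qed
 finally show ?thesis by (simp add: assms)
qed

lemma measure_eqI_bcont:
 fixes M N :: "'a::metric_space measure"
 assumes M: "M \<in> space (prob_algebra borel)" and N: "N \<in> space (prob_algebra borel)"
  and eq: "!!f. f \<in> bcont ==> (!!x. 0 <= f x & f x <= 1) ==>
   (\<integral>\<^sup>+x. ennreal (f x) \<partial>M) = (\<integral>\<^sup>+x. ennreal (f x) \<partial>N)"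
 shows "M = N"
proof -
 have sM: "sets M = sets borel" and sN: "sets N = sets borel" and pM: "prob_space M"
  using M N by (auto simp: space_prob_algebra)
 have op: "emeasure M G = emeasure N G" if "open G" for G
 proof -
  have "(\<integral>\<^sup>+x. ennreal (open_approx G n x) \<partial>M) = (\<integral>\<^sup>+x. ennreal (open_approx G n x) \<partial>N)" for n
   by (rule eq) (auto simp: open_approx_bcont open_approx_nonneg
     intro: order_trans[OF open_approx_le indicator_le_1])
  then show ?thesis by (simp flip: open_approx_SUP[OF sM that] open_approx_SUP[OF sN that])
 qed
 show ?thesis
 proof (rule measure_eqI_generator_eq[where E="{G. open G}" and \<Omega>=UNIV and A="%_. UNIV"])
  show "emeasure M UNIV ~= \<infinity>" for i :: nat
   using prob_space.emeasure_space_1[OF pM] sets_eq_imp_space_eq[OF sM] by simp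
 qed (auto simp: Int_stable_def sM sN borel_def op)
qed

text \<open>By Tychonoff's theorem the sequence of families runs in a compact product of intervals;
  the filter describes large indices at which it is near a cluster point. A filter is used in place
  of a subsequence because the family, later all of \<open>bcont\<close>, need not be
  countable.\<close>

lemma bounded_family_limit_filter:
 fixes s :: "nat => 'i => real"
 assumes "!!i. i \<in> I ==> \<exists>B. \<forall>n. \<bar>s n i\<bar> <= B"
 shows "\<exists>F. F ~= bot & F <= sequentially & (\<forall>i\<in>I. \<exists>l. ((%n. s n i) \<longlongrightarrow> l) F)"
proof -
 obtain B where B: "!!i n. i \<in> I ==> \<bar>s n i\<bar> <= B i" using assms by metis
 define U where "U = PiE UNIV (%i. if i \<in> I then {- B i..B i} else {0})"
 define t where "t n i = (if i \<in> I then s n i else 0)" for n i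
 have "compactin (product_topology (%i. euclidean) UNIV) U"
  unfolding U_def compactin_PiE by auto
 then have "compact U" by (simp add: euclidean_product_topology)
 moreover have "t n \<in> U" for n
  using B by (auto simp: U_def t_def abs_le_iff minus_le_iff)
 then have "eventually (%x. x \<in> U) (filtermap t sequentially)" by (simp add: eventually_filtermap)
 ultimately obtain x where x: "inf (nhds x) (filtermap t sequentially) ~= bot"
  unfolding compact_filter by (metis filtermap_bot_iff sequentially_bot)
 define F where "F = inf (filtercomap t (nhds x)) sequentially"
 have "F ~= bot"
 proof
  assume "F = bot"
  then have "eventually (%_. False) F" by simp
  then obtain P Q where "eventually P (filtercomap t (nhds x))" "eventually Q sequentially"
   and PQ: "!!n. P n & Q n --> False" unfolding F_def eventually_inf by auto
  then obtain P' where P': "eventually P' (nhds x)" "!!n. P' (t n) ==> P n"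
   by (auto simp: eventually_filtercomap)
  have "eventually (%y. \<not> P' y) (filtermap t sequentially)"
   unfolding eventually_filtermap
   using \<open>eventually Q sequentially\<close> by eventually_elim (use PQ P' in blast)
  with P' have "eventually (%_. False) (inf (nhds x) (filtermap t sequentially))"
   unfolding eventually_inf by blast
  with x show False by (simp add: eventually_False)
 qed
 moreover have "F <= sequentially" by (simp add: F_def)
 moreover have "((%n. s n i) \<longlongrightarrow> x i) F" if "i \<in> I" for i
 proof -
  have "(t \<longlongrightarrow> x) F" unfolding F_def
   by (rule filterlim_inf[THEN iffD2] filterlim_mono[OF filterlim_filtercomap order_refl])+ simp
  then have "((%n. t n i) \<longlongrightarrow> x i) F"
   by (rule continuous_on_tendsto_compose[OF continuous_on_product_coordinates]) auto
  then show ?thesis using that by (simp add: t_def)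
 qed
 ultimately show ?thesis by blast
qed

lemma dini_compact:
 fixes F :: "nat => 'a::metric_space => real"
 assumes "compact C" "!!n. continuous_on UNIV (F n)" "!!n x. F (Suc n) x <= F n x"
  "!!x. (%n. F n x) \<longlonglongrightarrow> 0" "0 < e"
 shows "\<exists>n0. \<forall>n\<ge>n0. \<forall>x\<in>C. F n x < e"
proof -
 have dec: "n <= m ==> F m x <= F n x" for n m x
  by (rule decseqD[of "%n. F n x"]) (auto simp: decseq_Suc_iff assms)
 have "C \<subseteq> (\<Union>n\<in>UNIV. {x. F n x < e})"
  using order_tendstoD(2)[OF assms(4) \<open>0 < e\<close>] eventually_happens'[OF sequentially_bot] by blast
 moreover have "open {x. F n x < e}" for n
  by (intro open_Collect_less assms continuous_on_const)
 ultimately obtain S where S: "finite S" "C \<subseteq> (\<Union>n\<in>S. {x. F n x < e})"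
  using \<open>compact C\<close> by (metis (lifting) compactE_image)
 have "F n x < e" if "n \<ge> Max (insert 0 S)" "x \<in> C" for n x
 proof -
  from S(2) that(2) obtain m where "m \<in> S" "F m x < e" by auto
  moreover have "m <= n" using that S \<open>m \<in> S\<close> by auto
  ultimately show ?thesis using dec le_less_trans by blast
 qed
 then show ?thesis by blast
qed

text \<open>The averaged integrals converge along one filter on all of \<open>bcont\<close> at once.
  Tightness enters only through \<open>daniell\<close>, where Dini's theorem works on the compact
  set. The Feller property keeps \<open>bcont\<close> stable under \<open>K\<close>, so that the
  limits for \<open>f\<close> and for its image can be compared.\<close>

theorem krylov_bogoliubov:
 fixes K :: "'a::metric_space => 'a measure"
 assumes K[measurable]: "K \<in> borel \<rightarrow>\<^sub>M prob_algebra borel"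
  and feller: "!!f. f \<in> bcont ==> (!!x. 0 <= f x & f x <= 1) ==> continuous_on UNIV (%x. \<integral>y. f y \<partial>K x)"
  and \<mu>: "!!n. \<mu> n \<in> space (prob_algebra borel)" "!!n. \<mu> (Suc n) = \<mu> n \<bind> K"
  and tight: "!!e. 0 < e ==> \<exists>C. compact C & (\<forall>n. measure (\<mu> n) (- C) <= e)"
 shows "\<exists>\<pi>\<in>space (prob_algebra borel). \<pi> \<bind> K = \<pi>"
proof -
 have s\<mu>[measurable_cong]: "sets (\<mu> n) = sets borel" and p\<mu>: "prob_space (\<mu> n)" for n
  using \<mu>(1)[of n] by (auto simp: space_prob_algebra)
 have sK: "sets (K x) = sets borel" and pK: "prob_space (K x)" for x
  using measurable_space[OF K, of x] by (auto simp: space_prob_algebra)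
 have K'[measurable]: "K \<in> borel \<rightarrow>\<^sub>M subprob_algebra borel" by (rule measurable_prob_algebraD[OF K])
 have int: "integrable M f" if "f \<in> bcont" "prob_space M" "sets M = sets borel" for f and M :: "'a measure"
 proof -
  note bcontD(2)[OF that(1)]
  then obtain B where "\<forall>x. \<bar>f x\<bar> <= B" by blast
  moreover have "f \<in> bm M" using bcont_measurable[OF that(1)] that(3) mcong by blast
  ultimately show ?thesis using that(2)
   by (intro finite_measure.integrable_const_bound[where B=B]) (auto simp: prob_space.finite_measure)
 qed
 have bnd: "\<bar>\<integral>x. f x \<partial>M\<bar> <= B" if "f \<in> bcont" "!!x. \<bar>f x\<bar> <= B" "prob_space M" "sets M = sets borel" for f B and M :: "'a measure"
 proof -
  have "\<bar>\<integral>x. f x \<partial>M\<bar> <= (\<integral>x. \<bar>f x\<bar> \<partial>M)" by (rule integral_abs_bound)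
  also have "... <= (\<integral>x. B \<partial>M)"
   using int[OF that(1,3,4)] that(2) prob_space.finite_measure[OF that(3)]
   by (intro integral_mono) (auto simp: finite_measure.integrable_const)
  also have "... = B" using that(3) by (simp add: prob_space.prob_space)
  finally show ?thesis .
 qed
 define avg where "avg N f = (\<Sum>k<Suc N. \<integral>x. f x \<partial>\<mu> k) / real (Suc N)" for N f
 have avg_le: "avg N f <= c" if "!!k. (\<integral>x. f x \<partial>\<mu> k) <= c" for N f c
 proof -
  have "(\<Sum>k<Suc N. \<integral>x. f x \<partial>\<mu> k) <= (\<Sum>k<Suc N. c)" by (intro sum_mono that)
  then show ?thesis unfolding avg_def by (simp add: field_simps)
 qed
 have avg_bnd: "\<bar>avg N f\<bar> <= B" if "f \<in> bcont" "!!x. \<bar>f x\<bar> <= B" for N f B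
 proof -
  have "\<bar>\<Sum>k<Suc N. \<integral>x. f x \<partial>\<mu> k\<bar> <= (\<Sum>k<Suc N. B)"
   by (rule order_trans[OF sum_abs]) (intro sum_mono bnd that p\<mu> s\<mu>)
  then show ?thesis unfolding avg_def by (simp add: field_simps abs_divide)
 qed
 have "\<exists>B. \<forall>N. \<bar>avg N f\<bar> <= B" if "f \<in> bcont" for f
  using avg_bnd[OF that] bcontD(2)[OF that] by blast
 then obtain F where F: "F ~= bot" "F <= sequentially" "\<forall>f\<in>bcont. \<exists>l. ((%N. avg N f) \<longlongrightarrow> l) F"
  using bounded_family_limit_filter[of bcont avg] by blast
 define \<Lambda> where "\<Lambda> f = Lim F (%N. avg N f)" for f
 have lim: "((%N. avg N f) \<longlongrightarrow> \<Lambda> f) F" if "f \<in> bcont" for f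
  using F(1,3) that tendsto_Lim unfolding \<Lambda>_def by metis
 have \<Lambda>_eq: "\<Lambda> f = l" if "((%N. avg N f) \<longlongrightarrow> l) F" for f l
  using tendsto_Lim[OF F(1) that] by (simp add: \<Lambda>_def)
 interpret daniell_functional \<Lambda>
 proof
  show "\<Lambda> (%x. f x + g x) = \<Lambda> f + \<Lambda> g" if "f \<in> bcont" "g \<in> bcont" for f g
  proof (rule \<Lambda>_eq)
   have "avg N (%x. f x + g x) = avg N f + avg N g" for N
    using int[OF _ p\<mu> s\<mu>] that unfolding avg_def by (simp add: sum.distrib add_divide_distrib)
   then show "((%N. avg N (%x. f x + g x)) \<longlongrightarrow> \<Lambda> f + \<Lambda> g) F"
    using tendsto_add[OF lim[OF that(1)] lim[OF that(2)]] by simp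
  qed
  show "\<Lambda> (%x. c * f x) = c * \<Lambda> f" if "f \<in> bcont" for f c
  proof (rule \<Lambda>_eq)
   have "avg N (%x. c * f x) = c * avg N f" for N
    unfolding avg_def by (simp add: sum_distrib_left distrib_left)
   then show "((%N. avg N (%x. c * f x)) \<longlongrightarrow> c * \<Lambda> f) F"
    using tendsto_mult_left[OF lim[OF that]] by simp
  qed
  show "0 <= \<Lambda> f" if "f \<in> bcont" "!!x. 0 <= f x" for f
   using that F(1) by (intro tendsto_lowerbound[OF lim]) (auto simp: avg_def sum_nonneg)
  show "\<Lambda> (%_. 1) = 1"
   by (rule \<Lambda>_eq) (simp add: avg_def prob_space.prob_space[OF p\<mu>])
  show "(%n. \<Lambda> (f n)) \<longlonglongrightarrow> 0"
   if f: "!!n. f n \<in> bcont" "!!n x. 0 <= f n x" "!!n x. f (Suc n) x <= f n x" "!!x. (%n. f n x) \<longlonglongrightarrow> 0"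
   for f :: "nat => 'a => real"
  proof -
   have nn: "0 <= \<Lambda> (f n)" for n
    using f F(1) by (intro tendsto_lowerbound[OF lim]) (auto simp: avg_def sum_nonneg)
   obtain B where B: "!!x. \<bar>f 0 x\<bar> <= B" using bcontD(2)[OF f(1)] by blast
   have B0: "0 <= B" using B[of undefined] by linarith
   have fB: "f n x <= B" for n x
   proof -
    have "f n x <= f 0 x" by (rule decseqD[of "%n. f n x"]) (auto simp: decseq_Suc_iff f)
    then show ?thesis using B[of x] by linarith
   qed
   \<comment> \<open>On \<open>C\<close> the functions are eventually below \<open>e\<close>; off
     \<open>C\<close> they are at most \<open>B\<close>, on a set of mass at most
     \<open>e\<close>.\<close>
   have "\<exists>n0. \<forall>n\<ge>n0. \<Lambda> (f n) <= e + B * e" if e: "0 < e" for e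
   proof -
    obtain C where C: "compact C" "!!k. measure (\<mu> k) (- C) <= e" using tight[OF e] by auto
    obtain n0 where n0: "\<forall>n\<ge>n0. \<forall>x\<in>C. f n x < e"
     using dini_compact[OF C(1) bcontD(1)[OF f(1)] f(3,4) e] by auto
    have Cm: "- C \<in> sets borel" using C(1) by (simp add: borel_closed compact_imp_closed borel_comp)
    have "\<Lambda> (f n) <= e + B * e" if "n \<ge> n0" for n
    proof -
     have "(\<integral>x. f n x \<partial>\<mu> k) <= e + B * e" for k
     proof -
      interpret \<mu>k: prob_space "\<mu> k" by (rule p\<mu>)
      have ii: "integrable (\<mu> k) (indicat_real (- C))"
       using Cm by (intro \<mu>k.integrable_const_bound[where B=1]) (auto simp: s\<mu> mcong[OF s\<mu> refl])
      have "(\<integral>x. f n x \<partial>\<mu> k) <= (\<integral>x. e + B * indicat_real (- C) x \<partial>\<mu> k)"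
      proof (rule integral_mono[OF int[OF f(1) p\<mu> s\<mu>]])
       show "f n x <= e + B * indicat_real (- C) x" for x
        using n0 that fB[of n x] e by (cases "x \<in> C") (auto intro: less_imp_le)
      qed (use ii in auto)
      also have "... = e + B * measure (\<mu> k) (- C)"
       using ii Cm by (subst Bochner_Integration.integral_add) (use \<mu>k.prob_space in \<open>auto simp: s\<mu> sets_eq_imp_space_eq[OF s\<mu>]\<close>)
      also have "... <= e + B * e" using C(2) B0 by (intro add_left_mono mult_left_mono)
      finally show ?thesis .
     qed
     then have "avg N (f n) <= e + B * e" for N by (rule avg_le)
     then show ?thesis using F(1) by (intro tendsto_upperbound[OF lim[OF f(1)]]) auto
    qed
    then show ?thesis by blast
   qed
   note ex = this
   show ?thesis
   proof (rule LIMSEQ_I)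
    fix r :: real assume r: "0 < r"
    define e where "e = r / (2 * (1 + B))"
    have "1 + B ~= 0" using B0 by simp
    then have "e * (1 + B) = r / 2" by (simp only: e_def) (simp add: divide_simps)
    then have "e + B * e = r / 2" by (simp add: distrib_left mult.commute)
    moreover have "0 < e" using r B0 by (simp add: e_def)
    ultimately have e: "0 < e" "e + B * e < r" using r by auto
    then obtain n0 where "\<forall>n\<ge>n0. \<Lambda> (f n) <= e + B * e" using ex by blast
    then show "\<exists>no. \<forall>n\<ge>no. norm (\<Lambda> (f n) - 0) < r"
     using e nn by (intro exI[of _ n0]) force
   qed
  qed
 qed
 obtain \<pi> where \<pi>: "prob_space \<pi>" and s\<pi>[measurable_cong]: "sets \<pi> = sets borel"
  and rep: "!!f. f \<in> bcont ==> (!!x. 0 <= f x & f x <= 1) ==> (\<integral>\<^sup>+x. ennreal (f x) \<partial>\<pi>) = ennreal (\<Lambda> f)"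
  using representation by metis
 have \<pi>P: "\<pi> \<in> space (prob_algebra borel)" using \<pi> s\<pi> by (simp add: space_prob_algebra)
 have "\<pi> \<bind> K = \<pi>"
 proof (rule measure_eqI_bcont)
  show "\<pi> \<bind> K \<in> space (prob_algebra borel)"
   using pK sK K' \<pi> s\<pi>
   by (auto simp: space_prob_algebra sets_eq_imp_space_eq[OF s\<pi>] mcong[OF s\<pi> refl]
     intro!: prob_space.prob_space_bind[where S=borel] sets_bind)
  fix f :: "'a => real" assume f: "f \<in> bcont" "!!x. 0 <= f x & f x <= 1"
  have [measurable]: "f \<in> bm borel" by (rule bcont_measurable[OF f(1)])
  define Kf where "Kf x = (\<integral>y. f y \<partial>K x)" for x
  have Kf01: "0 <= Kf x & Kf x <= 1" for x
   using bnd[OF f(1) _ pK sK, of 1 x] f(2) unfolding Kf_def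
   by (auto simp: abs_le_iff intro!: integral_nonneg)
  have Kf: "Kf \<in> bcont" using feller[OF f] Kf01
   unfolding Kf_def[abs_def] by (intro bcontI[where B=1]) (auto simp: abs_le_iff)
  have KfE: "ennreal (Kf x) = (\<integral>\<^sup>+y. ennreal (f y) \<partial>K x)" for x
   unfolding Kf_def using f(2) int[OF f(1) pK sK] by (intro nn_integral_eq_integral[symmetric]) auto
  have step: "(\<integral>x. f x \<partial>\<mu> (Suc k)) = (\<integral>x. Kf x \<partial>\<mu> k)" for k
  proof -
   have "ennreal (\<integral>x. f x \<partial>\<mu> (Suc k)) = (\<integral>\<^sup>+x. ennreal (f x) \<partial>\<mu> (Suc k))"
    using f(2) int[OF f(1) p\<mu> s\<mu>] by (intro nn_integral_eq_integral[symmetric]) auto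
   also have "... = (\<integral>\<^sup>+x. ennreal (Kf x) \<partial>\<mu> k)"
    unfolding \<mu>(2) KfE by (subst nn_integral_bind[where B=borel]) (auto simp: mcong[OF s\<mu> refl])
   also have "... = ennreal (\<integral>x. Kf x \<partial>\<mu> k)"
    using Kf01 int[OF Kf p\<mu> s\<mu>] by (intro nn_integral_eq_integral) auto
   finally show ?thesis using f(2) Kf01 by (subst (asm) ennreal_inj) (auto intro!: integral_nonneg)
  qed
  have "((%N. avg N Kf - avg N f) \<longlongrightarrow> \<Lambda> Kf - \<Lambda> f) F"
   by (intro tendsto_diff lim Kf f)
  moreover have "((%N. avg N Kf - avg N f) \<longlongrightarrow> 0) sequentially"
  proof (rule tendsto_rabs_zero_cancel, rule tendsto_sandwich[of "%_. 0" _ _ "%N. 2 / real (Suc N)"])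
   have "\<bar>avg N Kf - avg N f\<bar> <= 2 / real (Suc N)" for N
   proof -
    \<comment> \<open>By \<open>step\<close> the two sums differ by one shift of the index and
      telescope to two end terms, each at most 1 in absolute value.\<close>
    have "avg N Kf - avg N f = ((\<Sum>k<Suc N. \<integral>x. f x \<partial>\<mu> (Suc k)) - (\<Sum>k<Suc N. \<integral>x. f x \<partial>\<mu> k)) / real (Suc N)"
     unfolding avg_def step by (simp only: diff_divide_distrib)
    also have "(\<Sum>k<Suc N. \<integral>x. f x \<partial>\<mu> (Suc k)) - (\<Sum>k<Suc N. \<integral>x. f x \<partial>\<mu> k) = (\<integral>x. f x \<partial>\<mu> (Suc N)) - (\<integral>x. f x \<partial>\<mu> 0)"
     unfolding sum_subtractf[symmetric]
     by (rule sum_lessThan_telescope[of "%k. \<integral>x. f x \<partial>\<mu> k" "Suc N"])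
    finally have "\<bar>avg N Kf - avg N f\<bar> = \<bar>(\<integral>x. f x \<partial>\<mu> (Suc N)) - (\<integral>x. f x \<partial>\<mu> 0)\<bar> / real (Suc N)"
     by (simp add: abs_divide)
    also have "... <= 2 / real (Suc N)"
    proof (rule divide_right_mono)
     have "\<bar>f x\<bar> <= 1" for x using f(2)[of x] by simp
     then have "\<bar>\<integral>x. f x \<partial>\<mu> k\<bar> <= 1" for k by (rule bnd[OF f(1) _ p\<mu> s\<mu>])
     from this[of "Suc N"] this[of 0]
     show "\<bar>(\<integral>x. f x \<partial>\<mu> (Suc N)) - (\<integral>x. f x \<partial>\<mu> 0)\<bar> <= 2" by linarith
    qed simp
    finally show ?thesis .
   qed
   then show "\<forall>\<^sub>F N in sequentially. \<bar>avg N Kf - avg N f\<bar> <= 2 / real (Suc N)" by simp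
  next
   show "(%N. 2 / real (Suc N)) \<longlonglongrightarrow> 0"
    using LIMSEQ_Suc[OF lim_const_over_n[of "2::real"]] by simp
  qed auto
  then have "((%N. avg N Kf - avg N f) \<longlongrightarrow> 0) F" using F(2) by (rule tendsto_mono[rotated])
  ultimately have "\<Lambda> Kf = \<Lambda> f" using tendsto_unique[OF F(1)] by fastforce
  have "(\<integral>\<^sup>+x. ennreal (f x) \<partial>(\<pi> \<bind> K)) = (\<integral>\<^sup>+x. ennreal (Kf x) \<partial>\<pi>)"
   unfolding KfE by (subst nn_integral_bind[where B=borel]) (auto simp: mcong[OF s\<pi> refl])
  also have "... = (\<integral>\<^sup>+x. ennreal (f x) \<partial>\<pi>)"
   using rep[OF Kf Kf01] rep[OF f] \<open>\<Lambda> Kf = \<Lambda> f\<close> by simp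
  finally show "(\<integral>\<^sup>+x. ennreal (f x) \<partial>(\<pi> \<bind> K)) = (\<integral>\<^sup>+x. ennreal (f x) \<partial>\<pi>)" .
 qed (rule \<pi>P)
 with \<pi>P show ?thesis by blast
qed

text \<open>The test functions of the asymptotic distance. Merging copies get close uniformly in the
  inputs but in no fixed compact set, so uniform continuity is required; the Lipschitz bound, with
  an arbitrary constant, provides it.\<close>

definition lip01 :: "('a::metric_space => real) set" where
 "lip01 = {f. (\<forall>x. 0 <= f x & f x <= 1) & (\<exists>L. \<forall>x y. \<bar>f x - f y\<bar> <= L * dist x y)}"

lemma lip01_bcont: assumes "f \<in> lip01" shows "f \<in> bcont"
proof (rule bcontI[where B=1])
 obtain L where L: "\<forall>x y. \<bar>f x - f y\<bar> <= L * dist x y" using assms by (auto simp: lip01_def)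
 then have "(max L 0)-lipschitz_on UNIV f"
  by (intro lipschitz_onI)
   (auto simp: dist_real_def intro: order_trans[OF _ mult_right_mono[OF max.cobounded1 zero_le_dist]])
 then show "continuous_on UNIV f" by (rule lipschitz_on_continuous_on)
qed (use assms in \<open>auto simp: lip01_def abs_le_iff intro: order_trans[of _ 0]\<close>)

text \<open>Inner regularity gives a compact \<open>C\<close> inside \<open>A\<close>, and
  \<open>1 - open_approx (- C) n\<close> is a Lipschitz function with constant \<open>n\<close> that
  decreases to the indicator of \<open>C\<close>. This lets the Hahn set of two invariant laws be
  tested by \<open>lip01\<close>.\<close>

lemma lip01_approx:
 fixes M :: "'a::{second_countable_topology, complete_space} measure"
 assumes M: "sets M = sets borel" "emeasure M UNIV ~= \<infinity>" and A: "A \<in> sets borel" and e: "0 < e"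
 shows "\<exists>f\<in>lip01. (\<integral>\<^sup>+x. ennreal \<bar>f x - indicator A x\<bar> \<partial>M) <= ennreal e"
proof -
 note M(1)[measurable_cong] A[measurable]
 have sp: "space M = UNIV" using sets_eq_imp_space_eq[OF M(1)] by simp
 have fin: "emeasure M B ~= \<infinity>" for B
  using M(2) emeasure_space[of M B] by (auto simp: sp top_unique)
 have "\<exists>C\<in>{C. C \<subseteq> A & compact C}. emeasure M A < emeasure M C + ennreal (e/2)"
  using e fin M by (intro SUP_approx_ennreal inner_regular A) (auto simp: sp)
 then obtain C where C: "C \<subseteq> A" "compact C" "emeasure M A < emeasure M C + ennreal (e/2)" by auto
 have oC: "open (- C)" using C(2) by (simp add: compact_imp_closed open_Compl)
 then have [measurable]: "- C \<in> sets borel" "C \<in> sets borel" using borel_comp[of "-C"] by auto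
 have [measurable]: "open_approx (- C) n \<in> bm borel" for n
  by (rule bcont_measurable[OF open_approx_bcont])
 have "\<exists>n\<in>UNIV. emeasure M (- C) < (\<integral>\<^sup>+x. ennreal (open_approx (- C) n x) \<partial>M) + ennreal (e/2)"
  using e fin by (intro SUP_approx_ennreal open_approx_SUP[symmetric] M oC) auto
 then obtain n where n: "emeasure M (- C) < (\<integral>\<^sup>+x. ennreal (open_approx (- C) n x) \<partial>M) + ennreal (e/2)" by auto
 define f where "f x = 1 - open_approx (- C) n x" for x
 have [measurable]: "f \<in> bm borel" unfolding f_def by measurable
 have f01: "0 <= f x" "f x <= 1" "x \<in> C ==> f x = 1" for x
  using open_approx_le[of "-C" n x] open_approx_nonneg[of "-C" n x]
   order_trans[OF open_approx_le indicator_le_1, of "-C" n x]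
  by (auto simp: f_def)
 have "\<bar>f x - f y\<bar> <= real n * dist x y" for x y
 proof (cases "C = {}")
  case False
  have "\<bar>real n * infdist x C - real n * infdist y C\<bar> = real n * \<bar>infdist x C - infdist y C\<bar>"
   by (simp add: abs_mult flip: right_diff_distrib)
  also have "... <= real n * dist x y" by (intro mult_left_mono infdist_triangle_abs) auto
  finally show ?thesis using False by (auto simp: f_def open_approx_def min_def)
 qed (simp add: f_def open_approx_def)
 with f01 have lip: "f \<in> lip01" unfolding lip01_def by blast
 \<comment> \<open>The two approximations from below stand on the left, so that no difference of
   \<open>ennreal\<close> values occurs; the finite terms are cancelled after integration.\<close>
 have pw: "ennreal \<bar>f x - indicator A x\<bar> + indicator C x + ennreal (open_approx (- C) n x)
   <= indicator A x + indicator (- C) x" for x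
 proof -
  have "\<bar>f x - indicator A x\<bar> + indicator C x + open_approx (- C) n x <= indicator A x + indicator (- C) x"
   using f01[of x] C(1) open_approx_nonneg[of "-C" n x]
   by (cases "x \<in> C"; cases "x \<in> A") (auto simp: f_def)
  then have "ennreal (\<bar>f x - indicator A x\<bar> + indicator C x + open_approx (- C) n x)
   <= ennreal (indicator A x + indicator (- C) x)" by (rule ennreal_leI)
  then show ?thesis using open_approx_nonneg[of "-C" n x] by (simp add: ennreal_indicator)
 qed
 have "(\<integral>\<^sup>+x. ennreal \<bar>f x - indicator A x\<bar> \<partial>M) + emeasure M C + (\<integral>\<^sup>+x. ennreal (open_approx (- C) n x) \<partial>M)
   = (\<integral>\<^sup>+x. ennreal \<bar>f x - indicator A x\<bar> + indicator C x + ennreal (open_approx (- C) n x) \<partial>M)"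
  by (simp add: nn_integral_add)
 also have "... <= (\<integral>\<^sup>+x. indicator A x + indicator (- C) x \<partial>M)" by (intro nn_integral_mono pw)
 also have "... = emeasure M A + emeasure M (- C)" by (simp add: nn_integral_add)
 also have "... <= (emeasure M C + ennreal (e/2)) + ((\<integral>\<^sup>+x. ennreal (open_approx (- C) n x) \<partial>M) + ennreal (e/2))"
  by (intro add_mono less_imp_le n C)
 also have "... = ennreal e + emeasure M C + (\<integral>\<^sup>+x. ennreal (open_approx (- C) n x) \<partial>M)"
  using e by (simp add: ac_simps) (simp add: add.assoc[symmetric] flip: ennreal_plus)
 finally have *: "(\<integral>\<^sup>+x. ennreal \<bar>f x - indicator A x\<bar> \<partial>M) + emeasure M C + (\<integral>\<^sup>+x. ennreal (open_approx (- C) n x) \<partial>M)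
  <= ennreal e + emeasure M C + (\<integral>\<^sup>+x. ennreal (open_approx (- C) n x) \<partial>M)" .
 have "(\<integral>\<^sup>+x. ennreal (open_approx (- C) n x) \<partial>M) <= (\<integral>\<^sup>+x. 1 \<partial>M)"
  by (intro nn_integral_mono) (metis ennreal_1 ennreal_leI indicator_le_1 open_approx_le order_trans)
 then have "(\<integral>\<^sup>+x. ennreal (open_approx (- C) n x) \<partial>M) ~= \<infinity>" using fin[of UNIV] by (auto simp: sp top_unique)
 then have "(\<integral>\<^sup>+x. ennreal \<bar>f x - indicator A x\<bar> \<partial>M) <= ennreal e"
  using * fin[of C] by (simp add: ennreal_add_left_cancel_le add.assoc add.commute[of _ "emeasure M C + _"])
 with lip show ?thesis by blast
qed

subsection \<open>Chains driven by random inputs\<close>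

definition step ::
 "('s => 'w measure) => ('s => 'w => 's) => ('s => ennreal) => 's => ennreal" where
 "step kap t f s = (\<integral>\<^sup>+w. f (t s w) \<partial>kap s)"

primrec run :: "('s => 'w => 's) => 's => (nat => 'w) => nat => 's" where
 "run t s om 0 = s"
| "run t s om (Suc n) = t (run t s om n) (om n)"

lemma run_Suc_shift: "run t s om (Suc n) = run t (t s (om 0)) (%i. om (Suc i)) n"
 by (induction n) auto

lemma run_add: "run t s om (m + n) = run t (run t s om m) (%i. om (m + i)) n"
 by (induction n) auto

lemma run_cong: "(!!i. i < n ==> om i = om' i) ==> run t s om n = run t s om' n"
 by (induction n) auto

text \<open>With its converse \<open>cond_distrD\<close> this trades conditional expectations for an
  identity of measures on rectangles, the only form in which conditioning is used
  afterwards.\<close>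

lemma cond_distrI:
 assumes P: "prob_space P" and F: "subalgebra P F" and Y[measurable]: "Y \<in> P \<rightarrow>\<^sub>M N"
  and m: "!!B. B \<in> sets N ==> (%om. emeasure (kap om) B) \<in> bm F"
  and eq: "!!A B. A \<in> sets F ==> B \<in> sets N ==>
   emeasure P {om\<in>space P. om \<in> A & Y om \<in> B} = (\<integral>\<^sup>+om. indicator A om * emeasure (kap om) B \<partial>P)"
 shows "cond_distr P F Y N kap"
 unfolding cond_distr_def
proof
 fix B assume B[measurable]: "B \<in> sets N"
 interpret P: prob_space P by fact
 interpret finite_measure_subalgebra P F by unfold_locales (rule F)
 have "AE om in P. emeasure (kap om) B = nn_cond_exp P F (indicator (Y -` B \<inter> space P)) om"
 proof (rule nn_cond_exp_charact)
  fix A assume A: "A \<in> sets F"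
  then have [measurable]: "A \<in> sets P" using F by (auto simp: subalgebra_def)
  have "(\<integral>\<^sup>+ x \<in> A. indicator (Y -` B \<inter> space P) x \<partial>P) = (\<integral>\<^sup>+x. indicator {om\<in>space P. om \<in> A & Y om \<in> B} x \<partial>P)"
   by (intro nn_integral_cong) (auto simp: indicator_def)
  also have "... = (\<integral>\<^sup>+om. indicator A om * emeasure (kap om) B \<partial>P)"
   using eq[OF A B] by (subst nn_integral_indicator) auto
  finally show "(\<integral>\<^sup>+ x \<in> A. indicator (Y -` B \<inter> space P) x \<partial>P) = (\<integral>\<^sup>+om\<in>A. emeasure (kap om) B \<partial>P)"
   by (simp add: mult.commute)
 qed (use m B in auto)
 then show "AE om in P. nn_cond_exp P F (indicator (Y -` B \<inter> space P)) om = emeasure (kap om) B"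
  by eventually_elim simp
qed

lemma cond_distrD:
 assumes P: "prob_space P" and F: "subalgebra P F" and Y[measurable]: "Y \<in> P \<rightarrow>\<^sub>M N"
  and c: "cond_distr P F Y N kap" and A: "A \<in> sets F" and B[measurable]: "B \<in> sets N"
 shows "emeasure P {om\<in>space P. om \<in> A & Y om \<in> B} = (\<integral>\<^sup>+om. indicator A om * emeasure (kap om) B \<partial>P)"
proof -
 interpret P: prob_space P by fact
 interpret finite_measure_subalgebra P F by unfold_locales (rule F)
 have [measurable]: "A \<in> sets P" using F A by (auto simp: subalgebra_def)
 have "(\<integral>\<^sup>+om. indicator A om * emeasure (kap om) B \<partial>P)
  = (\<integral>\<^sup>+om. indicator A om * nn_cond_exp P F (indicator (Y -` B \<inter> space P)) om \<partial>P)"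
  using c B unfolding cond_distr_def
  by (intro nn_integral_cong_AE) (drule (1) bspec, erule AE_mp, auto)
 also have "... = (\<integral>\<^sup>+om. indicator A om * indicator (Y -` B \<inter> space P) om \<partial>P)"
  using A by (intro nn_cond_exp_intg) auto
 also have "... = (\<integral>\<^sup>+x. indicator {om\<in>space P. om \<in> A & Y om \<in> B} x \<partial>P)"
  by (intro nn_integral_cong) (auto simp: indicator_def)
 finally show ?thesis by (subst (asm) nn_integral_indicator) auto
qed

text \<open>Rectangles are stable under intersection and generate the product, so the law of
  \<open>(X, Y)\<close> coincides with the measure \<open>Q\<close> built from the kernel; integrals
  of arbitrary nonnegative functions follow.\<close>

lemma kernel_disintegration:
 assumes P: "prob_space P" and X[measurable]: "X \<in> P \<rightarrow>\<^sub>M M" and Y[measurable]: "Y \<in> P \<rightarrow>\<^sub>M W"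
  and k[measurable]: "k \<in> M \<rightarrow>\<^sub>M prob_algebra W"
  and eq: "!!A B. A \<in> sets M ==> B \<in> sets W ==>
   emeasure P {x\<in>space P. X x \<in> A & Y x \<in> B} = (\<integral>\<^sup>+x. indicator A (X x) * emeasure (k (X x)) B \<partial>P)"
  and f[measurable]: "f \<in> bm (M \<Otimes>\<^sub>M W)"
 shows "(\<integral>\<^sup>+x. f (X x, Y x) \<partial>P) = (\<integral>\<^sup>+x. (\<integral>\<^sup>+w. f (X x, w) \<partial>k (X x)) \<partial>P)"
proof -
 interpret P: prob_space P by fact
 have ne: "space P ~= {}" by (rule P.not_empty)
 have k'[measurable]: "k \<in> M \<rightarrow>\<^sub>M subprob_algebra W" by (rule measurable_prob_algebraD[OF k])
 have sk: "sets (k m) = sets W" "prob_space (k m)" if "m \<in> space M" for m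
  using measurable_space[OF k that] by (auto simp: space_prob_algebra)
 define L where "L m = distr (k m) (M \<Otimes>\<^sub>M W) (Pair m)" for m
 have L[measurable]: "L \<in> M \<rightarrow>\<^sub>M prob_algebra (M \<Otimes>\<^sub>M W)" unfolding L_def by measurable
 have L'[measurable]: "L \<in> M \<rightarrow>\<^sub>M subprob_algebra (M \<Otimes>\<^sub>M W)" by (rule measurable_prob_algebraD[OF L])
 have LX: "(%x. L (X x)) \<in> P \<rightarrow>\<^sub>M subprob_algebra (M \<Otimes>\<^sub>M W)" by measurable
 define Q where "Q = P \<bind> (%x. L (X x))"
 have sQ[measurable_cong]: "sets Q = sets (M \<Otimes>\<^sub>M W)"
  unfolding Q_def using ne by (intro sets_bind) (auto simp: measurable_space[OF X] sets_kernel[OF L'])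
 have Qint: "(\<integral>\<^sup>+z. h z \<partial>Q) = (\<integral>\<^sup>+x. (\<integral>\<^sup>+w. h (X x, w) \<partial>k (X x)) \<partial>P)"
  if h[measurable]: "h \<in> bm (M \<Otimes>\<^sub>M W)" for h
  unfolding Q_def
  by (subst nn_integral_bind[OF h LX], intro nn_integral_cong, unfold L_def, subst nn_integral_distr)
   (auto simp: measurable_space[OF X] sk cong: mcong)
 have "distr P (M \<Otimes>\<^sub>M W) (%x. (X x, Y x)) = Q"
 proof (rule measure_eqI_generator_eq[OF Int_stable_pair_measure_generator[of M W] _ _ _ _, where A="%_. space M \<times> space W"])
  show "{a \<times> b |a b. a \<in> sets M & b \<in> sets W} \<subseteq> Pow (space M \<times> space W)"
   by (auto dest: sets.sets_into_space)
  fix Z assume "Z \<in> {a \<times> b |a b. a \<in> sets M & b \<in> sets W}"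
  then obtain A B where Z: "Z = A \<times> B" and [measurable]: "A \<in> sets M" "B \<in> sets W" by auto
  have "emeasure (distr P (M \<Otimes>\<^sub>M W) (%x. (X x, Y x))) Z = emeasure P {x\<in>space P. X x \<in> A & Y x \<in> B}"
   unfolding Z by (subst emeasure_distr) (auto intro!: arg_cong2[of _ _ _ _ emeasure])
  also have "... = (\<integral>\<^sup>+x. indicator A (X x) * emeasure (k (X x)) B \<partial>P)" by (rule eq) auto
  also have "... = (\<integral>\<^sup>+x. (\<integral>\<^sup>+w. indicator Z (X x, w) \<partial>k (X x)) \<partial>P)"
  proof (intro nn_integral_cong)
   fix x assume "x \<in> space P"
   then have m: "X x \<in> space M" by (rule measurable_space[OF X])
   have "(\<integral>\<^sup>+w. indicator Z (X x, w) \<partial>k (X x)) = (\<integral>\<^sup>+w. indicator A (X x) * indicator B w \<partial>k (X x))"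
    unfolding Z by (intro nn_integral_cong) (auto simp: indicator_def)
   then show "indicator A (X x) * emeasure (k (X x)) B = (\<integral>\<^sup>+w. indicator Z (X x, w) \<partial>k (X x))"
    using nn_integral_cmult_indicator[of B "k (X x)" "indicator A (X x)"] sk(1)[OF m] by simp
  qed
  also have "... = emeasure Q Z"
  proof -
   have Zm: "Z \<in> sets (M \<Otimes>\<^sub>M W)" unfolding Z by measurable
   then have "indicator Z \<in> bm (M \<Otimes>\<^sub>M W)" by measurable
   from Qint[OF this] nn_integral_indicator[of Z Q] Zm sQ show ?thesis by simp
  qed
  finally show "emeasure (distr P (M \<Otimes>\<^sub>M W) (%x. (X x, Y x))) Z = emeasure Q Z" .
 next
  show "emeasure (distr P (M \<Otimes>\<^sub>M W) (%x. (X x, Y x))) (space M \<times> space W) ~= \<infinity>" for i :: nat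
  proof -
   interpret D: prob_space "distr P (M \<Otimes>\<^sub>M W) (%x. (X x, Y x))" by (rule P.prob_space_distr) measurable
   show ?thesis by simp
  qed
 qed (auto simp: sets_pair_measure sQ)
 then have "(\<integral>\<^sup>+z. f z \<partial>distr P (M \<Otimes>\<^sub>M W) (%x. (X x, Y x))) = (\<integral>\<^sup>+z. f z \<partial>Q)" by simp
 then show ?thesis by (simp add: Qint nn_integral_distr)
qed

abbreviation hist :: "('a => 's) => (nat => 'a => 'w) => nat => 'a => 's \<times> (nat => 'w)" where
 "hist S Y n x \<equiv> (S x, \<lambda>i\<in>{..<n}. Y i x)"

section \<open>The transition operator and its iterates\<close>

locale driven_chain =
 fixes W :: "'w measure" and kap :: "'s::topological_space => 'w measure" and t :: "'s => 'w => 's"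
 assumes kernel[measurable]: "kap \<in> borel \<rightarrow>\<^sub>M prob_algebra W"
  and update[measurable]: "(%(s, w). t s w) \<in> borel \<Otimes>\<^sub>M W \<rightarrow>\<^sub>M borel"
begin

lemma kernel_sub[measurable]: "kap \<in> borel \<rightarrow>\<^sub>M subprob_algebra W"
 by (rule measurable_prob_algebraD[OF kernel])

lemma sets_kernel_eq[simp, measurable_cong]: "sets (kap s) = sets W"
 and prob_space_kernel: "prob_space (kap s)"
 using measurable_space[OF kernel, of s] by (auto simp: space_prob_algebra)

lemma space_kernel_eq[simp]: "space (kap s) = space W"
 using sets_kernel_eq by (rule sets_eq_imp_space_eq)

lemma update1[measurable]: "t s \<in> W \<rightarrow>\<^sub>M borel"
 using mcomp[OF measurable_Pair1' update, of s] by simp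

lemma step_measurable[measurable]: "f \<in> bm borel ==> step kap t f \<in> bm borel"
 unfolding step_def[abs_def]
 by (rule nn_integral_measurable_subprob_algebra2[where N=W]) auto

lemma step_pow_measurable[measurable]: "f \<in> bm borel ==> (step kap t ^^ n) f \<in> bm borel"
 by (induction n) auto

lemma step_mono: "(!!s. f s <= g s) ==> step kap t f s <= step kap t g s"
 unfolding step_def by (intro nn_integral_mono)

lemma step_mono_update: "(!!w. f (t s w) <= g (t s w)) ==> step kap t f s <= step kap t g s"
 unfolding step_def by (intro nn_integral_mono)

lemma step_pow_mono: "(!!s. f s <= g s) ==> (step kap t ^^ n) f s <= (step kap t ^^ n) g s"
 by (induction n arbitrary: s) (auto intro: step_mono)

lemma step_const: "step kap t (%_. c) = (%_. c)"
 by (auto simp: step_def prob_space.emeasure_space_1[OF prob_space_kernel, simplified])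

lemma step_pow_const: "(step kap t ^^ n) (%_. c) = (%_. c)"
 by (induction n) (auto simp: step_const)

lemma step_add: "f \<in> bm borel ==> g \<in> bm borel ==>
  step kap t (%s. f s + g s) = (%s. step kap t f s + step kap t g s)"
 unfolding step_def by (auto intro!: nn_integral_add)

lemma step_pow_add: "f \<in> bm borel ==> g \<in> bm borel ==>
  (step kap t ^^ n) (%s. f s + g s) = (%s. (step kap t ^^ n) f s + (step kap t ^^ n) g s)"
 by (induction n) (auto simp: step_add)

lemma step_cmult: "f \<in> bm borel ==> step kap t (%s. c * f s) = (%s. c * step kap t f s)"
 unfolding step_def by (auto intro!: nn_integral_cmult)

lemma step_pow_cmult: "f \<in> bm borel ==>
  (step kap t ^^ n) (%s. c * f s) = (%s. c * (step kap t ^^ n) f s)"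
 by (induction n) (auto simp: step_cmult)

text \<open>The comparison is required only at points that some input sequence reaches from
  \<open>s\<close>. This is how bounds that hold along every path, such as the contraction, pass to
  expectations.\<close>

lemma step_pow_mono_run:
 "(!!om. f (run t s om n) <= g (run t s om n)) ==> (step kap t ^^ n) f s <= (step kap t ^^ n) g s"
proof (induction n arbitrary: s)
 case (Suc n)
 have "(step kap t ^^ n) f (t s w) <= (step kap t ^^ n) g (t s w)" for w
 proof (rule Suc.IH)
  fix om
  show "f (run t (t s w) om n) <= g (run t (t s w) om n)"
   using Suc.prems[of "case_nat w om"] by (simp add: run_Suc_shift del: run.simps)
 qed
 then show ?case by (simp add: step_mono_update)
qed (use run.simps(1) in \<open>metis funpow_0\<close>)

section \<open>Input sequences with the conditional laws of the chain\<close>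

abbreviation Wpi :: "nat => (nat => 'w) measure" where
 "Wpi n \<equiv> PiM {..<n} (%_. W)"

lemma run_measurable':
 assumes [measurable]: "S \<in> P \<rightarrow>\<^sub>M borel" "!!i. i < n ==> (%x. Y x i) \<in> P \<rightarrow>\<^sub>M W"
 shows "(%x. run t (S x) (Y x) n) \<in> P \<rightarrow>\<^sub>M borel"
 using assms(2)
proof (induction n)
 case (Suc n)
 then have [measurable]: "(%x. run t (S x) (Y x) n) \<in> P \<rightarrow>\<^sub>M borel" "(%x. Y x n) \<in> P \<rightarrow>\<^sub>M W" by auto
 have "(%x. (%(s, w). t s w) (run t (S x) (Y x) n, Y x n)) \<in> P \<rightarrow>\<^sub>M borel" by measurable
 then show ?case by simp
qed simp

lemma run_measurable[measurable]: "(%(s, om). run t s om n) \<in> borel \<Otimes>\<^sub>M Wpi n \<rightarrow>\<^sub>M borel"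
 using run_measurable'[of fst "borel \<Otimes>\<^sub>M Wpi n" n snd] by (auto simp: case_prod_beta)

text \<open>A process is represented by its initial state and its inputs, all later states being
  functions of these. The integral identity says that the \<open>n\<close>-th input has conditional
  law \<open>kap\<close> of the current state given the history. The space of \<open>P\<close> stays
  arbitrary, so that processes on different path spaces can be compared.\<close>

definition driven :: "'p measure => ('p => 's) => (nat => 'p => 'w) => bool" where
 "driven P S Y \<longleftrightarrow> prob_space P & S \<in> P \<rightarrow>\<^sub>M borel & (\<forall>n. Y n \<in> P \<rightarrow>\<^sub>M W) &
   (\<forall>n. \<forall>f\<in>bm ((borel \<Otimes>\<^sub>M Wpi n) \<Otimes>\<^sub>M W).
    (\<integral>\<^sup>+x. f ((hist S Y n x), Y n x) \<partial>P) =
    (\<integral>\<^sup>+x. (\<integral>\<^sup>+w. f ((hist S Y n x), w) \<partial>kap (run t (S x) (%i. Y i x) n)) \<partial>P))"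

lemma drivenD:
 assumes "driven P S Y"
 shows "prob_space P" "S \<in> P \<rightarrow>\<^sub>M borel" "Y n \<in> P \<rightarrow>\<^sub>M W"
  "f \<in> bm ((borel \<Otimes>\<^sub>M Wpi n) \<Otimes>\<^sub>M W) ==>
    (\<integral>\<^sup>+x. f ((hist S Y n x), Y n x) \<partial>P) =
    (\<integral>\<^sup>+x. (\<integral>\<^sup>+w. f ((hist S Y n x), w) \<partial>kap (run t (S x) (%i. Y i x) n)) \<partial>P)"
 using assms unfolding driven_def by auto

lemma run_restrict: "run t s (\<lambda>i\<in>{..<n}. om i) n = run t s om n"
 by (rule run_cong) auto

lemma drivenI:
 assumes P: "prob_space P" and S[measurable]: "S \<in> P \<rightarrow>\<^sub>M borel" and Y[measurable]: "!!n. Y n \<in> P \<rightarrow>\<^sub>M W"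
  and eq: "!!n A B. A \<in> sets (borel \<Otimes>\<^sub>M Wpi n) ==> B \<in> sets W ==>
   emeasure P {x\<in>space P. (hist S Y n x) \<in> A & Y n x \<in> B} =
   (\<integral>\<^sup>+x. indicator A (hist S Y n x) * emeasure (kap (run t (S x) (%i. Y i x) n)) B \<partial>P)"
 shows "driven P S Y"
 unfolding driven_def
proof (intro conjI allI ballI P S Y)
 fix n and f :: "('s \<times> (nat => 'w)) \<times> 'w => ennreal"
 assume f: "f \<in> bm ((borel \<Otimes>\<^sub>M Wpi n) \<Otimes>\<^sub>M W)"
 have "(\<integral>\<^sup>+x. f ((hist S Y n x), Y n x) \<partial>P) =
  (\<integral>\<^sup>+x. (\<integral>\<^sup>+w. f ((hist S Y n x), w) \<partial>(%(s, om). kap (run t s om n)) (hist S Y n x)) \<partial>P)"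
 proof (rule kernel_disintegration[OF P _ Y _ _ f])
  show "(%x. (hist S Y n x)) \<in> P \<rightarrow>\<^sub>M borel \<Otimes>\<^sub>M Wpi n" by measurable
  show "(%(s, om). kap (run t s om n)) \<in> borel \<Otimes>\<^sub>M Wpi n \<rightarrow>\<^sub>M prob_algebra W"
   using mcomp[OF run_measurable kernel] by (simp add: case_prod_beta)
 qed (simp add: eq run_restrict)
 then show "(\<integral>\<^sup>+x. f ((hist S Y n x), Y n x) \<partial>P) =
    (\<integral>\<^sup>+x. (\<integral>\<^sup>+w. f ((hist S Y n x), w) \<partial>kap (run t (S x) (%i. Y i x) n)) \<partial>P)"
  by (simp add: run_restrict)
qed

lemma driven_expectation:
 assumes d: "driven P S Y" and f: "f \<in> bm borel"
 shows "(\<integral>\<^sup>+x. f (run t (S x) (%i. Y i x) n) \<partial>P) = (\<integral>\<^sup>+x. (step kap t ^^ n) f (S x) \<partial>P)"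
 using f
proof (induction n arbitrary: f)
 case (Suc n)
 note [measurable] = Suc.prems
 have "(%z. f (t (run t (fst (fst z)) (snd (fst z)) n) (snd z))) \<in> bm ((borel \<Otimes>\<^sub>M Wpi n) \<Otimes>\<^sub>M W)"
 proof -
  have "(%z. (%(s, w). t s w) ((%(s, om). run t s om n) (fst z), snd z)) \<in> (borel \<Otimes>\<^sub>M Wpi n) \<Otimes>\<^sub>M W \<rightarrow>\<^sub>M borel"
   by measurable
  from mcomp[OF this Suc.prems] show ?thesis by (simp add: case_prod_beta)
 qed
 from drivenD(4)[OF d this] have "(\<integral>\<^sup>+x. f (run t (S x) (%i. Y i x) (Suc n)) \<partial>P) =
   (\<integral>\<^sup>+x. step kap t f (run t (S x) (%i. Y i x) n) \<partial>P)"
  by (simp add: run_restrict step_def)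
 also have "... = (\<integral>\<^sup>+x. (step kap t ^^ n) (step kap t f) (S x) \<partial>P)" by (rule Suc.IH) simp
 finally show ?case by (simp add: funpow_Suc_right del: funpow.simps)
qed simp

lemma driven_shift:
 assumes d: "driven P S Y"
 shows "driven P (%x. t (S x) (Y 0 x)) (%n. Y (Suc n))"
 unfolding driven_def
proof (intro conjI allI ballI)
 note [measurable] = drivenD(2,3)[OF d]
 show "prob_space P" by (rule drivenD[OF d])
 show S': "(%x. t (S x) (Y 0 x)) \<in> P \<rightarrow>\<^sub>M borel"
  using run_measurable'[of S P 1 "%x i. Y i x"] by simp
 show "Y (Suc n) \<in> P \<rightarrow>\<^sub>M W" for n by measurable
 fix n and f :: "('s \<times> (nat => 'w)) \<times> 'w => ennreal"
 assume f[measurable]: "f \<in> bm ((borel \<Otimes>\<^sub>M Wpi n) \<Otimes>\<^sub>M W)"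
 define g where "g z = f ((t (fst (fst z)) (snd (fst z) 0), \<lambda>i\<in>{..<n}. snd (fst z) (Suc i)), snd z)" for z :: "('s \<times> (nat => 'w)) \<times> 'w"
 have [measurable]: "(%z. t (fst (fst z)) (snd (fst z) 0)) \<in> (borel \<Otimes>\<^sub>M Wpi (Suc n)) \<Otimes>\<^sub>M W \<rightarrow>\<^sub>M borel"
  using run_measurable'[of "%z. fst (fst z)" "(borel \<Otimes>\<^sub>M Wpi (Suc n)) \<Otimes>\<^sub>M W" 1 "%z. snd (fst z)"] by simp
 have "g \<in> bm ((borel \<Otimes>\<^sub>M Wpi (Suc n)) \<Otimes>\<^sub>M W)"
  unfolding g_def by measurable
 from drivenD(4)[OF d this]
 show "(\<integral>\<^sup>+x. f ((t (S x) (Y 0 x), \<lambda>i\<in>{..<n}. Y (Suc i) x), Y (Suc n) x) \<partial>P) =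
  (\<integral>\<^sup>+x. (\<integral>\<^sup>+w. f ((t (S x) (Y 0 x), \<lambda>i\<in>{..<n}. Y (Suc i) x), w) \<partial>kap (run t (t (S x) (Y 0 x)) (%i. Y (Suc i) x) n)) \<partial>P)"
  by (simp add: g_def run_Suc_shift[of t] cong: restrict_cong del: run.simps)
qed

abbreviation joint :: "'p measure => ('p => 's) => (nat => 'p => 'w) => ('s \<times> (nat => 'w)) measure" where
 "joint P S Y \<equiv> distr P (borel \<Otimes>\<^sub>M PiM UNIV (%_. W)) (%x. (S x, %i. Y i x))"

lemma joint_measurable:
 assumes [measurable]: "S \<in> P \<rightarrow>\<^sub>M borel" "!!n. Y n \<in> P \<rightarrow>\<^sub>M W"
 shows "(%x. (S x, %i. Y i x)) \<in> P \<rightarrow>\<^sub>M borel \<Otimes>\<^sub>M PiM UNIV (%_. W)"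
proof -
 have "(%x. \<lambda>i\<in>UNIV. Y i x) \<in> P \<rightarrow>\<^sub>M PiM UNIV (%_. W)" by (rule measurable_restrict) simp
 then show ?thesis by (simp add: restrict_def)
qed

text \<open>The law of the history up to \<open>n\<close> is determined by induction, adding one
  input at a time; the cylinders over these histories are stable under intersection and generate the
  product.\<close>

theorem driven_unique:
 assumes d: "driven P S Y" and d': "driven P' S' Y'" and S: "distr P borel S = distr P' borel S'"
 shows "joint P S Y = joint P' S' Y'"
proof -
 note [measurable] = drivenD(2,3)[OF d] drivenD(2,3)[OF d']
 have fin: "(\<integral>\<^sup>+x. f (hist S Y n x) \<partial>P) = (\<integral>\<^sup>+x. f (S' x, \<lambda>i\<in>{..<n}. Y' i x) \<partial>P')"
  if "f \<in> bm (borel \<Otimes>\<^sub>M Wpi n)" for f n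
  using that
 proof (induction n arbitrary: f)
  case 0
  note [measurable] = 0
  have m: "(%s. f (s, \<lambda>i\<in>{..<0}. undefined)) \<in> bm borel"
  proof -
   have "(%s::'s. (s, \<lambda>i\<in>{..<0::nat}. undefined :: 'w)) \<in> borel \<rightarrow>\<^sub>M borel \<Otimes>\<^sub>M Wpi 0"
    by (intro measurable_Pair measurable_ident measurable_restrict) auto
   from mcomp[OF this 0] show ?thesis .
  qed
  have "(\<integral>\<^sup>+s. f (s, \<lambda>i\<in>{..<0}. undefined) \<partial>distr P borel S) = (\<integral>\<^sup>+s. f (s, \<lambda>i\<in>{..<0}. undefined) \<partial>distr P' borel S')"
   by (simp add: S)
  with m show ?case by (simp add: nn_integral_distr restrict_def)
 next
  case (Suc n)
  note [measurable] = Suc.prems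
  define g where "g z = f (fst (fst z), (snd (fst z))(n := snd z))" for z :: "('s \<times> (nat => 'w)) \<times> 'w"
  have u: "(%z. (snd (fst z))(n := snd z)) \<in> (borel \<Otimes>\<^sub>M Wpi n) \<Otimes>\<^sub>M W \<rightarrow>\<^sub>M Wpi (Suc n)"
   using mcomp[OF _ measurable_add_dim[of n "{..<n}" "%_. W"], of "%z. (snd (fst z), snd z)" "(borel \<Otimes>\<^sub>M Wpi n) \<Otimes>\<^sub>M W"]
   by (simp add: lessThan_Suc)
  have gm[measurable]: "g \<in> bm ((borel \<Otimes>\<^sub>M Wpi n) \<Otimes>\<^sub>M W)"
   unfolding g_def[abs_def] by (rule mcomp[OF _ Suc.prems]) (use u in measurable)
  have e: "(\<lambda>i\<in>{..<Suc n}. y i) = (\<lambda>i\<in>{..<n}. y i)(n := y n)" for y :: "nat => 'w"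
   by (auto simp: fun_eq_iff)
  define G where "G sw = (\<integral>\<^sup>+w. g (sw, w) \<partial>kap (run t (fst sw) (snd sw) n))" for sw
  have Gm: "G \<in> bm (borel \<Otimes>\<^sub>M Wpi n)"
   unfolding G_def
  proof (rule nn_integral_measurable_subprob_algebra2[where N=W])
   show "(%sw. kap (run t (fst sw) (snd sw) n)) \<in> borel \<Otimes>\<^sub>M Wpi n \<rightarrow>\<^sub>M subprob_algebra W"
    using mcomp[OF run_measurable kernel_sub] by (simp add: case_prod_beta)
  qed simp
  have "(\<integral>\<^sup>+x. f (S x, \<lambda>i\<in>{..<Suc n}. Y i x) \<partial>P) = (\<integral>\<^sup>+x. g ((hist S Y n x), Y n x) \<partial>P)"
   unfolding g_def e by simp
  also have "... = (\<integral>\<^sup>+x. G (hist S Y n x) \<partial>P)"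
   unfolding drivenD(4)[OF d gm] by (simp add: G_def run_restrict)
  also have "... = (\<integral>\<^sup>+x. G (S' x, \<lambda>i\<in>{..<n}. Y' i x) \<partial>P')" by (rule Suc.IH[OF Gm])
  also have "... = (\<integral>\<^sup>+x. g ((S' x, \<lambda>i\<in>{..<n}. Y' i x), Y' n x) \<partial>P')"
   unfolding drivenD(4)[OF d' gm] by (simp add: G_def run_restrict)
  also have "... = (\<integral>\<^sup>+x. f (S' x, \<lambda>i\<in>{..<Suc n}. Y' i x) \<partial>P')" unfolding g_def e by simp
  finally show ?case .
 qed
 let ?M = "borel \<Otimes>\<^sub>M PiM UNIV (%_::nat. W) :: ('s \<times> (nat => 'w)) measure"
 define cut where "cut n z = (fst z, \<lambda>i\<in>{..<n}. snd z i)" for n :: nat and z :: "'s \<times> (nat => 'w)"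
 have cut[measurable]: "cut n \<in> ?M \<rightarrow>\<^sub>M borel \<Otimes>\<^sub>M Wpi n" for n
  unfolding cut_def by measurable
 define E where "E = {cut n -` A \<inter> space ?M |n A. A \<in> sets (borel \<Otimes>\<^sub>M Wpi n)}"
 \<comment> \<open>A cylinder over a shorter history is also one over any longer history, so two
   cylinders can be brought to the common level \<open>max n m\<close>.\<close>
 have cut_cut: "\<exists>A'\<in>sets (borel \<Otimes>\<^sub>M Wpi m). cut n -` A \<inter> space ?M = cut m -` A' \<inter> space ?M"
  if "n <= m" "A \<in> sets (borel \<Otimes>\<^sub>M Wpi n)" for n m A
 proof -
  have c: "cut n \<in> borel \<Otimes>\<^sub>M Wpi m \<rightarrow>\<^sub>M borel \<Otimes>\<^sub>M Wpi n"
   unfolding cut_def using that by (intro measurable_Pair measurable_fst measurable_restrict mcomp[OF measurable_snd] mcoord) auto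
  have cc: "cut n (cut m z) = cut n z" for z using that by (auto simp: cut_def fun_eq_iff)
  have "cut n -` A \<inter> space ?M = cut m -` (cut n -` A \<inter> space (borel \<Otimes>\<^sub>M Wpi m)) \<inter> space ?M"
  proof (intro set_eqI)
   fix z show "z \<in> cut n -` A \<inter> space ?M \<longleftrightarrow> z \<in> cut m -` (cut n -` A \<inter> space (borel \<Otimes>\<^sub>M Wpi m)) \<inter> space ?M"
    unfolding Int_iff vimage_eq cc by (metis measurable_space[OF cut[of m]])
  qed
  then show ?thesis using measurable_sets[OF c that(2)] by blast
 qed
 have "Int_stable E"
 proof (rule Int_stableI)
  fix a b assume "a \<in> E" "b \<in> E"
  then obtain n A m B where a: "a = cut n -` A \<inter> space ?M" "A \<in> sets (borel \<Otimes>\<^sub>M Wpi n)"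
   and b: "b = cut m -` B \<inter> space ?M" "B \<in> sets (borel \<Otimes>\<^sub>M Wpi m)" unfolding E_def by blast
  obtain A' where A': "A' \<in> sets (borel \<Otimes>\<^sub>M Wpi (max n m))" "a = cut (max n m) -` A' \<inter> space ?M"
   using cut_cut[of n "max n m" A] a by auto
  obtain B' where B': "B' \<in> sets (borel \<Otimes>\<^sub>M Wpi (max n m))" "b = cut (max n m) -` B' \<inter> space ?M"
   using cut_cut[of m "max n m" B] b by auto
  have "a \<inter> b = cut (max n m) -` (A' \<inter> B') \<inter> space ?M" using A' B' by auto
  then show "a \<inter> b \<in> E" unfolding E_def using A' B' by blast
 qed
 have Esub: "E \<subseteq> sets ?M" unfolding E_def using measurable_sets[OF cut] by auto
 have EP: "E \<subseteq> Pow (space ?M)" using Esub sets.sets_into_space by blast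
 have gen: "sets ?M = sigma_sets (space ?M) E"
 proof (rule antisym)
  show "sigma_sets (space ?M) E \<subseteq> sets ?M" using Esub by (rule sets.sigma_sets_subset)
  have cutE: "cut n \<in> sigma (space ?M) E \<rightarrow>\<^sub>M borel \<Otimes>\<^sub>M Wpi n" for n
   using measurable_space[OF cut[of n]] EP
   by (intro measurableI) (auto simp: space_measure_of_conv sets_measure_of E_def intro!: sigma_sets.Basic)
  have "(%z. z) \<in> sigma (space ?M) E \<rightarrow>\<^sub>M ?M"
  proof -
   have "fst \<in> sigma (space ?M) E \<rightarrow>\<^sub>M borel"
    using mcomp[OF cutE[of 0] measurable_fst] by (simp add: cut_def)
   moreover have "(%z. snd z i) \<in> sigma (space ?M) E \<rightarrow>\<^sub>M W" for i
    using mcomp[OF mcomp[OF cutE[of "Suc i"] measurable_snd] mcoord[of i]]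
    by (simp add: cut_def)
   then have "snd \<in> sigma (space ?M) E \<rightarrow>\<^sub>M PiM UNIV (%_. W)"
    using measurable_restrict[of UNIV "%i z. snd z i" "sigma (space ?M) E" "%_. W"] by (simp add: restrict_def)
   ultimately show ?thesis by (simp add: measurable_pair_iff comp_def)
  qed
  from measurable_sets[OF this] EP show "sets ?M \<subseteq> sigma_sets (space ?M) E"
   using sets.sets_into_space by (auto simp: sets_measure_of space_measure_of_conv Int_absorb2 subset_iff)
 qed
 have em: "emeasure (joint Q T Z) (cut n -` A \<inter> space ?M) = (\<integral>\<^sup>+x. indicator A (T x, \<lambda>i\<in>{..<n}. Z i x) \<partial>Q)"
  if [measurable]: "T \<in> Q \<rightarrow>\<^sub>M borel" "!!n. Z n \<in> Q \<rightarrow>\<^sub>M W" and A[measurable]: "A \<in> sets (borel \<Otimes>\<^sub>M Wpi n)"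
  for Q :: "'q measure" and T Z n A
 proof -
  have [measurable]: "(%x. (T x, %i. Z i x)) \<in> Q \<rightarrow>\<^sub>M ?M" by (rule joint_measurable) measurable
  have "emeasure (joint Q T Z) (cut n -` A \<inter> space ?M) = (\<integral>\<^sup>+z. indicator (cut n -` A \<inter> space ?M) z \<partial>joint Q T Z)"
   using measurable_sets[OF cut A] by (subst nn_integral_indicator) auto
  also have "... = (\<integral>\<^sup>+x. indicator (cut n -` A \<inter> space ?M) (T x, %i. Z i x) \<partial>Q)"
   using measurable_sets[OF cut A] by (subst nn_integral_distr) auto
  also have "... = (\<integral>\<^sup>+x. indicator A (T x, \<lambda>i\<in>{..<n}. Z i x) \<partial>Q)"
   using measurable_space[OF joint_measurable[OF that(1,2)]]
   by (intro nn_integral_cong) (auto simp: indicator_def cut_def)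
  finally show ?thesis .
 qed
 show ?thesis
 proof (rule measure_eqI_generator_eq[OF \<open>Int_stable E\<close> EP, where A="%_. space ?M"])
  fix X assume "X \<in> E"
  then obtain n A where X: "X = cut n -` A \<inter> space ?M" and A: "A \<in> sets (borel \<Otimes>\<^sub>M Wpi n)" unfolding E_def by blast
  show "emeasure (joint P S Y) X = emeasure (joint P' S' Y') X"
   unfolding X using A by (subst (1 2) em) (auto intro!: fin)
 next
  show "range (%_. space ?M) \<subseteq> E"
  proof -
   have "space ?M = cut 0 -` space (borel \<Otimes>\<^sub>M Wpi 0) \<inter> space ?M" using measurable_space[OF cut[of 0]] by auto
   then show ?thesis unfolding E_def by blast
  qed
  interpret J: prob_space "joint P S Y"
   by (intro prob_space.prob_space_distr drivenD(1)[OF d] joint_measurable) measurable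
  show "emeasure (joint P S Y) (space ?M) ~= \<infinity>" for i :: nat by simp
 qed (use gen in auto)
qed


text \<open>The theorem of Ionescu Tulcea is applied with coordinates that are pairs of a current
  state and an input; the initial state then needs no coordinate of its own, and all coordinates
  have the same type.\<close>

theorem driven_exists:
 assumes \<xi>: "\<xi> \<in> space (prob_algebra borel)"
 shows "\<exists>(P :: (nat => 's \<times> 'w) measure) S Y. driven P S Y & distr P borel S = \<xi>"
proof -
 define MM where "MM = (borel \<Otimes>\<^sub>M W :: ('s \<times> 'w) measure)"
 define J where "J s = distr (kap s) MM (Pair s)" for s
 have Jp[measurable]: "J \<in> borel \<rightarrow>\<^sub>M prob_algebra MM" unfolding J_def MM_def by measurable
 have Js[measurable]: "J \<in> borel \<rightarrow>\<^sub>M subprob_algebra MM" by (rule measurable_prob_algebraD[OF Jp])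
 have p\<xi>: "prob_space \<xi>" and s\<xi>[measurable_cong]: "sets \<xi> = sets borel" using \<xi> by (auto simp: space_prob_algebra)
 have sp\<xi>: "space \<xi> = UNIV" using sets_eq_imp_space_eq[OF s\<xi>] by simp
 have pJ: "prob_space (J s)" and sJ[measurable_cong]: "sets (J s) = sets MM" for s
  using measurable_space[OF Jp, of s] by (auto simp: space_prob_algebra)
 have J_int: "(\<integral>\<^sup>+m. h m \<partial>J s) = (\<integral>\<^sup>+w. h (s, w) \<partial>kap s)" if [measurable]: "h \<in> bm MM" for h s
  unfolding J_def using that unfolding MM_def by (subst nn_integral_distr) auto
 \<comment> \<open>Of the state components of the past only that of coordinate 0 is read; the
   current state is recomputed from it and the inputs.\<close>
 define Pk where "Pk n om = (case n of 0 => \<xi> \<bind> J | Suc i => J (run t (fst (om 0)) (%j. snd (om j)) n))" for n and om :: "nat => 's \<times> 'w"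
 have \<xi>J: "prob_space (\<xi> \<bind> J)" "sets (\<xi> \<bind> J) = sets MM"
 proof -
  have "J \<in> \<xi> \<rightarrow>\<^sub>M subprob_algebra MM" using Js mcong[OF s\<xi> refl] by blast
  then show "prob_space (\<xi> \<bind> J)" using pJ by (intro prob_space.prob_space_bind[OF p\<xi>, where S=MM]) auto
  show "sets (\<xi> \<bind> J) = sets MM" by (rule sets_bind) (auto simp: sJ sp\<xi>)
 qed
 have MMf: "fst \<in> MM \<rightarrow>\<^sub>M borel" "snd \<in> MM \<rightarrow>\<^sub>M W" unfolding MM_def by measurable
 have runm: "(%om. run t (fst (om 0)) (%j. snd (om j)) n) \<in> PiM {0..<n} (%_. MM) \<rightarrow>\<^sub>M borel" if "0 < n" for n
 proof (rule run_measurable'[of "%om. fst (om 0)" _ n "%om j. snd (om j)"])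
  show "(%om. fst (om 0)) \<in> PiM {0..<n} (%_. MM) \<rightarrow>\<^sub>M borel"
   using that by (intro mcomp[OF mcoord[of 0 "{0..<n}" "%_. MM"] MMf(1)]) auto
  show "(%om. snd (om i)) \<in> PiM {0..<n} (%_. MM) \<rightarrow>\<^sub>M W" if "i < n" for i
   using that by (intro mcomp[OF mcoord[of i "{0..<n}" "%_. MM"] MMf(2)]) auto
 qed
 interpret IT: Ionescu_Tulcea Pk "%_. MM"
 proof (rule Ionescu_Tulcea.intro)
  show "Pk i \<in> PiM {0..<i} (%_. MM) \<rightarrow>\<^sub>M subprob_algebra MM" for i
  proof (cases i)
   case 0
   have "Pk 0 = (%_. \<xi> \<bind> J)" by (simp add: Pk_def fun_eq_iff)
   then show ?thesis using 0 \<xi>J by (simp add: space_subprob_algebra prob_space_imp_subprob_space)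
  next
   case (Suc j)
   then show ?thesis unfolding Pk_def[abs_def] using mcomp[OF runm[of i] Js] by simp
  qed
  show "prob_space (Pk i x)" for i x using \<xi>J pJ by (auto simp: Pk_def split: nat.split)
 qed
 define Q where "Q = IT.PF.lim"
 have sQ[measurable_cong]: "sets Q = sets (PiM UNIV (%_. MM))" unfolding Q_def by simp
 have ut: "IT.up_to {0..<k} = k" for k
  unfolding IT.up_to_def
 proof (rule Least_equality)
  show "k <= y" if "\<forall>i\<ge>y. i \<notin> {0..<k}" for y using that[rule_format, of y] by auto
 qed auto
 have law: "distr Q (PiM {0..<k} (%_. MM)) (%om. restrict om {0..<k}) = IT.C 0 k (%_. undefined)" for k
 proof -
  have "distr Q (PiM {0..<k} (%_. MM)) (%om. restrict om {0..<k}) = IT.CI {0..<k}"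
   unfolding Q_def by (rule IT.distr_lim) simp
  also have "... = distr (IT.C 0 k (%_. undefined)) (PiM {0..<k} (%_. MM)) (%om. restrict om {0..<k})"
   by (simp add: IT.CI_def ut)
  also have "... = IT.C 0 k (%_. undefined)"
   by (rule IT.distr_C[of k k "%_. undefined" 0, simplified, symmetric])
  finally show ?thesis .
 qed
 have pQ: "prob_space Q"
 proof (rule prob_space_distrD)
  show "(%om. restrict om {0..<0}) \<in> Q \<rightarrow>\<^sub>M PiM {0..<0} (%_. MM)" by measurable
  show "prob_space (distr Q (PiM {0..<0} (%_. MM)) (%om. restrict om {0..<0}))"
   unfolding law by (rule IT.prob_space_C) (simp add: space_PiM)
 qed
 have marg: "(\<integral>\<^sup>+om. f (restrict om {0..<Suc n}) \<partial>Q) =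
   (\<integral>\<^sup>+om. (\<integral>\<^sup>+m. f ((restrict om {0..<n})(n := m)) \<partial>Pk n (restrict om {0..<n})) \<partial>Q)"
  if f[measurable]: "f \<in> bm (PiM {0..<Suc n} (%_. MM))" for f n
 proof -
  have "(\<integral>\<^sup>+om. f (restrict om {0..<Suc n}) \<partial>Q) = (\<integral>\<^sup>+x. f x \<partial>IT.C 0 (Suc n) (%_. undefined))"
   unfolding law[symmetric] by (subst nn_integral_distr) auto
  also have "... = (\<integral>\<^sup>+x. (\<integral>\<^sup>+y. f y \<partial>IT.eP n x) \<partial>IT.C 0 n (%_. undefined))"
   using IT.measurable_eP[of n] IT.sets_C[of "%_. undefined" 0 n]
   by (simp, subst nn_integral_bind[OF f]) (auto simp: space_PiM cong: mcong)
  also have "... = (\<integral>\<^sup>+x. (\<integral>\<^sup>+m. f (x(n := m)) \<partial>Pk n x) \<partial>IT.C 0 n (%_. undefined))"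
   using IT.space_C[of "%_. undefined" 0 n] by (intro nn_integral_cong IT.nn_integral_eP f) (auto simp: space_PiM)
  also have "... = (\<integral>\<^sup>+om. (\<integral>\<^sup>+m. f ((restrict om {0..<n})(n := m)) \<partial>Pk n (restrict om {0..<n})) \<partial>Q)"
  proof -
   have "(%x. \<integral>\<^sup>+m. f (x(n := m)) \<partial>Pk n x) \<in> bm (PiM {0..<n} (%_. MM))"
   proof (rule nn_integral_measurable_subprob_algebra2[where N=MM])
    show "(%(x, y). f (x(n := y))) \<in> bm (PiM {0..<n} (%_. MM) \<Otimes>\<^sub>M MM)"
     using mcomp[OF measurable_add_dim[of n "{0..<n}" "%_. MM"], of f borel] f
     by (simp add: atLeast0_lessThan_Suc case_prod_beta)
   qed (rule IT.P)
   then show ?thesis unfolding law[symmetric] by (subst nn_integral_distr) auto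
  qed
  finally show ?thesis .
 qed
 define S where "S om = fst (om 0)" for om :: "nat => 's \<times> 'w"
 define Y where "Y n om = snd (om n)" for n :: nat and om :: "nat => 's \<times> 'w"
 have Sm[measurable]: "S \<in> Q \<rightarrow>\<^sub>M borel" and Ym[measurable]: "Y n \<in> Q \<rightarrow>\<^sub>M W" for n
  unfolding S_def Y_def using MMf mcomp[OF mcoord[of _ UNIV "%_. MM"]]
  by (auto simp: mcong[OF sQ refl])
 have zero: "(\<integral>\<^sup>+om. g (om 0) \<partial>Q) = (\<integral>\<^sup>+s. (\<integral>\<^sup>+w. g (s, w) \<partial>kap s) \<partial>\<xi>)" if g: "g \<in> bm MM" for g
 proof -
  have "(%x. g (x 0)) \<in> bm (PiM {0..<Suc 0} (%_. MM))"
   by (rule mcomp[OF mcoord[of 0 "{0..<Suc 0}" "%_. MM"] g]) simp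
  from marg[OF this] have "(\<integral>\<^sup>+om. g (om 0) \<partial>Q) = (\<integral>\<^sup>+om. (\<integral>\<^sup>+m. g m \<partial>(\<xi> \<bind> J)) \<partial>Q)"
   by (simp add: Pk_def)
  also have "... = (\<integral>\<^sup>+m. g m \<partial>(\<xi> \<bind> J))"
   using prob_space.emeasure_space_1[OF pQ] by simp
  also have "... = (\<integral>\<^sup>+s. (\<integral>\<^sup>+w. g (s, w) \<partial>kap s) \<partial>\<xi>)"
   by (subst nn_integral_bind[OF g]) (auto simp: J_int g mcong[OF s\<xi> refl])
  finally show ?thesis .
 qed
 have zeroS: "(\<integral>\<^sup>+om. g (S om) \<partial>Q) = (\<integral>\<^sup>+s. g s \<partial>\<xi>)" if [measurable]: "g \<in> bm borel" for g
  using zero[of "%m. g (fst m)"] mcomp[OF MMf(1) that]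
  by (simp add: S_def prob_space.emeasure_space_1[OF prob_space_kernel, simplified])
 have "distr Q borel S = \<xi>"
 proof (rule measure_eqI)
  fix A assume "A \<in> sets (distr Q borel S)"
  then have [measurable]: "A \<in> sets borel" by simp
  have "emeasure (distr Q borel S) A = (\<integral>\<^sup>+x. indicator A x \<partial>distr Q borel S)" by simp
  also have "... = (\<integral>\<^sup>+om. indicator A (S om) \<partial>Q)" by (rule nn_integral_distr) auto
  also have "... = emeasure \<xi> A" by (subst zeroS) (auto simp: s\<xi>)
  finally show "emeasure (distr Q borel S) A = emeasure \<xi> A" .
 qed (simp add: s\<xi>)
 moreover have "driven Q S Y"
  unfolding driven_def
 proof (intro conjI allI ballI pQ Sm Ym)
  fix n and f :: "('s \<times> (nat => 'w)) \<times> 'w => ennreal"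
  assume f[measurable]: "f \<in> bm ((borel \<Otimes>\<^sub>M Wpi n) \<Otimes>\<^sub>M W)"
  show "(\<integral>\<^sup>+x. f ((hist S Y n x), Y n x) \<partial>Q) =
    (\<integral>\<^sup>+x. (\<integral>\<^sup>+w. f ((hist S Y n x), w) \<partial>kap (run t (S x) (%i. Y i x) n)) \<partial>Q)"
  proof (cases n)
   case 0
   have c: "(\<lambda>i\<in>{..<0::nat}. y i) = (%_. undefined)" for y :: "nat => 'w" by auto
   have fm: "(%m. f ((fst m, %_. undefined), snd m)) \<in> bm MM"
   proof -
    have "(%_ _. undefined) \<in> MM \<rightarrow>\<^sub>M Wpi 0" by (intro measurable_const) (simp add: space_PiM)
    then have "(%m. ((fst m, %_. undefined), snd m)) \<in> MM \<rightarrow>\<^sub>M (borel \<Otimes>\<^sub>M Wpi 0) \<Otimes>\<^sub>M W"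
     using MMf by measurable
    from mcomp[OF this f[unfolded 0]] show ?thesis .
   qed
   have "(%s. \<integral>\<^sup>+w. f ((s, %_. undefined), w) \<partial>kap s) \<in> bm borel"
    using fm unfolding MM_def
    by (intro nn_integral_measurable_subprob_algebra2[where N=W]) (auto simp: case_prod_beta)
   from zeroS[OF this] zero[OF fm] show ?thesis unfolding 0 c by (simp add: S_def Y_def)
  next
   case (Suc j)
   define g where "g x = f ((fst (x 0), \<lambda>i\<in>{..<n}. snd (x i)), snd (x n))" for x :: "nat => 's \<times> 'w"
   have "(%x. ((fst (x 0), \<lambda>i\<in>{..<n}. snd (x i)), snd (x n))) \<in> PiM {0..<Suc n} (%_. MM) \<rightarrow>\<^sub>M (borel \<Otimes>\<^sub>M Wpi n) \<Otimes>\<^sub>M W"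
    using MMf by (intro measurable_Pair measurable_restrict mcomp[OF mcoord]) auto
   from mcomp[OF this f] have gm: "g \<in> bm (PiM {0..<Suc n} (%_. MM))"
    unfolding g_def .
   have "(\<integral>\<^sup>+x. f ((hist S Y n x), Y n x) \<partial>Q) = (\<integral>\<^sup>+om. g (restrict om {0..<Suc n}) \<partial>Q)"
    unfolding g_def S_def Y_def by (intro nn_integral_cong arg_cong[of _ _ f]) (auto simp: restrict_def)
   also have "... = (\<integral>\<^sup>+x. (\<integral>\<^sup>+w. f ((hist S Y n x), w) \<partial>kap (run t (S x) (%i. Y i x) n)) \<partial>Q)"
    unfolding marg[OF gm]
   proof (intro nn_integral_cong)
    fix om :: "nat => 's \<times> 'w" assume om: "om \<in> space Q"
    let ?r = "restrict om {0..<n}"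
    have k: "Pk n ?r = J (run t (S om) (%i. Y i om) n)"
    proof -
     have "run t (fst (?r 0)) (%j. snd (?r j)) n = run t (S om) (%j. snd (?r j)) n"
      by (simp add: S_def Suc del: run.simps)
     also have "... = run t (S om) (%i. Y i om) n" by (rule run_cong) (simp add: Y_def)
     finally show ?thesis by (simp only: Pk_def Suc nat.case)
    qed
    have mm: "(%m. g (?r(n := m))) \<in> bm MM"
    proof -
     have "?r \<in> space (PiM {0..<n} (%_. MM))" using om sets_eq_imp_space_eq[OF sQ] by (auto simp: space_PiM PiE_iff)
     from measurable_Pair1'[OF this] have "(%m. (?r, m)) \<in> MM \<rightarrow>\<^sub>M PiM {0..<n} (%_. MM) \<Otimes>\<^sub>M MM" .
     from mcomp[OF mcomp[OF this measurable_add_dim[of n "{0..<n}" "%_. MM"]], of g borel] gm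
     show ?thesis by (simp only: prod.case atLeast0_lessThan_Suc)
    qed
    show "(\<integral>\<^sup>+m. g (?r(n := m)) \<partial>Pk n ?r) = (\<integral>\<^sup>+w. f ((S om, \<lambda>i\<in>{..<n}. Y i om), w) \<partial>kap (run t (S om) (%i. Y i om) n))"
     unfolding k J_int[OF mm]
     by (intro nn_integral_cong) (auto simp: g_def S_def Y_def Suc intro!: arg_cong[of _ _ f])
   qed
   finally show ?thesis .
  qed
 qed
 ultimately show ?thesis by blast
qed

text \<open>The field \<open>F n\<close> may be larger than that of the history. Conditioning on it
  is enough, since the conditional law is almost surely a function of the history.\<close>

lemma drivenI_cond_distr:
 assumes P: "prob_space P" and S[measurable]: "S \<in> P \<rightarrow>\<^sub>M borel" and Y[measurable]: "!!n. Y n \<in> P \<rightarrow>\<^sub>M W"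
  and F: "!!n. subalgebra P (F n)" and c: "!!n. cond_distr P (F n) (Y n) W (k n)"
  and SY: "!!n. (%x. (hist S Y n x)) \<in> F n \<rightarrow>\<^sub>M borel \<Otimes>\<^sub>M Wpi n"
  and k: "!!n. AE x in P. k n x = kap (run t (S x) (%i. Y i x) n)"
 shows "driven P S Y"
proof (rule drivenI[OF P S Y])
 fix n B and A :: "('s \<times> (nat => 'w)) set" assume A: "A \<in> sets (borel \<Otimes>\<^sub>M Wpi n)" and B: "B \<in> sets W"
 let ?A = "(%x. (hist S Y n x)) -` A \<inter> space P"
 have sp: "space (F n) = space P" using F[of n] by (simp add: subalgebra_def)
 have "?A \<in> sets (F n)" using measurable_sets[OF SY A] by (simp add: sp)
 from cond_distrD[OF P F Y c this B]
 have "emeasure P {om \<in> space P. om \<in> ?A & Y n om \<in> B} = (\<integral>\<^sup>+om. indicator ?A om * emeasure (k n om) B \<partial>P)" .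
 also have "... = (\<integral>\<^sup>+x. indicator A (hist S Y n x) * emeasure (kap (run t (S x) (%i. Y i x) n)) B \<partial>P)"
  using k[of n] by (intro nn_integral_cong_AE) (auto simp: indicator_def)
 finally show "emeasure P {x\<in>space P. (hist S Y n x) \<in> A & Y n x \<in> B} =
   (\<integral>\<^sup>+x. indicator A (hist S Y n x) * emeasure (kap (run t (S x) (%i. Y i x) n)) B \<partial>P)"
  by (simp add: Int_def conj_commute conj_left_commute cong: conj_cong)
qed

text \<open>Converse direction, for an image measure: \<open>FA\<close> says that, seen from
  \<open>P\<close>, every event of \<open>F\<close> is an event of the history, so that the identity
  in \<open>driven\<close> covers it.\<close>

lemma driven_distr_cond_distr:
 assumes d: "driven P S Y" and \<phi>[measurable]: "\<phi> \<in> P \<rightarrow>\<^sub>M M" and F: "subalgebra M F" and Z[measurable]: "Z \<in> M \<rightarrow>\<^sub>M W"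
  and ZY: "!!x. x \<in> space P ==> Z (\<phi> x) = Y n x"
  and k: "!!B. B \<in> sets W ==> (%om. emeasure (k om) B) \<in> bm F"
  and k\<phi>: "!!x. x \<in> space P ==> k (\<phi> x) = kap (run t (S x) (%i. Y i x) n)"
  and FA: "!!A. A \<in> sets F ==> \<exists>A'\<in>sets (borel \<Otimes>\<^sub>M Wpi n). \<forall>x\<in>space P. \<phi> x \<in> A \<longleftrightarrow> (hist S Y n x) \<in> A'"
 shows "cond_distr (distr P M \<phi>) F Z W k"
proof (rule cond_distrI)
 note [measurable] = drivenD(2,3)[OF d]
 show "prob_space (distr P M \<phi>)" by (rule prob_space.prob_space_distr[OF drivenD(1)[OF d] \<phi>])
 show "subalgebra (distr P M \<phi>) F" using F by (simp add: subalgebra_def)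
 show "Z \<in> distr P M \<phi> \<rightarrow>\<^sub>M W" by simp
 fix A B assume A: "A \<in> sets F" and B[measurable]: "B \<in> sets W"
 have [measurable]: "A \<in> sets M" using F A by (auto simp: subalgebra_def)
 have km[measurable]: "(%om. emeasure (k om) B) \<in> bm M"
  using k[OF B] F measurable_from_subalg[of M F] by (auto simp: subalgebra_def)
 obtain A' where A'[measurable]: "A' \<in> sets (borel \<Otimes>\<^sub>M Wpi n)" and eq: "!!x. x \<in> space P ==> \<phi> x \<in> A \<longleftrightarrow> (hist S Y n x) \<in> A'"
  using FA[OF A] by blast
 have "emeasure (distr P M \<phi>) {om \<in> space (distr P M \<phi>). om \<in> A & Z om \<in> B} = emeasure P {x\<in>space P. \<phi> x \<in> A & Z (\<phi> x) \<in> B}"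
  using measurable_space[OF \<phi>] by (subst emeasure_distr) (auto intro!: arg_cong2[of _ _ _ _ emeasure])
 also have "... = emeasure P {x\<in>space P. (hist S Y n x) \<in> A' & Y n x \<in> B}"
  by (intro arg_cong2[of _ _ _ _ emeasure]) (auto simp: eq ZY)
 also have "... = (\<integral>\<^sup>+x. indicator (A' \<times> B) ((hist S Y n x), Y n x) \<partial>P)"
 proof -
  have "{x\<in>space P. (hist S Y n x) \<in> A' & Y n x \<in> B} \<in> sets P" by measurable
  from nn_integral_indicator[OF this, symmetric] show ?thesis
   by (rule trans) (auto intro!: nn_integral_cong simp: indicator_def)
 qed
 also have "... = (\<integral>\<^sup>+x. (\<integral>\<^sup>+w. indicator (A' \<times> B) ((hist S Y n x), w) \<partial>kap (run t (S x) (%i. Y i x) n)) \<partial>P)"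
  by (rule drivenD(4)[OF d]) measurable
 also have "... = (\<integral>\<^sup>+x. indicator A (\<phi> x) * emeasure (k (\<phi> x)) B \<partial>P)"
 proof (rule nn_integral_cong)
  fix x assume x: "x \<in> space P"
  have "(\<integral>\<^sup>+w. indicator (A' \<times> B) ((hist S Y n x), w) \<partial>kap (run t (S x) (%i. Y i x) n))
   = (\<integral>\<^sup>+w. indicator A (\<phi> x) * indicator B w \<partial>kap (run t (S x) (%i. Y i x) n))"
   using eq[OF x] by (intro nn_integral_cong) (auto simp: indicator_def)
  then show "(\<integral>\<^sup>+w. indicator (A' \<times> B) ((hist S Y n x), w) \<partial>kap (run t (S x) (%i. Y i x) n)) = indicator A (\<phi> x) * emeasure (k (\<phi> x)) B"
   using nn_integral_cmult_indicator[of B "kap (run t (S x) (%i. Y i x) n)" "indicator A (\<phi> x)"] k\<phi>[OF x] by simp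
 qed
 also have "... = (\<integral>\<^sup>+om. indicator A om * emeasure (k om) B \<partial>distr P M \<phi>)"
  by (subst nn_integral_distr) auto
 finally show "emeasure (distr P M \<phi>) {om \<in> space (distr P M \<phi>). om \<in> A & Z om \<in> B} = (\<integral>\<^sup>+om. indicator A om * emeasure (k om) B \<partial>distr P M \<phi>)" .
qed (rule k)

text \<open>Phrased through the operator, so that functions rather than measures are moved;
  \<open>Kern\<close> supplies the version with measures where averaging requires it.\<close>

definition invariant :: "'s measure => bool" where
 "invariant \<xi> \<longleftrightarrow> (\<forall>f\<in>bm borel. (\<integral>\<^sup>+s. step kap t f s \<partial>\<xi>) = (\<integral>\<^sup>+s. f s \<partial>\<xi>))"

lemma invariant_pow:
 assumes "invariant \<xi>" "f \<in> bm borel"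
 shows "(\<integral>\<^sup>+s. (step kap t ^^ n) f s \<partial>\<xi>) = (\<integral>\<^sup>+s. f s \<partial>\<xi>)"
 using assms(2) by (induction n) (use assms(1) in \<open>auto simp: invariant_def\<close>)

lemma driven_invariant_iff:
 assumes d: "driven P S Y"
 shows "invariant (distr P borel S) \<longleftrightarrow> distr P borel (%x. t (S x) (Y 0 x)) = distr P borel S"
proof -
 note [measurable] = drivenD(2,3)[OF d]
 have tm[measurable]: "(%x. t (S x) (Y 0 x)) \<in> P \<rightarrow>\<^sub>M borel" by (rule drivenD(2)[OF driven_shift[OF d]])
 have e: "(\<integral>\<^sup>+x. f (t (S x) (Y 0 x)) \<partial>P) = (\<integral>\<^sup>+s. step kap t f s \<partial>distr P borel S)" if "f \<in> bm borel" for f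
  using driven_expectation[OF d that, of 1] that by (simp add: nn_integral_distr)
 show ?thesis
 proof
  assume inv: "invariant (distr P borel S)"
  show "distr P borel (%x. t (S x) (Y 0 x)) = distr P borel S"
  proof (rule measure_eqI)
   fix A assume "A \<in> sets (distr P borel (%x. t (S x) (Y 0 x)))"
   then have A[measurable]: "A \<in> sets borel" by simp
   have i: "indicator A \<in> bm borel" by measurable
   have "emeasure (distr P borel (%x. t (S x) (Y 0 x))) A = (\<integral>\<^sup>+s. indicator A s \<partial>distr P borel (%x. t (S x) (Y 0 x)))" by simp
   also have "... = (\<integral>\<^sup>+x. indicator A (t (S x) (Y 0 x)) \<partial>P)" by (rule nn_integral_distr) auto
   also have "... = (\<integral>\<^sup>+s. indicator A s \<partial>distr P borel S)" using trans[OF e[OF i] bspec[OF inv[unfolded invariant_def] i]] .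
   finally show "emeasure (distr P borel (%x. t (S x) (Y 0 x))) A = emeasure (distr P borel S) A" by simp
  qed simp
 next
  assume "distr P borel (%x. t (S x) (Y 0 x)) = distr P borel S"
  note eq = this
  show "invariant (distr P borel S)"
   unfolding invariant_def
  proof
   fix f :: "'s => ennreal" assume f: "f \<in> bm borel"
   have "(\<integral>\<^sup>+s. step kap t f s \<partial>distr P borel S) = (\<integral>\<^sup>+s. f s \<partial>distr P borel (%x. t (S x) (Y 0 x)))"
    unfolding e[OF f, symmetric] using f by (intro nn_integral_distr[symmetric]) auto
   then show "(\<integral>\<^sup>+s. step kap t f s \<partial>distr P borel S) = (\<integral>\<^sup>+s. f s \<partial>distr P borel S)"
    unfolding eq .
  qed
 qed
qed

end

subsection \<open>The one-step update and paths of the model\<close>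

text \<open>The new observation becomes the last of the \<open>q\<close> inputs, and only then the
  windows move on by one. Entries outside of the windows are discarded, so that the result lies in
  the space of \<open>Zsp\<close> for every \<open>z\<close>.\<close>

definition upd :: "nat => nat => ('y => 'u) => ('x, 'u) upd => ('x, 'u) vec2 => 'y => ('x, 'u) vec2" where
 "upd p q ups \<psi> z y =
   (let u = (\<lambda>i\<in>{1..q}. if i < q then snd z i else ups y)
   in (\<lambda>i\<in>{1..p}. if i < p then fst z (Suc i) else \<psi> u (restrict (fst z) {1..p}),
     \<lambda>i\<in>{1..<q}. u (Suc i)))"

text \<open>The chain lives on the whole type of pairs of functions with its Borel sets, where
  continuity and compactness are at hand. \<open>trunc_vec\<close> is the retraction onto the
  extensional vectors, along which laws are moved between this type and \<open>Zsp\<close>.\<close>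

definition trunc_vec :: "nat => nat => ('x, 'u) vec2 => ('x, 'u) vec2" where
 "trunc_vec p q z = (restrict (fst z) {1..p}, restrict (snd z) {1..<q})"

lemma vec2_coord_continuous:
 "continuous_on UNIV (%z::('x::topological_space, 'u::topological_space) vec2. fst z k)"
 "continuous_on UNIV (%z::('x, 'u) vec2. snd z k)"
 by (rule continuous_on_compose2[OF continuous_on_product_coordinates[of k]],
   rule continuous_on_fst continuous_on_snd, rule continuous_on_id, simp)+

lemma vec2_coord_measurable [measurable]:
 "(%z::('x::polish_space, 'u::polish_space) vec2. fst z k) \<in> borel \<rightarrow>\<^sub>M borel"
 "(%z::('x, 'u) vec2. snd z k) \<in> borel \<rightarrow>\<^sub>M borel"
 by (rule borel_measurable_continuous_onI, rule vec2_coord_continuous)+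

lemma vec2_measurable:
 fixes f :: "'a => ('x::polish_space, 'u::polish_space) vec2"
 assumes "!!k. (%m. fst (f m) k) \<in> M \<rightarrow>\<^sub>M borel" "!!k. (%m. snd (f m) k) \<in> M \<rightarrow>\<^sub>M borel"
 shows "f \<in> M \<rightarrow>\<^sub>M borel"
proof -
 have "(%m. fst (f m)) \<in> M \<rightarrow>\<^sub>M borel" "(%m. snd (f m)) \<in> M \<rightarrow>\<^sub>M borel"
  by (rule measurable_coordinatewise_then_product, rule assms)+
 then have "(%m. (fst (f m), snd (f m))) \<in> M \<rightarrow>\<^sub>M borel \<Otimes>\<^sub>M borel" by measurable
 then show ?thesis by (simp add: borel_prod)
qed

lemma space_Zsp: "space (Zsp p q) = ({1..p} \<rightarrow>\<^sub>E UNIV) \<times> ({1..<q} \<rightarrow>\<^sub>E UNIV)"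
 by (simp add: Zsp_def space_pair_measure space_PiM)

lemma trunc_vec_in_Zsp [simp]: "trunc_vec p q z \<in> space (Zsp p q)"
 by (simp add: trunc_vec_def space_Zsp)

lemma trunc_vec_ident: "z \<in> space (Zsp p q) ==> trunc_vec p q z = z"
 by (auto simp: trunc_vec_def space_Zsp PiE_def extensional_restrict prod_eq_iff)

lemma trunc_vec_measurable: "trunc_vec p q \<in> borel \<rightarrow>\<^sub>M Zsp p q"
 unfolding trunc_vec_def Zsp_def by (intro measurable_Pair measurable_restrict) measurable

lemma Zsp_into_borel: "(%z. z) \<in> (Zsp p q :: ('x::polish_space, 'u::polish_space) vec2 measure) \<rightarrow>\<^sub>M borel"
proof (rule measurable_cong[THEN iffD1])
 show "trunc_vec p q z = z" if "z \<in> space (Zsp p q)" for z :: "('x, 'u) vec2" using that by (rule trunc_vec_ident)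
 show "trunc_vec p q \<in> Zsp p q \<rightarrow>\<^sub>M (borel :: ('x, 'u) vec2 measure)"
 proof (rule vec2_measurable)
  show "(%m. fst (trunc_vec p q m) k) \<in> Zsp p q \<rightarrow>\<^sub>M (borel :: 'x measure)" for k
   unfolding trunc_vec_def Zsp_def by (cases "k \<in> {1..p}") auto
  show "(%m. snd (trunc_vec p q m) k) \<in> Zsp p q \<rightarrow>\<^sub>M (borel :: 'u measure)" for k
   unfolding trunc_vec_def Zsp_def by (cases "k \<in> {1..<q}") auto
 qed
qed

lemma upd_in_Zsp [simp]: "upd p q ups \<psi> z y \<in> space (Zsp p q)"
 by (simp add: upd_def space_Zsp Let_def)

lemma upd_trunc_vec: "upd p q ups \<psi> (trunc_vec p q z) y = upd p q ups \<psi> z y"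
 by (auto simp: upd_def trunc_vec_def Let_def fun_eq_iff intro!: arg_cong2[of _ _ _ _ \<psi>])

definition pathX :: "nat => nat => ('y => 'u) => ('x, 'u) upd => ('x, 'u) vec2 => (nat => 'y) => int => 'x" where
 "pathX p q ups \<psi> s om k = (if k <= 0 then fst s (nat (int p + k)) else fst (run (upd p q ups \<psi>) s om (nat k)) p)"

definition pathU :: "nat => ('y => 'u) => ('x, 'u) vec2 => (nat => 'y) => int => 'u" where
 "pathU q ups s om k = (if k < 0 then snd s (nat (int q + k)) else ups (om (nat k)))"

lemma run_snd:
 "i \<in> {1..<q} ==> snd (run (upd p q ups \<psi>) s om n) i = pathU q ups s om (int n - int q + int i)"
proof (induction n arbitrary: i)
 case (Suc n)
 show ?case
 proof (cases "Suc i < q")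
  case True
  then show ?thesis using Suc.IH[of "Suc i"] Suc.prems by (simp add: upd_def Let_def algebra_simps)
 next
  case False
  then have "Suc i = q" using Suc.prems by auto
  then have e: "int (Suc n) - int q + int i = int n" by auto
  show ?thesis unfolding e using False Suc.prems by (simp add: upd_def Let_def pathU_def)
 qed
qed (simp add: pathU_def)

lemma run_fst:
 "i \<in> {1..p} ==> fst (run (upd p q ups \<psi>) s om n) i = pathX p q ups \<psi> s om (int n - int p + int i)"
proof (induction n arbitrary: i)
 case (Suc n)
 show ?case
 proof (cases "i < p")
  case True
  then have "fst (run (upd p q ups \<psi>) s om (Suc n)) i = fst (run (upd p q ups \<psi>) s om n) (Suc i)"
   using Suc.prems by (simp add: upd_def Let_def)
  also have "... = pathX p q ups \<psi> s om (int n - int p + int (Suc i))"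
   using True by (intro Suc.IH) auto
  finally show ?thesis by (simp add: algebra_simps)
 next
  case False
  then have "i = p" using Suc.prems by auto
  then have e: "int (Suc n) - int p + int i = int (Suc n)" by simp
  show ?thesis unfolding e using \<open>i = p\<close> by (simp add: pathX_def del: of_nat_Suc run.simps)
 qed
qed (simp add: pathX_def)

lemma state_at_path: "state_at p q (int n) (pathX p q ups \<psi> s om) (pathU q ups s om) = trunc_vec p q (run (upd p q ups \<psi>) s om n)"
 by (auto simp: state_at_def window_def trunc_vec_def run_fst run_snd fun_eq_iff)

lemma pathX_step:
 assumes "1 <= p"
 shows "pathX p q ups \<psi> s om (int n + 1) =
  \<psi> (window (pathU q ups s om) (int n - int q) {1..q}) (window (pathX p q ups \<psi> s om) (int n - int p) {1..p})"
proof -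
 have "pathX p q ups \<psi> s om (int n + 1) = fst (run (upd p q ups \<psi>) s om (Suc n)) p"
  by (simp add: pathX_def nat_add_distrib del: run.simps)
 also have "... = \<psi> (\<lambda>i\<in>{1..q}. if i < q then snd (run (upd p q ups \<psi>) s om n) i else ups (om n))
   (restrict (fst (run (upd p q ups \<psi>) s om n)) {1..p})"
  using assms by (simp add: upd_def Let_def)
 also have "(\<lambda>i\<in>{1..q}. if i < q then snd (run (upd p q ups \<psi>) s om n) i else ups (om n)) = window (pathU q ups s om) (int n - int q) {1..q}"
  by (auto simp: window_def fun_eq_iff run_snd pathU_def[of q ups s om "int n"])
 also have "restrict (fst (run (upd p q ups \<psi>) s om n)) {1..p} = window (pathX p q ups \<psi> s om) (int n - int p) {1..p}"
  by (auto simp: window_def fun_eq_iff run_fst)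
 finally show ?thesis .
qed

lemma run_eq_state_at:
 assumes "1 <= p" "1 <= q"
  and U: "!!n::nat. U (int n) = ups (om n)"
  and X: "!!n::nat. X (int n + 1) = \<psi> (window U (int n - int q) {1..q}) (window X (int n - int p) {1..p})"
 shows "run (upd p q ups \<psi>) (state_at p q 0 X U) om n = state_at p q (int n) X U"
proof (induction n)
 case (Suc n)
 have u: "(\<lambda>i\<in>{1..q}. if i < q then snd (state_at p q (int n) X U) i else ups (om n)) = window U (int n - int q) {1..q}"
  using U[of n] by (auto simp: window_def state_at_def fun_eq_iff)
 have x: "restrict (fst (state_at p q (int n) X U)) {1..p} = window X (int n - int p) {1..p}"
  by (auto simp: state_at_def window_def)
 have "upd p q ups \<psi> (state_at p q (int n) X U) (om n) = state_at p q (int (Suc n)) X U"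
  unfolding upd_def u x Let_def X[symmetric]
  using assms(1) by (auto simp: state_at_def window_def fun_eq_iff algebra_simps
    intro!: arg_cong[of _ _ X] arg_cong[of _ _ U])
 then show ?case using Suc by simp
qed simp

text \<open>Solutions of the recursion are determined by the initial state and the observations;
  this makes every path of the model a function of a driven sequence.\<close>

lemma path_eq_pathXU:
 assumes "1 <= p" "1 <= q"
  and U: "!!n::nat. U (int n) = ups (om n)"
  and X: "!!n::nat. X (int n + 1) = \<psi> (window U (int n - int q) {1..q}) (window X (int n - int p) {1..p})"
 shows "k > - int p ==> pathX p q ups \<psi> (state_at p q 0 X U) om k = X k"
  and "k > - int q ==> pathU q ups (state_at p q 0 X U) om k = U k"
proof -
 show "pathX p q ups \<psi> (state_at p q 0 X U) om k = X k" if "k > - int p"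
 proof (cases "k <= 0")
  case True
  then show ?thesis using that by (auto simp: pathX_def state_at_def window_def intro!: arg_cong[of _ _ X])
 next
  case False
  have "pathX p q ups \<psi> (state_at p q 0 X U) om k = fst (state_at p q (int (nat k)) X U) p"
   unfolding pathX_def run_eq_state_at[of p q U ups om X \<psi>, OF assms] using False by simp
  then show ?thesis using False assms(1) by (simp add: state_at_def window_def)
 qed
 show "pathU q ups (state_at p q 0 X U) om k = U k" if "k > - int q"
  using that U[of "nat k"] by (auto simp: pathU_def state_at_def window_def intro!: arg_cong[of _ _ U])
qed

lemma pathX_shift:
 assumes "1 <= p" "k > - int p"
 shows "pathX p q ups \<psi> (upd p q ups \<psi> s (om 0)) (%i. om (Suc i)) k = pathX p q ups \<psi> s om (k + 1)"
proof (cases "k <= 0")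
 case True
 have "pathX p q ups \<psi> (upd p q ups \<psi> s (om 0)) (%i. om (Suc i)) k = fst (run (upd p q ups \<psi>) s om 1) (nat (int p + k))"
  using True by (simp add: pathX_def)
 also have "... = pathX p q ups \<psi> s om (k + 1)"
  using True assms by (subst run_fst) (auto intro!: arg_cong[of _ _ "pathX p q ups \<psi> s om"])
 finally show ?thesis .
next
 case False
 then have "nat (k + 1) = Suc (nat k)" by simp
 then show ?thesis using False by (simp add: pathX_def run_Suc_shift[symmetric] del: run.simps)
qed

lemma pathU_shift:
 assumes "1 <= q" "k > - int q"
 shows "pathU q ups (upd p q ups \<psi> s (om 0)) (%i. om (Suc i)) k = pathU q ups s om (k + 1)"
proof (cases "k < 0")
 case True
 have "pathU q ups (upd p q ups \<psi> s (om 0)) (%i. om (Suc i)) k = snd (run (upd p q ups \<psi>) s om 1) (nat (int q + k))"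
  using True by (simp add: pathU_def)
 also have "... = pathU q ups s om (k + 1)"
  using True assms by (subst run_snd) (auto intro!: arg_cong[of _ _ "pathU q ups s om"])
 finally show ?thesis .
next
 case False
 then have "nat (k + 1) = Suc (nat k)" by simp
 then show ?thesis using False by (simp add: pathU_def)
qed

lemma sets_vimage_algebraE:
 assumes "A \<in> sets (vimage_algebra X f N)" "f \<in> X \<rightarrow> space N"
 obtains B where "B \<in> sets N" "A = f -` B \<inter> X"
 using assms by (auto simp: sets_vimage_algebra2)

lemma subalgebra_vimage_algebra:
 assumes "f \<in> M \<rightarrow>\<^sub>M N" shows "subalgebra M (vimage_algebra (space M) f N)"
 unfolding subalgebra_def
proof
 show "sets (vimage_algebra (space M) f N) \<subseteq> sets M"
  using assms measurable_space[OF assms] by (subst sets_vimage_algebra2) auto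
qed simp

section \<open>The law of the model as the image of a driven sequence\<close>

locale od =
 fixes p q :: nat and \<nu> :: "'y measure" and ups :: "'y => 'u::polish_space"
  and \<psi> :: "('x::polish_space, 'u) upd" and g :: "'x => 'y => real"
 assumes p1: "1 <= p" and q1: "1 <= q" and model: "od_model p q \<nu> ups \<psi> g"
begin

abbreviation T :: "('x, 'u) vec2 => 'y => ('x, 'u) vec2" where "T \<equiv> upd p q ups \<psi>"
abbreviation G :: "('x, 'u) vec2 => 'y measure" where "G z \<equiv> dkernel \<nu> g (fst z p)"

lemma Upsilon_measurable[measurable]: "ups \<in> \<nu> \<rightarrow>\<^sub>M borel"
 using model by (simp add: od_model_def)

lemma psi_measurable: "(%(x, u). \<psi> u x) \<in> PiM {1..p} (%_. borel) \<Otimes>\<^sub>M PiM {1..q} (%_. borel) \<rightarrow>\<^sub>M borel"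
 using model by (simp add: od_model_def)

lemma dkernel_measurable[measurable]: "dkernel \<nu> g \<in> borel \<rightarrow>\<^sub>M prob_algebra \<nu>"
 using model by (simp add: od_model_def is_dkernel_def)

lemma T_measurable: "(%(z, y). T z y) \<in> borel \<Otimes>\<^sub>M \<nu> \<rightarrow>\<^sub>M borel"
proof (rule vec2_measurable)
 let ?u = "%m. \<lambda>i\<in>{1..q}. if i < q then snd (fst m) i else ups (snd m)"
 have "(%m. (restrict (fst (fst m :: ('x, 'u) vec2)) {1..p}, ?u m)) \<in> borel \<Otimes>\<^sub>M \<nu> \<rightarrow>\<^sub>M PiM {1..p} (%_. borel) \<Otimes>\<^sub>M PiM {1..q} (%_. borel)"
 proof (intro measurable_Pair measurable_restrict)
  show "(%m. fst (fst m :: ('x, 'u) vec2) i) \<in> borel \<Otimes>\<^sub>M \<nu> \<rightarrow>\<^sub>M borel" for i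
   by (rule mcomp[OF measurable_fst vec2_coord_measurable(1)])
  show "(%m. if i < q then snd (fst m :: ('x, 'u) vec2) i else ups (snd m)) \<in> borel \<Otimes>\<^sub>M \<nu> \<rightarrow>\<^sub>M borel" for i
   using mcomp[OF measurable_fst vec2_coord_measurable(2)]
   by (cases "i < q") auto
 qed
 from mcomp[OF this psi_measurable]
 have \<psi>m: "(%m. \<psi> (?u m) (restrict (fst (fst m)) {1..p})) \<in> borel \<Otimes>\<^sub>M \<nu> \<rightarrow>\<^sub>M borel" by simp
 show "(%m. fst (case m of (z, y) => T z y) k) \<in> borel \<Otimes>\<^sub>M \<nu> \<rightarrow>\<^sub>M borel" for k
 proof -
  consider "k \<in> {1..p}" "k < p" | "k = p" | "k \<notin> {1..p}" by fastforce
  then show ?thesis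
  proof cases
   case 1
   then show ?thesis using mcomp[OF measurable_fst vec2_coord_measurable(1)]
    by (simp add: upd_def Let_def case_prod_beta)
  next
   case 2
   then show ?thesis using \<psi>m p1 by (simp add: upd_def Let_def case_prod_beta)
  next
   case 3
   then have "(%m. fst (case m of (z, y) => T z y) k) = (%_. undefined)"
    by (auto simp: upd_def Let_def case_prod_beta fun_eq_iff)
   then show ?thesis by simp
  qed
 qed
 show "(%m. snd (case m of (z, y) => T z y) k) \<in> borel \<Otimes>\<^sub>M \<nu> \<rightarrow>\<^sub>M borel" for k
  by (cases "k \<in> {1..<q}"; cases "Suc k < q") (use mcomp[OF measurable_fst vec2_coord_measurable(2)] in \<open>simp_all add: upd_def Let_def case_prod_beta\<close>)
qed

sublocale driven_chain \<nu> G T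
proof
 show "G \<in> borel \<rightarrow>\<^sub>M prob_algebra \<nu>" by measurable
qed (rule T_measurable)

definition path_of :: "('x, 'u) vec2 \<times> (nat => 'y) => ('x, 'u, 'y) path" where
 "path_of = (%(s, om). (\<lambda>k\<in>{- int p<..}. pathX p q ups \<psi> s om k, \<lambda>k\<in>{- int q<..}. pathU q ups s om k, \<lambda>k\<in>{0..}. om (nat k)))"

lemma pathX_measurable:
 fixes S :: "'m => ('x, 'u) vec2"
 assumes [measurable]: "S \<in> M \<rightarrow>\<^sub>M borel" "!!i. int i < k ==> (%m. om m i) \<in> M \<rightarrow>\<^sub>M \<nu>"
 shows "(%m. pathX p q ups \<psi> (S m) (om m) k) \<in> M \<rightarrow>\<^sub>M borel"
proof -
 have "(%m. run T (S m) (om m) (nat k)) \<in> M \<rightarrow>\<^sub>M borel"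
  by (rule run_measurable') (use assms in auto)
 from mcomp[OF this vec2_coord_measurable(1)] mcomp[OF assms(1) vec2_coord_measurable(1)]
 show ?thesis unfolding pathX_def by (cases "k <= 0") auto
qed

lemma pathU_measurable:
 fixes S :: "'m => ('x, 'u) vec2"
 assumes [measurable]: "S \<in> M \<rightarrow>\<^sub>M borel" "k \<ge> 0 ==> (%m. om m (nat k)) \<in> M \<rightarrow>\<^sub>M \<nu>"
 shows "(%m. pathU q ups (S m) (om m) k) \<in> M \<rightarrow>\<^sub>M borel"
 unfolding pathU_def by (cases "k < 0") (auto intro!: mcomp[OF assms(1) vec2_coord_measurable(2)] mcomp[OF assms(2) Upsilon_measurable])

lemma path_of_measurable: "path_of \<in> borel \<Otimes>\<^sub>M PiM UNIV (%_. \<nu>) \<rightarrow>\<^sub>M path_space p q \<nu>"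
 unfolding path_of_def path_space_def case_prod_beta
 by (intro measurable_Pair measurable_restrict pathX_measurable pathU_measurable
   mcomp[OF measurable_snd] mcoord) auto

definition S0 :: "('x, 'u, 'y) path => ('x, 'u) vec2" where
 "S0 = (%(X, U, Y). state_at p q 0 X U)"

definition Y0 :: "nat => ('x, 'u, 'y) path => 'y" where
 "Y0 n = (%(X, U, Y). Y (int n))"

text \<open>Stated for an arbitrary \<open>M\<close>, because measurability is needed both on the
  full path space and on its past.\<close>

lemma S0_gen_measurable:
 assumes "!!k. - int p < k ==> k <= 0 ==> (%om. fst om k) \<in> M \<rightarrow>\<^sub>M borel"
  "!!k. - int q < k ==> k < 0 ==> (%om. fst (snd om) k) \<in> M \<rightarrow>\<^sub>M borel"
 shows "S0 \<in> M \<rightarrow>\<^sub>M borel"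
proof (rule vec2_measurable)
 show "(%m. fst (S0 m) k) \<in> M \<rightarrow>\<^sub>M borel" for k
  using assms(1)[of "int k - int p"]
  by (cases "k \<in> {1..p}") (auto simp: S0_def state_at_def window_def case_prod_beta)
 show "(%m. snd (S0 m) k) \<in> M \<rightarrow>\<^sub>M borel" for k
  using assms(2)[of "int k - int q"]
  by (cases "k \<in> {1..<q}") (auto simp: S0_def state_at_def window_def case_prod_beta)
qed

lemma path_space_coord[measurable]:
 "- int p < k ==> (%om. fst om k) \<in> path_space p q \<nu> \<rightarrow>\<^sub>M borel"
 "- int q < k ==> (%om. fst (snd om) k) \<in> path_space p q \<nu> \<rightarrow>\<^sub>M borel"
 "0 <= k ==> (%om. snd (snd om) k) \<in> path_space p q \<nu> \<rightarrow>\<^sub>M \<nu>"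
 unfolding path_space_def
 by (auto intro!: mcomp[OF measurable_fst] mcomp[OF measurable_snd] mcoord)

lemma S0_measurable[measurable]: "S0 \<in> path_space p q \<nu> \<rightarrow>\<^sub>M borel"
 by (rule S0_gen_measurable) measurable

lemma Y0_measurable[measurable]: "Y0 n \<in> path_space p q \<nu> \<rightarrow>\<^sub>M \<nu>"
 unfolding Y0_def case_prod_beta by measurable

lemma S0_path_of: "S0 (path_of (s, om)) = trunc_vec p q s"
proof -
 have "S0 (path_of (s, om)) = state_at p q (int 0) (pathX p q ups \<psi> s om) (pathU q ups s om)"
  by (auto simp: S0_def path_of_def state_at_def window_def fun_eq_iff)
 then show ?thesis unfolding state_at_path by simp
qed

lemma Y0_path_of: "Y0 n (path_of (s, om)) = om n"
 by (simp add: Y0_def path_of_def)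

lemma past_map:
 "(%(X, U, Y). (restrict X {- int p<..k}, restrict U {- int q<..<k}, restrict Y {0..<k})) \<in>
  path_space p q \<nu> \<rightarrow>\<^sub>M PiM {- int p<..k} (%_. borel) \<Otimes>\<^sub>M PiM {- int q<..<k} (%_. borel) \<Otimes>\<^sub>M PiM {0..<k} (%_. \<nu>)"
 unfolding case_prod_beta by (intro measurable_Pair measurable_restrict path_space_coord) auto

lemma subalgebra_past: "subalgebra (path_space p q \<nu>) (past p q \<nu> k)"
 unfolding past_def by (rule subalgebra_vimage_algebra[OF past_map])

lemma past_coord:
 "- int p < j ==> j <= k ==> (%om. fst om j) \<in> past p q \<nu> k \<rightarrow>\<^sub>M borel"
 "- int q < j ==> j < k ==> (%om. fst (snd om) j) \<in> past p q \<nu> k \<rightarrow>\<^sub>M borel"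
 "0 <= j ==> j < k ==> (%om. snd (snd om) j) \<in> past p q \<nu> k \<rightarrow>\<^sub>M \<nu>"
proof -
 let ?N = "PiM {- int p<..k} (%_. borel) \<Otimes>\<^sub>M PiM {- int q<..<k} (%_. borel) \<Otimes>\<^sub>M PiM {0..<k} (%_. \<nu>)"
 have m: "(%(X, U, Y). (restrict X {- int p<..k}, restrict U {- int q<..<k}, restrict Y {0..<k})) \<in> past p q \<nu> k \<rightarrow>\<^sub>M ?N"
  unfolding past_def using measurable_space[OF past_map] by (intro measurable_vimage_algebra1) auto
 show "(%om. fst om j) \<in> past p q \<nu> k \<rightarrow>\<^sub>M borel" if "- int p < j" "j <= k"
  using mcomp[OF m mcomp[OF measurable_fst mcoord[of j]]] that
  by (simp add: case_prod_beta)
 show "(%om. fst (snd om) j) \<in> past p q \<nu> k \<rightarrow>\<^sub>M borel" if "- int q < j" "j < k"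
  using mcomp[OF m mcomp[OF measurable_snd mcomp[OF measurable_fst mcoord[of j]]]] that
  by (simp add: case_prod_beta)
 show "(%om. snd (snd om) j) \<in> past p q \<nu> k \<rightarrow>\<^sub>M \<nu>" if "0 <= j" "j < k"
  using mcomp[OF m mcomp[OF measurable_snd mcomp[OF measurable_snd mcoord[of j]]]] that
  by (simp add: case_prod_beta)
qed

lemma dkernel_emeasure[measurable]: "B \<in> sets \<nu> ==> (%x. emeasure (dkernel \<nu> g x) B) \<in> bm borel"
 using mcomp[OF measurable_prob_algebraD[OF dkernel_measurable] measurable_emeasure_subprob_algebra] by simp

text \<open>The model equations hold almost surely for all times together, so the path is recovered
  from its initial state and observations. With the converse \<open>driven_model_law\<close>,
  existence and uniqueness of the model law become those of driven sequences.\<close>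

lemma model_law_driven:
 assumes "is_model_law p q \<nu> ups \<psi> g \<xi> P"
 shows "driven P S0 Y0" "AE om in P. om = path_of (S0 om, %n. Y0 n om)"
  "distr P borel S0 = distr \<xi> borel (%z. z)"
proof -
 have P: "prob_space P" and sP[measurable_cong]: "sets P = sets (path_space p q \<nu>)"
  using assms by (auto simp: is_model_law_def space_prob_algebra)
 have spP: "space P = space (path_space p q \<nu>)" by (rule sets_eq_imp_space_eq[OF sP])
 have \<xi>: "\<xi> = distr P (Zsp p q) (%(X, U, Y). state_at p q 0 X U)" using assms by (auto simp: is_model_law_def)
 have c: "cond_distr P (past p q \<nu> (int n)) (Y0 n) \<nu> (%(X, U, Y). dkernel \<nu> g (X (int n)))" for n
  using assms unfolding is_model_law_def Y0_def by auto
 have U: "AE (X, U, Y) in P. U (int n) = ups (Y (int n))" for n using assms unfolding is_model_law_def by auto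
 have X: "AE (X, U, Y) in P. X (int n + 1) = \<psi> (window U (int n - int q) {1..q}) (window X (int n - int p) {1..p})" for n
  using assms unfolding is_model_law_def by auto
 have ae: "AE (X, U, Y) in P. (\<forall>n. U (int n) = ups (Y (int n))) &
   (\<forall>n. X (int n + 1) = \<psi> (window U (int n - int q) {1..q}) (window X (int n - int p) {1..p}))"
  using U X by (simp add: case_prod_beta AE_all_countable AE_conj_iff)
 have S0Z: "(%om. trunc_vec p q (S0 om)) = S0" by (auto simp: S0_def trunc_vec_def state_at_def window_def fun_eq_iff)
 have S0m: "S0 \<in> path_space p q \<nu> \<rightarrow>\<^sub>M Zsp p q"
  using mcomp[OF S0_measurable trunc_vec_measurable[of p q]] by (simp add: S0Z)
 then show "distr P borel S0 = distr \<xi> borel (%z. z)"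
  unfolding \<xi> S0_def[symmetric] using sP by (subst distr_distr[OF Zsp_into_borel]) (auto simp: comp_def cong: mcong)
 show "AE om in P. om = path_of (S0 om, %n. Y0 n om)"
  using ae AE_space
 proof eventually_elim
  case (elim om)
  obtain X U Y where om: "om = (X, U, Y)" by (cases om) auto
  then have e: "X \<in> extensional {- int p<..}" "U \<in> extensional {- int q<..}" "Y \<in> extensional {0..}"
   using elim by (auto simp: spP path_space_def space_pair_measure space_PiM PiE_def)
  show ?case
   using path_eq_pathXU[OF p1 q1, of U ups "%n. Y (int n)" X \<psi>] elim e
   by (auto simp: om path_of_def S0_def Y0_def fun_eq_iff extensional_def)
 qed
 show "driven P S0 Y0"
 proof (rule drivenI_cond_distr[OF P _ _ _ c])
  show "S0 \<in> P \<rightarrow>\<^sub>M borel" "Y0 n \<in> P \<rightarrow>\<^sub>M \<nu>" for n by measurable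
  show "subalgebra P (past p q \<nu> (int n))" for n using subalgebra_past[of "int n"] sP spP by (simp add: subalgebra_def)
  show "(%x. (S0 x, \<lambda>i\<in>{..<n}. Y0 i x)) \<in> past p q \<nu> (int n) \<rightarrow>\<^sub>M borel \<Otimes>\<^sub>M Wpi n" for n
  proof (intro measurable_Pair measurable_restrict S0_gen_measurable)
   show "Y0 i \<in> past p q \<nu> (int n) \<rightarrow>\<^sub>M \<nu>" if "i \<in> {..<n}" for i
    using past_coord(3)[of "int i" "int n"] that by (simp add: Y0_def case_prod_unfold)
  qed (auto intro!: past_coord)
  show "AE x in P. (case x of (X, U, Y) => dkernel \<nu> g (X (int n))) = G (run T (S0 x) (%i. Y0 i x) n)" for n
   using ae
  proof eventually_elim
   case (elim om)
   obtain X U Y where om: "om = (X, U, Y)" by (cases om) auto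
   have "run T (S0 om) (%i. Y0 i om) n = state_at p q (int n) X U"
    using run_eq_state_at[OF p1 q1, of U ups "%n. Y (int n)" X \<psi> n] elim by (auto simp: om S0_def Y0_def)
   then show ?case using p1 by (simp add: om state_at_def window_def)
  qed
 qed
qed

text \<open>Although \<open>path_of\<close> reads the whole sequence, its part up to time
  \<open>n\<close> depends on the initial state and the first \<open>n\<close> inputs alone; this
  provides the condition \<open>FA\<close> of \<open>driven_distr_cond_distr\<close> for the
  past.\<close>

lemma driven_past_set:
 assumes d: "driven P S Y" and A: "A \<in> sets (past p q \<nu> (int n))"
 shows "\<exists>A'\<in>sets (borel \<Otimes>\<^sub>M Wpi n). \<forall>x\<in>space P. path_of (S x, %i. Y i x) \<in> A \<longleftrightarrow> (hist S Y n x) \<in> A'"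
proof -
 let ?k = "int n"
 let ?N = "PiM {- int p<..?k} (%_. borel) \<Otimes>\<^sub>M PiM {- int q<..<?k} (%_. borel) \<Otimes>\<^sub>M PiM {0..<?k} (%_. \<nu>)"
 let ?c = "%(X, U, Y). (restrict X {- int p<..?k}, restrict U {- int q<..<?k}, restrict Y {0..<?k})"
 obtain B where B: "B \<in> sets ?N" "A = ?c -` B \<inter> space (path_space p q \<nu>)"
  using A unfolding past_def by (rule sets_vimage_algebraE) (use measurable_space[OF past_map[of ?k]] in auto)
 define h where "h = (%(s, om). (\<lambda>k\<in>{- int p<..?k}. pathX p q ups \<psi> s om k, \<lambda>k\<in>{- int q<..<?k}. pathU q ups s om k, \<lambda>k\<in>{0..<?k}. om (nat k)))"
 have h: "h \<in> borel \<Otimes>\<^sub>M Wpi n \<rightarrow>\<^sub>M ?N"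
  unfolding h_def case_prod_beta
  by (intro measurable_Pair measurable_restrict pathX_measurable pathU_measurable
    mcomp[OF measurable_snd] mcoord) auto
 have "path_of (S x, %i. Y i x) \<in> A \<longleftrightarrow> (hist S Y n x) \<in> h -` B \<inter> space (borel \<Otimes>\<^sub>M Wpi n)" if x: "x \<in> space P" for x
 proof -
  note [measurable] = drivenD(2,3)[OF d]
  have 1: "path_of (S x, %i. Y i x) \<in> space (path_space p q \<nu>)"
   using measurable_space[OF mcomp[OF joint_measurable path_of_measurable, of S P Y] x] by simp
  have 2: "(hist S Y n x) \<in> space (borel \<Otimes>\<^sub>M Wpi n)"
   using measurable_space[of "%x. (hist S Y n x)" P "borel \<Otimes>\<^sub>M Wpi n", OF _ x] by simp
  have "pathX p q ups \<psi> (S x) (%i. Y i x) k = pathX p q ups \<psi> (S x) (\<lambda>i\<in>{..<n}. Y i x) k" if "k <= int n" for k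
   using that unfolding pathX_def by (auto intro!: arg_cong[of _ _ "%z. fst z p"] run_cong)
  moreover have "pathU q ups (S x) (%i. Y i x) k = pathU q ups (S x) (\<lambda>i\<in>{..<n}. Y i x) k" if "k < int n" for k
   using that unfolding pathU_def by auto
  ultimately have "?c (path_of (S x, %i. Y i x)) = h (hist S Y n x)"
   by (auto simp: path_of_def h_def fun_eq_iff)
  with 1 2 B show ?thesis by simp
 qed
 with measurable_sets[OF h B(1)] show ?thesis by blast
qed

lemma driven_model_law:
 assumes d: "driven P S Y"
 shows "is_model_law p q \<nu> ups \<psi> g (distr P (Zsp p q) (%x. trunc_vec p q (S x)))
  (distr P (path_space p q \<nu>) (%x. path_of (S x, %n. Y n x)))"
proof -
 note [measurable] = drivenD(2,3)[OF d] trunc_vec_measurable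
 let ?\<phi> = "%x. path_of (S x, %n. Y n x)"
 let ?Q = "distr P (path_space p q \<nu>) ?\<phi>"
 have \<phi>[measurable]: "?\<phi> \<in> P \<rightarrow>\<^sub>M path_space p q \<nu>"
  by (rule mcomp[OF joint_measurable path_of_measurable]) measurable
 have S0Z: "(%om. trunc_vec p q (S0 om)) = S0" by (auto simp: S0_def trunc_vec_def state_at_def window_def fun_eq_iff)
 have S0m: "S0 \<in> path_space p q \<nu> \<rightarrow>\<^sub>M Zsp p q"
  using mcomp[OF S0_measurable trunc_vec_measurable[of p q]] by (simp add: S0Z)
 have ae: "AE om in ?Q. a om = b om"
  if ab: "a \<in> path_space p q \<nu> \<rightarrow>\<^sub>M borel" "b \<in> path_space p q \<nu> \<rightarrow>\<^sub>M borel" "!!x. x \<in> space P ==> a (?\<phi> x) = b (?\<phi> x)"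
  for a b :: "('x, 'u, 'y) path => 'c::polish_space"
  using measurable_equality_set[OF ab(1,2)] ab(3) by (subst AE_distr_iff[OF \<phi>]) auto
 show ?thesis
  unfolding is_model_law_def
 proof (intro conjI allI impI)
  show "?Q \<in> space (prob_algebra (path_space p q \<nu>))"
   using prob_space.prob_space_distr[OF drivenD(1)[OF d] \<phi>] by (simp add: space_prob_algebra)
  show "distr ?Q (Zsp p q) (%(X, U, Y). state_at p q 0 X U) = distr P (Zsp p q) (%x. trunc_vec p q (S x))"
   unfolding S0_def[symmetric] by (subst distr_distr[OF S0m \<phi>]) (simp add: comp_def S0_path_of)
  fix k :: int assume "0 <= k"
  then obtain n where k: "k = int n" using zero_le_imp_eq_int by blast
  show "cond_distr ?Q (past p q \<nu> k) (%(X, U, Y). Y k) \<nu> (%(X, U, Y). dkernel \<nu> g (X k))"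
  proof (rule driven_distr_cond_distr[OF d \<phi> subalgebra_past])
   show "(%(X, U, Y). Y k) \<in> path_space p q \<nu> \<rightarrow>\<^sub>M \<nu>" using Y0_measurable[of n] by (simp add: Y0_def k)
   show "(%(X, U, Y). Y k) (?\<phi> x) = Y n x" for x using Y0_path_of[of n] by (simp add: Y0_def k)
   show "(%om. emeasure ((%(X, U, Y). dkernel \<nu> g (X k)) om) B) \<in> bm (past p q \<nu> k)" if "B \<in> sets \<nu>" for B
    using mcomp[OF past_coord(1)[of k k] dkernel_emeasure[OF that]] p1 \<open>0 <= k\<close> by (simp add: case_prod_beta)
   show "(%(X, U, Y). dkernel \<nu> g (X k)) (?\<phi> x) = G (run T (S x) (%i. Y i x) n)" for x
    using p1 run_fst[of p p q ups \<psi> "S x" "%i. Y i x" n] by (simp add: path_of_def k)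
   show "\<exists>A'\<in>sets (borel \<Otimes>\<^sub>M Wpi n). \<forall>x\<in>space P. ?\<phi> x \<in> A \<longleftrightarrow> (hist S Y n x) \<in> A'" if "A \<in> sets (past p q \<nu> k)" for A
    using driven_past_set[OF d] that by (simp add: k)
  qed
  have "AE om in ?Q. fst (snd om) k = ups (snd (snd om) k)"
   using q1 \<open>0 <= k\<close>
   by (intro ae mcomp[OF path_space_coord(3) Upsilon_measurable] path_space_coord(2))
    (auto simp: path_of_def k pathU_def)
  then show "AE (X, U, Y) in ?Q. U k = ups (Y k)" by (simp add: case_prod_beta)
  have "AE om in ?Q. fst om (k + 1) = \<psi> (window (fst (snd om)) (k - int q) {1..q}) (window (fst om) (k - int p) {1..p})"
  proof (rule ae)
   show "(%om. fst om (k + 1)) \<in> path_space p q \<nu> \<rightarrow>\<^sub>M borel" using \<open>0 <= k\<close> by (intro path_space_coord) auto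
   have "(%om. (window (fst om) (k - int p) {1..p}, window (fst (snd om)) (k - int q) {1..q}))
     \<in> path_space p q \<nu> \<rightarrow>\<^sub>M PiM {1..p} (%_. borel) \<Otimes>\<^sub>M PiM {1..q} (%_. borel)"
    unfolding window_def using \<open>0 <= k\<close>
    by (intro measurable_Pair measurable_restrict path_space_coord) auto
   from mcomp[OF this psi_measurable]
   show "(%om. \<psi> (window (fst (snd om)) (k - int q) {1..q}) (window (fst om) (k - int p) {1..p})) \<in> path_space p q \<nu> \<rightarrow>\<^sub>M borel"
    by simp
   fix x assume "x \<in> space P"
   have "window (restrict (pathU q ups (S x) (%n. Y n x)) {- int q<..}) (k - int q) {1..q} = window (pathU q ups (S x) (%n. Y n x)) (k - int q) {1..q}"
    "window (restrict (pathX p q ups \<psi> (S x) (%n. Y n x)) {- int p<..}) (k - int p) {1..p} = window (pathX p q ups \<psi> (S x) (%n. Y n x)) (k - int p) {1..p}"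
    by (auto simp: window_def k fun_eq_iff)
   then show "fst (?\<phi> x) (k + 1) = \<psi> (window (fst (snd (?\<phi> x))) (k - int q) {1..q}) (window (fst (?\<phi> x)) (k - int p) {1..p})"
    using pathX_step[OF p1, of q ups \<psi> "S x" "%n. Y n x" n] by (simp add: path_of_def k)
  qed
  then show "AE (X, U, Y) in ?Q. X (k + 1) = \<psi> (window U (k - int q) {1..q}) (window X (k - int p) {1..p})"
   by (simp add: case_prod_beta)
 qed
qed

end

section \<open>Shift invariance of the model law\<close>

context od
begin

lemma path_of_driven_measurable:
 assumes "driven P S Y" shows "(%x. path_of (S x, %n. Y n x)) \<in> P \<rightarrow>\<^sub>M path_space p q \<nu>"
 by (rule mcomp[OF joint_measurable path_of_measurable]) (use drivenD[OF assms] in auto)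

lemma distr_path_of:
 assumes "driven P S Y"
 shows "distr P (path_space p q \<nu>) (%x. path_of (S x, %n. Y n x)) = distr (joint P S Y) (path_space p q \<nu>) path_of"
 using drivenD(2,3)[OF assms] by (subst distr_distr[OF path_of_measurable joint_measurable]) (auto simp: comp_def)

lemma model_law_eq:
 assumes "is_model_law p q \<nu> ups \<psi> g \<xi> P"
 shows "P = distr P (path_space p q \<nu>) (%om. path_of (S0 om, %n. Y0 n om))"
proof -
 note d = model_law_driven[OF assms]
 have sP: "sets P = sets (path_space p q \<nu>)" using assms by (auto simp: is_model_law_def space_prob_algebra)
 have "P = distr P (path_space p q \<nu>) (%om. om)" using sP by (simp add: distr_id2)
 also have "... = distr P (path_space p q \<nu>) (%om. path_of (S0 om, %n. Y0 n om))"
  by (rule distr_cong_AE[OF refl refl d(2)]) (use path_of_driven_measurable[OF d(1)] sP in \<open>auto cong: mcong\<close>)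
 finally show ?thesis .
qed

lemma model_law_unique:
 assumes 1: "is_model_law p q \<nu> ups \<psi> g \<xi> P" and 2: "is_model_law p q \<nu> ups \<psi> g \<xi> P'"
 shows "P = P'"
proof -
 note d = model_law_driven[OF 1] and d' = model_law_driven[OF 2]
 have "joint P S0 Y0 = joint P' S0 Y0" by (rule driven_unique[OF d(1) d'(1)]) (simp add: d(3) d'(3))
 then show ?thesis
  using model_law_eq[OF 1] model_law_eq[OF 2] distr_path_of[OF d(1)] distr_path_of[OF d'(1)] by simp
qed

lemma borel_Zsp_inverse:
 assumes "\<xi> \<in> space (prob_algebra (Zsp p q))"
 shows "distr (distr \<xi> borel (%z. z)) (Zsp p q) (trunc_vec p q) = \<xi>"
proof -
 have s\<xi>[measurable_cong]: "sets \<xi> = sets (Zsp p q)" using assms by (simp add: space_prob_algebra)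
 have "distr (distr \<xi> borel (%z. z)) (Zsp p q) (trunc_vec p q) = distr \<xi> (Zsp p q) (trunc_vec p q)"
 proof -
  have "(%z. z) \<in> \<xi> \<rightarrow>\<^sub>M borel"
   using Zsp_into_borel[of p q] mcong[OF s\<xi> refl, of borel] by blast
  then show ?thesis by (subst distr_distr[OF trunc_vec_measurable]) (simp_all add: comp_def)
 qed
 also have "... = distr \<xi> (Zsp p q) (%z. z)"
  using sets_eq_imp_space_eq[OF s\<xi>] by (intro distr_cong) (auto simp: trunc_vec_ident)
 also have "... = \<xi>" using s\<xi> by (simp add: distr_id2)
 finally show ?thesis .
qed

lemma borel_of_Zsp_prob:
 assumes "\<xi> \<in> space (prob_algebra (Zsp p q))"
 shows "distr \<xi> borel (%z. z) \<in> space (prob_algebra borel)"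
proof -
 have s\<xi>: "sets \<xi> = sets (Zsp p q)" "prob_space \<xi>" using assms by (simp_all add: space_prob_algebra)
 have "(%z. z) \<in> \<xi> \<rightarrow>\<^sub>M borel"
  using Zsp_into_borel[of p q] mcong[OF s\<xi>(1) refl, of borel] by blast
 then show ?thesis using prob_space.prob_space_distr[OF s\<xi>(2)] by (simp add: space_prob_algebra)
qed

text \<open>Existence of driven sequences and \<open>model_law_unique\<close> together give a
  denotation to the definite description in \<open>model_law\<close>.\<close>

lemma is_model_law_model_law:
 assumes \<xi>: "\<xi> \<in> space (prob_algebra (Zsp p q))"
 shows "is_model_law p q \<nu> ups \<psi> g \<xi> (model_law p q \<nu> ups \<psi> g \<xi>)"
proof -
 obtain P :: "(nat => ('x, 'u) vec2 \<times> 'y) measure" and S Y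
  where d: "driven P S Y" and S: "distr P borel S = distr \<xi> borel (%z. z)"
  using driven_exists[OF borel_of_Zsp_prob[OF \<xi>]] by blast
 have "distr P (Zsp p q) (%x. trunc_vec p q (S x)) = distr (distr P borel S) (Zsp p q) (trunc_vec p q)"
  using drivenD(2)[OF d] by (subst distr_distr[OF trunc_vec_measurable]) (auto simp: comp_def)
 also have "... = \<xi>" unfolding S by (rule borel_Zsp_inverse[OF \<xi>])
 finally have "\<exists>P. is_model_law p q \<nu> ups \<psi> g \<xi> P" using driven_model_law[OF d] by metis
 then show ?thesis unfolding model_law_def using model_law_unique by (metis theI)
qed

text \<open>Iterates of the transition operator replace the definite description; the expectations
  in (A-6) are used in this form only.\<close>

lemma expect_from_eq:
 assumes \<xi>: "\<xi> \<in> space (prob_algebra (Zsp p q))" and f[measurable]: "f \<in> bm borel"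
 shows "expect_from p q \<nu> ups \<psi> g \<xi> f n = (\<integral>\<^sup>+z. (step G T ^^ n) (%z. ennreal (f (fst z p))) z \<partial>\<xi>)"
proof -
 define P where "P = model_law p q \<nu> ups \<psi> g \<xi>"
 note d = model_law_driven[OF is_model_law_model_law[OF \<xi>], folded P_def]
 note [measurable] = drivenD(2,3)[OF d(1)]
 have fm[measurable]: "(%z::('x, 'u) vec2. ennreal (f (fst z p))) \<in> bm borel"
  using mcomp[OF vec2_coord_measurable(1) f] by measurable
 have s\<xi>: "sets \<xi> = sets (Zsp p q)" using \<xi> by (simp_all add: space_prob_algebra)
 have id\<xi>: "(%z. z) \<in> \<xi> \<rightarrow>\<^sub>M borel"
  using Zsp_into_borel[of p q] mcong[OF s\<xi> refl, of borel] by blast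
 have "expect_from p q \<nu> ups \<psi> g \<xi> f n = (\<integral>\<^sup>+om. ennreal (f (fst (run T (S0 om) (%i. Y0 i om) n) p)) \<partial>P)"
  unfolding expect_from_def P_def[symmetric]
 proof (rule nn_integral_cong_AE, use d(2) in eventually_elim)
  fix om assume "om = path_of (S0 om, %n. Y0 n om)"
  from arg_cong[OF this, of "%om. fst om (int n)"]
  have "fst om (int n) = pathX p q ups \<psi> (S0 om) (%n. Y0 n om) (int n)"
   by (rule trans) (use p1 in \<open>simp add: path_of_def\<close>)
  then show "(case om of (X, U, Y) => ennreal (f (X (int n)))) = ennreal (f (fst (run T (S0 om) (%i. Y0 i om) n) p))"
   using run_fst[of p p q ups \<psi> "S0 om" "%i. Y0 i om" n] p1 by (simp add: case_prod_beta)
 qed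
 also have "... = (\<integral>\<^sup>+om. (step G T ^^ n) (%z. ennreal (f (fst z p))) (S0 om) \<partial>P)"
  by (rule driven_expectation[OF d(1) fm])
 also have "... = (\<integral>\<^sup>+z. (step G T ^^ n) (%z. ennreal (f (fst z p))) z \<partial>distr P borel S0)"
  by (rule nn_integral_distr[symmetric]) auto
 also have "... = (\<integral>\<^sup>+z. (step G T ^^ n) (%z. ennreal (f (fst z p))) z \<partial>\<xi>)"
  unfolding d(3) using id\<xi> by (intro nn_integral_distr) auto
 finally show ?thesis .
qed

lemma path_shift_path_of: "path_shift p q (path_of (s, om)) = path_of (T s (om 0), %i. om (Suc i))"
 using pathX_shift[OF p1, of _ q ups \<psi> s om] pathU_shift[OF q1, of _ ups p \<psi> s om]
 by (auto simp: path_shift_def path_of_def fun_eq_iff nat_add_distrib)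

lemma path_shift_measurable: "path_shift p q \<in> path_space p q \<nu> \<rightarrow>\<^sub>M path_space p q \<nu>"
proof -
 have "(%om. (\<lambda>k\<in>{- int p<..}. fst om (k + 1), \<lambda>k\<in>{- int q<..}. fst (snd om) (k + 1), \<lambda>k\<in>{0..}. snd (snd om) (k + 1)))
  \<in> path_space p q \<nu> \<rightarrow>\<^sub>M PiM {- int p<..} (%_. borel) \<Otimes>\<^sub>M PiM {- int q<..} (%_. borel) \<Otimes>\<^sub>M PiM {0..} (%_. \<nu>)"
  by (intro measurable_Pair measurable_restrict path_space_coord) auto
 then show ?thesis by (simp add: path_shift_def case_prod_unfold path_space_def)
qed

lemma driven_invariant_joint:
 assumes d: "driven P S Y" and inv: "invariant (distr P borel S)"
 shows "joint P (%x. T (S x) (Y 0 x)) (%n. Y (Suc n)) = joint P S Y"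
 by (rule driven_unique[OF driven_shift[OF d] d]) (use driven_invariant_iff[OF d] inv in simp)

text \<open>The shift replaces the driven sequence by the one that starts after the first step. A
  driven law is determined by its initial law, so invariance of the latter under one step is enough;
  conversely the initial state can be read off the path.\<close>

lemma shift_invariant_iff:
 assumes \<xi>: "\<xi> \<in> space (prob_algebra (Zsp p q))"
 shows "shift_invariant p q \<nu> (model_law p q \<nu> ups \<psi> g \<xi>) \<longleftrightarrow> invariant (distr \<xi> borel (%z. z))"
proof -
 define P where "P = model_law p q \<nu> ups \<psi> g \<xi>"
 note ml = is_model_law_model_law[OF \<xi>, folded P_def]
 note d = model_law_driven[OF ml]
 have sP: "sets P = sets (path_space p q \<nu>)" using ml by (auto simp: is_model_law_def space_prob_algebra)
 have shm: "path_shift p q \<in> P \<rightarrow>\<^sub>M path_space p q \<nu>" using path_shift_measurable sP by (auto cong: mcong)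
 have d': "driven P (%x. T (S0 x) (Y0 0 x)) (%n. Y0 (Suc n))" by (rule driven_shift[OF d(1)])
 have ae: "AE om in P. path_shift p q om = path_of (T (S0 om) (Y0 0 om), %n. Y0 (Suc n) om)"
  using d(2)
 proof eventually_elim
  case (elim om)
  from arg_cong[OF this, of "path_shift p q"] show ?case by (rule trans) (rule path_shift_path_of)
 qed
 have sh: "distr P (path_space p q \<nu>) (path_shift p q) = distr P (path_space p q \<nu>) (%om. path_of (T (S0 om) (Y0 0 om), %n. Y0 (Suc n) om))"
  by (rule distr_cong_AE[OF refl refl ae shm path_of_driven_measurable[OF d']])
 show ?thesis
  unfolding P_def[symmetric] shift_invariant_def
 proof
  assume eq: "distr P (path_space p q \<nu>) (path_shift p q) = P"
  have "distr P borel (%x. T (S0 x) (Y0 0 x)) = distr P borel (%x. S0 (path_shift p q x))"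
  proof (rule distr_cong_AE[OF refl refl])
   show "AE x in P. T (S0 x) (Y0 0 x) = S0 (path_shift p q x)"
    using ae by eventually_elim (simp add: S0_path_of trunc_vec_ident)
   show "(%x. T (S0 x) (Y0 0 x)) \<in> bm P" by (rule drivenD(2)[OF d'])
   show "(%x. S0 (path_shift p q x)) \<in> bm P" by (rule mcomp[OF shm S0_measurable])
  qed
  also have "... = distr (distr P (path_space p q \<nu>) (path_shift p q)) borel S0"
   by (subst distr_distr[OF S0_measurable shm]) (simp add: comp_def)
  also have "... = distr P borel S0" unfolding eq ..
  finally show "invariant (distr \<xi> borel (%z. z))" using driven_invariant_iff[OF d(1)] d(3) by simp
 next
  assume "invariant (distr \<xi> borel (%z. z))"
  then have "joint P (%x. T (S0 x) (Y0 0 x)) (%n. Y0 (Suc n)) = joint P S0 Y0"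
   using driven_invariant_joint[OF d(1)] d(3) by simp
  then have "distr P (path_space p q \<nu>) (path_shift p q) = distr (joint P S0 Y0) (path_space p q \<nu>) path_of"
   unfolding sh distr_path_of[OF d'] by simp
  also have "... = P" using model_law_eq[OF ml] distr_path_of[OF d(1)] by simp
  finally show "distr P (path_space p q \<nu>) (path_shift p q) = P" .
 qed
qed

text \<open>After one step every state is extensional; an invariant law on the larger type is
  therefore carried by the space of \<open>Zsp\<close>.\<close>

lemma invariant_trunc:
 assumes \<pi>: "\<pi> \<in> space (prob_algebra borel)" and inv: "invariant \<pi>"
 shows "distr (distr \<pi> (Zsp p q) (trunc_vec p q)) borel (%z. z) = \<pi>"
proof -
 have s\<pi>[measurable_cong]: "sets \<pi> = sets borel" using \<pi> by (simp add: space_prob_algebra)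
 have tm[measurable]: "trunc_vec p q \<in> \<pi> \<rightarrow>\<^sub>M Zsp p q" using trunc_vec_measurable[of p q] mcong[OF s\<pi> refl, of "Zsp p q"] by blast
 have tb: "trunc_vec p q \<in> borel \<rightarrow>\<^sub>M (borel :: ('x, 'u) vec2 measure)" using mcomp[OF trunc_vec_measurable[of p q] Zsp_into_borel] by simp
 have "distr (distr \<pi> (Zsp p q) (trunc_vec p q)) borel (%z. z) = distr \<pi> borel (trunc_vec p q)"
  by (subst distr_distr[OF Zsp_into_borel tm]) (simp add: comp_def)
 also have "... = \<pi>"
 proof (rule measure_eqI)
  fix A assume "A \<in> sets (distr \<pi> borel (trunc_vec p q))"
  then have A[measurable]: "A \<in> sets borel" by simp
  have i: "indicator A \<in> bm borel" "(%z. indicator A (trunc_vec p q z)) \<in> bm borel"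
   using mcomp[OF tb borel_measurable_indicator[OF A]] by auto
  have tb': "trunc_vec p q \<in> \<pi> \<rightarrow>\<^sub>M borel" using tb mcong[OF s\<pi> refl, of borel] by blast
  have "emeasure (distr \<pi> borel (trunc_vec p q)) A = (\<integral>\<^sup>+z. indicator A z \<partial>distr \<pi> borel (trunc_vec p q))" by simp
  also have "... = (\<integral>\<^sup>+z. indicator A (trunc_vec p q z) \<partial>\<pi>)" by (rule nn_integral_distr[OF tb']) auto
  also have "... = (\<integral>\<^sup>+z. step G T (%z. indicator A (trunc_vec p q z)) z \<partial>\<pi>)"
   using inv i(2) unfolding invariant_def by metis
  also have "... = (\<integral>\<^sup>+z. step G T (indicator A) z \<partial>\<pi>)" by (simp add: step_def trunc_vec_ident)
  also have "... = (\<integral>\<^sup>+z. indicator A z \<partial>\<pi>)" using inv i(1) unfolding invariant_def by metis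
  finally show "emeasure (distr \<pi> borel (trunc_vec p q)) A = emeasure \<pi> A" by (simp add: s\<pi>)
 qed (simp add: s\<pi>)
 finally show ?thesis .
qed

lemma shift_invariant_ex1:
 assumes "\<exists>!\<pi>. \<pi> \<in> space (prob_algebra borel) & invariant \<pi>"
 shows "\<exists>!\<pi>. \<pi> \<in> space (prob_algebra (Zsp p q)) & shift_invariant p q \<nu> (model_law p q \<nu> ups \<psi> g \<pi>)"
proof -
 obtain \<pi> where \<pi>: "\<pi> \<in> space (prob_algebra borel)" "invariant \<pi>"
  and un: "!!\<pi>'. \<pi>' \<in> space (prob_algebra borel) ==> invariant \<pi>' ==> \<pi>' = \<pi>" using assms by blast
 define \<xi> where "\<xi> = distr \<pi> (Zsp p q) (trunc_vec p q)"
 have s\<pi>: "sets \<pi> = sets borel" "prob_space \<pi>" using \<pi> by (simp_all add: space_prob_algebra)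
 have tm: "trunc_vec p q \<in> \<pi> \<rightarrow>\<^sub>M Zsp p q" using trunc_vec_measurable[of p q] mcong[OF s\<pi>(1) refl, of "Zsp p q"] by blast
 have \<xi>: "\<xi> \<in> space (prob_algebra (Zsp p q))"
  unfolding \<xi>_def using prob_space.prob_space_distr[OF s\<pi>(2) tm] by (simp add: space_prob_algebra)
 show ?thesis
 proof (rule ex1I[of _ \<xi>])
  show "\<xi> \<in> space (prob_algebra (Zsp p q)) & shift_invariant p q \<nu> (model_law p q \<nu> ups \<psi> g \<xi>)"
   using \<xi> shift_invariant_iff[OF \<xi>] invariant_trunc[OF \<pi>] \<pi>(2) by (simp add: \<xi>_def)
  fix \<xi>' assume a: "\<xi>' \<in> space (prob_algebra (Zsp p q)) & shift_invariant p q \<nu> (model_law p q \<nu> ups \<psi> g \<xi>')"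
  then have "distr \<xi>' borel (%z. z) = \<pi>"
   using shift_invariant_iff by (intro un borel_of_Zsp_prob) auto
  then show "\<xi>' = \<xi>" using borel_Zsp_inverse[of \<xi>'] a by (simp add: \<xi>_def)
 qed
qed

section \<open>Stationary solutions with observations at negative times\<close>

definition S1 :: "(int => 'x) \<times> (int => 'y) => ('x, 'u) vec2" where
 "S1 om = state_at p q 0 (fst om) (%j. ups (snd om j))"

definition Y1 :: "nat => (int => 'x) \<times> (int => 'y) => 'y" where
 "Y1 n om = snd om (int n)"

text \<open>Time is shifted by \<open>q - 1\<close> so that all reduced observations entering the
 solution stem from observations of the chain and not from its initial state.\<close>

definition xy_of :: "('x, 'u) vec2 \<times> (nat => 'y) => (int => 'x) \<times> (int => 'y)" where
 "xy_of = (%(s, om). (\<lambda>k\<in>{- int p<..}. pathX p q ups \<psi> s om (k + int (q - 1)), \<lambda>k\<in>{- int q<..}. om (nat (k + int (q - 1)))))"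

lemma xy_of_measurable: "xy_of \<in> borel \<Otimes>\<^sub>M PiM UNIV (%_. \<nu>) \<rightarrow>\<^sub>M xy_space p q \<nu>"
 unfolding xy_of_def xy_space_def case_prod_unfold
 by (intro measurable_Pair measurable_restrict pathX_measurable
   mcomp[OF measurable_snd] mcoord) auto

lemma xy_space_coord:
 "- int p < k ==> (%om. fst om k) \<in> xy_space p q \<nu> \<rightarrow>\<^sub>M borel"
 "- int q < k ==> (%om. snd om k) \<in> xy_space p q \<nu> \<rightarrow>\<^sub>M \<nu>"
 unfolding xy_space_def
 by (auto intro!: mcomp[OF measurable_fst] mcomp[OF measurable_snd] mcoord)

lemma S1_gen_measurable:
 assumes "!!k. - int p < k ==> k <= 0 ==> (%om. fst om k) \<in> M \<rightarrow>\<^sub>M borel"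
  "!!k. - int q < k ==> k < 0 ==> (%om. snd om k) \<in> M \<rightarrow>\<^sub>M \<nu>"
 shows "S1 \<in> M \<rightarrow>\<^sub>M borel"
proof (rule vec2_measurable)
 show "(%m. fst (S1 m) k) \<in> M \<rightarrow>\<^sub>M borel" for k
  using assms(1)[of "int k - int p"]
  by (cases "k \<in> {1..p}") (auto simp: S1_def state_at_def window_def)
 show "(%m. snd (S1 m) k) \<in> M \<rightarrow>\<^sub>M borel" for k
  using mcomp[OF assms(2)[of "int k - int q"] Upsilon_measurable]
  by (cases "k \<in> {1..<q}") (auto simp: S1_def state_at_def window_def)
qed

lemma xy_past_map:
 "(%(X, Y). (restrict X {- int p<..k}, restrict Y {- int q<..<k})) \<in>
  xy_space p q \<nu> \<rightarrow>\<^sub>M PiM {- int p<..k} (%_. borel) \<Otimes>\<^sub>M PiM {- int q<..<k} (%_. \<nu>)"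
 unfolding case_prod_beta by (intro measurable_Pair measurable_restrict xy_space_coord) auto

lemma subalgebra_xy_past: "subalgebra (xy_space p q \<nu>) (xy_past p q \<nu> k)"
 unfolding xy_past_def by (rule subalgebra_vimage_algebra[OF xy_past_map])

lemma xy_past_coord:
 "- int p < j ==> j <= k ==> (%om. fst om j) \<in> xy_past p q \<nu> k \<rightarrow>\<^sub>M borel"
 "- int q < j ==> j < k ==> (%om. snd om j) \<in> xy_past p q \<nu> k \<rightarrow>\<^sub>M \<nu>"
proof -
 let ?N = "PiM {- int p<..k} (%_. borel) \<Otimes>\<^sub>M PiM {- int q<..<k} (%_. \<nu>)"
 have m: "(%(X, Y). (restrict X {- int p<..k}, restrict Y {- int q<..<k})) \<in> xy_past p q \<nu> k \<rightarrow>\<^sub>M ?N"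
  unfolding xy_past_def using measurable_space[OF xy_past_map] by (intro measurable_vimage_algebra1) auto
 show "(%om. fst om j) \<in> xy_past p q \<nu> k \<rightarrow>\<^sub>M borel" if "- int p < j" "j <= k"
  using mcomp[OF m mcomp[OF measurable_fst mcoord[of j]]] that
  by (simp add: case_prod_beta)
 show "(%om. snd om j) \<in> xy_past p q \<nu> k \<rightarrow>\<^sub>M \<nu>" if "- int q < j" "j < k"
  using mcomp[OF m mcomp[OF measurable_snd mcoord[of j]]] that
  by (simp add: case_prod_beta)
qed

lemma solution_driven:
 assumes "is_solution_law p q \<nu> ups \<psi> g P"
 shows "driven P S1 Y1"
  "AE om in P. \<forall>k>- int p. fst om k = pathX p q ups \<psi> (S1 om) (%n. Y1 n om) k"
  "AE om in P. T (S1 om) (Y1 0 om) = state_at p q 1 (fst om) (%j. ups (snd om j))"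
proof -
 have P: "prob_space P" and sP[measurable_cong]: "sets P = sets (xy_space p q \<nu>)"
  using assms by (auto simp: is_solution_law_def space_prob_algebra)
 have spP: "space P = space (xy_space p q \<nu>)" by (rule sets_eq_imp_space_eq[OF sP])
 have c: "cond_distr P (xy_past p q \<nu> (int n)) (Y1 n) \<nu> (%(X, Y). dkernel \<nu> g (X (int n)))" for n
  using assms unfolding is_solution_law_def Y1_def by (auto simp: case_prod_unfold)
 have "AE om in P. fst om (int n + 1) = \<psi> (window (%j. ups (snd om j)) (int n - int q) {1..q}) (window (fst om) (int n - int p) {1..p})" for n
  using assms unfolding is_solution_law_def by (auto simp: case_prod_unfold)
 then have ae: "AE om in P. \<forall>n. fst om (int n + 1) = \<psi> (window (%j. ups (snd om j)) (int n - int q) {1..q}) (window (fst om) (int n - int p) {1..p})"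
  by (simp add: AE_all_countable)
 have run: "AE om in P. \<forall>n. run T (S1 om) (%i. Y1 i om) n = state_at p q (int n) (fst om) (%j. ups (snd om j))"
  using ae
 proof eventually_elim
  case (elim om)
  then show ?case
   using run_eq_state_at[OF p1 q1, of "%j. ups (snd om j)" ups "%n. snd om (int n)" "fst om" \<psi>]
   by (simp add: S1_def Y1_def)
 qed
 show "AE om in P. \<forall>k>- int p. fst om k = pathX p q ups \<psi> (S1 om) (%n. Y1 n om) k"
  using ae
 proof eventually_elim
  case (elim om)
  then show ?case
   using path_eq_pathXU(1)[OF p1 q1, of "%j. ups (snd om j)" ups "%n. snd om (int n)" "fst om" \<psi>]
   by (simp add: S1_def Y1_def)
 qed
 show "AE om in P. T (S1 om) (Y1 0 om) = state_at p q 1 (fst om) (%j. ups (snd om j))"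
  using run by eventually_elim (drule spec[of _ 1], simp)
 show "driven P S1 Y1"
 proof (rule drivenI_cond_distr[OF P _ _ _ c])
  have "S1 \<in> xy_space p q \<nu> \<rightarrow>\<^sub>M borel" by (rule S1_gen_measurable) (auto intro: xy_space_coord)
  then show "S1 \<in> P \<rightarrow>\<^sub>M borel" by (auto cong: mcong)
  have "Y1 n \<in> xy_space p q \<nu> \<rightarrow>\<^sub>M \<nu>" for n unfolding Y1_def using q1 by (auto intro: xy_space_coord)
  then show "Y1 n \<in> P \<rightarrow>\<^sub>M \<nu>" for n by (auto cong: mcong)
  show "subalgebra P (xy_past p q \<nu> (int n))" for n using subalgebra_xy_past[of "int n"] sP spP by (simp add: subalgebra_def)
  show "(%x. (S1 x, \<lambda>i\<in>{..<n}. Y1 i x)) \<in> xy_past p q \<nu> (int n) \<rightarrow>\<^sub>M borel \<Otimes>\<^sub>M Wpi n" for n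
  proof (intro measurable_Pair measurable_restrict S1_gen_measurable)
   show "Y1 i \<in> xy_past p q \<nu> (int n) \<rightarrow>\<^sub>M \<nu>" if "i \<in> {..<n}" for i
    unfolding Y1_def using xy_past_coord(2)[of "int i" "int n"] that q1 by simp
  qed (auto intro!: xy_past_coord)
  show "AE x in P. (case x of (X, Y) => dkernel \<nu> g (X (int n))) = G (run T (S1 x) (%i. Y1 i x) n)" for n
   using run by eventually_elim (use p1 in \<open>simp add: state_at_def window_def case_prod_beta\<close>)
 qed
qed

lemma xy_shift_pow:
 assumes "om \<in> space (xy_space p q \<nu>)"
 shows "(xy_shift p q ^^ n) om = (\<lambda>k\<in>{- int p<..}. fst om (k + int n), \<lambda>k\<in>{- int q<..}. snd om (k + int n))"
proof (induction n)
 case 0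
 then show ?case using assms
  by (cases om) (auto simp: xy_space_def space_pair_measure space_PiM PiE_def extensional_restrict)
next
 case (Suc n)
 then show ?case by (auto simp: xy_shift_def fun_eq_iff algebra_simps)
qed

lemma xy_shift_measurable: "xy_shift p q \<in> xy_space p q \<nu> \<rightarrow>\<^sub>M xy_space p q \<nu>"
proof -
 have "(%om. (\<lambda>k\<in>{- int p<..}. fst om (k + 1), \<lambda>k\<in>{- int q<..}. snd om (k + 1)))
  \<in> xy_space p q \<nu> \<rightarrow>\<^sub>M PiM {- int p<..} (%_. borel) \<Otimes>\<^sub>M PiM {- int q<..} (%_. \<nu>)"
  by (intro measurable_Pair measurable_restrict xy_space_coord) auto
 then show ?thesis by (simp add: xy_shift_def case_prod_unfold xy_space_def)
qed

text \<open>The state \<open>S1\<close> keeps only reduced observations at negative times, so the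
  original ones cannot be read off the driven sequence. By stationarity \<open>P\<close> is also the
  law of the path shifted by \<open>q - 1\<close>, and for this one they can.\<close>

lemma stationary_solution_eq:
 assumes "is_stationary_solution_law p q \<nu> ups \<psi> g P"
 shows "P = distr (joint P S1 Y1) (xy_space p q \<nu>) xy_of" "driven P S1 Y1" "invariant (distr P borel S1)"
proof -
 have sol: "is_solution_law p q \<nu> ups \<psi> g P" and st: "distr P (xy_space p q \<nu>) (xy_shift p q) = P"
  using assms by (auto simp: is_stationary_solution_law_def)
 note d = solution_driven[OF sol]
 note [measurable] = drivenD(2,3)[OF d(1)]
 have P: "prob_space P" and sP: "sets P = sets (xy_space p q \<nu>)"
  using sol by (auto simp: is_solution_law_def space_prob_algebra)
 have spP: "space P = space (xy_space p q \<nu>)" by (rule sets_eq_imp_space_eq[OF sP])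
 have shm: "xy_shift p q \<in> P \<rightarrow>\<^sub>M xy_space p q \<nu>" using xy_shift_measurable sP by (auto cong: mcong)
 have pm: "(xy_shift p q ^^ n) \<in> P \<rightarrow>\<^sub>M xy_space p q \<nu>" for n
 proof (induction n)
  case 0 then show ?case using sP by (simp add: id_def cong: mcong)
 next
  case (Suc n) then show ?case using mcomp[OF Suc xy_shift_measurable] by (simp add: comp_def)
 qed
 have pow: "distr P (xy_space p q \<nu>) (xy_shift p q ^^ n) = P" for n
 proof (induction n)
  case 0 then show ?case using sP by (simp add: distr_id2 id_def)
 next
  case (Suc n)
  have "distr P (xy_space p q \<nu>) (xy_shift p q ^^ Suc n) = distr (distr P (xy_space p q \<nu>) (xy_shift p q ^^ n)) (xy_space p q \<nu>) (xy_shift p q)"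
   by (simp only: distr_distr[OF xy_shift_measurable pm] funpow.simps)
  then show ?case unfolding Suc st .
 qed
 have jm: "(%x. (S1 x, %n. Y1 n x)) \<in> P \<rightarrow>\<^sub>M borel \<Otimes>\<^sub>M PiM UNIV (%_. \<nu>)" by (rule joint_measurable) measurable
 \<comment> \<open>For \<open>k > - q\<close> the shifted time \<open>k + (q - 1)\<close> is
   nonnegative, so every observation of the shifted path is an input of the chain.\<close>
 have ae: "AE om in P. (xy_shift p q ^^ (q - 1)) om = xy_of (S1 om, %n. Y1 n om)"
  using d(2) AE_space
 proof eventually_elim
  case (elim om)
  have w: "om \<in> space (xy_space p q \<nu>)" using elim spP by simp
  show ?case
   unfolding xy_shift_pow[OF w] using elim(1) q1 by (auto simp: xy_of_def Y1_def fun_eq_iff)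
 qed
 have "P = distr P (xy_space p q \<nu>) (xy_shift p q ^^ (q - 1))" by (simp add: pow)
 also have "... = distr P (xy_space p q \<nu>) (%om. xy_of (S1 om, %n. Y1 n om))"
  by (rule distr_cong_AE[OF refl refl ae pm mcomp[OF jm xy_of_measurable]])
 also have "... = distr (joint P S1 Y1) (xy_space p q \<nu>) xy_of"
  by (subst distr_distr[OF xy_of_measurable jm]) (simp add: comp_def)
 finally show "P = distr (joint P S1 Y1) (xy_space p q \<nu>) xy_of" .
 show "driven P S1 Y1" by (rule d)
 have S1m: "S1 \<in> xy_space p q \<nu> \<rightarrow>\<^sub>M borel" by (rule S1_gen_measurable) (auto intro: xy_space_coord)
 have "distr P borel (%x. T (S1 x) (Y1 0 x)) = distr P borel (%x. S1 (xy_shift p q x))"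
 proof (rule distr_cong_AE[OF refl refl])
  show "AE x in P. T (S1 x) (Y1 0 x) = S1 (xy_shift p q x)"
   using d(3) by eventually_elim (auto simp: S1_def xy_shift_def state_at_def window_def fun_eq_iff case_prod_unfold algebra_simps)
  show "(%x. T (S1 x) (Y1 0 x)) \<in> bm P" by (rule drivenD(2)[OF driven_shift[OF d(1)]])
  show "(%x. S1 (xy_shift p q x)) \<in> bm P" by (rule mcomp[OF shm S1m])
 qed
 also have "... = distr (distr P (xy_space p q \<nu>) (xy_shift p q)) borel S1"
  by (subst distr_distr[OF S1m shm]) (simp add: comp_def)
 also have "... = distr P borel S1" unfolding st ..
 finally show "invariant (distr P borel S1)" using driven_invariant_iff[OF d(1)] by simp
qed

lemma driven_xy_past_set:
 assumes d: "driven P S Y" and n: "int n = k + int (q - 1)" and k: "0 <= k" and A: "A \<in> sets (xy_past p q \<nu> k)"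
 shows "\<exists>A'\<in>sets (borel \<Otimes>\<^sub>M Wpi n). \<forall>x\<in>space P. xy_of (S x, %i. Y i x) \<in> A \<longleftrightarrow> (hist S Y n x) \<in> A'"
proof -
 let ?N = "PiM {- int p<..k} (%_. borel) \<Otimes>\<^sub>M PiM {- int q<..<k} (%_. \<nu>)"
 let ?c = "%(X, Y). (restrict X {- int p<..k}, restrict Y {- int q<..<k})"
 obtain B where B: "B \<in> sets ?N" "A = ?c -` B \<inter> space (xy_space p q \<nu>)"
  using A unfolding xy_past_def by (rule sets_vimage_algebraE) (use measurable_space[OF xy_past_map[of k]] in auto)
 define h where "h = (%(s, om). (\<lambda>j\<in>{- int p<..k}. pathX p q ups \<psi> s om (j + int (q - 1)), \<lambda>j\<in>{- int q<..<k}. om (nat (j + int (q - 1)))))"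
 have h: "h \<in> borel \<Otimes>\<^sub>M Wpi n \<rightarrow>\<^sub>M ?N"
  unfolding h_def case_prod_beta using n q1
  by (intro measurable_Pair measurable_restrict pathX_measurable
    mcomp[OF measurable_snd] mcoord) auto
 have "xy_of (S x, %i. Y i x) \<in> A \<longleftrightarrow> (hist S Y n x) \<in> h -` B \<inter> space (borel \<Otimes>\<^sub>M Wpi n)" if x: "x \<in> space P" for x
 proof -
  note [measurable] = drivenD(2,3)[OF d]
  have 1: "xy_of (S x, %i. Y i x) \<in> space (xy_space p q \<nu>)"
   using measurable_space[OF mcomp[OF joint_measurable xy_of_measurable, of S P Y] x] by simp
  have 2: "(hist S Y n x) \<in> space (borel \<Otimes>\<^sub>M Wpi n)"
   using measurable_space[of "%x. (hist S Y n x)" P "borel \<Otimes>\<^sub>M Wpi n", OF _ x] by simp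
  have "pathX p q ups \<psi> (S x) (%i. Y i x) j = pathX p q ups \<psi> (S x) (\<lambda>i\<in>{..<n}. Y i x) j" if "j <= int n" for j
   using that unfolding pathX_def by (auto intro!: arg_cong[of _ _ "%z. fst z p"] run_cong)
  then have "?c (xy_of (S x, %i. Y i x)) = h (hist S Y n x)"
   using n q1 by (auto simp: xy_of_def h_def fun_eq_iff)
  with 1 2 B show ?thesis by simp
 qed
 with measurable_sets[OF h B(1)] show ?thesis by blast
qed

lemma driven_stationary_solution:
 assumes d: "driven P S Y" and inv: "invariant (distr P borel S)"
 shows "is_stationary_solution_law p q \<nu> ups \<psi> g (distr P (xy_space p q \<nu>) (%x. xy_of (S x, %n. Y n x)))"
proof -
 note [measurable] = drivenD(2,3)[OF d]
 let ?\<phi> = "%x. xy_of (S x, %n. Y n x)"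
 let ?Q = "distr P (xy_space p q \<nu>) ?\<phi>"
 have jm: "(%x. (S x, %n. Y n x)) \<in> P \<rightarrow>\<^sub>M borel \<Otimes>\<^sub>M PiM UNIV (%_. \<nu>)" by (rule joint_measurable) measurable
 have \<phi>[measurable]: "?\<phi> \<in> P \<rightarrow>\<^sub>M xy_space p q \<nu>" by (rule mcomp[OF jm xy_of_measurable])
 have "is_solution_law p q \<nu> ups \<psi> g ?Q"
  unfolding is_solution_law_def
 proof (intro conjI allI impI)
  show "?Q \<in> space (prob_algebra (xy_space p q \<nu>))"
   using prob_space.prob_space_distr[OF drivenD(1)[OF d] \<phi>] by (simp add: space_prob_algebra)
  fix k :: int assume k0: "0 <= k"
  \<comment> \<open>The time of the driven sequence that corresponds to time \<open>k\<close> of the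
    solution.\<close>
  define n where "n = nat (k + int (q - 1))"
  have n: "int n = k + int (q - 1)" using k0 by (simp add: n_def)
  show "cond_distr ?Q (xy_past p q \<nu> k) (%(X, Y). Y k) \<nu> (%(X, Y). dkernel \<nu> g (X k))"
  proof (rule driven_distr_cond_distr[OF d \<phi> subalgebra_xy_past])
   show "(%(X, Y). Y k) \<in> xy_space p q \<nu> \<rightarrow>\<^sub>M \<nu>" using xy_space_coord(2)[of k] k0 q1 by (simp add: case_prod_unfold)
   show "(%(X, Y). Y k) (?\<phi> x) = Y n x" for x using k0 q1 by (simp add: xy_of_def n_def)
   show "(%om. emeasure ((%(X, Y). dkernel \<nu> g (X k)) om) B) \<in> bm (xy_past p q \<nu> k)" if "B \<in> sets \<nu>" for B
    using mcomp[OF xy_past_coord(1)[of k k] dkernel_emeasure[OF that]] p1 k0 by (simp add: case_prod_unfold)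
   show "(%(X, Y). dkernel \<nu> g (X k)) (?\<phi> x) = G (run T (S x) (%i. Y i x) n)" for x
    using p1 k0 run_fst[of p p q ups \<psi> "S x" "%i. Y i x" n] by (simp add: xy_of_def n)
   show "\<exists>A'\<in>sets (borel \<Otimes>\<^sub>M Wpi n). \<forall>x\<in>space P. ?\<phi> x \<in> A \<longleftrightarrow> (hist S Y n x) \<in> A'" if "A \<in> sets (xy_past p q \<nu> k)" for A
    by (rule driven_xy_past_set[OF d n k0 that])
  qed
  have fm: "(%om. fst om (k + 1)) \<in> xy_space p q \<nu> \<rightarrow>\<^sub>M borel" using k0 by (intro xy_space_coord) auto
  have "(%om. (window (fst om) (k - int p) {1..p}, window (%j. ups (snd om j)) (k - int q) {1..q}))
    \<in> xy_space p q \<nu> \<rightarrow>\<^sub>M PiM {1..p} (%_. borel) \<Otimes>\<^sub>M PiM {1..q} (%_. borel)"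
   unfolding window_def using k0
   by (intro measurable_Pair measurable_restrict xy_space_coord mcomp[OF xy_space_coord(2) Upsilon_measurable]) auto
  from mcomp[OF this psi_measurable]
  have gm: "(%om. \<psi> (window (%j. ups (snd om j)) (k - int q) {1..q}) (window (fst om) (k - int p) {1..p})) \<in> xy_space p q \<nu> \<rightarrow>\<^sub>M borel"
   by simp
  have "fst (?\<phi> x) (k + 1) = \<psi> (window (%j. ups (snd (?\<phi> x) j)) (k - int q) {1..q}) (window (fst (?\<phi> x)) (k - int p) {1..p})" for x
  proof -
   have "window (%j. ups (snd (?\<phi> x) j)) (k - int q) {1..q} = window (pathU q ups (S x) (%n. Y n x)) (int n - int q) {1..q}"
    using k0 q1 by (auto simp: window_def xy_of_def pathU_def n fun_eq_iff algebra_simps)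
   moreover have "window (fst (?\<phi> x)) (k - int p) {1..p} = window (pathX p q ups \<psi> (S x) (%n. Y n x)) (int n - int p) {1..p}"
    using k0 by (auto simp: window_def xy_of_def n fun_eq_iff algebra_simps)
   moreover have "fst (?\<phi> x) (k + 1) = pathX p q ups \<psi> (S x) (%n. Y n x) (int n + 1)"
    using k0 by (simp add: xy_of_def n algebra_simps)
   ultimately show ?thesis using pathX_step[OF p1, of q ups \<psi> "S x" "%n. Y n x" n] by simp
  qed
  then have "AE om in ?Q. fst om (k + 1) = \<psi> (window (%j. ups (snd om j)) (k - int q) {1..q}) (window (fst om) (k - int p) {1..p})"
   using measurable_equality_set[OF fm gm] by (subst AE_distr_iff[OF \<phi>]) auto
  then show "AE (X, Y) in ?Q. X (k + 1) = \<psi> (window (%j. ups (Y j)) (k - int q) {1..q}) (window X (k - int p) {1..p})"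
   by (simp add: case_prod_unfold)
 qed
 moreover have "distr ?Q (xy_space p q \<nu>) (xy_shift p q) = ?Q"
 proof -
  have sh: "xy_shift p q (xy_of (s, om)) = xy_of (T s (om 0), %i. om (Suc i))" for s om
   using pathX_shift[OF p1, of _ q ups \<psi> s om] q1
   by (auto simp: xy_shift_def xy_of_def fun_eq_iff algebra_simps nat_add_distrib Suc_nat_eq_nat_zadd1
     intro!: arg_cong[of _ _ om])
  have d': "driven P (%x. T (S x) (Y 0 x)) (%n. Y (Suc n))" by (rule driven_shift[OF d])
  have jm': "(%x. (T (S x) (Y 0 x), %n. Y (Suc n) x)) \<in> P \<rightarrow>\<^sub>M borel \<Otimes>\<^sub>M PiM UNIV (%_. \<nu>)"
   by (rule joint_measurable) (use drivenD(2,3)[OF d'] in auto)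
  have "distr ?Q (xy_space p q \<nu>) (xy_shift p q) = distr P (xy_space p q \<nu>) (%x. xy_of (T (S x) (Y 0 x), %n. Y (Suc n) x))"
   by (subst distr_distr[OF xy_shift_measurable \<phi>]) (simp add: comp_def sh)
  also have "... = distr (joint P (%x. T (S x) (Y 0 x)) (%n. Y (Suc n))) (xy_space p q \<nu>) xy_of"
   by (subst distr_distr[OF xy_of_measurable jm']) (simp add: comp_def)
  also have "... = distr (joint P S Y) (xy_space p q \<nu>) xy_of" by (simp add: driven_invariant_joint[OF d inv])
  also have "... = ?Q" by (subst distr_distr[OF xy_of_measurable jm]) (simp add: comp_def)
  finally show ?thesis .
 qed
 ultimately show ?thesis by (simp add: is_stationary_solution_law_def)
qed

lemma stationary_solution_ex1:
 assumes "\<exists>!\<pi>. \<pi> \<in> space (prob_algebra borel) & invariant \<pi>"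
 shows "\<exists>!P. is_stationary_solution_law p q \<nu> ups \<psi> g P"
proof -
 obtain \<pi> where \<pi>: "\<pi> \<in> space (prob_algebra borel)" "invariant \<pi>"
  and un: "!!\<pi>'. \<pi>' \<in> space (prob_algebra borel) ==> invariant \<pi>' ==> \<pi>' = \<pi>" using assms by blast
 obtain P :: "(nat => ('x, 'u) vec2 \<times> 'y) measure" and S Y where d: "driven P S Y" and S: "distr P borel S = \<pi>"
  using driven_exists[OF \<pi>(1)] by blast
 have law: "distr Q borel S1 = \<pi>" if "is_stationary_solution_law p q \<nu> ups \<psi> g Q" for Q
  using stationary_solution_eq(2,3)[OF that] prob_space.prob_space_distr[OF drivenD(1) drivenD(2)]
  by (intro un) (auto simp: space_prob_algebra)
 show ?thesis
 proof (rule ex_ex1I)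
  show "\<exists>P. is_stationary_solution_law p q \<nu> ups \<psi> g P"
   using driven_stationary_solution[OF d] \<pi>(2) S by blast
  fix Q Q' assume 1: "is_stationary_solution_law p q \<nu> ups \<psi> g Q" and 2: "is_stationary_solution_law p q \<nu> ups \<psi> g Q'"
  have "joint Q S1 Y1 = joint Q' S1 Y1"
   by (rule driven_unique[OF stationary_solution_eq(2)[OF 1] stationary_solution_eq(2)[OF 2]]) (simp add: law 1 2)
  then show "Q = Q'" using stationary_solution_eq(1)[OF 1] stationary_solution_eq(1)[OF 2] by simp
 qed
qed

lemma stationary_solution_expectation:
 assumes st: "is_stationary_solution_law p q \<nu> ups \<psi> g P" and f[measurable]: "f \<in> bm borel"
 shows "(\<integral>\<^sup>+x. ennreal (f x) \<partial>law_X0 P) = (\<integral>\<^sup>+z. ennreal (f (fst z p)) \<partial>distr P borel S1)"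
proof -
 note d = drivenD(2,3)[OF stationary_solution_eq(2)[OF st]]
 have sP: "sets P = sets (xy_space p q \<nu>)" using st by (auto simp: is_stationary_solution_law_def is_solution_law_def space_prob_algebra)
 have "(%(X, Y). X 0) \<in> xy_space p q \<nu> \<rightarrow>\<^sub>M (borel :: 'x measure)" using xy_space_coord(1)[of 0] p1 by (simp add: case_prod_unfold)
 then have X0: "(%(X, Y). X 0) \<in> P \<rightarrow>\<^sub>M (borel :: 'x measure)" using sP by (auto cong: mcong)
 have "(\<integral>\<^sup>+x. ennreal (f x) \<partial>law_X0 P) = (\<integral>\<^sup>+om. ennreal (f ((%(X, Y). X 0) om)) \<partial>P)"
  unfolding law_X0_def by (rule nn_integral_distr[OF X0]) measurable
 also have "... = (\<integral>\<^sup>+om. ennreal (f (fst (S1 om) p)) \<partial>P)"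
  using p1 by (intro nn_integral_cong) (auto simp: S1_def state_at_def window_def case_prod_unfold)
 also have "... = (\<integral>\<^sup>+z. ennreal (f (fst z p)) \<partial>distr P borel S1)"
  using mcomp[OF vec2_coord_measurable(1) f] by (intro nn_integral_distr[symmetric] d) measurable
 finally show ?thesis .
qed

end

subsection \<open>The coupled process\<close>

lemma upd_reduced: "upd p q ups \<psi> z y = upd p q (%u. u) \<psi> z (ups y)"
 by (simp add: upd_def)

lemma run_reduced: "run (upd p q ups \<psi>) s om n = run (upd p q (%u. u) \<psi>) s (%i. ups (om i)) n"
 by (induction n) (simp_all add: upd_reduced[of p q ups])

lemma pathX_reduced: "pathX p q ups \<psi> s om k = pathX p q (%u. u) \<psi> s (%i. ups (om i)) k"
 by (simp add: pathX_def run_reduced[of p q ups])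

type_synonym ('x, 'u) vec4 = "('x, 'u) vec2 \<times> ('x, 'u) vec2"

definition upd2 :: "nat => nat => ('y => 'u) => ('x, 'u) upd => ('x, 'u) vec4 => 'y => ('x, 'u) vec4" where
 "upd2 p q ups \<psi> v y = (upd p q ups \<psi> (fst v) y, upd p q ups \<psi> (snd v) y)"

lemma run_upd2: "run (upd2 p q ups \<psi>) v om n = (run (upd p q ups \<psi>) (fst v) om n, run (upd p q ups \<psi>) (snd v) om n)"
 by (induction n) (simp_all add: upd2_def)

lemma vec2_pair_measurable [measurable]:
 "(%v. fst (fst v) k) \<in> bm (borel :: (('x::polish_space, 'u::polish_space) vec2 \<times> ('x, 'u) vec2) measure)"
 "(%v. fst (snd v) k) \<in> bm (borel :: (('x, 'u) vec4) measure)"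
 "(%v. snd (fst v) k) \<in> bm (borel :: (('x, 'u) vec4) measure)"
 "(%v. snd (snd v) k) \<in> bm (borel :: (('x, 'u) vec4) measure)"
 by (rule borel_measurable_continuous_onI,
   rule continuous_on_compose2[OF vec2_coord_continuous(1)[of k]] continuous_on_compose2[OF vec2_coord_continuous(2)[of k]],
   rule continuous_on_fst continuous_on_snd, rule continuous_on_id, simp)+

lemma borel_fst_snd_measurable:
 "fst \<in> (borel :: ('a::second_countable_topology \<times> 'b::second_countable_topology) measure) \<rightarrow>\<^sub>M borel"
 "snd \<in> (borel :: ('a \<times> 'b) measure) \<rightarrow>\<^sub>M borel"
 by (simp_all flip: borel_prod)

lemma borel_Pair_measurable:
 fixes f :: "'m => 'a::second_countable_topology" and g :: "'m => 'b::second_countable_topology"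
 assumes "f \<in> M \<rightarrow>\<^sub>M borel" "g \<in> M \<rightarrow>\<^sub>M borel" shows "(%x. (f x, g x)) \<in> M \<rightarrow>\<^sub>M borel"
 using assms by (simp flip: borel_prod)

section \<open>Two driven chains behind the coupled process\<close>

locale od_coupled = od p q \<nu> ups \<psi> g
 for p q :: nat and \<nu> :: "'y measure" and ups :: "'y => 'u::polish_space"
  and \<psi> :: "('x::polish_space, 'u) upd" and g :: "'x => 'y => real" +
 fixes h :: "'x \<times> 'x => 'y => real"
 assumes h_kernel: "is_dkernel (borel \<Otimes>\<^sub>M borel) \<nu> h"
begin

abbreviation H :: "('x, 'u) vec4 => 'y measure" where
 "H v \<equiv> dkernel \<nu> h (fst (fst v) p, fst (snd v) p)"

abbreviation T2 :: "('x, 'u) vec4 => 'y => ('x, 'u) vec4" where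
 "T2 \<equiv> upd2 p q ups \<psi>"

lemma h_measurable: "dkernel \<nu> h \<in> borel \<Otimes>\<^sub>M borel \<rightarrow>\<^sub>M prob_algebra \<nu>"
 using h_kernel by (simp add: is_dkernel_def)

lemma H_measurable: "H \<in> borel \<rightarrow>\<^sub>M prob_algebra \<nu>"
proof -
 have "(%v::('x, 'u) vec4. (fst (fst v) p, fst (snd v) p)) \<in> borel \<rightarrow>\<^sub>M borel \<Otimes>\<^sub>M borel"
  by measurable
 from mcomp[OF this h_measurable] show ?thesis .
qed

lemma T2_measurable: "(%(v, y). T2 v y) \<in> borel \<Otimes>\<^sub>M \<nu> \<rightarrow>\<^sub>M borel"
proof -
 have "(%m. (%(z, y). T z y) (fst (fst m), snd m)) \<in> (borel :: (('x, 'u) vec4) measure) \<Otimes>\<^sub>M \<nu> \<rightarrow>\<^sub>M borel"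
  by (rule mcomp[OF _ T_measurable], rule measurable_Pair, rule mcomp[OF measurable_fst borel_fst_snd_measurable(1)], simp)
 moreover have "(%m. (%(z, y). T z y) (snd (fst m), snd m)) \<in> (borel :: (('x, 'u) vec4) measure) \<Otimes>\<^sub>M \<nu> \<rightarrow>\<^sub>M borel"
  by (rule mcomp[OF _ T_measurable], rule measurable_Pair, rule mcomp[OF measurable_fst borel_fst_snd_measurable(2)], simp)
 ultimately show ?thesis using borel_Pair_measurable by (fastforce simp: upd2_def case_prod_unfold)
qed

sublocale C: driven_chain \<nu> H T2
 by unfold_locales (rule H_measurable, rule T2_measurable)

text \<open>The coupled equations condition on states and reduced observations, not on the past of
  \<open>Y\<close>, and so leave the joint law with the observations open. Uniqueness is therefore
  proved for a chain driven by reduced observations, with input law \<open>HU\<close>, while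
  existence comes from the chain driven by the observations themselves.\<close>

definition HU :: "('x, 'u) vec4 => 'u measure" where
 "HU v = distr (H v) borel ups"

abbreviation TU :: "('x, 'u) vec4 => 'u => ('x, 'u) vec4" where
 "TU \<equiv> upd2 p q (%u. u) \<psi>"

lemma T_reduced_measurable: "(%(z, y). upd p q (%u. u) \<psi> z y) \<in> borel \<Otimes>\<^sub>M (borel :: 'u measure) \<rightarrow>\<^sub>M borel"
proof (rule vec2_measurable)
 let ?f = "%m::('x, 'u) vec2 \<times> 'u. case m of (z, y) => upd p q (%u. u) \<psi> z y"
 let ?u = "%m. \<lambda>i\<in>{1..q}. if i < q then snd (fst m) i else (snd m)"
 have c1: "(%m. fst (fst m :: ('x, 'u) vec2) i) \<in> borel \<Otimes>\<^sub>M (borel :: 'u measure) \<rightarrow>\<^sub>M borel" for i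
  by (rule mcomp[OF measurable_fst vec2_coord_measurable(1)])
 have c2: "(%m. snd (fst m :: ('x, 'u) vec2) i) \<in> borel \<Otimes>\<^sub>M (borel :: 'u measure) \<rightarrow>\<^sub>M borel" for i
  by (rule mcomp[OF measurable_fst vec2_coord_measurable(2)])
 have "(%m. (restrict (fst (fst m :: ('x, 'u) vec2)) {1..p}, ?u m)) \<in> borel \<Otimes>\<^sub>M (borel :: 'u measure) \<rightarrow>\<^sub>M PiM {1..p} (%_. borel) \<Otimes>\<^sub>M PiM {1..q} (%_. borel)"
 proof (intro measurable_Pair measurable_restrict c1)
  show "(%m. if i < q then snd (fst m :: ('x, 'u) vec2) i else snd m) \<in> borel \<Otimes>\<^sub>M borel \<rightarrow>\<^sub>M borel" for i
   using c2 by (cases "i < q") auto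
 qed
 from mcomp[OF this psi_measurable]
 have \<psi>m: "(%m. \<psi> (?u m) (restrict (fst (fst m)) {1..p})) \<in> borel \<Otimes>\<^sub>M borel \<rightarrow>\<^sub>M borel" by simp
 show "(%m. fst (?f m) k) \<in> borel \<Otimes>\<^sub>M borel \<rightarrow>\<^sub>M borel" for k
 proof -
  consider "k \<in> {1..p}" "k < p" | "k = p" | "k \<notin> {1..p}" by fastforce
  then show ?thesis
  proof cases
   case 1
   then show ?thesis using c1 by (simp add: upd_def Let_def case_prod_beta)
  next
   case 2
   then show ?thesis using \<psi>m p1 by (simp add: upd_def Let_def case_prod_beta)
  next
   case 3
   then have "(%m. fst (?f m) k) = (%_. undefined)"
    by (auto simp: upd_def Let_def case_prod_beta fun_eq_iff)
   then show ?thesis by simp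
  qed
 qed
 show "(%m. snd (?f m) k) \<in> borel \<Otimes>\<^sub>M borel \<rightarrow>\<^sub>M borel" for k
  by (cases "k \<in> {1..<q}"; cases "Suc k < q") (use c2 in \<open>simp_all add: upd_def Let_def case_prod_beta\<close>)
qed

sublocale CU: driven_chain "borel :: 'u measure" HU TU
proof
 show "HU \<in> borel \<rightarrow>\<^sub>M prob_algebra borel"
  unfolding HU_def[abs_def] by (rule measurable_distr_prob_space2[OF H_measurable]) measurable
 have "(%m. (%(z, y). upd p q (%u. u) \<psi> z y) (fst (fst m), snd m)) \<in> (borel :: (('x, 'u) vec4) measure) \<Otimes>\<^sub>M (borel :: 'u measure) \<rightarrow>\<^sub>M borel"
  by (rule mcomp[OF _ T_reduced_measurable], rule measurable_Pair, rule mcomp[OF measurable_fst borel_fst_snd_measurable(1)], simp)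
 moreover have "(%m. (%(z, y). upd p q (%u. u) \<psi> z y) (snd (fst m), snd m)) \<in> (borel :: (('x, 'u) vec4) measure) \<Otimes>\<^sub>M (borel :: 'u measure) \<rightarrow>\<^sub>M borel"
  by (rule mcomp[OF _ T_reduced_measurable], rule measurable_Pair, rule mcomp[OF measurable_fst borel_fst_snd_measurable(2)], simp)
 ultimately show "(%(v, y). TU v y) \<in> borel \<Otimes>\<^sub>M borel \<rightarrow>\<^sub>M borel"
  using borel_Pair_measurable by (fastforce simp: upd2_def case_prod_unfold)
qed

definition xxuu_of :: "(('x, 'u) vec4) \<times> (nat => 'u) => (int => 'x) \<times> (int => 'x) \<times> (int => 'u) \<times> (int => 'u)" where
 "xxuu_of = (%(v, om). (\<lambda>k\<in>{- int p<..}. pathX p q (%u. u) \<psi> (fst v) om k, \<lambda>k\<in>{- int p<..}. pathX p q (%u. u) \<psi> (snd v) om k,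
   \<lambda>k\<in>{- int q<..}. pathU q (%u. u) (fst v) om k, \<lambda>k\<in>{- int q<..}. pathU q (%u. u) (snd v) om k))"

lemma pathX_reduced_measurable:
 assumes S: "S \<in> M \<rightarrow>\<^sub>M (borel :: (('x, 'u) vec4) measure)" and om: "!!i. int i < k ==> (%m. om m i) \<in> M \<rightarrow>\<^sub>M borel"
 shows "(%m. pathX p q (%u. u) \<psi> (fst (S m)) (om m) k) \<in> M \<rightarrow>\<^sub>M borel"
  "(%m. pathX p q (%u. u) \<psi> (snd (S m)) (om m) k) \<in> M \<rightarrow>\<^sub>M borel"
proof -
 have "(%m. run TU (S m) (om m) (nat k)) \<in> M \<rightarrow>\<^sub>M borel"
  by (rule CU.run_measurable') (use assms in auto)
 note r = mcomp[OF this vec2_pair_measurable(1)] mcomp[OF this vec2_pair_measurable(2)]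
 show "(%m. pathX p q (%u. u) \<psi> (fst (S m)) (om m) k) \<in> M \<rightarrow>\<^sub>M borel"
  using r(1)[of p] mcomp[OF S vec2_pair_measurable(1)] unfolding pathX_def by (cases "k <= 0") (auto simp: run_upd2)
 show "(%m. pathX p q (%u. u) \<psi> (snd (S m)) (om m) k) \<in> M \<rightarrow>\<^sub>M borel"
  using r(2)[of p] mcomp[OF S vec2_pair_measurable(2)] unfolding pathX_def by (cases "k <= 0") (auto simp: run_upd2)
qed

lemma pathU_reduced_measurable:
 assumes S: "S \<in> M \<rightarrow>\<^sub>M (borel :: (('x, 'u) vec4) measure)" and om: "k \<ge> 0 ==> (%m. om m (nat k)) \<in> M \<rightarrow>\<^sub>M borel"
 shows "(%m. pathU q (%u. u) (fst (S m)) (om m) k) \<in> M \<rightarrow>\<^sub>M borel"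
  "(%m. pathU q (%u. u) (snd (S m)) (om m) k) \<in> M \<rightarrow>\<^sub>M borel"
 using om mcomp[OF S vec2_pair_measurable(3)] mcomp[OF S vec2_pair_measurable(4)]
 unfolding pathU_def by (cases "k < 0"; auto)+

lemma xxuu_of_measurable: "xxuu_of \<in> borel \<Otimes>\<^sub>M PiM UNIV (%_. borel) \<rightarrow>\<^sub>M xxuu_space p q"
 unfolding xxuu_of_def xxuu_space_def case_prod_unfold
 by (intro measurable_Pair measurable_restrict pathX_reduced_measurable pathU_reduced_measurable
   mcomp[OF measurable_snd] mcoord measurable_fst) auto

abbreviation cX1 :: "('x, 'u, 'y) cpath => int => 'x" where "cX1 c \<equiv> fst (fst c)"
abbreviation cX2 :: "('x, 'u, 'y) cpath => int => 'x" where "cX2 c \<equiv> fst (snd (fst c))"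
abbreviation cU1 :: "('x, 'u, 'y) cpath => int => 'u" where "cU1 c \<equiv> fst (snd (snd (fst c)))"
abbreviation cU2 :: "('x, 'u, 'y) cpath => int => 'u" where "cU2 c \<equiv> snd (snd (snd (fst c)))"

abbreviation cpath_of :: "('a => ('x, 'u) vec4) => (nat => 'a => 'y) => 'a => ('x, 'u, 'y) cpath" where
 "cpath_of S Y x \<equiv> (xxuu_of (S x, %n. ups (Y n x)), \<lambda>k\<in>{0..}. Y (nat k) x)"

lemma cpath_space_coord:
 "- int p < k ==> (%om. cX1 om k) \<in> cpath_space p q \<nu> \<rightarrow>\<^sub>M (borel :: 'x measure)"
 "- int p < k ==> (%om. cX2 om k) \<in> cpath_space p q \<nu> \<rightarrow>\<^sub>M (borel :: 'x measure)"
 "- int q < k ==> (%om. cU1 om k) \<in> cpath_space p q \<nu> \<rightarrow>\<^sub>M (borel :: 'u measure)"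
 "- int q < k ==> (%om. cU2 om k) \<in> cpath_space p q \<nu> \<rightarrow>\<^sub>M (borel :: 'u measure)"
 "0 <= k ==> (%om. snd om k) \<in> cpath_space p q \<nu> \<rightarrow>\<^sub>M \<nu>"
 unfolding cpath_space_def xxuu_space_def
 by (auto intro!: mcomp[OF measurable_fst] mcomp[OF measurable_snd] mcoord)

lemma cpast_map:
 "(%((X, X', U, U'), Y).
     (restrict X {- int p<..k}, restrict X' {- int p<..k},
      restrict U {- int q<..<k}, restrict U' {- int q<..<k})) \<in> cpath_space p q \<nu> \<rightarrow>\<^sub>M
  (PiM {- int p<..k} (%_. borel :: 'x measure) \<Otimes>\<^sub>M PiM {- int p<..k} (%_. borel :: 'x measure) \<Otimes>\<^sub>M
    PiM {- int q<..<k} (%_. borel :: 'u measure) \<Otimes>\<^sub>M PiM {- int q<..<k} (%_. borel :: 'u measure))"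
 unfolding case_prod_unfold by (intro measurable_Pair measurable_restrict cpath_space_coord) auto

lemma subalgebra_cpast: "subalgebra (cpath_space p q \<nu>) (cpast p q \<nu> k :: ('x, 'u, 'y) cpath measure)"
 unfolding cpast_def by (rule subalgebra_vimage_algebra[OF cpast_map])

lemma cpast_coord:
 "- int p < j ==> j <= k ==> (%om. cX1 om j) \<in> (cpast p q \<nu> k :: ('x, 'u, 'y) cpath measure) \<rightarrow>\<^sub>M (borel :: 'x measure)" (is "_ ==> _ ==> ?A")
 "- int p < j ==> j <= k ==> (%om. cX2 om j) \<in> (cpast p q \<nu> k :: ('x, 'u, 'y) cpath measure) \<rightarrow>\<^sub>M (borel :: 'x measure)" (is "_ ==> _ ==> ?B")
 "- int q < j ==> j < k ==> (%om. cU1 om j) \<in> (cpast p q \<nu> k :: ('x, 'u, 'y) cpath measure) \<rightarrow>\<^sub>M (borel :: 'u measure)" (is "_ ==> _ ==> ?C")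
 "- int q < j ==> j < k ==> (%om. cU2 om j) \<in> (cpast p q \<nu> k :: ('x, 'u, 'y) cpath measure) \<rightarrow>\<^sub>M (borel :: 'u measure)" (is "_ ==> _ ==> ?D")
proof -
 have m: "(%((X, X', U, U'), Y).
     (restrict X {- int p<..k}, restrict X' {- int p<..k},
      restrict U {- int q<..<k}, restrict U' {- int q<..<k})) \<in> (cpast p q \<nu> k :: ('x, 'u, 'y) cpath measure) \<rightarrow>\<^sub>M
  (PiM {- int p<..k} (%_. borel :: 'x measure) \<Otimes>\<^sub>M PiM {- int p<..k} (%_. borel :: 'x measure) \<Otimes>\<^sub>M
    PiM {- int q<..<k} (%_. borel :: 'u measure) \<Otimes>\<^sub>M PiM {- int q<..<k} (%_. borel :: 'u measure))"
  unfolding cpast_def using measurable_space[OF cpast_map] by (intro measurable_vimage_algebra1) auto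
 show ?A if "- int p < j" "j <= k"
  using mcomp[OF m mcomp[OF measurable_fst mcoord[of j]]] that
  by (simp add: case_prod_unfold)
 show ?B if "- int p < j" "j <= k"
  using mcomp[OF m mcomp[OF measurable_snd mcomp[OF measurable_fst mcoord[of j]]]] that
  by (simp add: case_prod_unfold)
 show ?C if "- int q < j" "j < k"
  using mcomp[OF m mcomp[OF measurable_snd mcomp[OF measurable_snd mcomp[OF measurable_fst mcoord[of j]]]]] that
  by (simp add: case_prod_unfold)
 show ?D if "- int q < j" "j < k"
  using mcomp[OF m mcomp[OF measurable_snd mcomp[OF measurable_snd mcomp[OF measurable_snd mcoord[of j]]]]] that
  by (simp add: case_prod_unfold)
qed

definition S2 :: "('x, 'u, 'y) cpath => ('x, 'u) vec4" where
 "S2 om = (state_at p q 0 (cX1 om) (cU1 om), state_at p q 0 (cX2 om) (cU2 om))"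

definition U2 :: "nat => ('x, 'u, 'y) cpath => 'u" where
 "U2 n om = cU1 om (int n)"

lemma S2_gen_measurable:
 assumes "!!k. - int p < k ==> k <= 0 ==> (%om. cX1 om k) \<in> M \<rightarrow>\<^sub>M borel"
  "!!k. - int p < k ==> k <= 0 ==> (%om. cX2 om k) \<in> M \<rightarrow>\<^sub>M borel"
  "!!k. - int q < k ==> k < 0 ==> (%om. cU1 om k) \<in> M \<rightarrow>\<^sub>M borel"
  "!!k. - int q < k ==> k < 0 ==> (%om. cU2 om k) \<in> M \<rightarrow>\<^sub>M borel"
 shows "S2 \<in> M \<rightarrow>\<^sub>M borel"
 unfolding S2_def[abs_def]
proof (rule borel_Pair_measurable; rule vec2_measurable)
 fix k
 show "(%om. fst (state_at p q 0 (cX1 om) (cU1 om)) k) \<in> M \<rightarrow>\<^sub>M borel"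
  using assms(1)[of "int k - int p"] by (cases "k \<in> {1..p}") (auto simp: state_at_def window_def)
 show "(%om. fst (state_at p q 0 (cX2 om) (cU2 om)) k) \<in> M \<rightarrow>\<^sub>M borel"
  using assms(2)[of "int k - int p"] by (cases "k \<in> {1..p}") (auto simp: state_at_def window_def)
 show "(%om. snd (state_at p q 0 (cX1 om) (cU1 om)) k) \<in> M \<rightarrow>\<^sub>M borel"
  using assms(3)[of "int k - int q"] by (cases "k \<in> {1..<q}") (auto simp: state_at_def window_def)
 show "(%om. snd (state_at p q 0 (cX2 om) (cU2 om)) k) \<in> M \<rightarrow>\<^sub>M borel"
  using assms(4)[of "int k - int q"] by (cases "k \<in> {1..<q}") (auto simp: state_at_def window_def)
qed

lemma H_emeasure_measurable: "B \<in> sets \<nu> ==> (%w. emeasure (dkernel \<nu> h w) B) \<in> bm (borel \<Otimes>\<^sub>M borel)"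
 using mcomp[OF measurable_prob_algebraD[OF h_measurable] measurable_emeasure_subprob_algebra] by simp

lemma coupled_model_driven:
 assumes "is_coupled_model p q \<nu> ups \<psi> h v P"
 shows "CU.driven P S2 U2" "AE om in P. fst om = xxuu_of (S2 om, %n. U2 n om)" "AE om in P. S2 om = v"
  "S2 \<in> P \<rightarrow>\<^sub>M borel"
proof -
 have P: "prob_space P" and sP: "sets P = sets (cpath_space p q \<nu>)"
  using assms by (auto simp: is_coupled_model_def space_prob_algebra)
 note mc = mcong[OF sP refl]
 have spP: "space P = space (cpath_space p q \<nu>)" by (rule sets_eq_imp_space_eq[OF sP])
 have c: "cond_distr P (cpast p q \<nu> (int n)) (%om. snd om (int n)) \<nu> (%om. dkernel \<nu> h (cX1 om (int n), cX2 om (int n)))" for n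
  using assms unfolding is_coupled_model_def by (auto simp: case_prod_unfold)
 have ae1: "AE om in P. cU1 om (int n) = ups (snd om (int n)) & cU2 om (int n) = ups (snd om (int n))" for n
  using assms unfolding is_coupled_model_def by (auto simp: case_prod_unfold)
 have ae2: "AE om in P. cX1 om (int n + 1) = \<psi> (window (cU1 om) (int n - int q) {1..q}) (window (cX1 om) (int n - int p) {1..p})
   & cX2 om (int n + 1) = \<psi> (window (cU2 om) (int n - int q) {1..q}) (window (cX2 om) (int n - int p) {1..p})" for n
  using assms unfolding is_coupled_model_def by (auto simp: case_prod_unfold)
 have ae: "AE om in P. \<forall>n. (cU1 om (int n) = ups (snd om (int n)) & cU2 om (int n) = ups (snd om (int n))) &
   (cX1 om (int n + 1) = \<psi> (window (cU1 om) (int n - int q) {1..q}) (window (cX1 om) (int n - int p) {1..p})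
   & cX2 om (int n + 1) = \<psi> (window (cU2 om) (int n - int q) {1..q}) (window (cX2 om) (int n - int p) {1..p}))"
  unfolding AE_all_countable using ae1 ae2 by (auto intro: AE_conjI)
 show S2v: "AE om in P. S2 om = v"
  using assms unfolding is_coupled_model_def S2_def by (auto simp: case_prod_unfold prod_eq_iff)
 have "S2 \<in> cpath_space p q \<nu> \<rightarrow>\<^sub>M borel" by (rule S2_gen_measurable) (auto intro: cpath_space_coord)
 then show S2m: "S2 \<in> P \<rightarrow>\<^sub>M borel" using mc by blast
 have run: "AE om in P. \<forall>n. run TU (S2 om) (%n. U2 n om) n =
   (state_at p q (int n) (cX1 om) (cU1 om), state_at p q (int n) (cX2 om) (cU2 om))"
  using ae
 proof eventually_elim
  case (elim om)
  then show ?case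
   using run_eq_state_at[OF p1 q1, of "cU1 om" "%u. u" "%n. U2 n om" "cX1 om" \<psi>]
    run_eq_state_at[OF p1 q1, of "cU2 om" "%u. u" "%n. U2 n om" "cX2 om" \<psi>]
   by (simp add: run_upd2 S2_def U2_def)
 qed
 show "AE om in P. fst om = xxuu_of (S2 om, %n. U2 n om)"
  using ae AE_space
 proof eventually_elim
  case (elim om)
  obtain X X' U U' Y where om: "om = ((X, X', U, U'), Y)" by (metis prod.collapse)
  then have e: "X \<in> extensional {- int p<..}" "X' \<in> extensional {- int p<..}" "U \<in> extensional {- int q<..}" "U' \<in> extensional {- int q<..}"
   using elim(2) by (auto simp: spP cpath_space_def xxuu_space_def space_pair_measure space_PiM PiE_def)
  show ?case
   using path_eq_pathXU[OF p1 q1, of U "%u. u" "%n. U (int n)" X \<psi>] path_eq_pathXU[OF p1 q1, of U' "%u. u" "%n. U (int n)" X' \<psi>] elim(1) e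
   by (auto simp: om xxuu_of_def S2_def U2_def fun_eq_iff extensional_def)
 qed
 have U2m: "U2 n \<in> P \<rightarrow>\<^sub>M borel" for n
  unfolding U2_def mc using q1 by (intro cpath_space_coord) auto
 have Ym: "(%om. snd om (int n)) \<in> P \<rightarrow>\<^sub>M \<nu>" for n
  unfolding mc by (intro cpath_space_coord) auto
 have sub: "subalgebra P (cpast p q \<nu> (int n))" for n
  using subalgebra_cpast[of "int n"] sP spP by (simp add: subalgebra_def)
 show "CU.driven P S2 U2"
 proof (rule CU.drivenI[OF P S2m U2m])
  fix n and A :: "((('x, 'u) vec4) \<times> (nat => 'u)) set" and B :: "'u set"
  assume A: "A \<in> sets (borel \<Otimes>\<^sub>M CU.Wpi n)" and B[measurable]: "B \<in> sets borel"
  define f where "f om = (S2 om, \<lambda>i\<in>{..<n}. U2 i om)" for om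
  have "f \<in> cpast p q \<nu> (int n) \<rightarrow>\<^sub>M borel \<Otimes>\<^sub>M CU.Wpi n"
   unfolding f_def
  proof (intro measurable_Pair measurable_restrict S2_gen_measurable)
   show "U2 i \<in> cpast p q \<nu> (int n) \<rightarrow>\<^sub>M borel" if "i \<in> {..<n}" for i
    unfolding U2_def using cpast_coord(3)[of "int i" "int n"] that q1 by simp
  qed (auto intro!: cpast_coord)
  from measurable_sets[OF this A] have fA: "f -` A \<inter> space P \<in> sets (cpast p q \<nu> (int n))"
   using sub[of n] by (simp add: subalgebra_def)
  have fAP[measurable]: "f -` A \<inter> space P \<in> sets P" using fA sub[of n] by (auto simp: subalgebra_def)
  have upsB: "ups -` B \<inter> space \<nu> \<in> sets \<nu>" by measurable
  note [measurable] = U2m Ym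
  \<comment> \<open>Almost surely \<open>U2 n\<close> is the reduced observation at time
    \<open>n\<close>, so the event can be expressed through the observation, whose conditional law
    is given.\<close>
  have "emeasure P {x\<in>space P. f x \<in> A & U2 n x \<in> B} = emeasure P {om\<in>space P. om \<in> f -` A \<inter> space P & snd om (int n) \<in> ups -` B \<inter> space \<nu>}"
  proof (rule emeasure_eq_AE)
   show "AE x in P. (x \<in> {x \<in> space P. f x \<in> A & U2 n x \<in> B}) = (x \<in> {om \<in> space P. om \<in> f -` A \<inter> space P & snd om (int n) \<in> ups -` B \<inter> space \<nu>})"
    using ae AE_space by eventually_elim (use measurable_space[OF Ym] in \<open>auto simp: U2_def\<close>)
   have "{x \<in> space P. f x \<in> A & U2 n x \<in> B} = {x\<in>space P. x \<in> f -` A \<inter> space P & U2 n x \<in> B}" by auto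
   moreover have "{x\<in>space P. x \<in> f -` A \<inter> space P & U2 n x \<in> B} \<in> sets P" by measurable
   ultimately show "{x \<in> space P. f x \<in> A & U2 n x \<in> B} \<in> sets P" by (simp only:)
   show "{om \<in> space P. om \<in> f -` A \<inter> space P & snd om (int n) \<in> ups -` B \<inter> space \<nu>} \<in> sets P" using upsB by measurable
  qed
  also have "... = (\<integral>\<^sup>+om. indicator (f -` A \<inter> space P) om * emeasure (dkernel \<nu> h (cX1 om (int n), cX2 om (int n))) (ups -` B \<inter> space \<nu>) \<partial>P)"
   by (rule cond_distrD[OF P sub Ym c fA upsB])
  also have "... = (\<integral>\<^sup>+x. indicator A (f x) * emeasure (HU (run TU (S2 x) (%i. U2 i x) n)) B \<partial>P)"
  proof (rule nn_integral_cong_AE, use run AE_space in eventually_elim)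
   fix om assume om: "\<forall>n. run TU (S2 om) (%n. U2 n om) n =
    (state_at p q (int n) (cX1 om) (cU1 om), state_at p q (int n) (cX2 om) (cU2 om))" "om \<in> space P"
   have "emeasure (HU (run TU (S2 om) (%i. U2 i om) n)) B = emeasure (dkernel \<nu> h (cX1 om (int n), cX2 om (int n))) (ups -` B \<inter> space \<nu>)"
    using om(1) p1 unfolding HU_def by (subst emeasure_distr) (auto simp: state_at_def window_def dkernel_def)
   then show "indicator (f -` A \<inter> space P) om * emeasure (dkernel \<nu> h (cX1 om (int n), cX2 om (int n))) (ups -` B \<inter> space \<nu>)
    = indicator A (f om) * emeasure (HU (run TU (S2 om) (%i. U2 i om) n)) B"
    using om(2) by (simp add: indicator_def)
  qed
  finally show "emeasure P {x \<in> space P. (S2 x, \<lambda>i\<in>{..<n}. U2 i x) \<in> A & U2 n x \<in> B} =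
   (\<integral>\<^sup>+x. indicator A (S2 x, \<lambda>i\<in>{..<n}. U2 i x) * emeasure (HU (run TU (S2 x) (%i. U2 i x) n)) B \<partial>P)"
   by (simp add: f_def)
 qed
qed

lemma fst_cpath_measurable: "fst \<in> cpath_space p q \<nu> \<rightarrow>\<^sub>M xxuu_space p q"
 unfolding cpath_space_def by (rule measurable_fst)

lemma coupled_model_law_eq:
 assumes "is_coupled_model p q \<nu> ups \<psi> h v P"
 shows "distr P (xxuu_space p q) fst = distr (CU.joint P S2 U2) (xxuu_space p q) xxuu_of"
proof -
 note d = coupled_model_driven[OF assms]
 have sP: "sets P = sets (cpath_space p q \<nu>)" using assms by (auto simp: is_coupled_model_def space_prob_algebra)
 have jm: "(%x. (S2 x, %n. U2 n x)) \<in> P \<rightarrow>\<^sub>M borel \<Otimes>\<^sub>M PiM UNIV (%_. borel)"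
  by (rule CU.joint_measurable) (use CU.drivenD(2,3)[OF d(1)] in auto)
 have fm: "fst \<in> P \<rightarrow>\<^sub>M xxuu_space p q" using fst_cpath_measurable mcong[OF sP refl, of "xxuu_space p q"] by blast
 have "distr P (xxuu_space p q) fst = distr P (xxuu_space p q) (%om. xxuu_of (S2 om, %n. U2 n om))"
  by (rule distr_cong_AE[OF refl refl d(2) fm mcomp[OF jm xxuu_of_measurable]])
 also have "... = distr (CU.joint P S2 U2) (xxuu_space p q) xxuu_of"
  by (subst distr_distr[OF xxuu_of_measurable jm]) (simp add: comp_def)
 finally show ?thesis .
qed

lemma coupled_model_unique:
 assumes 1: "is_coupled_model p q \<nu> ups \<psi> h v P" and 2: "is_coupled_model p q \<nu> ups \<psi> h v P'"
 shows "distr P (xxuu_space p q) fst = distr P' (xxuu_space p q) fst"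
proof -
 note d = coupled_model_driven[OF 1] and d' = coupled_model_driven[OF 2]
 have "distr P borel S2 = distr P borel (%_. v)" by (rule distr_cong_AE[OF refl refl d(3,4)]) simp
 also have "... = return borel v" by (rule prob_space.distr_const[OF CU.drivenD(1)[OF d(1)]]) simp
 also have "... = distr P' borel (%_. v)" by (rule prob_space.distr_const[OF CU.drivenD(1)[OF d'(1)], symmetric]) simp
 also have "... = distr P' borel S2" by (rule distr_cong_AE[OF refl refl d'(3,4), symmetric]) simp
 finally have "CU.joint P S2 U2 = CU.joint P' S2 U2" by (rule CU.driven_unique[OF d(1) d'(1)])
 then show ?thesis by (simp add: coupled_model_law_eq[OF 1] coupled_model_law_eq[OF 2])
qed

abbreviation CP :: "('x, 'u, 'y) cpath measure" where "CP \<equiv> cpath_space p q \<nu>"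

lemma cpath_driven_measurable:
 assumes d: "C.driven P S Y"
 shows "(cpath_of S Y) \<in> P \<rightarrow>\<^sub>M CP"
proof -
 note [measurable] = C.drivenD(2,3)[OF d]
 have "(%x. (S x, %n. ups (Y n x))) \<in> P \<rightarrow>\<^sub>M borel \<Otimes>\<^sub>M PiM UNIV (%_. borel)"
  by (rule CU.joint_measurable) measurable
 from mcomp[OF this xxuu_of_measurable] show ?thesis
  unfolding cpath_space_def by (intro measurable_Pair measurable_restrict) auto
qed

lemma driven_cpast_set:
 assumes d: "C.driven P S Y" and A: "A \<in> sets (cpast p q \<nu> (int n))"
 shows "\<exists>A'\<in>sets (borel \<Otimes>\<^sub>M C.Wpi n). \<forall>x\<in>space P. (cpath_of S Y x) \<in> A \<longleftrightarrow> (hist S Y n x) \<in> A'"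
proof -
 let ?k = "int n"
 let ?N = "PiM {- int p<..?k} (%_. borel :: 'x measure) \<Otimes>\<^sub>M PiM {- int p<..?k} (%_. borel :: 'x measure) \<Otimes>\<^sub>M
    PiM {- int q<..<?k} (%_. borel :: 'u measure) \<Otimes>\<^sub>M PiM {- int q<..<?k} (%_. borel :: 'u measure)"
 let ?c = "%((X, X', U, U'), Y).
     (restrict X {- int p<..?k}, restrict X' {- int p<..?k},
      restrict U {- int q<..<?k}, restrict U' {- int q<..<?k})"
 obtain B where B: "B \<in> sets ?N" "A = ?c -` B \<inter> space (CP)"
  using A unfolding cpast_def by (rule sets_vimage_algebraE) (use measurable_space[OF cpast_map[of ?k]] in auto)
 define f where "f = (%(v, om). (\<lambda>k\<in>{- int p<..?k}. pathX p q (%u. u) \<psi> (fst v) (%i. ups (om i)) k, \<lambda>k\<in>{- int p<..?k}. pathX p q (%u. u) \<psi> (snd v) (%i. ups (om i)) k,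
   \<lambda>k\<in>{- int q<..<?k}. pathU q (%u. u) (fst v) (%i. ups (om i)) k, \<lambda>k\<in>{- int q<..<?k}. pathU q (%u. u) (snd v) (%i. ups (om i)) k))"
 have upsc: "i < n ==> (%x. ups (snd x i)) \<in> borel \<Otimes>\<^sub>M C.Wpi n \<rightarrow>\<^sub>M borel" for i
  by (rule mcomp[OF mcomp[OF measurable_snd mcoord[of i "{..<n}" "%_. \<nu>"]] Upsilon_measurable]) simp
 have f: "f \<in> borel \<Otimes>\<^sub>M C.Wpi n \<rightarrow>\<^sub>M ?N"
  unfolding f_def case_prod_beta
  by (intro measurable_Pair measurable_restrict pathX_reduced_measurable pathU_reduced_measurable measurable_fst upsc) auto
 have "(cpath_of S Y x) \<in> A \<longleftrightarrow> (hist S Y n x) \<in> f -` B \<inter> space (borel \<Otimes>\<^sub>M C.Wpi n)" if x: "x \<in> space P" for x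
 proof -
  note [measurable] = C.drivenD(2,3)[OF d]
  note 1 = measurable_space[OF cpath_driven_measurable[OF d] x]
  have 2: "(hist S Y n x) \<in> space (borel \<Otimes>\<^sub>M C.Wpi n)"
   using measurable_space[of "%x. (hist S Y n x)" P "borel \<Otimes>\<^sub>M C.Wpi n", OF _ x] by simp
  have "pathX p q (%u. u) \<psi> s (%i. ups (Y i x)) k = pathX p q (%u. u) \<psi> s (%i. ups ((\<lambda>i\<in>{..<n}. Y i x) i)) k" if "k <= int n" for k s
   using that unfolding pathX_def by (auto intro!: arg_cong[of _ _ "%z. fst z p"] run_cong)
  moreover have "pathU q (%u. u) s (%i. ups (Y i x)) k = pathU q (%u. u) s (%i. ups ((\<lambda>i\<in>{..<n}. Y i x) i)) k" if "k < int n" for k and s :: "('x, 'u) vec2"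
   using that unfolding pathU_def by auto
  ultimately have "?c (cpath_of S Y x) = f (hist S Y n x)"
   by (simp add: xxuu_of_def f_def fun_eq_iff)
  with 1 2 B show ?thesis by simp
 qed
 with measurable_sets[OF f B(1)] show ?thesis by blast
qed

lemma driven_coupled_model:
 assumes d: "C.driven P S Y" and Sv: "distr P borel S = return borel v" and v: "v \<in> space (Zsp p q) \<times> space (Zsp p q)"
 shows "is_coupled_model p q \<nu> ups \<psi> h v (distr P (CP) (cpath_of S Y))"
  (is "is_coupled_model p q \<nu> ups \<psi> h v ?Q")
  and "AE x in P. S x = v"
proof -
 note [measurable] = C.drivenD(2,3)[OF d]
 let ?\<phi> = "%x. (cpath_of S Y x)"
 note \<phi> = cpath_driven_measurable[OF d]
 have cl: "{v} \<in> sets borel" by simp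
 have "AE w in distr P borel S. w = v" unfolding Sv using cl by (subst AE_return) auto
 then show SvAE: "AE x in P. S x = v" by (subst (asm) AE_distr_iff) auto
 have ae: "AE om in ?Q. a om = b om"
  if ab: "a \<in> CP \<rightarrow>\<^sub>M borel" "b \<in> CP \<rightarrow>\<^sub>M borel" "AE x in P. a (?\<phi> x) = b (?\<phi> x)"
  for a b :: "('x, 'u, 'y) cpath => 'c::{second_countable_topology, t2_space}"
  using measurable_equality_set[OF ab(1,2)] ab(3) by (subst AE_distr_iff[OF \<phi>]) auto
 show "is_coupled_model p q \<nu> ups \<psi> h v ?Q"
  unfolding is_coupled_model_def
 proof (intro conjI allI impI)
  show "?Q \<in> space (prob_algebra (CP))"
   using prob_space.prob_space_distr[OF C.drivenD(1)[OF d] \<phi>] by (simp add: space_prob_algebra)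
  have "AE om in ?Q. S2 om = v"
  proof (rule ae)
   show "S2 \<in> CP \<rightarrow>\<^sub>M borel" by (rule S2_gen_measurable) (auto intro: cpath_space_coord)
   have S2\<phi>: "S2 (?\<phi> x) = (trunc_vec p q (fst (S x)), trunc_vec p q (snd (S x)))" for x
   proof -
    let ?st = "%s. state_at p q (int 0) (pathX p q (%u. u) \<psi> s (%n. ups (Y n x))) (pathU q (%u. u) s (%n. ups (Y n x)))"
    have "S2 (?\<phi> x) = (?st (fst (S x)), ?st (snd (S x)))"
     by (auto simp: S2_def xxuu_of_def state_at_def window_def fun_eq_iff)
    then show ?thesis by (simp only: state_at_path run.simps)
   qed
   show "AE x in P. S2 (?\<phi> x) = v"
    using SvAE
   proof eventually_elim
    case (elim x)
    show ?case by (rule trans[OF S2\<phi>]) (use elim v in \<open>simp add: trunc_vec_ident mem_Times_iff\<close>)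
   qed
  qed simp
  then show "AE ((X, X', U, U'), Y) in ?Q. state_at p q 0 X U = fst v & state_at p q 0 X' U' = snd v"
   by (auto simp: S2_def case_prod_unfold prod_eq_iff elim!: eventually_mono)
  fix k :: int assume k0: "0 <= k"
  then obtain n where k: "k = int n" using zero_le_imp_eq_int by blast
  show "cond_distr ?Q (cpast p q \<nu> k) (%((X, X', U, U'), Y). Y k) \<nu> (%((X, X', U, U'), Y). dkernel \<nu> h (X k, X' k))"
  proof (rule C.driven_distr_cond_distr[OF d \<phi> subalgebra_cpast])
   show "(%((X, X', U, U'), Y). Y k) \<in> CP \<rightarrow>\<^sub>M \<nu>" using cpath_space_coord(5)[OF k0] by (simp add: case_prod_unfold)
   show "(%((X, X', U, U'), Y). Y k) (?\<phi> x) = Y n x" for x by (simp add: k case_prod_unfold)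
   show "(%om. emeasure ((%((X, X', U, U'), Y). dkernel \<nu> h (X k, X' k)) om) B) \<in> bm (cpast p q \<nu> k :: ('x, 'u, 'y) cpath measure)" if "B \<in> sets \<nu>" for B
    using mcomp[OF measurable_Pair[OF cpast_coord(1)[of k k] cpast_coord(2)[of k k]] H_emeasure_measurable[OF that]] p1 k0
    by (simp add: case_prod_unfold)
   show "(%((X, X', U, U'), Y). dkernel \<nu> h (X k, X' k)) (?\<phi> x) = H (run T2 (S x) (%i. Y i x) n)" for x
    using p1 run_fst[of p p q ups \<psi> "fst (S x)" "%i. Y i x" n] run_fst[of p p q ups \<psi> "snd (S x)" "%i. Y i x" n]
    by (simp add: xxuu_of_def k run_upd2 pathX_reduced[of p q ups])
   show "\<exists>A'\<in>sets (borel \<Otimes>\<^sub>M C.Wpi n). \<forall>x\<in>space P. ?\<phi> x \<in> A \<longleftrightarrow> (hist S Y n x) \<in> A'" if "A \<in> sets (cpast p q \<nu> k)" for A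
    using driven_cpast_set[OF d] that by (simp add: k)
  qed
  have "AE om in ?Q. cU1 om k = ups (snd om k)"
   using q1 k0 by (intro ae mcomp[OF cpath_space_coord(5) Upsilon_measurable] cpath_space_coord) (auto simp: xxuu_of_def k pathU_def)
  moreover have "AE om in ?Q. cU2 om k = ups (snd om k)"
   using q1 k0 by (intro ae mcomp[OF cpath_space_coord(5) Upsilon_measurable] cpath_space_coord) (auto simp: xxuu_of_def k pathU_def)
  ultimately show "AE ((X, X', U, U'), Y) in ?Q. U k = ups (Y k) & U' k = ups (Y k)"
   by (auto simp: case_prod_unfold)
  have w: "window (restrict (pathU q (%u. u) s om) {- int q<..}) (k - int q) {1..q} = window (pathU q (%u. u) s om) (k - int q) {1..q}"
    "window (restrict (pathX p q (%u. u) \<psi> s om) {- int p<..}) (k - int p) {1..p} = window (pathX p q (%u. u) \<psi> s om) (k - int p) {1..p}" for s om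
   by (auto simp: window_def k fun_eq_iff)
  have "(%om. (window (cX1 om) (k - int p) {1..p}, window (cU1 om) (k - int q) {1..q}))
    \<in> CP \<rightarrow>\<^sub>M PiM {1..p} (%_. borel) \<Otimes>\<^sub>M PiM {1..q} (%_. borel)"
   unfolding window_def using k0 by (intro measurable_Pair measurable_restrict cpath_space_coord) auto
  note m1 = mcomp[OF this psi_measurable]
  have "(%om. (window (cX2 om) (k - int p) {1..p}, window (cU2 om) (k - int q) {1..q}))
    \<in> CP \<rightarrow>\<^sub>M PiM {1..p} (%_. borel) \<Otimes>\<^sub>M PiM {1..q} (%_. borel)"
   unfolding window_def using k0 by (intro measurable_Pair measurable_restrict cpath_space_coord) auto
  note m2 = mcomp[OF this psi_measurable]
  have "AE om in ?Q. cX1 om (k + 1) = \<psi> (window (cU1 om) (k - int q) {1..q}) (window (cX1 om) (k - int p) {1..p})"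
   using k0 m1 w pathX_step[OF p1, of q "%u. u" \<psi> _ _ n]
   by (intro ae cpath_space_coord) (auto simp: xxuu_of_def k)
  moreover have "AE om in ?Q. cX2 om (k + 1) = \<psi> (window (cU2 om) (k - int q) {1..q}) (window (cX2 om) (k - int p) {1..p})"
   using k0 m2 w pathX_step[OF p1, of q "%u. u" \<psi> _ _ n]
   by (intro ae cpath_space_coord) (auto simp: xxuu_of_def k)
  ultimately show "AE ((X, X', U, U'), Y) in ?Q.
    X (k + 1) = \<psi> (window U (k - int q) {1..q}) (window X (k - int p) {1..p}) &
    X' (k + 1) = \<psi> (window U' (k - int q) {1..q}) (window X' (k - int p) {1..p})"
   by (auto simp: case_prod_unfold)
 qed
qed

text \<open>The form in which the moment conditions of (A-8) become accessible: an iterate of the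
  coupled operator in place of an expectation under a definite description.\<close>

lemma coupled_expect_eq:
 assumes v: "v \<in> space (Zsp p q) \<times> space (Zsp p q)" and f[measurable]: "f \<in> bm (borel \<Otimes>\<^sub>M borel)"
 shows "coupled_expect p q \<nu> ups \<psi> h v f n = (step H T2 ^^ n) (%w. ennreal (f (fst (fst w) p, fst (snd w) p))) v"
proof -
 have "return borel v \<in> space (prob_algebra borel)" by (simp add: space_prob_algebra prob_space_return)
 from C.driven_exists[OF this] obtain P :: "(nat => (('x, 'u) vec4) \<times> 'y) measure" and S Y
  where d: "C.driven P S Y" and S: "distr P borel S = return borel v" by blast
 let ?\<phi> = "%x. (cpath_of S Y x)"
 let ?Q = "distr P (CP) ?\<phi>"
 let ?f = "%w::('x, 'u) vec4. ennreal (f (fst (fst w) p, fst (snd w) p))"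
 note \<phi> = cpath_driven_measurable[OF d]
 note cm = driven_coupled_model[OF d S v]
 have "coupled_law p q \<nu> ups \<psi> h v = distr ?Q (xxuu_space p q) fst"
  unfolding coupled_law_def using cm(1) coupled_model_unique by (intro the_equality) blast+
 then have "coupled_expect p q \<nu> ups \<psi> h v f n = (\<integral>\<^sup>+om. ennreal (f (fst om (int n), fst (snd om) (int n))) \<partial>distr ?Q (xxuu_space p q) fst)"
  unfolding coupled_expect_def by (simp add: case_prod_unfold)
 also have "... = (\<integral>\<^sup>+x. ennreal (f (fst (fst (?\<phi> x)) (int n), fst (snd (fst (?\<phi> x))) (int n))) \<partial>P)"
 proof -
  have m: "(%om. ennreal (f (fst om (int n), fst (snd om) (int n)))) \<in> bm (xxuu_space p q)"
  proof -
   have "(%om. (fst om (int n), fst (snd om) (int n))) \<in> xxuu_space p q \<rightarrow>\<^sub>M (borel :: 'x measure) \<Otimes>\<^sub>M (borel :: 'x measure)"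
    unfolding xxuu_space_def using p1
    by (intro measurable_Pair mcomp[OF measurable_fst] mcomp[OF measurable_snd] mcoord) auto
   from mcomp[OF this f] show ?thesis by measurable
  qed
  have fm: "fst \<in> ?Q \<rightarrow>\<^sub>M xxuu_space p q" using fst_cpath_measurable by simp
  have m': "(%om. ennreal (f (fst om (int n), fst (snd om) (int n)))) \<in> bm (distr ?Q (xxuu_space p q) fst)"
   using m by simp
  have "(%om. ennreal (f (cX1 om (int n), cX2 om (int n)))) \<in> bm ?Q"
   using mcomp[OF fst_cpath_measurable m] by simp
  from nn_integral_distr[OF \<phi> this] show ?thesis unfolding nn_integral_distr[OF fm m'] .
 qed
 also have "... = (\<integral>\<^sup>+x. ?f (run T2 (S x) (%i. Y i x) n) \<partial>P)"
 proof (intro nn_integral_cong)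
  fix x
  have "fst (fst (run T2 (S x) (%i. Y i x) n)) p = fst (fst (?\<phi> x)) (int n)"
   "fst (snd (run T2 (S x) (%i. Y i x) n)) p = fst (snd (fst (?\<phi> x))) (int n)"
   using p1 run_fst[of p p q ups \<psi> "fst (S x)" "%i. Y i x" n] run_fst[of p p q ups \<psi> "snd (S x)" "%i. Y i x" n]
   by (simp_all add: xxuu_of_def run_upd2 pathX_reduced[of p q ups])
  then show "ennreal (f (fst (fst (?\<phi> x)) (int n), fst (snd (fst (?\<phi> x))) (int n))) = ?f (run T2 (S x) (%i. Y i x) n)" by simp
 qed
 also have "... = (\<integral>\<^sup>+x. (step H T2 ^^ n) ?f (S x) \<partial>P)"
 proof (rule C.driven_expectation[OF d])
  have "(%v::('x, 'u) vec4. (fst (fst v) p, fst (snd v) p)) \<in> borel \<rightarrow>\<^sub>M borel \<Otimes>\<^sub>M borel" by measurable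
  from mcomp[OF this f] show "?f \<in> bm borel" by measurable
 qed
 also have "... = (\<integral>\<^sup>+x. (step H T2 ^^ n) ?f v \<partial>P)"
  by (rule nn_integral_cong_AE) (use cm(2) in eventually_elim, simp)
 also have "... = (step H T2 ^^ n) ?f v"
  using prob_space.emeasure_space_1[OF C.drivenD(1)[OF d]] by simp
 finally show ?thesis .
qed

end

subsection \<open>Contraction of the iterated update\<close>

lemma dist_Z_le_iff:
 assumes "1 <= p"
 shows "dist_Z p q z z' <= c \<longleftrightarrow> (\<forall>k\<in>{1..p}. dist (fst z k) (fst z' k) <= c) & (\<forall>l\<in>{1..<q}. dist (snd z l) (snd z' l) <= c)"
 unfolding dist_Z_def using assms by (subst Max_le_iff) auto

lemma dist_Z_fst: "1 <= p ==> k \<in> {1..p} ==> dist (fst z k) (fst z' k) <= dist_Z p q z z'"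
 and dist_Z_snd: "1 <= p ==> l \<in> {1..<q} ==> dist (snd z l) (snd z' l) <= dist_Z p q z z'"
 using dist_Z_le_iff[of p q z z' "dist_Z p q z z'"] by auto

lemma dist_Z_nonneg: "1 <= p ==> 0 <= dist_Z p q z z'"
 by (rule order_trans[OF zero_le_dist dist_Z_fst[of p 1]]) auto

lemma dist_Z_trunc: "dist_Z p q (trunc_vec p q z) (trunc_vec p q z') = dist_Z p q z z'"
 unfolding dist_Z_def trunc_vec_def by (intro arg_cong[of _ _ Max] arg_cong2[of _ _ _ _ "(\<union>)"] image_cong) auto

text \<open>The metric of the function type weights the coordinates by the powers of 1/2, starting
  with exponent 0, and these add up to 2.\<close>

lemma dist_fun_le:
 fixes f g :: "nat => 'a::metric_space"
 assumes "!!i. dist (f i) (g i) <= c" shows "dist f g <= 2 * c"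
proof -
 have s: "summable (%n. (1/2::real)^n)" by (simp add: summable_geometric_iff)
 have c: "0 <= c" using zero_le_dist assms by (rule order_trans)
 have "dist f g <= (\<Sum>n. (1/2)^n * c)"
  unfolding dist_fun_def
 proof (rule suminf_le)
  show "summable (%n. (1/2)^n * min (dist (f (from_nat n)) (g (from_nat n))) 1)"
   by (rule summable_comparison_test'[OF s, of 0]) auto
  show "(1/2)^n * min (dist (f (from_nat n)) (g (from_nat n))) 1 <= (1/2)^n * c" for n
   by (intro mult_left_mono) (auto intro: min.coboundedI1 assms)
 qed (intro summable_mult2 s)
 also have "... = (\<Sum>n. (1/2)^n) * c" by (intro suminf_mult2[symmetric] s)
 also have "... = 2 * c" using suminf_geometric[of "1/2::real"] by simp
 finally show ?thesis .
qed

text \<open>\<open>dist_Z\<close> ignores the entries outside of the windows, hence the truncation;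
  each of the two components of a state contributes a factor 2.\<close>

lemma dist_trunc_le_dist_Z:
 fixes z z' :: "('x::metric_space, 'u::metric_space) vec2"
 assumes "1 <= p"
 shows "dist (trunc_vec p q z) (trunc_vec p q z') <= 4 * dist_Z p q z z'"
proof -
 let ?d = "dist_Z p q z z'"
 note n = dist_Z_nonneg[OF assms, of q z z']
 have 1: "dist (restrict (fst z) {1..p}) (restrict (fst z') {1..p}) <= 2 * ?d"
 proof (rule dist_fun_le)
  show "dist (restrict (fst z) {1..p} i) (restrict (fst z') {1..p} i) <= ?d" for i
   using dist_Z_fst[OF assms, of i z z' q] n by (cases "i \<in> {1..p}") auto
 qed
 have 2: "dist (restrict (snd z) {1..<q}) (restrict (snd z') {1..<q}) <= 2 * ?d"
 proof (rule dist_fun_le)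
  show "dist (restrict (snd z) {1..<q} i) (restrict (snd z') {1..<q} i) <= ?d" for i
   using dist_Z_snd[OF assms, of i q z z'] n by (cases "i \<in> {1..<q}") auto
 qed
 have "dist (a, b) (a', b') <= dist a a' + dist b b'" for a a' :: "nat => 'x" and b b' :: "nat => 'u"
  unfolding dist_Pair_Pair by (rule sqrt_sum_squares_le_sum) auto
 note * = this
 have "dist (trunc_vec p q z) (trunc_vec p q z') <=
   dist (restrict (fst z) {1..p}) (restrict (fst z') {1..p}) + dist (restrict (snd z) {1..<q}) (restrict (snd z') {1..<q})"
  unfolding trunc_vec_def by (rule *)
 with 1 2 show ?thesis by linarith
qed

lemma tendsto_vec2_coord:
 fixes s :: "nat => ('x::metric_space, 'u::metric_space) vec2"
 assumes "s \<longlonglongrightarrow> z"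
 shows "(%i. fst (s i) k) \<longlonglongrightarrow> fst z k" "(%i. snd (s i) k) \<longlonglongrightarrow> snd z k"
 by (rule continuous_on_tendsto_compose[OF vec2_coord_continuous(1) assms] continuous_on_tendsto_compose[OF vec2_coord_continuous(2) assms]; simp)+

lemma tendsto_dist_Z:
 fixes s :: "nat => ('x::metric_space, 'u::metric_space) vec2"
 assumes "1 <= p" "s \<longlonglongrightarrow> z" shows "(%i. dist_Z p q z (s i)) \<longlonglongrightarrow> 0"
proof (rule tendsto_sandwich[of "%_. 0" _ _ "%i. (\<Sum>k=1..p. dist (fst z k) (fst (s i) k)) + (\<Sum>l\<in>{1..<q}. dist (snd z l) (snd (s i) l))"])
 show "\<forall>\<^sub>F i in sequentially. dist_Z p q z (s i) <= (\<Sum>k=1..p. dist (fst z k) (fst (s i) k)) + (\<Sum>l\<in>{1..<q}. dist (snd z l) (snd (s i) l))"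
  unfolding dist_Z_le_iff[OF assms(1)]
 proof (intro always_eventually allI conjI ballI)
  fix i
  have nn: "0 <= (\<Sum>k=1..p. dist (fst z k) (fst (s i) k))" "0 <= (\<Sum>l\<in>{1..<q}. dist (snd z l) (snd (s i) l))"
   by (simp_all add: sum_nonneg)
  show "dist (fst z k) (fst (s i) k) <= (\<Sum>k=1..p. dist (fst z k) (fst (s i) k)) + (\<Sum>l\<in>{1..<q}. dist (snd z l) (snd (s i) l))" if "k \<in> {1..p}" for k
   using member_le_sum[OF that, of "%k. dist (fst z k) (fst (s i) k)"] nn by simp
  show "dist (snd z l) (snd (s i) l) <= (\<Sum>k=1..p. dist (fst z k) (fst (s i) k)) + (\<Sum>l\<in>{1..<q}. dist (snd z l) (snd (s i) l))" if "l \<in> {1..<q}" for l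
   using member_le_sum[OF that, of "%l. dist (snd z l) (snd (s i) l)"] nn by simp
 qed
 have "(%i. (\<Sum>k=1..p. dist (fst z k) (fst (s i) k)) + (\<Sum>l\<in>{1..<q}. dist (snd z l) (snd (s i) l))) \<longlonglongrightarrow> (\<Sum>k=1..p. dist (fst z k) (fst z k)) + (\<Sum>l\<in>{1..<q}. dist (snd z l) (snd z l))"
  by (intro tendsto_intros tendsto_vec2_coord assms)
 then show "(%i. (\<Sum>k=1..p. dist (fst z k) (fst (s i) k)) + (\<Sum>l\<in>{1..<q}. dist (snd z l) (snd (s i) l))) \<longlonglongrightarrow> 0" by simp
qed (auto intro!: always_eventually simp: dist_Z_nonneg[OF assms(1)])

lemma pathU_ext_inputs: "ext_inputs q z u = pathU q (%u. u) z u"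
 by (auto simp: ext_inputs_def pathU_def fun_eq_iff)

lemma traj_eq_pathX:
 assumes "1 <= p" shows "traj p q \<psi> z u k = pathX p q (%u. u) \<psi> z u k"
proof (induction "nat k" arbitrary: k rule: less_induct)
 case less
 show ?case
 proof (cases "k <= 0")
  case True
  then show ?thesis by (simp add: pathX_def traj.simps)
 next
  case False
  define n where "n = nat (k - 1)"
  have k: "k = int n + 1" using False by (simp add: n_def)
  have "window (traj p q \<psi> z u) (int n - int p) {1..p} = window (pathX p q (%u. u) \<psi> z u) (int n - int p) {1..p}"
   unfolding window_def
  proof (rule restrict_ext)
   fix i assume "i \<in> {1..p}"
   then show "traj p q \<psi> z u (int n - int p + int i) = pathX p q (%u. u) \<psi> z u (int n - int p + int i)"
    using False k by (intro less) auto
  qed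
  then show ?thesis
   using False pathX_step[OF assms, of q "%u. u" \<psi> z u n] unfolding k
   by (subst traj.simps) (simp add: pathU_ext_inputs algebra_simps)
 qed
qed

lemma Lip_upper:
 assumes "z \<in> space (Zsp p q)" "z' \<in> space (Zsp p q)" "u \<in> {..<n} \<rightarrow>\<^sub>E UNIV"
 shows "ennreal (dist (psi_iter p q \<psi> n u z) (psi_iter p q \<psi> n u z')) / ennreal (dist_Z p q z z') <= Lip p q \<psi> n"
 unfolding Lip_def by (rule SUP_upper2[of "(z, z', u)"]) (use assms in auto)

context od
begin

lemma run_trunc: "0 < n ==> run T (trunc_vec p q z) om n = run T z om n"
proof (induction n)
 case (Suc n)
 then show ?case by (cases n) (auto simp: upd_trunc_vec)
qed simp

lemma run_in_Zsp: "0 < n ==> run T z om n \<in> space (Zsp p q)"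
 by (cases n) auto

lemma Lip_run:
 assumes "0 < n" "Lip p q \<psi> n <= ennreal L" "0 <= L"
 shows "dist (fst (run T z om n) p) (fst (run T z' om n) p) <= L * dist_Z p q z z'"
proof -
 define u where "u = (\<lambda>i\<in>{..<n}. ups (om i))"
 have e: "psi_iter p q \<psi> n u (trunc_vec p q s) = fst (run T s om n) p" for s
 proof -
  have "psi_iter p q \<psi> n u (trunc_vec p q s) = fst (run (upd p q (%u. u) \<psi>) (trunc_vec p q s) u n) p"
   using assms(1) by (simp add: psi_iter_def traj_eq_pathX[OF p1] pathX_def)
  also have "run (upd p q (%u. u) \<psi>) (trunc_vec p q s) u n = run (upd p q (%u. u) \<psi>) (trunc_vec p q s) (%i. ups (om i)) n"
   by (rule run_cong) (simp add: u_def)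
  finally show ?thesis using run_trunc[OF assms(1), of s om] by (simp add: run_reduced[of p q ups])
 qed
 let ?d = "dist (fst (run T z om n) p) (fst (run T z' om n) p)"
 have le: "ennreal ?d / ennreal (dist_Z p q z z') <= ennreal L"
  using Lip_upper[of "trunc_vec p q z" p q "trunc_vec p q z'" u n \<psi>] assms(2)
  unfolding e dist_Z_trunc by (auto simp: u_def intro: order_trans)
 have nn: "0 <= dist_Z p q z z'" by (rule dist_Z_nonneg[OF p1])
 show ?thesis
 proof (cases "dist_Z p q z z' = 0")
  case True
  \<comment> \<open>A nonzero value divided by 0 is infinite, so the finite Lipschitz bound forces
    equality.\<close>
  have "?d = 0"
  proof (rule ccontr)
   assume "?d ~= 0"
   then have "ennreal ?d / ennreal (dist_Z p q z z') = top"
    unfolding True by (simp add: divide_ennreal_def ennreal_mult_top)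
   with le show False by (simp add: top_unique)
  qed
  then show ?thesis using True by simp
 next
  case False
  then have pos: "0 < dist_Z p q z z'" using nn by simp
  then show ?thesis using le assms(3)
   by (simp add: divide_ennreal ennreal_le_iff divide_le_eq)
 qed
qed

lemma dist_run_inputs: "i \<in> {1..<q} ==> q <= n ==> snd (run T z om n) i = snd (run T z' om n) i"
 by (simp add: run_snd pathU_def)

end

locale od_contr = od p q \<nu> ups \<psi> g
 for p q :: nat and \<nu> :: "'y measure" and ups :: "'y => 'u::polish_space"
  and \<psi> :: "('x::polish_space, 'u) upd" and g :: "'x => 'y => real" +
 assumes A4: "cond_A4 p q \<psi>"
begin

lemma one_step_lipschitz: "\<exists>L\<ge>1. \<forall>z z' y. dist_Z p q (T z y) (T z' y) <= L * dist_Z p q z z'"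
proof -
 obtain L0 where L0: "0 <= L0" "Lip p q \<psi> 1 = ennreal L0" using A4 by (auto simp: cond_A4_def less_top_ennreal)
 \<comment> \<open>Entries that are merely moved need the constant 1 and the new state needs
   \<open>L0\<close>; the new input is common to both copies.\<close>
 define L where "L = max 1 L0"
 have "dist_Z p q (T z y) (T z' y) <= L * dist_Z p q z z'" for z z' y
  unfolding dist_Z_le_iff[OF p1]
 proof (intro conjI ballI)
  let ?d = "dist_Z p q z z'"
  have d: "0 <= ?d" "?d <= L * ?d" "L0 * ?d <= L * ?d"
   using dist_Z_nonneg[OF p1, of q z z'] by (auto simp: L_def mult_le_cancel_right1 mult_right_mono max_def)
  show "dist (fst (T z y) k) (fst (T z' y) k) <= L * ?d" if k: "k \<in> {1..p}" for k
  proof (cases "k < p")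
   case True
   then have "dist (fst (T z y) k) (fst (T z' y) k) = dist (fst z (Suc k)) (fst z' (Suc k))"
    using k by (simp add: upd_def Let_def)
   also have "... <= ?d" using True by (intro dist_Z_fst[OF p1]) auto
   finally show ?thesis using d by linarith
  next
   case False
   then have "k = p" using k by simp
   then show ?thesis
    using Lip_run[of 1 L0 z "%_. y" z'] L0 d by simp
  qed
  show "dist (snd (T z y) l) (snd (T z' y) l) <= L * ?d" if l: "l \<in> {1..<q}" for l
  proof (cases "Suc l < q")
   case True
   then have "dist (snd (T z y) l) (snd (T z' y) l) = dist (snd z (Suc l)) (snd z' (Suc l))"
    using l by (simp add: upd_def Let_def)
   also have "... <= ?d" using True by (intro dist_Z_snd[OF p1]) auto
   finally show ?thesis using d by linarith
  next
   case False
   then show ?thesis using l d by (simp add: upd_def Let_def)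
  qed
 qed
 then show ?thesis by (intro exI[of _ L]) (auto simp: L_def)
qed

lemma block_contraction: "\<exists>m>0. \<forall>z z' om. dist_Z p q (run T z om m) (run T z' om m) <= 1/2 * dist_Z p q z z'"
proof -
 have "\<forall>\<^sub>F n in sequentially. Lip p q \<psi> n < ennreal (1/2)"
 proof (rule order_tendstoD(2))
  show "Lip p q \<psi> \<longlonglongrightarrow> 0" using A4 by (simp add: cond_A4_def)
  show "0 < ennreal (1/2)" by (simp only: ennreal_less_zero_iff)
 qed
 then obtain n0 where n0: "!!n. n \<ge> n0 ==> Lip p q \<psi> n < ennreal (1/2)" by (auto simp: eventually_sequentially)
 \<comment> \<open>After this many steps all stored states stem from times at least
   \<open>n0\<close>, and all stored inputs are common to the two copies.\<close>
 define m where "m = n0 + p + q"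
 have "dist_Z p q (run T z om m) (run T z' om m) <= 1/2 * dist_Z p q z z'" for z z' om
  unfolding dist_Z_le_iff[OF p1]
 proof (intro conjI ballI)
  show "dist (fst (run T z om m) k) (fst (run T z' om m) k) <= 1/2 * dist_Z p q z z'" if k: "k \<in> {1..p}" for k
  proof -
   define n where "n = m - p + k"
   have n: "0 < n" "n \<ge> n0" "int m - int p + int k = int n" using k by (auto simp: n_def m_def)
   have "fst (run T s om m) k = fst (run T s om n) p" for s
    using run_fst[OF k, of q ups \<psi> s om m] n by (simp add: pathX_def)
   then show ?thesis using Lip_run[OF n(1), of "1/2" z om z'] n0[OF n(2)] by simp
  qed
  show "dist (snd (run T z om m) l) (snd (run T z' om m) l) <= 1/2 * dist_Z p q z z'" if "l \<in> {1..<q}" for l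
   using dist_run_inputs[OF that, of m z om z'] dist_Z_nonneg[OF p1, of q z z'] by (simp add: m_def)
 qed
 moreover have "0 < m" using p1 by (simp add: m_def)
 ultimately show ?thesis by blast
qed

lemma geometric_contraction:
 "\<exists>C \<rho>. 0 < C & 0 < \<rho> & \<rho> < 1 & (\<forall>n z z' om. dist_Z p q (run T z om n) (run T z' om n) <= C * \<rho> ^ n * dist_Z p q z z')"
proof -
 let ?d = "dist_Z p q"
 obtain L where L: "1 <= L" "!!z z' y. ?d (T z y) (T z' y) <= L * ?d z z'" using one_step_lipschitz by blast
 obtain m where m: "0 < m" "!!z z' om. ?d (run T z om m) (run T z' om m) <= 1/2 * ?d z z'" using block_contraction by blast
 have r: "?d (run T z om n) (run T z' om n) <= L ^ n * ?d z z'" for n z z' om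
 proof (induction n)
  case (Suc n)
  have "?d (run T z om (Suc n)) (run T z' om (Suc n)) <= L * ?d (run T z om n) (run T z' om n)" using L(2) by simp
  also have "... <= L * (L ^ n * ?d z z')" using Suc L by (intro mult_left_mono) auto
  finally show ?case by simp
 qed simp
 have b: "?d (run T z om (m * j)) (run T z' om (m * j)) <= (1/2) ^ j * ?d z z'" for j z z' om
 proof (induction j)
  case (Suc j)
  have "?d (run T z om (m * Suc j)) (run T z' om (m * Suc j)) <= 1/2 * ?d (run T z om (m * j)) (run T z' om (m * j))"
   unfolding mult_Suc_right add.commute[of m "m * j"] run_add by (rule m(2))
  also have "... <= 1/2 * ((1/2) ^ j * ?d z z')" using Suc by (intro mult_left_mono) auto
  finally show ?case by simp
 qed simp
 \<comment> \<open>The \<open>m\<close>-th root of the block factor 1/2; the remainder of less than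
   a full block costs at most \<open>L ^ m\<close>.\<close>
 define \<rho> where "\<rho> = (1/2::real) powr (1 / real m)"
 have \<rho>m: "\<rho> ^ m = 1/2" using m(1) by (simp add: \<rho>_def powr_power)
 have \<rho>: "0 < \<rho>" "\<rho> < 1"
 proof -
  show "0 < \<rho>" by (simp add: \<rho>_def)
  show "\<rho> < 1"
  proof (rule ccontr)
   assume "\<not> \<rho> < 1"
   then have "1 <= \<rho> ^ m" by (intro one_le_power) simp
   then show False unfolding \<rho>m by simp
  qed
 qed
 have "?d (run T z om n) (run T z' om n) <= (2 * L ^ m) * \<rho> ^ n * ?d z z'" for n z z' om
 proof -
  define j where "j = n div m"
  have n: "n = m * j + n mod m" by (simp add: j_def)
  have d0: "0 <= ?d z z'" by (rule dist_Z_nonneg[OF p1])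
  have "?d (run T z om n) (run T z' om n) <= L ^ (n mod m) * ?d (run T z om (m * j)) (run T z' om (m * j))"
   using r[of "run T z om (m * j)" "%i. om (m * j + i)" "n mod m" "run T z' om (m * j)"]
    trans[OF arg_cong[OF n, of "run T z om"] run_add] trans[OF arg_cong[OF n, of "run T z' om"] run_add] by simp
  also have "... <= L ^ m * ((1/2) ^ j * ?d z z')"
   by (intro mult_mono power_increasing b dist_Z_nonneg[OF p1])
    (use m(1) L(1) in \<open>auto intro: less_imp_le\<close>)
  \<comment> \<open>Completing the last block, which brings the exponent from \<open>m * j\<close>
    to a multiple of \<open>m\<close> that is at least \<open>n\<close>, costs the factor 2.\<close>
  also have "(1/2) ^ j = 2 * \<rho> ^ (m * Suc j)" by (simp add: power_add power_mult \<rho>m)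
  also have "L ^ m * (2 * \<rho> ^ (m * Suc j) * ?d z z') <= L ^ m * (2 * \<rho> ^ n * ?d z z')"
  proof -
   have "n <= m * Suc j" using n mod_less_divisor[OF m(1), of n] by (simp add: algebra_simps)
   then show ?thesis using \<rho> L(1) d0 by (intro mult_left_mono mult_right_mono power_decreasing) auto
  qed
  finally show ?thesis by (simp add: algebra_simps)
 qed
 then show ?thesis using \<rho> L(1) by (intro exI[of _ "2 * L ^ m"] exI[of _ \<rho>]) auto
qed

lemma T_tendsto:
 assumes "s \<longlonglongrightarrow> z" shows "(%i. T (s i) y) \<longlonglongrightarrow> T z y"
proof -
 obtain L where L: "!!z z' y. dist_Z p q (T z y) (T z' y) <= L * dist_Z p q z z'" using one_step_lipschitz by blast
 have le: "dist (T z y) (T (s i) y) <= 4 * (L * dist_Z p q z (s i))" for i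
 proof -
  have "dist (T z y) (T (s i) y) <= 4 * dist_Z p q (T z y) (T (s i) y)"
   using dist_trunc_le_dist_Z[OF p1, of q "T z y" "T (s i) y"] by (simp only: trunc_vec_ident[OF upd_in_Zsp])
  also have "... <= 4 * (L * dist_Z p q z (s i))" using L[of z y "s i"] by simp
  finally show ?thesis .
 qed
 have "(%i. 4 * (L * dist_Z p q z (s i))) \<longlonglongrightarrow> 4 * (L * 0)"
  by (intro tendsto_mult tendsto_const tendsto_dist_Z[OF p1 assms])
 then have "(%i. 4 * (L * dist_Z p q z (s i))) \<longlonglongrightarrow> 0" by simp
 from tendsto_sandwich[OF always_eventually[OF allI[OF zero_le_dist]] always_eventually[OF allI[OF le]] tendsto_const this]
 show ?thesis unfolding tendsto_dist_iff[of _ "T z y"] dist_commute[of "T z y"] .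
qed

end

subsection \<open>Geometric drift\<close>

context driven_chain
begin

text \<open>The hypotheses are the form taken by (A-6) and by (A-8)(v), with \<open>f\<close> the function of the
 current state whose maximum over the last \<open>d\<close> times controls \<open>V\<close>.\<close>

lemma drift_iterates:
 assumes f[measurable]: "f \<in> bm borel" and V[measurable]: "V \<in> bm borel"
  and lim: "!!eps::real. 0 < eps ==> \<exists>n0. \<forall>n\<ge>n0. \<exists>M::real\<ge>0. \<forall>s. (step kap t ^^ n) f s <= ennreal eps * (ennreal M + V s)"
  and dom: "!!n s. d <= n ==> (step kap t ^^ n) V s <= of_nat N * (\<Sum>i\<le>d. (step kap t ^^ (n - i)) f s)"
 shows "\<exists>m b. 0 < m & 0 <= (b::real) & (\<forall>s. (step kap t ^^ m) V s <= ennreal (1/2) * V s + ennreal b)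
  & (\<exists>C::real\<ge>0. \<forall>n\<ge>m. \<forall>s. (step kap t ^^ n) f s <= ennreal C * (1 + V s))"
proof -
 let ?R = "step kap t"
 \<comment> \<open>\<open>eps = 1 / (2 * Q)\<close> makes \<open>N * (d + 1) * eps\<close> at most
   1/2, the factor of the drift; the added ones keep \<open>Q\<close> positive.\<close>
 define Q where "Q = (real N + 1) * (real d + 1)"
 have Q: "0 < Q" "real N * real (Suc d) <= Q" by (auto simp: Q_def algebra_simps intro!: add_pos_nonneg)
 define eps where "eps = 1 / (2 * Q)"
 have eps: "0 < eps" using Q by (simp add: eps_def)
 obtain n0 where n0: "!!n. n \<ge> n0 ==> \<exists>M::real\<ge>0. \<forall>s. (?R ^^ n) f s <= ennreal eps * (ennreal M + V s)" using lim[OF eps] by blast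
 then obtain M where M: "!!n. n \<ge> n0 ==> 0 <= M n" "!!n s. n \<ge> n0 ==> (?R ^^ n) f s <= ennreal eps * (ennreal (M n) + V s)" by metis
 \<comment> \<open>All times \<open>m - i\<close> with \<open>i \<le> d\<close> are then at least
   \<open>n0\<close>.\<close>
 define m where "m = Suc (n0 + d)"
 \<comment> \<open>The constants \<open>M n\<close> depend on \<open>n\<close>. One bound for
   \<open>n \<le> 2 * m\<close> is enough, since later times are reduced modulo
   \<open>m\<close>.\<close>
 define K where "K = (\<Sum>n\<le>2 * m. \<bar>M n\<bar>)"
 have MK: "ennreal (M n) <= ennreal K" "M n <= K" if "n <= 2 * m" for n
 proof -
  have "\<bar>M n\<bar> <= K" unfolding K_def using that by (intro member_le_sum) auto
  then show "ennreal (M n) <= ennreal K" "M n <= K" by (auto intro!: ennreal_leI)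
 qed
 have K0: "0 <= K" by (simp add: K_def sum_nonneg)
 have f_le: "(?R ^^ n) f s <= ennreal eps * (ennreal K + V s)" if "n0 <= n" "n <= 2 * m" for n s
  using M(2)[OF that(1), of s] MK(1)[OF that(2)] by (meson add_right_mono mult_left_mono order_trans zero_le)
 define h where "h = ennreal (1/2)"
 have hK: "h * ennreal K <= ennreal K"
  unfolding h_def using K0 by (subst ennreal_mult[symmetric]) (auto intro!: ennreal_leI)
 have Vm: "(?R ^^ m) V s <= h * V s + ennreal K" for s
 proof -
  have "(?R ^^ m) V s <= of_nat N * (\<Sum>i\<le>d. (?R ^^ (m - i)) f s)" by (rule dom) (simp add: m_def)
  also have "... <= of_nat N * (\<Sum>i\<le>d. ennreal eps * (ennreal K + V s))"
   by (intro mult_left_mono sum_mono f_le) (auto simp: m_def)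
  also have "... = (of_nat N * of_nat (Suc d) * ennreal eps) * (ennreal K + V s)" by (simp add: mult.assoc)
  also have "... <= h * (ennreal K + V s)"
  proof (rule mult_right_mono)
   have "of_nat N * of_nat (Suc d) * ennreal eps = ennreal (real N * real (Suc d) * eps)"
    using eps by (simp only: ennreal_of_nat_eq_real_of_nat ennreal_mult''[symmetric] of_nat_0_le_iff mult_nonneg_nonneg)
   also have "... <= h"
    unfolding eps_def h_def using Q by (intro ennreal_leI) (simp add: divide_simps)
   finally show "of_nat N * of_nat (Suc d) * ennreal eps <= h" .
  qed simp
  also have "... = h * V s + h * ennreal K" by (simp add: distrib_left add.commute)
  also have "... <= h * V s + ennreal K" by (intro add_left_mono hK)
  finally show ?thesis .
 qed
 \<comment> \<open>The affine recursion with factor 1/2 and constant \<open>K\<close> has the fixed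
   point \<open>2 * K\<close>, which bounds the additive term for all \<open>j\<close>.\<close>
 have pow: "(?R ^^ (m * j)) V s <= V s + ennreal (2 * K)" for j s
 proof (induction j arbitrary: s)
  case (Suc j)
  have "(?R ^^ (m * Suc j)) V s = (?R ^^ (m * j)) ((?R ^^ m) V) s" by (simp add: mult_Suc_right add.commute[of m "m * j"] funpow_add)
  also have "... <= (?R ^^ (m * j)) (%s. h * V s + ennreal K) s" by (rule step_pow_mono) (rule Vm)
  also have "... = h * (?R ^^ (m * j)) V s + ennreal K" by (simp add: step_pow_add step_pow_cmult step_pow_const)
  also have "... <= h * (V s + ennreal (2 * K)) + ennreal K" by (intro add_right_mono mult_left_mono Suc) auto
  also have "... = h * V s + (h * ennreal (2 * K) + ennreal K)" by (simp add: distrib_left add.assoc)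
  also have "h * ennreal (2 * K) + ennreal K = ennreal (2 * K)"
   unfolding h_def using K0 by (subst ennreal_mult[symmetric]) (simp_all flip: ennreal_plus)
  also have "h * V s + ennreal (2 * K) <= 1 * V s + ennreal (2 * K)"
   unfolding h_def by (intro add_right_mono mult_right_mono) (simp_all only: ennreal_1[symmetric] ennreal_leI[of "1/2" 1] zero_le)
  finally show ?case by simp
 qed simp
 define C where "C = eps * (1 + 3 * K)"
 have C0: "0 <= C" using eps K0 by (simp add: C_def)
 have "(?R ^^ n) f s <= ennreal C * (1 + V s)" if n: "n \<ge> m" for n s
 proof -
  \<comment> \<open>One block fewer than the quotient is split off, so that the remainder
    \<open>r\<close> lies between \<open>m\<close> and \<open>2 * m\<close>, where
    \<open>f_le\<close> applies.\<close>
  define j where "j = n div m - 1"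
  define r where "r = m + n mod m"
  have m0: "0 < m" by (simp add: m_def)
  have "1 <= n div m" using n m0 by (simp add: div_greater_zero_iff Suc_le_eq)
  then have nr: "n = m * j + r" unfolding j_def r_def using mult_div_mod_eq[of m n] by (cases "n div m") (auto simp: algebra_simps)
  have "n0 <= m" by (simp add: m_def)
  then have r: "n0 <= r" "r <= 2 * m" unfolding r_def using mod_less_divisor[OF m0, of n] by linarith+
  have "(?R ^^ n) f s = (?R ^^ (m * j)) ((?R ^^ r) f) s" unfolding nr by (simp add: funpow_add)
  also have "... <= (?R ^^ (m * j)) (%s. ennreal eps * (ennreal K + V s)) s" by (rule step_pow_mono) (rule f_le[OF r])
  also have "... = ennreal eps * (ennreal K + (?R ^^ (m * j)) V s)" by (simp add: step_pow_add step_pow_cmult step_pow_const)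
  also have "... <= ennreal eps * (ennreal K + (V s + ennreal (2 * K)))" by (intro mult_left_mono add_left_mono pow) auto
  also have "... = ennreal eps * (ennreal (3 * K) + V s)"
   using K0 by (simp add: add.left_commute[of _ "V s"] flip: ennreal_plus) (simp add: add.commute)
  also have "... <= ennreal eps * (ennreal (1 + 3 * K) * 1 + ennreal (1 + 3 * K) * V s)"
  proof (intro mult_left_mono add_mono)
   have "1 * V s <= ennreal (1 + 3 * K) * V s" using K0 by (intro mult_right_mono) (auto simp flip: ennreal_1 intro!: ennreal_leI)
   then show "V s <= ennreal (1 + 3 * K) * V s" by simp
   show "ennreal (3 * K) <= ennreal (1 + 3 * K) * 1" using K0 by (simp add: ennreal_leI)
  qed auto
  also have "... = ennreal C * (1 + V s)"
   proof -
   have e: "ennreal C = ennreal eps * ennreal (1 + 3 * K)" using eps K0 by (simp add: C_def ennreal_mult)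
   show ?thesis unfolding e by (simp only: distrib_left mult.assoc)
  qed
  finally show ?thesis .
 qed
 moreover have "0 < m" by (simp add: m_def)
 ultimately show ?thesis using Vm[unfolded h_def] K0 C0 by blast
qed

end

subsection \<open>Coupling and the e-property\<close>

text \<open>\<open>\<mu>\<close> is a common part of \<open>M\<close> and \<open>N\<close>. On it
  \<open>F\<close> and \<open>F'\<close> are compared directly, while the remaining mass of
  \<open>M\<close> costs at most itself because \<open>F \<le> 1\<close>. In the proof the mass of
  \<open>\<mu>\<close> is added on both sides and cancelled at the end, since subtraction of
  \<open>ennreal\<close> values is truncated.\<close>

lemma overlap_coupling:
 fixes M N \<mu> :: "'y measure"
 assumes sM[measurable_cong]: "sets M = sets \<mu>" and sN[measurable_cong]: "sets N = sets \<mu>" and pM: "prob_space M"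
  and leM: "!!k. k \<in> bm \<mu> ==> (\<integral>\<^sup>+y. k y \<partial>\<mu>) <= (\<integral>\<^sup>+y. k y \<partial>M)"
  and leN: "!!k. k \<in> bm \<mu> ==> (\<integral>\<^sup>+y. k y \<partial>\<mu>) <= (\<integral>\<^sup>+y. k y \<partial>N)"
  and F[measurable]: "F \<in> bm \<mu>" "F' \<in> bm \<mu>" and F1: "!!y. F y <= (1::ennreal)"
 shows "(\<integral>\<^sup>+y. F y \<partial>M) <= (\<integral>\<^sup>+y. F' y \<partial>N) + (1 - emeasure \<mu> (space \<mu>)) + (\<integral>\<^sup>+y. F y - F' y \<partial>\<mu>)"
proof -
 define m where "m = emeasure \<mu> (space \<mu>)"
 have sp: "space M = space \<mu>" by (rule sets_eq_imp_space_eq[OF sM])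
 have one: "(\<integral>\<^sup>+y. 1 \<partial>M) = 1" using prob_space.emeasure_space_1[OF pM] by simp
 have m1: "m <= 1" using leM[of "%_. 1"] one by (simp add: m_def)
 then have mf: "m ~= top" by (auto simp: top_unique)
 have FF: "F y + (1 - F y) = 1" for y using F1[of y] by (simp add: add_diff_inverse_ennreal)
 have "(\<integral>\<^sup>+y. F y \<partial>M) + m = (\<integral>\<^sup>+y. F y \<partial>M) + ((\<integral>\<^sup>+y. F y \<partial>\<mu>) + (\<integral>\<^sup>+y. 1 - F y \<partial>\<mu>))"
  by (subst nn_integral_add[symmetric]) (auto simp: FF m_def)
 also have "... <= (\<integral>\<^sup>+y. F y \<partial>M) + ((\<integral>\<^sup>+y. F y \<partial>\<mu>) + (\<integral>\<^sup>+y. 1 - F y \<partial>M))"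
  by (intro add_left_mono leM) measurable
 also have "... = (\<integral>\<^sup>+y. F y + (1 - F y) \<partial>M) + (\<integral>\<^sup>+y. F y \<partial>\<mu>)"
  by (subst nn_integral_add) (auto simp: ac_simps)
 also have "... = ((1 - m) + m) + (\<integral>\<^sup>+y. F y \<partial>\<mu>)"
  using m1 by (simp add: FF prob_space.emeasure_space_1[OF pM] diff_add_cancel_ennreal)
 finally have "m + (\<integral>\<^sup>+y. F y \<partial>M) <= m + ((1 - m) + (\<integral>\<^sup>+y. F y \<partial>\<mu>))" by (simp only: ac_simps)
 then have "(\<integral>\<^sup>+y. F y \<partial>M) <= (1 - m) + (\<integral>\<^sup>+y. F y \<partial>\<mu>)"
  using mf by (simp add: ennreal_add_left_cancel_le)
 also have "(\<integral>\<^sup>+y. F y \<partial>\<mu>) <= (\<integral>\<^sup>+y. F' y + (F y - F' y) \<partial>\<mu>)"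
  by (intro nn_integral_mono) (metis add.commute diff_le_self_ennreal ennreal_minus_le_iff order_refl)
 also have "... = (\<integral>\<^sup>+y. F' y \<partial>\<mu>) + (\<integral>\<^sup>+y. F y - F' y \<partial>\<mu>)" by (intro nn_integral_add) measurable
 also have "... <= (\<integral>\<^sup>+y. F' y \<partial>N) + (\<integral>\<^sup>+y. F y - F' y \<partial>\<mu>)" by (intro add_right_mono leN) measurable
 finally show ?thesis by (simp add: m_def ac_simps)
qed

section \<open>The chain of pairs that fails with probability \<open>1 - \<alpha>\<close>\<close>

locale od_A8 = od_contr p q \<nu> ups \<psi> g + od_coupled p q \<nu> ups \<psi> g h
 for p q :: nat and \<nu> :: "'y measure" and ups :: "'y => 'u::polish_space"
  and \<psi> :: "('x::polish_space, 'u) upd" and g :: "'x => 'y => real" and h :: "'x \<times> 'x => 'y => real" +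
 fixes \<alpha> WX :: "'x \<times> 'x => real"
 assumes \<alpha>_measurable[measurable]: "\<alpha> \<in> bm (borel \<Otimes>\<^sub>M borel)"
  and \<alpha>01: "!!w. 0 <= \<alpha> w" "!!w. \<alpha> w <= 1"
  and minorization: "!!x x' y. y \<in> space \<nu> ==> \<alpha> (x, x') * h (x, x') y <= min (g x y) (g x' y)"
  and WX_measurable[measurable]: "WX \<in> bm (borel \<Otimes>\<^sub>M borel)"
  and WX1: "!!w. 1 <= WX w"
  and WX_locally_bdd: "!!x. locally_bdd (%x'. WX (x, x'))"
  and \<alpha>_WX: "!!x x'. 1 - \<alpha> (x, x') <= dist x x' * WX (x, x')"
begin

abbreviation R :: "(('x, 'u) vec2 => ennreal) => ('x, 'u) vec2 => ennreal" where "R \<equiv> step G T"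
abbreviation Q :: "(('x, 'u) vec4 => ennreal) => ('x, 'u) vec4 => ennreal" where "Q \<equiv> step H T2"

text \<open>Both copies are updated with an observation drawn for the first one. This is a Markov
  operator above \<open>S\<close>; its first component is the original chain, and its input law does
  not involve the second copy.\<close>

abbreviation B :: "(('x, 'u) vec4 => ennreal) => ('x, 'u) vec4 => ennreal" where "B \<equiv> step (%v. G (fst v)) T2"

sublocale B: driven_chain \<nu> "%v. G (fst v)" T2
proof
 show "(%v::('x, 'u) vec4. G (fst v)) \<in> borel \<rightarrow>\<^sub>M prob_algebra \<nu>"
  using mcomp[OF borel_fst_snd_measurable(1) kernel] by simp
qed (rule T2_measurable)

definition pairp :: "('x, 'u) vec4 => 'x \<times> 'x" where
 "pairp v = (fst (fst v) p, fst (snd v) p)"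

lemma pairp_measurable[measurable]: "pairp \<in> borel \<rightarrow>\<^sub>M borel \<Otimes>\<^sub>M borel"
 unfolding pairp_def by measurable

definition ab :: "('x, 'u) vec4 => ennreal" where "ab v = ennreal (1 - \<alpha> (pairp v))"

text \<open>By (A-8)(i), \<open>\<alpha> * h\<close> is a common part of the two observation laws,
  of mass \<open>\<alpha>\<close>. \<open>S\<close> performs the common step on this part and loses
  the rest, whose mass is \<open>ab\<close>.\<close>

definition S :: "(('x, 'u) vec4 => ennreal) => ('x, 'u) vec4 => ennreal" where
 "S F v = ennreal (\<alpha> (pairp v)) * Q F v"

lemma ab_measurable[measurable]: "ab \<in> bm borel" unfolding ab_def by measurable
lemma ab_le_1: "ab v <= 1" using \<alpha>01[of "pairp v"] by (simp add: ab_def ennreal_le_1)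

lemma S_measurable[measurable]: "F \<in> bm borel ==> S F \<in> bm borel"
 unfolding S_def[abs_def] using C.step_measurable[of F] by measurable

lemma S_pow_measurable[measurable]: "F \<in> bm borel ==> (S ^^ n) F \<in> bm borel"
 by (induction n) auto

lemma S_add: "F \<in> bm borel ==> F' \<in> bm borel ==> S (%v. F v + F' v) = (%v. S F v + S F' v)"
 unfolding S_def by (simp add: C.step_add distrib_left)

lemma S_pow_add: "F \<in> bm borel ==> F' \<in> bm borel ==> (S ^^ n) (%v. F v + F' v) = (%v. (S ^^ n) F v + (S ^^ n) F' v)"
 by (induction n) (auto simp: S_add)

lemma S_zero: "S (%_. 0) = (%_. 0)" unfolding S_def by (simp add: C.step_const)

lemma S_sum: "finite I ==> (!!i. i \<in> I ==> F i \<in> bm borel) ==> S (%v. \<Sum>i\<in>I. F i v) = (%v. \<Sum>i\<in>I. S (F i) v)"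
 by (induction I rule: finite_induct) (auto simp: S_add S_zero)

lemma S_suminf: "(!!i. F i \<in> bm borel) ==> S (%v. \<Sum>i. F i v) = (%v. \<Sum>i. S (F i) v)"
 unfolding S_def step_def by (auto simp: nn_integral_suminf)

lemma S_pow_suminf: "(!!i. F i \<in> bm borel) ==> (S ^^ n) (%v. \<Sum>i. F i v) = (%v. \<Sum>i. (S ^^ n) (F i) v)"
 by (induction n) (auto simp: S_suminf)

lemma g_measurable: "g x \<in> bm \<nu>" and g_nonneg: "y \<in> space \<nu> ==> 0 <= g x y"
 using model by (auto simp: od_model_def is_dkernel_def)

lemma h_measurable1: "h w \<in> bm \<nu>" and h_nonneg: "y \<in> space \<nu> ==> 0 <= h w y"
 using h_kernel by (cases w; auto simp: is_dkernel_def space_pair_measure)+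

lemma sets_dkernel[simp]: "sets (dkernel \<nu> f w) = sets \<nu>" and space_dkernel[simp]: "space (dkernel \<nu> f w) = space \<nu>"
 by (simp_all add: dkernel_def)

lemma prob_G: "prob_space (dkernel \<nu> g x)" using measurable_space[OF dkernel_measurable, of x] by (simp add: space_prob_algebra)
lemma prob_h: "prob_space (dkernel \<nu> h w)" using measurable_space[OF h_measurable, of w] by (simp add: space_prob_algebra space_pair_measure)

lemma alpha_h_le:
 assumes k: "k \<in> bm \<nu>"
 shows "ennreal (\<alpha> (x, x')) * (\<integral>\<^sup>+y. k y \<partial>dkernel \<nu> h (x, x')) <= (\<integral>\<^sup>+y. k y \<partial>dkernel \<nu> g x)"
  and "ennreal (\<alpha> (x, x')) * (\<integral>\<^sup>+y. k y \<partial>dkernel \<nu> h (x, x')) <= (\<integral>\<^sup>+y. k y \<partial>dkernel \<nu> g x')"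
proof -
 note [measurable] = k h_measurable1 g_measurable
 have "ennreal (\<alpha> (x, x')) * (\<integral>\<^sup>+y. k y \<partial>dkernel \<nu> h (x, x')) = (\<integral>\<^sup>+y. ennreal (\<alpha> (x, x')) * (ennreal (h (x, x') y) * k y) \<partial>\<nu>)"
  unfolding dkernel_def by (simp add: nn_integral_density nn_integral_cmult)
 also have "... = (\<integral>\<^sup>+y. ennreal (\<alpha> (x, x') * h (x, x') y) * k y \<partial>\<nu>)"
  using \<alpha>01 by (intro nn_integral_cong) (simp add: ennreal_mult' mult.assoc)
 finally have eq: "ennreal (\<alpha> (x, x')) * (\<integral>\<^sup>+y. k y \<partial>dkernel \<nu> h (x, x')) = (\<integral>\<^sup>+y. ennreal (\<alpha> (x, x') * h (x, x') y) * k y \<partial>\<nu>)" .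
 have "(\<integral>\<^sup>+y. ennreal (\<alpha> (x, x') * h (x, x') y) * k y \<partial>\<nu>) <= (\<integral>\<^sup>+y. ennreal (g x y) * k y \<partial>\<nu>)"
  "(\<integral>\<^sup>+y. ennreal (\<alpha> (x, x') * h (x, x') y) * k y \<partial>\<nu>) <= (\<integral>\<^sup>+y. ennreal (g x' y) * k y \<partial>\<nu>)"
  using minorization[of _ x x'] by (intro nn_integral_mono mult_right_mono ennreal_leI; force)+
 then show "ennreal (\<alpha> (x, x')) * (\<integral>\<^sup>+y. k y \<partial>dkernel \<nu> h (x, x')) <= (\<integral>\<^sup>+y. k y \<partial>dkernel \<nu> g x)"
  "ennreal (\<alpha> (x, x')) * (\<integral>\<^sup>+y. k y \<partial>dkernel \<nu> h (x, x')) <= (\<integral>\<^sup>+y. k y \<partial>dkernel \<nu> g x')"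
  unfolding eq by (simp_all add: dkernel_def nn_integral_density)
qed

text \<open>Neither \<open>\<alpha>\<close> nor \<open>h\<close> is assumed symmetric; letting
  \<open>a\<close> and \<open>b\<close> be either of the two points serves both directions of a
  comparison with the same value \<open>\<alpha> (x, x')\<close>.\<close>

lemma alpha_coupling:
 assumes F: "F \<in> bm \<nu>" "F' \<in> bm \<nu>" "!!y. F y <= (1::ennreal)"
  and a: "a \<in> {x, x'}" and b: "b \<in> {x, x'}"
 shows "(\<integral>\<^sup>+y. F y \<partial>dkernel \<nu> g a) <= (\<integral>\<^sup>+y. F' y \<partial>dkernel \<nu> g b) + ennreal (1 - \<alpha> (x, x'))
   + ennreal (\<alpha> (x, x')) * (\<integral>\<^sup>+y. F y - F' y \<partial>dkernel \<nu> h (x, x'))"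
proof -
 let ?\<mu> = "scale_measure (ennreal (\<alpha> (x, x'))) (dkernel \<nu> h (x, x'))"
 have i: "(\<integral>\<^sup>+y. k y \<partial>?\<mu>) = ennreal (\<alpha> (x, x')) * (\<integral>\<^sup>+y. k y \<partial>dkernel \<nu> h (x, x'))" if "k \<in> bm \<nu>" for k
  using that by (intro nn_integral_scale_measure) (simp cong: mcong)
 have bm: "bm ?\<mu> = (bm \<nu> :: ('y => ennreal) set)" by (rule mcong) simp_all
 have "(\<integral>\<^sup>+y. F y \<partial>dkernel \<nu> g a) <= (\<integral>\<^sup>+y. F' y \<partial>dkernel \<nu> g b) + (1 - emeasure ?\<mu> (space ?\<mu>)) + (\<integral>\<^sup>+y. F y - F' y \<partial>?\<mu>)"
  by (rule overlap_coupling)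
   (use F a b alpha_h_le[of _ x x'] in \<open>auto simp: prob_G bm i\<close>)
 moreover have "emeasure ?\<mu> (space ?\<mu>) = ennreal (\<alpha> (x, x'))"
  using prob_space.emeasure_space_1[OF prob_h] by (simp add: space_scale_measure)
 moreover have "1 - ennreal (\<alpha> (x, x')) = ennreal (1 - \<alpha> (x, x'))"
  using \<alpha>01 by (simp add: ennreal_minus flip: ennreal_1)
 moreover have "(%y. F y - F' y) \<in> bm \<nu>" using F by measurable
 ultimately show ?thesis by (simp add: i)
qed

text \<open>With the same function in both places the last term of \<open>alpha_coupling\<close>
  disappears, so the observation laws at two points differ by at most \<open>1 - \<alpha>\<close> in
  total variation.\<close>

lemma total_variation:
 assumes "F \<in> bm \<nu>" "!!y. F y <= (1::ennreal)" "a \<in> {x, x'}" "b \<in> {x, x'}"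
 shows "(\<integral>\<^sup>+y. F y \<partial>dkernel \<nu> g a) <= (\<integral>\<^sup>+y. F y \<partial>dkernel \<nu> g b) + ennreal (1 - \<alpha> (x, x'))"
proof -
 have "F y - F y = 0" for y using assms(2)[of y] by (intro diff_eq_0_ennreal) (auto intro: le_less_trans[OF _ ennreal_one_less_top])
 then show ?thesis using alpha_coupling[OF assms(1) assms(1) assms(2-4)] by simp
qed

lemma S_le_Q: "S F v <= Q F v"
proof -
 have "S F v <= 1 * Q F v" unfolding S_def using \<alpha>01 by (intro mult_right_mono) (auto simp: ennreal_le_1)
 then show ?thesis by simp
qed

lemma S_le_B: assumes "F \<in> bm borel" shows "S F v <= B F v"
 unfolding S_def step_def pairp_def
 by (rule alpha_h_le) (use mcomp[OF C.update1 assms] in simp)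

lemma S_pow_le_Q: "(S ^^ n) F v <= (Q ^^ n) F v"
proof (induction n arbitrary: v)
 case (Suc n)
 have "(S ^^ Suc n) F v <= Q ((S ^^ n) F) v" using S_le_Q by simp
 also have "... <= Q ((Q ^^ n) F) v" by (rule C.step_mono) (rule Suc)
 finally show ?case by simp
qed simp

lemma S_pow_le_B: assumes "F \<in> bm borel" shows "(S ^^ n) F v <= (B ^^ n) F v"
proof (induction n arbitrary: v)
 case (Suc n)
 have "(S ^^ Suc n) F v <= B ((S ^^ n) F) v" using S_le_B[of "(S ^^ n) F"] assms by simp
 also have "... <= B ((B ^^ n) F) v" by (rule B.step_mono) (rule Suc)
 finally show ?case by simp
qed simp

text \<open>The k-th term is the probability that the first failure occurs in step \<open>k\<close>,
  and the last summand the probability that \<open>n\<close> steps pass without failure.\<close>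

lemma S_ab_sum: "(\<Sum>k<n. (S ^^ k) ab v) + (S ^^ n) (%_. 1) v = 1"
proof (induction n)
 case (Suc n)
 have "S (%_. 1) v + ab v = 1" for v
  using \<alpha>01[of "pairp v"] by (simp add: S_def C.step_const ab_def flip: ennreal_plus)
 then have "(%_. 1) = (%v. S (%_. 1) v + ab v)" by auto
 then have "(S ^^ n) (%_. 1) v = (S ^^ n) (%v. S (%_. 1) v + ab v) v" by simp
 also have "... = (S ^^ n) (S (%_. 1)) v + (S ^^ n) ab v" by (subst S_pow_add) auto
 also have "(S ^^ n) (S (%_. 1)) v = (S ^^ Suc n) (%_. 1) v" by (simp add: funpow_swap1)
 finally show ?case using Suc by (simp add: ac_simps)
qed simp

lemma S_ab_suminf_le_1: "(\<Sum>k. (S ^^ (n + k)) ab v) <= 1"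
proof (rule suminf_le_const[OF summableI])
 fix N
 have "(\<Sum>k<N. (S ^^ (n + k)) ab v) <= (\<Sum>k<n + N. (S ^^ k) ab v)"
 proof -
  have "(\<Sum>k<n + N. (S ^^ k) ab v) = (\<Sum>k<n. (S ^^ k) ab v) + (\<Sum>k<N. (S ^^ (n + k)) ab v)"
   by (induction N) (auto simp: ac_simps)
  then show ?thesis by simp
 qed
 also have "... <= 1" using S_ab_sum[of v "n + N"] by (metis le_iff_add)
 finally show "(\<Sum>k<N. (S ^^ (n + k)) ab v) <= 1" .
qed

text \<open>The first step costs \<open>ab v\<close>, and \<open>S\<close> integrates the bound of
  the induction hypothesis over the successful common steps, which shifts the sum by one. Along
  common inputs the values of \<open>f\<close> at the two copies differ by \<open>eps\<close> at
  most.\<close>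

lemma coupling_bound:
 assumes f[measurable]: "f \<in> bm borel" and f1: "!!z. f z <= 1"
  and le: "!!om. f (run T (fst v) om n) <= f (run T (snd v) om n) + eps"
   "!!om. f (run T (snd v) om n) <= f (run T (fst v) om n) + eps"
 shows "(R ^^ n) f (fst v) <= (R ^^ n) f (snd v) + ((\<Sum>k<n. (S ^^ k) ab v) + eps)"
  and "(R ^^ n) f (snd v) <= (R ^^ n) f (fst v) + ((\<Sum>k<n. (S ^^ k) ab v) + eps)"
proof -
 have "(R ^^ n) f (fst v) <= (R ^^ n) f (snd v) + ((\<Sum>k<n. (S ^^ k) ab v) + eps) &
  (R ^^ n) f (snd v) <= (R ^^ n) f (fst v) + ((\<Sum>k<n. (S ^^ k) ab v) + eps)"
  using le
 proof (induction n arbitrary: v)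
  case 0
  then show ?case by auto
 next
  case (Suc n)
  define z z' where "z = fst v" and "z' = snd v"
  let ?x = "fst z p" and ?x' = "fst z' p"
  let ?F = "(R ^^ n) f"
  let ?\<Sigma> = "%v. \<Sum>k<n. (S ^^ k) ab v"
  have Fm[measurable]: "?F \<in> bm borel" by measurable
  have F1: "?F z <= 1" for z
   using step_pow_mono[of f "%_. 1" n z] f1 by (simp add: step_pow_const)
  have Ty[measurable]: "T s \<in> \<nu> \<rightarrow>\<^sub>M borel" for s by (rule update1)
  have Fy: "(%y. ?F (T s y)) \<in> bm \<nu>" for s by measurable
  have IH: "?F (T z y) <= ?F (T z' y) + (?\<Sigma> (T2 v y) + eps)" "?F (T z' y) <= ?F (T z y) + (?\<Sigma> (T2 v y) + eps)" for y
  proof -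
   have "f (run T (T z y) om n) <= f (run T (T z' y) om n) + eps" "f (run T (T z' y) om n) <= f (run T (T z y) om n) + eps" for om
    using Suc.prems(1)[of "case_nat y om"] Suc.prems(2)[of "case_nat y om"]
    by (simp_all add: run_Suc_shift z_def z'_def del: run.simps)
   with Suc.IH[of "T2 v y"] show "?F (T z y) <= ?F (T z' y) + (?\<Sigma> (T2 v y) + eps)" "?F (T z' y) <= ?F (T z y) + (?\<Sigma> (T2 v y) + eps)"
    by (simp_all add: upd2_def z_def z'_def)
  qed
  have bound: "ennreal (\<alpha> (?x, ?x')) * (\<integral>\<^sup>+y. ?\<Sigma> (T2 v y) + eps \<partial>dkernel \<nu> h (?x, ?x')) + ennreal (1 - \<alpha> (?x, ?x')) <= (\<Sum>k<Suc n. (S ^^ k) ab v) + eps"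
  proof -
   have "ennreal (\<alpha> (?x, ?x')) * (\<integral>\<^sup>+y. ?\<Sigma> (T2 v y) + eps \<partial>dkernel \<nu> h (?x, ?x')) = S (%v. ?\<Sigma> v + eps) v"
    by (simp add: S_def step_def pairp_def z_def z'_def)
   also have "... = (\<Sum>k<n. (S ^^ Suc k) ab v) + S (%_. eps) v"
    by (subst S_add) (auto simp: S_sum)
   also have "... <= (\<Sum>k<n. (S ^^ Suc k) ab v) + eps"
    using S_le_Q[of "%_. eps" v] by (intro add_left_mono) (simp add: C.step_const)
   finally have "ennreal (\<alpha> (?x, ?x')) * (\<integral>\<^sup>+y. ?\<Sigma> (T2 v y) + eps \<partial>dkernel \<nu> h (?x, ?x')) + ennreal (1 - \<alpha> (?x, ?x')) <= (\<Sum>k<n. (S ^^ Suc k) ab v) + eps + ab v"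
    by (intro add_mono) (simp_all add: ab_def pairp_def z_def z'_def)
   also have "... = (\<Sum>k<Suc n. (S ^^ k) ab v) + eps"
    unfolding sum.lessThan_Suc_shift by (simp add: ac_simps)
   finally show ?thesis .
  qed
  have d: "a - b <= c" if "a <= b + c" "b <= 1" for a b c :: ennreal
   using that by (auto simp: ennreal_minus_le_iff top_unique add.commute)
  have "(R ^^ Suc n) f z = (\<integral>\<^sup>+y. ?F (T z y) \<partial>dkernel \<nu> g ?x)" by (simp add: step_def)
  also have "... <= (\<integral>\<^sup>+y. ?F (T z' y) \<partial>dkernel \<nu> g ?x') + ennreal (1 - \<alpha> (?x, ?x'))
    + ennreal (\<alpha> (?x, ?x')) * (\<integral>\<^sup>+y. ?F (T z y) - ?F (T z' y) \<partial>dkernel \<nu> h (?x, ?x'))"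
   by (rule alpha_coupling[OF Fy Fy F1]) auto
  also have "... <= (\<integral>\<^sup>+y. ?F (T z' y) \<partial>dkernel \<nu> g ?x') + ennreal (1 - \<alpha> (?x, ?x'))
    + ennreal (\<alpha> (?x, ?x')) * (\<integral>\<^sup>+y. ?\<Sigma> (T2 v y) + eps \<partial>dkernel \<nu> h (?x, ?x'))"
   by (intro add_left_mono mult_left_mono nn_integral_mono d IH F1) auto
  also have "... <= (\<integral>\<^sup>+y. ?F (T z' y) \<partial>dkernel \<nu> g ?x') + ((\<Sum>k<Suc n. (S ^^ k) ab v) + eps)"
   unfolding add.assoc by (rule add_left_mono) (use bound in \<open>simp only: add.commute add.left_commute\<close>)
  also have "(\<integral>\<^sup>+y. ?F (T z' y) \<partial>dkernel \<nu> g ?x') = (R ^^ Suc n) f z'" by (simp add: step_def)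
  finally have 1: "(R ^^ Suc n) f z <= (R ^^ Suc n) f z' + ((\<Sum>k<Suc n. (S ^^ k) ab v) + eps)" .
  have "(R ^^ Suc n) f z' = (\<integral>\<^sup>+y. ?F (T z' y) \<partial>dkernel \<nu> g ?x')" by (simp add: step_def)
  also have "... <= (\<integral>\<^sup>+y. ?F (T z y) \<partial>dkernel \<nu> g ?x) + ennreal (1 - \<alpha> (?x, ?x'))
    + ennreal (\<alpha> (?x, ?x')) * (\<integral>\<^sup>+y. ?F (T z' y) - ?F (T z y) \<partial>dkernel \<nu> h (?x, ?x'))"
   by (rule alpha_coupling[OF Fy Fy F1]) auto
  also have "... <= (\<integral>\<^sup>+y. ?F (T z y) \<partial>dkernel \<nu> g ?x) + ennreal (1 - \<alpha> (?x, ?x'))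
    + ennreal (\<alpha> (?x, ?x')) * (\<integral>\<^sup>+y. ?\<Sigma> (T2 v y) + eps \<partial>dkernel \<nu> h (?x, ?x'))"
   by (intro add_left_mono mult_left_mono nn_integral_mono d IH F1) auto
  also have "... <= (\<integral>\<^sup>+y. ?F (T z y) \<partial>dkernel \<nu> g ?x) + ((\<Sum>k<Suc n. (S ^^ k) ab v) + eps)"
   unfolding add.assoc by (rule add_left_mono) (use bound in \<open>simp only: add.commute add.left_commute\<close>)
  also have "(\<integral>\<^sup>+y. ?F (T z y) \<partial>dkernel \<nu> g ?x) = (R ^^ Suc n) f z" by (simp add: step_def)
  finally show ?case using 1 by (simp add: z_def z'_def)
 qed
 then show "(R ^^ n) f (fst v) <= (R ^^ n) f (snd v) + ((\<Sum>k<n. (S ^^ k) ab v) + eps)"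
  "(R ^^ n) f (snd v) <= (R ^^ n) f (fst v) + ((\<Sum>k<n. (S ^^ k) ab v) + eps)" by auto
qed

text \<open>Continuity at the diagonal in the second argument, along sequences all of whose pairs
  satisfy \<open>P\<close>; this relation will record which stored inputs the copies share.\<close>

definition vanishing :: "(('x, 'u) vec2 => ('x, 'u) vec2 => bool) => (('x, 'u) vec4 => ennreal) => bool" where
 "vanishing P F \<longleftrightarrow> (\<forall>z s. s \<longlonglongrightarrow> z --> (\<forall>i. P z (s i)) --> (%i::nat. F (z, s i)) \<longlonglongrightarrow> 0)"

text \<open>Observations are drawn from \<open>G z\<close>, which is the same along the whole
  sequence, so dominated convergence applies with the bound 1. Under \<open>S\<close> or
  \<open>Q\<close> the law of the observation would vary with \<open>s i\<close>.\<close>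

lemma vanishing_B:
 assumes F[measurable]: "F \<in> bm borel" and F1: "!!v. F v <= 1" and van: "vanishing P' F"
  and P: "!!z z'. P z z' ==> AE y in G z. P' (T z y) (T z' y)"
 shows "vanishing P (B F)"
 unfolding vanishing_def
proof (intro allI impI)
 fix z and s :: "nat => ('x, 'u) vec2" assume s: "s \<longlonglongrightarrow> z" and Ps: "\<forall>i. P z (s i)"
 have T2m: "(%y. F (T2 v y)) \<in> bm \<nu>" for v by (rule mcomp[OF C.update1 F])
 have "(%i. \<integral>\<^sup>+y. F (T2 (z, s i) y) \<partial>G z) \<longlonglongrightarrow> (\<integral>\<^sup>+y. 0 \<partial>G z)"
 proof (rule nn_integral_dominated_convergence[where w="%_. 1"])
  show "(\<integral>\<^sup>+ x. 1 \<partial>G z) < \<infinity>" using prob_space.emeasure_space_1[OF prob_G] by simp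
  show "AE y in G z. (%i. F (T2 (z, s i) y)) \<longlonglongrightarrow> 0"
  proof -
   have "AE y in G z. \<forall>i. P' (T z y) (T (s i) y)" unfolding AE_all_countable using P Ps by blast
   then show ?thesis
   proof eventually_elim
    case (elim y)
    then show ?case
     using van[unfolded vanishing_def, rule_format, OF T_tendsto[OF s, of y]] by (simp add: upd2_def)
   qed
  qed
 qed (use T2m F1 in auto)
 then show "(%i. B F (z, s i)) \<longlonglongrightarrow> 0" by (simp add: step_def)
qed

lemma vanishing_B_pow:
 assumes "F \<in> bm borel" "!!v. F v <= 1" "vanishing (%_ _. True) F"
 shows "vanishing (%_ _. True) ((B ^^ n) F)"
proof (induction n)
 case (Suc n)
 have "(B ^^ n) F v <= 1" for v using B.step_pow_mono[of F "%_. 1" n v] assms(2) by (simp add: B.step_pow_const)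
 then show ?case using Suc assms(1) by (auto intro!: vanishing_B)
qed (use assms in simp)

lemma WX_bound: "\<exists>e>0. \<exists>K. \<forall>x'. dist x' x < e --> WX (x, x') <= K"
proof -
 obtain e where e: "e > 0" "bounded ((%x'. WX (x, x')) ` ball x e)" using WX_locally_bdd[of x] by (auto simp: locally_bdd_def)
 then obtain K where "\<forall>x'\<in>ball x e. \<bar>WX (x, x')\<bar> <= K" by (auto simp: bounded_iff)
 then show ?thesis using e(1) by (intro exI[of _ e] conjI exI[of _ K]) (auto simp: dist_commute abs_le_iff)
qed

lemma WX_seq_bound:
 assumes "xs \<longlonglongrightarrow> x" shows "\<exists>K. \<forall>\<^sub>F i in sequentially. WX (x, xs i) <= K"
proof -
 obtain e K where "0 < e" and K: "!!x'. dist x' x < e ==> WX (x, x') <= K" using WX_bound by blast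
 then have "\<forall>\<^sub>F i in sequentially. dist (xs i) x < e" using assms tendstoD by blast
 then have "\<forall>\<^sub>F i in sequentially. WX (x, xs i) <= K" by eventually_elim (rule K)
 then show ?thesis by blast
qed

text \<open>(A-8)(iii) bounds the failure probability by a distance times \<open>WX\<close>, which
  is locally bounded in its second argument.\<close>

lemma ab_vanishing: "vanishing (%_ _. True) ab"
 unfolding vanishing_def
proof (intro allI impI)
 fix z and s :: "nat => ('x, 'u) vec2" assume s: "s \<longlonglongrightarrow> z"
 have xs: "(%i. fst (s i) p) \<longlonglongrightarrow> fst z p" by (rule tendsto_vec2_coord(1)[OF s])
 obtain K where K: "\<forall>\<^sub>F i in sequentially. WX (fst z p, fst (s i) p) <= K" using WX_seq_bound[OF xs] by blast
 have "(%i. ennreal (dist (fst z p) (fst (s i) p) * K)) \<longlonglongrightarrow> ennreal (dist (fst z p) (fst z p) * K)"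
  by (intro tendsto_ennrealI tendsto_intros xs)
 moreover have "\<forall>\<^sub>F i in sequentially. ab (z, s i) <= ennreal (dist (fst z p) (fst (s i) p) * K)"
  using K
 proof eventually_elim
  case (elim i)
  have "1 - \<alpha> (fst z p, fst (s i) p) <= dist (fst z p) (fst (s i) p) * WX (fst z p, fst (s i) p)" by (rule \<alpha>_WX)
  also have "... <= dist (fst z p) (fst (s i) p) * K" using elim by (intro mult_left_mono) auto
  finally show ?case by (simp add: ab_def pairp_def ennreal_leI)
 qed
 ultimately show "(%i. ab (z, s i)) \<longlonglongrightarrow> 0"
  by (intro tendsto_sandwich[of "%_. 0" "%i. ab (z, s i)" sequentially "%i. ennreal (dist (fst z p) (fst (s i) p) * K)"]) auto
qed

end

subsection \<open>Drift and moment bounds\<close>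

text \<open>The side conditions cover the conventions: a quotient by 0 is 0 or infinity, and every
  quotient by infinity is 0.\<close>

lemma ennreal_le_mult_of_divide_le:
 fixes a b c :: ennreal
 assumes "a / b <= c" "b = 0 ==> c < \<infinity>" "b = \<infinity> ==> 0 < c"
 shows "a <= c * b"
proof -
 consider "b = 0" | "b = \<infinity>" | "b ~= 0" "b ~= \<infinity>" by blast
 then show ?thesis
 proof cases
  case 1
  then have "a = 0" using assms(1,2) by (cases "a = 0") (auto simp: ennreal_divide_zero)
  then show ?thesis by simp
 next
  case 2
  then show ?thesis using assms(3) by (simp add: ennreal_mult_top)
 next
  case 3
  then have "a = a / b * b" by (simp add: ennreal_divide_times ennreal_divide_self less_top zero_less_iff_neq_zero)
  also have "... <= c * b" by (rule mult_right_mono[OF assms(1)]) simp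
  finally show ?thesis .
 qed
qed

text \<open>If the relative norm is 0, then \<open>f\<close> vanishes and the quotient is
  \<open>0 / 0 = 0\<close>.\<close>

lemma rel_sup_divide_le:
 assumes "rel_sup f V < \<infinity>"
 shows "f s / rel_sup f V <= ennreal (V s)"
proof -
 have le: "f s / ennreal (V s) <= rel_sup f V" unfolding rel_sup_def by (rule SUP_upper) simp
 then have "f s <= rel_sup f V * ennreal (V s)" by (rule ennreal_le_mult_of_divide_le) (use assms in auto)
 then show ?thesis
  using assms by (cases "rel_sup f V = 0") (auto simp: divide_le_posI_ennreal mult.commute zero_less_iff_neq_zero)
qed

text \<open>Brings the double limits of (A-6) and (A-8)(v) into the form that
  \<open>drift_iterates\<close> asks for.\<close>

lemma ratio_limit:
 fixes E :: "'a => nat => ennreal"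
 assumes lim: "\<forall>n. ((%M::real. SUP z\<in>Z. E z n / (ennreal M + V z)) \<longlongrightarrow> L n) at_top" and L: "L \<longlonglongrightarrow> 0" and eps: "0 < (eps::real)"
 shows "\<exists>n0. \<forall>n\<ge>n0. \<exists>M::real\<ge>0. \<forall>z\<in>Z. E z n <= ennreal eps * (ennreal M + V z)"
proof -
 have "\<forall>\<^sub>F n in sequentially. L n < ennreal eps" using order_tendstoD(2)[OF L, of "ennreal eps"] eps by simp
 then obtain n0 where n0: "!!n. n0 <= n ==> L n < ennreal eps" by (auto simp: eventually_sequentially)
 have "\<exists>M::real\<ge>0. \<forall>z\<in>Z. E z n <= ennreal eps * (ennreal M + V z)" if "n0 <= n" for n
 proof -
  have "\<forall>\<^sub>F M in at_top. (SUP z\<in>Z. E z n / (ennreal M + V z)) < ennreal eps"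
   using order_tendstoD(2)[OF lim[rule_format] n0[OF that]] .
  then have "\<forall>\<^sub>F M in at_top. (SUP z\<in>Z. E z n / (ennreal M + V z)) < ennreal eps & 1 <= M"
   using eventually_ge_at_top[of 1] by eventually_elim auto
  then obtain M where M: "(SUP z\<in>Z. E z n / (ennreal M + V z)) < ennreal eps" "1 <= M"
   using eventually_happens'[OF trivial_limit_at_top_linorder] by blast
  have "E z n <= ennreal eps * (ennreal M + V z)" if "z \<in> Z" for z
  proof (rule ennreal_le_mult_of_divide_le)
   show "E z n / (ennreal M + V z) <= ennreal eps"
    using SUP_upper[OF that, of "%z. E z n / (ennreal M + V z)"] M(1) by simp
  qed (use eps M(2) in auto)
  then show ?thesis using M(2) by (intro exI[of _ M]) auto
 qed
 then show ?thesis by blast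
qed

context driven_chain
begin

lemma step_eqI: "(!!w. w \<in> space W ==> f (t s w) = c) ==> step kap t f s = c"
 using nn_integral_cong[of "kap s" "%w. f (t s w)" "%_. c"] fun_cong[OF step_const[of c], of s] by (simp add: step_def)

text \<open>Entries move one place per step without randomness, so the entry that arrives in place 0
  after \<open>j\<close> steps is known now.\<close>

lemma step_pow_coord:
 assumes "!!i s w. i < j ==> \<phi> i (t s w) = \<phi> (Suc i) s"
 shows "(step kap t ^^ j) (\<phi> 0) s = \<phi> j s"
 using assms
proof (induction j arbitrary: s)
 case (Suc j)
 then have "(step kap t ^^ j) (\<phi> 0) = \<phi> j" by auto
 then show ?case using Suc.prems by (auto intro!: step_eqI)
qed simp

text \<open>In mean, \<open>\<phi>\<close> is controlled by the values of \<open>f\<close> at the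
  current and the last \<open>d\<close> times. The relation is stable under sums and passes to
  smaller functions, so the maximum \<open>V\<close> is handled through the sum of its entries; it
  ends up as the hypothesis \<open>dom\<close> of \<open>drift_iterates\<close>.\<close>

definition delayed :: "nat => nat => ('s => ennreal) => ('s => ennreal) => bool" where
 "delayed d N f \<phi> \<longleftrightarrow> (\<forall>n\<ge>d. \<forall>s. (step kap t ^^ n) \<phi> s <= of_nat N * (\<Sum>i\<le>d. (step kap t ^^ (n - i)) f s))"

lemma delayed_step:
 assumes "i <= d" "!!s. (step kap t ^^ i) \<phi> s <= f s"
 shows "delayed d 1 f \<phi>"
 unfolding delayed_def
proof (intro allI impI)
 fix n s assume "d <= n"
 then have "(step kap t ^^ n) \<phi> s = (step kap t ^^ (n - i)) ((step kap t ^^ i) \<phi>) s"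
  using assms(1) funpow_add[of "n - i" i "step kap t"] by simp
 also have "... <= (step kap t ^^ (n - i)) f s" by (rule step_pow_mono) (rule assms(2))
 also have "... <= (\<Sum>i\<le>d. (step kap t ^^ (n - i)) f s)" using assms(1) by (intro member_le_sum) auto
 finally show "(step kap t ^^ n) \<phi> s <= of_nat 1 * (\<Sum>i\<le>d. (step kap t ^^ (n - i)) f s)" by simp
qed

lemma delayed_mono: "delayed d N f \<phi> ==> (!!s. \<phi>' s <= \<phi> s) ==> delayed d N f \<phi>'"
 unfolding delayed_def by (meson order_trans step_pow_mono)

lemma delayed_add:
 assumes "delayed d N f \<phi>" "delayed d N' f \<phi>'" "\<phi> \<in> bm borel" "\<phi>' \<in> bm borel"
 shows "delayed d (N + N') f (%s. \<phi> s + \<phi>' s)"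
 using assms unfolding delayed_def by (auto simp: step_pow_add distrib_right intro!: add_mono)

lemma delayed_sum:
 assumes "finite A" "!!a. a \<in> A ==> delayed d N f (\<phi> a)" "!!a. a \<in> A ==> \<phi> a \<in> bm borel"
 shows "delayed d (card A * N) f (%s. \<Sum>a\<in>A. \<phi> a s)"
 using assms
proof (induction A rule: finite_induct)
 case empty
 then show ?case by (simp add: delayed_def step_pow_const)
next
 case (insert a A)
 then show ?case using delayed_add[of d N f "\<phi> a" "card A * N" "%s. \<Sum>a\<in>A. \<phi> a s"] by simp
qed

end

lemma upd_fst: "1 <= k ==> k < p ==> fst (upd p q ups \<psi> z y) k = fst z (Suc k)"
 and upd_snd: "1 <= l ==> Suc l < q ==> snd (upd p q ups \<psi> z y) l = snd z (Suc l)"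
 and upd_snd_last: "1 < q ==> snd (upd p q ups \<psi> z y) (q - Suc 0) = ups y"
 by (auto simp: upd_def Let_def)

context od
begin

lemma step_x_coord:
 "k \<in> {1..p} ==> (step G T ^^ (p - k)) (%z. F (fst z k)) z = F (fst z p)"
 using step_pow_coord[of "p - k" "%i z. F (fst z (k + i))" z] by (simp add: upd_fst)

lemma step_u_coord:
 assumes l: "l \<in> {1..<q}" and F: "!!z. (\<integral>\<^sup>+y. F (ups y) \<partial>G z) <= f z"
 shows "(step G T ^^ (q - l)) (%z. F (snd z l)) z <= f z"
proof -
 have "(step G T ^^ (q - 1 - l)) (%z. F (snd z l)) = (%z. F (snd z (q - 1)))"
  using l step_pow_coord[of "q - 1 - l" "%i z. F (snd z (l + i))"] by (auto simp: upd_snd)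
 moreover have "q - l = Suc (q - 1 - l)" using l by auto
 ultimately have "(step G T ^^ (q - l)) (%z. F (snd z l)) z = step G T (%z. F (snd z (q - 1))) z" by simp
 then show ?thesis using F[of z] l by (simp add: step_def upd_snd_last)
qed

lemma step_pow_trunc: "0 < n ==> (step G T ^^ n) f (trunc_vec p q z) = (step G T ^^ n) f z"
 using p1 by (cases n) (simp_all add: step_def upd_trunc_vec, simp add: trunc_vec_def)

lemma x_fun_measurable: "F \<in> bm borel ==> (%z::('x, 'u) vec2. F (fst z k)) \<in> bm borel"
 and u_fun_measurable: "F' \<in> bm borel ==> (%z::('x, 'u) vec2. F' (snd z k)) \<in> bm borel"
 by (rule mcomp[OF vec2_coord_measurable(1)] mcomp[OF vec2_coord_measurable(2)]; assumption)+

lemma V_Z_measurable: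
 fixes VX :: "'x => real" and VU :: "'u => real"
 assumes [measurable]: "VX \<in> bm borel" "VU \<in> bm borel"
 shows "V_Z p q VX VU c \<in> bm borel"
proof -
 have "V_Z p q VX VU c = (%z. Max ((%i. (case i of Inl k => ennreal (VX (fst z k)) | Inr l => ennreal (VU (snd z l)) / c)) ` ({1..p} <+> {1..<q})))"
  unfolding V_Z_def Plus_def image_Un image_image by simp
 also have "... \<in> bm borel"
 proof (rule borel_measurable_Max)
  show "(%z::('x, 'u) vec2. case i of Inl k => ennreal (VX (fst z k)) | Inr l => ennreal (VU (snd z l)) / c) \<in> bm borel" for i
   using x_fun_measurable[of "%x. ennreal (VX x)"] u_fun_measurable[of "%x. ennreal (VU x) / c"] by (cases i) auto
 qed simp
 finally show ?thesis .
qed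

lemma V_Z_ge: "k \<in> {1..p} ==> ennreal (VX (fst z k)) <= V_Z p q VX VU c z"
 unfolding V_Z_def by (rule Max_ge) auto

lemma V_Z_le_sum: "V_Z p q VX VU c z <= (\<Sum>k=1..p. ennreal (VX (fst z k))) + (\<Sum>l\<in>{1..<q}. ennreal (VU (snd z l)) / c)"
proof -
 have "ennreal (VX (fst z k)) <= (\<Sum>k=1..p. ennreal (VX (fst z k))) + (\<Sum>l\<in>{1..<q}. ennreal (VU (snd z l)) / c)" if "k \<in> {1..p}" for k
  using member_le_sum[of k "{1..p}" "%k. ennreal (VX (fst z k))"] that by (simp add: add_increasing2)
 moreover have "ennreal (VU (snd z l)) / c <= (\<Sum>k=1..p. ennreal (VX (fst z k))) + (\<Sum>l\<in>{1..<q}. ennreal (VU (snd z l)) / c)" if "l \<in> {1..<q}" for l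
  using member_le_sum[of l "{1..<q}" "%l. ennreal (VU (snd z l)) / c"] that by (simp add: add_increasing)
 ultimately show ?thesis unfolding V_Z_def using p1 by (subst Max_le_iff) auto
qed

lemma V_Z_trunc: "V_Z p q VX VU c (trunc_vec p q z) = V_Z p q VX VU c z"
 unfolding V_Z_def trunc_vec_def by (intro arg_cong[of _ _ Max] arg_cong2[of _ _ _ _ "(\<union>)"] image_cong) auto

text \<open>A stored state was the current one at most \<open>p - 1\<close> steps before, and the
  normalised weight of a stored input has conditional mean at most \<open>VX\<close> of the state
  that produced it. So \<open>V\<close> is delayed with respect to a function of the current state
  alone.\<close>

lemma drift_A6:
 assumes A6: "cond_A6 p q \<nu> TY ups \<psi> g VX"
 shows "\<exists>VU c m b C. VU \<in> bm borel & (\<forall>x. (\<integral>\<^sup>+y. ennreal (VU (ups y)) / c \<partial>dkernel \<nu> g x) <= ennreal (VX x)) &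
  0 < m & 0 <= (b::real) & 0 <= (C::real) &
  (\<forall>z. (step G T ^^ m) (V_Z p q VX VU c) z <= ennreal (1/2) * V_Z p q VX VU c z + ennreal b) &
  (\<forall>n\<ge>m. \<forall>z. (step G T ^^ n) (%z. ennreal (VX (fst z p))) z <= ennreal C * (1 + V_Z p q VX VU c z))"
proof -
 obtain VU L c where VX[measurable]: "VX \<in> bm borel" and VU[measurable]: "VU \<in> bm borel"
  and c: "c = rel_sup (%x. \<integral>\<^sup>+y. ennreal (VU (ups y)) \<partial>dkernel \<nu> g x) VX" "c < \<infinity>"
  and lim: "\<forall>n. ((%M::real. SUP z\<in>space (Zsp p q).
           expect_from p q \<nu> ups \<psi> g (return (Zsp p q) z) VX n /
           (ennreal M + V_Z p q VX VU c z)) \<longlongrightarrow> L n) at_top" and L: "L \<longlonglongrightarrow> 0"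
  using A6 unfolding cond_A6_def Let_def by blast
 let ?V = "V_Z p q VX VU c" and ?v = "%z::('x, 'u) vec2. ennreal (VX (fst z p))"
 have upsm[measurable]: "ups \<in> \<nu> \<rightarrow>\<^sub>M borel" using model by (simp add: od_model_def)
 have Um: "(%y. ennreal (VU (ups y))) \<in> bm (dkernel \<nu> g x)" for x
 proof -
  have "(%y. ennreal (VU (ups y))) \<in> bm \<nu>" by measurable
  then show ?thesis by (simp add: dkernel_def)
 qed
 have U: "(\<integral>\<^sup>+y. ennreal (VU (ups y)) / c \<partial>dkernel \<nu> g x) <= ennreal (VX x)" for x
  using rel_sup_divide_le[of "%x. \<integral>\<^sup>+y. ennreal (VU (ups y)) \<partial>dkernel \<nu> g x" VX x] c
  by (simp add: nn_integral_divide[OF Um])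
 have vm[measurable]: "?v \<in> bm borel" by (rule mcomp[OF vec2_coord_measurable(1)]) measurable
 have xm: "(%z::('x, 'u) vec2. ennreal (VX (fst z k))) \<in> bm borel" for k
  by (rule mcomp[OF vec2_coord_measurable(1)]) measurable
 have um: "(%z::('x, 'u) vec2. ennreal (VU (snd z l)) / c) \<in> bm borel" for l
  by (rule mcomp[OF vec2_coord_measurable(2)]) measurable
 have dx: "delayed (p + q) 1 ?v (%z. ennreal (VX (fst z k)))" if "k \<in> {1..p}" for k
  by (rule delayed_step[where i="p - k"]) (use step_x_coord[OF that, of "%x. ennreal (VX x)"] in auto)
 have du: "delayed (p + q) 1 ?v (%z. ennreal (VU (snd z l)) / c)" if "l \<in> {1..<q}" for l
  by (rule delayed_step[where i="q - l"]) (use step_u_coord[OF that, of "%u. ennreal (VU u) / c" ?v] U in auto)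
 have "delayed (p + q) (card {1..p} * 1 + card {1..<q} * 1) ?v ?V"
  by (rule delayed_mono[OF delayed_add V_Z_le_sum])
   (rule delayed_sum borel_measurable_sum finite_atLeastAtMost finite_atLeastLessThan dx du xm um; assumption?)+
 note dom = this[unfolded delayed_def, rule_format]
 have lim': "\<exists>n0. \<forall>n\<ge>n0. \<exists>M::real\<ge>0. \<forall>z. (step G T ^^ n) ?v z <= ennreal eps * (ennreal M + ?V z)" if "0 < eps" for eps :: real
 proof -
  obtain n0 where n0: "\<forall>n\<ge>n0. \<exists>M::real\<ge>0. \<forall>z\<in>space (Zsp p q). expect_from p q \<nu> ups \<psi> g (return (Zsp p q) z) VX n <= ennreal eps * (ennreal M + ?V z)"
   using ratio_limit[OF lim L \<open>0 < eps\<close>] by blast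
  \<comment> \<open>At least one step is taken, so that \<open>step_pow_trunc\<close> extends the
    bound from extensional vectors to all \<open>z\<close>.\<close>
  have "\<exists>M::real\<ge>0. \<forall>z. (step G T ^^ n) ?v z <= ennreal eps * (ennreal M + ?V z)" if n: "Suc n0 <= n" for n
  proof -
   obtain M :: real where M: "0 <= M" "!!z. z \<in> space (Zsp p q) ==> expect_from p q \<nu> ups \<psi> g (return (Zsp p q) z) VX n <= ennreal eps * (ennreal M + ?V z)"
    using n0[rule_format, OF Suc_leD[OF n]] by blast
   have "(step G T ^^ n) ?v z <= ennreal eps * (ennreal M + ?V z)" for z
   proof -
    let ?z = "trunc_vec p q z"
    have z: "?z \<in> space (Zsp p q)" by (simp add: trunc_vec_def space_Zsp)
    have "expect_from p q \<nu> ups \<psi> g (return (Zsp p q) ?z) VX n = (\<integral>\<^sup>+z. (step G T ^^ n) ?v z \<partial>return (Zsp p q) ?z)"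
     by (rule expect_from_eq) (auto simp: space_prob_algebra prob_space_return z)
    also have "... = (step G T ^^ n) ?v ?z"
    proof (rule nn_integral_return[OF z])
     show "(step G T ^^ n) ?v \<in> bm (Zsp p q)"
      by (rule mcomp[OF Zsp_into_borel, of "(step G T ^^ n) ?v", simplified]) measurable
    qed
    also have "... = (step G T ^^ n) ?v z" using n by (intro step_pow_trunc) auto
    finally show ?thesis using M(2)[OF z] by (simp add: V_Z_trunc)
   qed
   then show ?thesis using M(1) by blast
  qed
  then show ?thesis by blast
 qed
 obtain m b C where "0 < m" "0 <= (b::real)" "\<forall>z. (step G T ^^ m) ?V z <= ennreal (1/2) * ?V z + ennreal b"
  "0 <= (C::real)" "\<forall>n\<ge>m. \<forall>z. (step G T ^^ n) ?v z <= ennreal C * (1 + ?V z)"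
  using drift_iterates[OF vm V_Z_measurable[OF VX VU, of c] lim' dom] by blast
 then show ?thesis using VU U by (intro exI[of _ VU] exI[of _ c] exI[of _ m] exI[of _ b] exI[of _ C]) auto
qed

end

lemma epow_1: "epow a 1 = a" by (cases a) (auto simp: epow_def)

lemma eln_leD:
 assumes "eln s <= ereal r" shows "s <= ennreal (exp r)"
proof (cases s)
 case (real x)
 then show ?thesis
 proof (cases "x = 0")
  case False
  then have x: "0 < x" using real by simp
  then have "ln x <= r" using assms real by (simp add: eln_def)
  then have "x <= exp r" using x by (metis exp_le_cancel_iff exp_ln)
  then show ?thesis using real by (simp add: ennreal_leI)
 qed simp
qed (use assms in \<open>simp add: eln_def\<close>)

section \<open>Moments of the coupled chain\<close>

context od_A8
begin

abbreviation WXp :: "('x, 'u) vec4 => ennreal" where "WXp v \<equiv> ennreal (WX (pairp v))"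

text \<open>The index set no longer depends on \<open>v\<close>, so measurability of finite maxima
  applies.\<close>

lemma W_Z_eq:
 fixes WU :: "'u => real"
 shows "W_Z p q WX WU c = (%v. Max ((%i. (case i of Inl k => ennreal (WX (fst (fst v) k, fst (snd v) k))
  | Inr (b, l) => ennreal (WU (snd (if b then fst v else snd v) l)) / c)) ` ({1..p} <+> (UNIV \<times> {1..<q}))))"
proof -
 have "(%(zt, l). ennreal (WU (snd zt l)) / c) ` ({z, z'} \<times> {1..<q}) = (%(b, l). ennreal (WU (snd (if b then z else z') l)) / c) ` (UNIV \<times> {1..<q})" for z z' :: "('x, 'u) vec2"
 proof -
  have *: "{z, z'} \<times> {1..<q} = (%i. (if fst i then z else z', snd i)) ` (UNIV \<times> {1..<q})"
   by (auto simp: UNIV_bool image_Un insert_Times_insert image_iff)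
  show ?thesis unfolding * image_image by (simp only: case_prod_unfold fst_conv snd_conv)
 qed
 note * = this
 show ?thesis
  unfolding W_Z_def Plus_def image_Un image_image * by (simp only: case_prod_unfold sum.case)
qed

lemma pair_coord_measurable: "(%v::('x, 'u) vec4. ennreal (WX (fst (fst v) k, fst (snd v) k))) \<in> bm borel"
 by measurable

lemma W_Z_measurable:
 fixes WU :: "'u => real"
 assumes WU[measurable]: "WU \<in> bm borel" shows "W_Z p q WX WU c \<in> bm borel"
 unfolding W_Z_eq
proof (rule borel_measurable_Max)
 have "(%v::('x, 'u) vec4. ennreal (WU (snd (if b then fst v else snd v) l)) / c) \<in> bm borel" for b l
  by (cases b; simp; measurable)
 then show "(%v::('x, 'u) vec4. case i of Inl k => ennreal (WX (fst (fst v) k, fst (snd v) k))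
  | Inr (b, l) => ennreal (WU (snd (if b then fst v else snd v) l)) / c) \<in> bm borel" for i :: "nat + bool \<times> nat"
  using pair_coord_measurable by (cases i) (simp_all add: case_prod_unfold)
qed simp

lemma W_Z_ge_1:
 fixes WU :: "'u => real"
 shows "1 <= W_Z p q WX WU c v"
proof -
 have "1 <= ennreal (WX (pairp v))" using ennreal_leI[OF WX1, of "pairp v"] by simp
 also have "... <= W_Z p q WX WU c v" unfolding W_Z_def pairp_def case_prod_unfold using p1 by (intro Max_ge) auto
 finally show ?thesis .
qed

lemma W_Z_le_iff:
 fixes WU :: "'u => real"
 shows "W_Z p q WX WU c v <= K \<longleftrightarrow> (\<forall>k\<in>{1..p}. ennreal (WX (fst (fst v) k, fst (snd v) k)) <= K)
  & (\<forall>l\<in>{1..<q}. ennreal (WU (snd (fst v) l)) / c <= K & ennreal (WU (snd (snd v) l)) / c <= K)"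
 unfolding W_Z_def case_prod_unfold using p1 by (subst Max_le_iff) (auto simp: ball_Un)

lemma W_Z_le_sum:
 fixes WU :: "'u => real"
 shows "W_Z p q WX WU c v <= (\<Sum>k=1..p. ennreal (WX (fst (fst v) k, fst (snd v) k)))
  + ((\<Sum>l\<in>{1..<q}. ennreal (WU (snd (fst v) l)) / c) + (\<Sum>l\<in>{1..<q}. ennreal (WU (snd (snd v) l)) / c))" (is "_ <= ?A + (?B + ?C)")
proof -
 have "ennreal (WX (fst (fst v) k, fst (snd v) k)) <= ?A" if "k \<in> {1..p}" for k
  using member_le_sum[of k "{1..p}" "%k. ennreal (WX (fst (fst v) k, fst (snd v) k))"] that by simp
 moreover have "ennreal (WU (snd (fst v) l)) / c <= ?B" "ennreal (WU (snd (snd v) l)) / c <= ?C" if "l \<in> {1..<q}" for l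
  using member_le_sum[of l "{1..<q}" "%l. ennreal (WU (snd (fst v) l)) / c"]
   member_le_sum[of l "{1..<q}" "%l. ennreal (WU (snd (snd v) l)) / c"] that by simp_all
 ultimately show ?thesis unfolding W_Z_le_iff
  by (intro conjI ballI)
   (blast intro: add_increasing[OF zero_le] add_increasing2[OF zero_le])+
qed

lemma W_Z_trunc:
 fixes WU :: "'u => real"
 shows "W_Z p q WX WU c (trunc_vec p q z, trunc_vec p q z') = W_Z p q WX WU c (z, z')"
 unfolding W_Z_eq trunc_vec_def by (intro arg_cong[of _ _ Max] image_cong) (auto split: sum.split)

lemma Q_pow_trunc: "0 < n ==> (Q ^^ n) F (trunc_vec p q z, trunc_vec p q z') = (Q ^^ n) F (z, z')"
 using p1 by (cases n) (simp_all add: step_def upd2_def upd_trunc_vec, simp add: trunc_vec_def)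

lemma Q_x_coord: "k \<in> {1..p} ==> (Q ^^ (p - k)) (%v. F (fst (fst v) k, fst (snd v) k)) v = F (pairp v)"
 using C.step_pow_coord[of "p - k" "%i v. F (fst (fst v) (k + i), fst (snd v) (k + i))" v] by (simp add: upd_fst upd2_def pairp_def)

lemma Q_u_coord:
 assumes l: "l \<in> {1..<q}" and F: "!!v. (\<integral>\<^sup>+y. F (ups y) \<partial>H v) <= f v"
 shows "(Q ^^ (q - l)) (%v. F (snd (fst v) l)) v <= f v" and "(Q ^^ (q - l)) (%v. F (snd (snd v) l)) v <= f v"
proof -
 have "(Q ^^ (q - 1 - l)) (%v. F (snd (fst v) l)) = (%v. F (snd (fst v) (q - 1)))"
  using l C.step_pow_coord[of "q - 1 - l" "%i v. F (snd (fst v) (l + i))"] by (auto simp: upd_snd upd2_def)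
 moreover have "(Q ^^ (q - 1 - l)) (%v. F (snd (snd v) l)) = (%v. F (snd (snd v) (q - 1)))"
  using l C.step_pow_coord[of "q - 1 - l" "%i v. F (snd (snd v) (l + i))"] by (auto simp: upd_snd upd2_def)
 moreover have "q - l = Suc (q - 1 - l)" using l by auto
 ultimately have "(Q ^^ (q - l)) (%v. F (snd (fst v) l)) v = Q (%v. F (snd (fst v) (q - 1))) v"
  "(Q ^^ (q - l)) (%v. F (snd (snd v) l)) v = Q (%v. F (snd (snd v) (q - 1))) v" by simp_all
 then show "(Q ^^ (q - l)) (%v. F (snd (fst v) l)) v <= f v" "(Q ^^ (q - l)) (%v. F (snd (snd v) l)) v <= f v"
  using F[of v] l by (simp_all add: step_def upd_snd_last upd2_def)
qed

text \<open>Both alternatives of (A-8) give a moment bound whose growth rate is beaten by the contraction rate \<open>\<rho>\<close>.\<close>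

lemma moment_A8:
 fixes \<rho> :: real and WU :: "'u => real"
 assumes WU[measurable]: "WU \<in> bm borel"
  and U: "!!w. (\<integral>\<^sup>+y. ennreal (WU (ups y)) / c \<partial>dkernel \<nu> h w) <= ennreal (WX w)"
  and alt: "(\<exists>l\<le>0. ((%\<zeta>::real. limsup (%n. ereal (1 / real n) *
            eln (SUP v\<in>space (Zsp p q) \<times> space (Zsp p q). coupled_expect p q \<nu> ups \<psi> h v WX n / epow (W_Z p q WX WU c v) \<zeta>))) \<longlongrightarrow> l) at_top) \<or>
       (\<exists>L. (\<forall>n. ((%M::real. SUP v\<in>space (Zsp p q) \<times> space (Zsp p q). coupled_expect p q \<nu> ups \<psi> h v WX n / (ennreal M + W_Z p q WX WU c v)) \<longlongrightarrow> L n) at_top) & L \<longlonglongrightarrow> 0)"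
  and \<rho>: "0 < \<rho>" "\<rho> < 1"
 shows "\<exists>C a \<zeta> n0. 0 <= C & 0 < a & a * \<rho> < 1 & 0 < \<zeta> &
  (\<forall>n\<ge>n0. \<forall>v. (Q ^^ n) WXp v <= ennreal (C * a ^ n) * epow (W_Z p q WX WU c v) \<zeta>)"
proof -
 let ?W = "W_Z p q WX WU c" and ?Z = "space (Zsp p q) \<times> space (Zsp p q) :: (('x, 'u) vec4) set"
 let ?E = "%v n. coupled_expect p q \<nu> ups \<psi> h v WX n"
 have E: "?E v n = (Q ^^ n) WXp v" if "v \<in> ?Z" for v n
  using coupled_expect_eq[OF that WX_measurable] by (simp add: pairp_def)
 \<comment> \<open>A step maps truncated and untruncated pairs to the same pair of states, so a
   bound on extensional pairs extends to all pairs once \<open>n\<close> is positive.\<close>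
 have ext: "(Q ^^ n) WXp v <= F (?W v)" if "!!v. v \<in> ?Z ==> ?E v n <= F (?W v)" "0 < n" for F :: "ennreal => ennreal" and n v
 proof -
  obtain z z' where v: "v = (z, z')" by (cases v)
  have "(trunc_vec p q z, trunc_vec p q z') \<in> ?Z" by (simp add: trunc_vec_def space_Zsp)
  from that(1)[OF this] E[OF this] show ?thesis by (simp add: v Q_pow_trunc[OF that(2)] W_Z_trunc)
 qed
 from alt show ?thesis
 proof
  assume "\<exists>l\<le>0. ((%\<zeta>::real. limsup (%n. ereal (1 / real n) * eln (SUP v\<in>?Z. ?E v n / epow (?W v) \<zeta>))) \<longlongrightarrow> l) at_top"
  then obtain l where l: "l <= 0" "((%\<zeta>::real. limsup (%n. ereal (1 / real n) * eln (SUP v\<in>?Z. ?E v n / epow (?W v) \<zeta>))) \<longlongrightarrow> l) at_top" by blast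
  \<comment> \<open>The rate \<open>exp eps\<close> is the inverse square root of
    \<open>\<rho>\<close>, so that its product with \<open>\<rho>\<close> is still below 1.\<close>
  define eps where "eps = - ln \<rho> / 2"
  have eps: "0 < eps" using \<rho> by (simp add: eps_def)
  have "exp eps * \<rho> = exp (eps + ln \<rho>)" using \<rho> by (simp add: exp_add)
  also have "... < 1" using \<rho> by (simp add: eps_def)
  finally have a: "exp eps * \<rho> < 1" .
  have "l < ereal eps" using le_less_trans[OF l(1), of "ereal eps"] eps by simp
  from order_tendstoD(2)[OF l(2) this]
  have "\<forall>\<^sub>F \<zeta> in at_top. limsup (%n. ereal (1 / real n) * eln (SUP v\<in>?Z. ?E v n / epow (?W v) \<zeta>)) < ereal eps & 1 <= \<zeta>"
   using eventually_ge_at_top[of 1] by eventually_elim auto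
  then obtain \<zeta> where \<zeta>: "limsup (%n. ereal (1 / real n) * eln (SUP v\<in>?Z. ?E v n / epow (?W v) \<zeta>)) < ereal eps" "1 <= \<zeta>"
   using eventually_happens'[OF trivial_limit_at_top_linorder] by blast
  have "\<forall>\<^sub>F n in sequentially. ereal (1 / real n) * eln (SUP v\<in>?Z. ?E v n / epow (?W v) \<zeta>) < ereal eps"
   by (rule Limsup_le_iff[THEN iffD1, OF order_refl, rule_format, OF \<zeta>(1)])
  then obtain n1 where n1: "!!n. n1 <= n ==> ereal (1 / real n) * eln (SUP v\<in>?Z. ?E v n / epow (?W v) \<zeta>) < ereal eps"
   by (auto simp: eventually_sequentially)
  have "(Q ^^ n) WXp v <= ennreal (1 * exp eps ^ n) * epow (?W v) \<zeta>" if n: "Suc n1 <= n" for n v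
  proof (rule ext[of n "%w. ennreal (1 * exp eps ^ n) * epow w \<zeta>"])
   fix v assume v: "v \<in> ?Z"
   let ?s = "SUP v\<in>?Z. ?E v n / epow (?W v) \<zeta>"
   have "eln ?s <= ereal (eps * real n)"
   proof (cases "eln ?s")
    case (real r)
    have n0: "0 < real n" using n by simp
    have "1 / real n * r < eps" using n1[of n] n real by simp
    then show ?thesis using n0 by (simp add: real field_simps)
   next
    case PInf
    then show ?thesis using n1[of n] n by (simp add: zero_less_divide_iff split: if_splits)
   qed simp
   then have "?s <= ennreal (exp (eps * real n))" by (rule eln_leD)
   then have "?E v n / epow (?W v) \<zeta> <= ennreal (exp (eps * real n))"
    using SUP_upper[OF v, of "%v. ?E v n / epow (?W v) \<zeta>"] by (rule order_trans[rotated])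
   then have "?E v n <= ennreal (exp (eps * real n)) * epow (?W v) \<zeta>"
    by (rule ennreal_le_mult_of_divide_le) auto
   then show "?E v n <= ennreal (1 * exp eps ^ n) * epow (?W v) \<zeta>"
    by (simp add: exp_of_nat2_mult)
  qed (use n in simp)
  then show ?thesis using a \<zeta>(2) by (intro exI[of _ 1] exI[of _ "exp eps"] exI[of _ \<zeta>] exI[of _ "Suc n1"]) auto
 next
  assume "\<exists>L. (\<forall>n. ((%M::real. SUP v\<in>?Z. ?E v n / (ennreal M + ?W v)) \<longlongrightarrow> L n) at_top) & L \<longlonglongrightarrow> 0"
  then obtain L where L: "\<forall>n. ((%M::real. SUP v\<in>?Z. ?E v n / (ennreal M + ?W v)) \<longlongrightarrow> L n) at_top" "L \<longlonglongrightarrow> 0" by blast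
  have lim: "\<exists>n0. \<forall>n\<ge>n0. \<exists>M::real\<ge>0. \<forall>v. (Q ^^ n) WXp v <= ennreal eps * (ennreal M + ?W v)" if "0 < eps" for eps :: real
  proof -
   obtain n0 where n0: "\<forall>n\<ge>n0. \<exists>M::real\<ge>0. \<forall>v\<in>?Z. ?E v n <= ennreal eps * (ennreal M + ?W v)"
    using ratio_limit[OF L \<open>0 < eps\<close>] by blast
   have "\<exists>M::real\<ge>0. \<forall>v. (Q ^^ n) WXp v <= ennreal eps * (ennreal M + ?W v)" if n: "Suc n0 <= n" for n
   proof -
    obtain M :: real where M: "0 <= M" "!!v. v \<in> ?Z ==> ?E v n <= ennreal eps * (ennreal M + ?W v)" using n0[rule_format, OF Suc_leD[OF n]] by blast
    then have "(Q ^^ n) WXp v <= ennreal eps * (ennreal M + ?W v)" for v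
     using ext[of n "%w. ennreal eps * (ennreal M + w)" v] n by simp
    then show ?thesis using M(1) by blast
   qed
   then show ?thesis by blast
  qed
  have wm[measurable]: "WXp \<in> bm borel" by measurable
  have um: "(%v::('x, 'u) vec4. ennreal (WU (snd (fst v) l)) / c) \<in> bm borel"
   "(%v::('x, 'u) vec4. ennreal (WU (snd (snd v) l)) / c) \<in> bm borel" for l
   by measurable
  have dx: "C.delayed (p + q) 1 WXp (%v. ennreal (WX (fst (fst v) k, fst (snd v) k)))" if "k \<in> {1..p}" for k
   by (rule C.delayed_step[where i="p - k"]) (use Q_x_coord[OF that, of "%x. ennreal (WX x)"] in auto)
  have U': "(\<integral>\<^sup>+y. ennreal (WU (ups y)) / c \<partial>H v) <= WXp v" for v using U by (simp add: pairp_def)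
  have du: "C.delayed (p + q) 1 WXp (%v. ennreal (WU (snd (fst v) l)) / c)" "C.delayed (p + q) 1 WXp (%v. ennreal (WU (snd (snd v) l)) / c)"
   if "l \<in> {1..<q}" for l
   by (rule C.delayed_step[where i="q - l"]; use Q_u_coord[OF that, of "%u. ennreal (WU u) / c" WXp] U' in auto)+
  let ?A = "%v::('x, 'u) vec4. \<Sum>k=1..p. ennreal (WX (fst (fst v) k, fst (snd v) k))"
  let ?B = "%v::('x, 'u) vec4. \<Sum>l\<in>{1..<q}. ennreal (WU (snd (fst v) l)) / c"
  let ?C = "%v::('x, 'u) vec4. \<Sum>l\<in>{1..<q}. ennreal (WU (snd (snd v) l)) / c"
  have A: "C.delayed (p + q) (card {1..p} * 1) WXp ?A" "?A \<in> bm borel"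
   by (rule C.delayed_sum borel_measurable_sum finite_atLeastAtMost dx pair_coord_measurable; assumption?)+
  have B: "C.delayed (p + q) (card {1..<q} * 1) WXp ?B" "?B \<in> bm borel"
   by (rule C.delayed_sum borel_measurable_sum finite_atLeastLessThan du um; assumption?)+
  have C: "C.delayed (p + q) (card {1..<q} * 1) WXp ?C" "?C \<in> bm borel"
   by (rule C.delayed_sum borel_measurable_sum finite_atLeastLessThan du um; assumption?)+
  have "C.delayed (p + q) (card {1..p} * 1 + (card {1..<q} * 1 + card {1..<q} * 1)) WXp ?W"
   by (rule C.delayed_mono[OF C.delayed_add[OF A(1) C.delayed_add[OF B(1) C(1) B(2) C(2)] A(2) borel_measurable_add[OF B(2) C(2)]]])
    (rule W_Z_le_sum)
  note dom = this[unfolded C.delayed_def, rule_format]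
  have "\<exists>m b. 0 < m & 0 <= (b::real) & (\<forall>v. (Q ^^ m) ?W v <= ennreal (1/2) * ?W v + ennreal b)
   & (\<exists>C::real\<ge>0. \<forall>n\<ge>m. \<forall>v. (Q ^^ n) WXp v <= ennreal C * (1 + ?W v))"
   by (rule C.drift_iterates[OF wm W_Z_measurable[OF WU, of c] lim dom])
  then obtain m C where C: "0 <= (C::real)" "\<forall>n\<ge>m. \<forall>v. (Q ^^ n) WXp v <= ennreal C * (1 + ?W v)"
   by (elim exE conjE) (rule that)
  \<comment> \<open>Here the moments do not grow at all, so \<open>a = 1\<close> and
    \<open>\<zeta> = 1\<close> serve; the summand 1 is absorbed by \<open>W \<ge> 1\<close>.\<close>
  have "(Q ^^ n) WXp v <= ennreal (2 * C * 1 ^ n) * epow (?W v) 1" if "m <= n" for n v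
  proof -
   have "(Q ^^ n) WXp v <= ennreal C * (1 + ?W v)" by (rule C(2)[rule_format, OF that])
   also have "... <= ennreal C * (?W v + ?W v)" by (intro mult_left_mono add_right_mono W_Z_ge_1) auto
   also have "... = (ennreal C + ennreal C) * ?W v" by (simp only: distrib_left distrib_right)
   also have "ennreal C + ennreal C = ennreal (2 * C)" by (simp only: mult_2 ennreal_plus[OF C(1) C(1)])
   finally show ?thesis by (simp add: epow_1)
  qed
  then show ?thesis using C(1) \<rho> by (intro exI[of _ "2 * C"] exI[of _ 1] exI[of _ m]) auto
 qed
qed

end

section \<open>Continuity of the failure probability at the diagonal\<close>

lemma ennreal_tendsto_0I:
 fixes a :: "'a => ennreal"
 assumes "!!eps::real. 0 < eps ==> \<forall>\<^sub>F i in F. a i <= ennreal eps"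
 shows "(a \<longlongrightarrow> 0) F"
proof (rule order_tendstoI)
 fix c :: ennreal assume "0 < c"
 then obtain e where e: "0 < e" "e < c" using dense by blast
 then have "e < top" using less_le_trans[OF e(2) top_greatest] by simp
 then have "e = ennreal (enn2real e)" "0 < enn2real e" using e(1) by (simp_all add: enn2real_positive_iff)
 then have "\<forall>\<^sub>F i in F. a i <= e" using assms[of "enn2real e"] by simp
 then show "\<forall>\<^sub>F i in F. a i < c" by eventually_elim (use e in auto)
qed simp

lemma epow_mono: "a <= b ==> 0 < t ==> epow a t <= epow b t"
 by (cases a; cases b) (auto simp: epow_def top_unique intro!: ennreal_leI powr_mono2)

lemma epow_finite: "a < \<infinity> ==> epow a t < \<infinity>"
 by (simp add: epow_def)

lemma suminf_split_le:
 fixes f :: "nat => ennreal"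
 shows "(\<Sum>k. f k) <= (\<Sum>k<N. f k) + (\<Sum>k. f (N + k))"
proof (rule suminf_le_const[OF summableI])
 fix n
 have "(\<Sum>k<n. f k) <= (\<Sum>k<N + n. f k)" by (intro sum_mono2) auto
 also have "... = (\<Sum>k<N. f k) + (\<Sum>k<n. f (N + k))" by (induction n) (auto simp: add.assoc)
 also have "... <= (\<Sum>k<N. f k) + (\<Sum>k. f (N + k))" by (intro add_left_mono sum_le_suminf) auto
 finally show "(\<Sum>k<n. f k) <= (\<Sum>k<N. f k) + (\<Sum>k. f (N + k))" .
qed

text \<open>The consequences of (A-6) to (A-8), with all constants fixed. The moment bound alone is
  kept for every \<open>\<rho>\<close>, because its constants have to be chosen after the
  contraction rate.\<close>

locale od_stable = od_A8 p q \<nu> ups \<psi> g h \<alpha> WX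
 for p q :: nat and \<nu> :: "'y measure" and ups :: "'y => 'u::polish_space"
  and \<psi> :: "('x::polish_space, 'u) upd" and g :: "'x => 'y => real" and h :: "'x \<times> 'x => 'y => real"
  and \<alpha> WX :: "'x \<times> 'x => real" +
 fixes WU :: "'u => real" and cW :: ennreal and VX :: "'x => real" and VU :: "'u => real" and cV :: ennreal
  and m :: nat and b C :: real
 assumes WU_measurable[measurable]: "WU \<in> bm borel"
  and WU_bound: "!!w. (\<integral>\<^sup>+y. ennreal (WU (ups y)) / cW \<partial>dkernel \<nu> h w) <= ennreal (WX w)"
  and moment: "!!\<rho>::real. 0 < \<rho> ==> \<rho> < 1 ==> \<exists>C a \<zeta> n0. 0 <= C & 0 < a & a * \<rho> < 1 & 0 < \<zeta> &
   (\<forall>n\<ge>n0. \<forall>v. (Q ^^ n) WXp v <= ennreal (C * a ^ n) * epow (W_Z p q WX WU cW v) \<zeta>)"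
  and VX_measurable[measurable]: "VX \<in> bm borel"
  and VU_measurable[measurable]: "VU \<in> bm borel"
  and VX_compact: "!!M. 0 < M ==> compact {x. VX x <= M}"
  and VU_bound: "!!x. (\<integral>\<^sup>+y. ennreal (VU (ups y)) / cV \<partial>dkernel \<nu> g x) <= ennreal (VX x)"
  and mbC: "0 < m" "0 <= b" "0 <= C"
  and drift: "!!z. (R ^^ m) (V_Z p q VX VU cV) z <= ennreal (1/2) * V_Z p q VX VU cV z + ennreal b"
  and VX_moment: "!!n z. m <= n ==> (R ^^ n) (%z. ennreal (VX (fst z p))) z <= ennreal C * (1 + V_Z p q VX VU cV z)"
  and g_pos: "!!x y. y \<in> space \<nu> ==> 0 < g x y"
begin

abbreviation V :: "('x, 'u) vec2 => ennreal" where "V \<equiv> V_Z p q VX VU cV"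
abbreviation W :: "('x, 'u) vec4 => ennreal" where "W \<equiv> W_Z p q WX WU cW"

lemma ups_measurable[measurable]: "ups \<in> \<nu> \<rightarrow>\<^sub>M borel" using model by (simp add: od_model_def)

lemma borel_dkernel: "bm (dkernel \<nu> f w) = bm \<nu>"
 by (rule mcong) simp_all

text \<open>The weight is integrable under \<open>h (x, x)\<close>, and on the diagonal (A-8)(iii)
  gives \<open>\<alpha> (x, x) = 1\<close>, so that null sets of \<open>h (x, x)\<close> are null
  under the observation law at \<open>x\<close>.\<close>

lemma WU_finite: "AE y in dkernel \<nu> g x. ennreal (WU (ups y)) / cW ~= top"
proof -
 let ?u = "%y. ennreal (WU (ups y)) / cW"
 let ?N = "{y \<in> space \<nu>. ?u y = top}"
 have um[measurable]: "?u \<in> bm \<nu>" by measurable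
 have Nm[measurable]: "?N \<in> sets \<nu>" by measurable
 have "(\<integral>\<^sup>+y. ?u y \<partial>dkernel \<nu> h (x, x)) ~= top" using WU_bound[of "(x, x)"] by (auto simp: top_unique)
 then have "AE y in dkernel \<nu> h (x, x). ?u y ~= top"
  using nn_integral_PInf_AE[of ?u "dkernel \<nu> h (x, x)"] um by (simp add: borel_dkernel)
 then have "AE y in dkernel \<nu> h (x, x). indicator ?N y = (0::ennreal)" by eventually_elim (simp add: indicator_def)
 then have h0: "(\<integral>\<^sup>+y. indicator ?N y \<partial>dkernel \<nu> h (x, x)) = 0"
  using nn_integral_0_iff_AE[of "indicator ?N :: 'y => ennreal" "dkernel \<nu> h (x, x)"] by (simp add: borel_dkernel)
 have a: "1 - \<alpha> (x, x) <= 0" using \<alpha>_WX[of x x] by simp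
 have "(\<integral>\<^sup>+y. indicator ?N y \<partial>dkernel \<nu> g x) <= (\<integral>\<^sup>+y. 0 \<partial>dkernel \<nu> g x) + ennreal (1 - \<alpha> (x, x))
   + ennreal (\<alpha> (x, x)) * (\<integral>\<^sup>+y. indicator ?N y - 0 \<partial>dkernel \<nu> h (x, x))"
  by (rule alpha_coupling) (auto simp: indicator_def)
 also have "... = 0" using a by (simp add: h0 ennreal_neg del: nn_integral_indicator)
 finally have "(\<integral>\<^sup>+y. indicator ?N y \<partial>dkernel \<nu> g x) = 0" by simp
 then have "AE y in dkernel \<nu> g x. indicator ?N y = (0::ennreal)"
  using nn_integral_0_iff_AE[of "indicator ?N :: 'y => ennreal" "dkernel \<nu> g x"] by (simp add: borel_dkernel)
 then show ?thesis using AE_space by eventually_elim (auto simp: indicator_def split: if_splits)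
qed

text \<open>Finiteness is not automatic, since the weight of an input is infinite if \<open>cW = 0 < WU u\<close>.\<close>

definition merged :: "nat => ('x, 'u) vec2 => ('x, 'u) vec2 => bool" where
 "merged j z z' \<longleftrightarrow> (\<forall>l\<in>{1..<q}. q - j <= l --> snd z l = snd z' l & ennreal (WU (snd z l)) / cW ~= top)"

text \<open>The appended input is common to both copies and has finite weight almost surely, while
  the inputs already shared move one place towards the front.\<close>

lemma merged_step: assumes "merged j z z'" shows "AE y in G z. merged (Suc j) (T z y) (T z' y)"
 using WU_finite[of "fst z p"]
proof eventually_elim
 case (elim y)
 have "snd (T z y) l = snd (T z' y) l & ennreal (WU (snd (T z y) l)) / cW ~= top" if l: "l \<in> {1..<q}" "q - Suc j <= l" for l
 proof (cases "Suc l < q")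
  case True
  then have e2: "snd (T z y) l = snd z (Suc l)" "snd (T z' y) l = snd z' (Suc l)" using l by (simp_all add: upd_snd)
  have "Suc l \<in> {1..<q}" "q - j <= Suc l" using True l by auto
  then have "snd z (Suc l) = snd z' (Suc l) & ennreal (WU (snd z (Suc l))) / cW ~= top"
   using assms unfolding merged_def by blast
  with e2 show ?thesis by metis
 next
  case False
  then have "l = q - Suc 0" "1 < q" using l by auto
  then show ?thesis using elim by (simp add: upd_snd_last)
 qed
 then show ?case unfolding merged_def by blast
qed

definition \<Phi> :: "('x, 'u) vec4 => ennreal" where "\<Phi> v = (\<Sum>k. (S ^^ k) ab v)"

text \<open>The contraction holds along every input sequence, so the distance factor of (A-8)(iii)
  leaves the expectation and only a moment of \<open>WX\<close> under \<open>Q\<close>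
  remains.\<close>

lemma S_pow_ab_le:
 assumes \<rho>: "!!n z z' om. dist_Z p q (run T z om n) (run T z' om n) <= Cg * \<rho> ^ n * dist_Z p q z z'"
 shows "(S ^^ n) ab v <= ennreal (Cg * \<rho> ^ n * dist_Z p q (fst v) (snd v)) * (Q ^^ n) WXp v"
proof -
 let ?c = "Cg * \<rho> ^ n * dist_Z p q (fst v) (snd v)"
 have c0: "0 <= ?c" using order_trans[OF dist_Z_nonneg[OF p1] \<rho>[of "fst v" _ n "snd v"]] .
 have WXm: "WXp \<in> bm borel" by measurable
 have "(S ^^ n) ab v <= (Q ^^ n) ab v" by (rule S_pow_le_Q)
 also have "... <= (Q ^^ n) (%w. ennreal ?c * WXp w) v"
 proof (rule C.step_pow_mono_run)
  fix om
  let ?w = "run T2 v om n"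
  have "1 - \<alpha> (pairp ?w) <= dist (fst (fst ?w) p) (fst (snd ?w) p) * WX (pairp ?w)"
   unfolding pairp_def by (rule \<alpha>_WX)
  also have "... <= ?c * WX (pairp ?w)"
  proof (rule mult_right_mono)
   have "dist (fst (fst ?w) p) (fst (snd ?w) p) <= dist_Z p q (fst ?w) (snd ?w)" using p1 by (intro dist_Z_fst) auto
   also have "... <= ?c" using \<rho> by (simp add: run_upd2)
   finally show "dist (fst (fst ?w) p) (fst (snd ?w) p) <= ?c" .
   show "0 <= WX (pairp ?w)" using WX1[of "pairp ?w"] by linarith
  qed
  finally show "ab ?w <= ennreal ?c * WXp ?w" using c0 by (simp add: ab_def ennreal_leI flip: ennreal_mult')
 qed
 also have "... = ennreal ?c * (Q ^^ n) WXp v" by (simp only: C.step_pow_cmult[OF WXm])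
 finally show ?thesis .
qed

text \<open>The moments grow like \<open>a ^ n\<close> with \<open>a * \<rho> < 1\<close>, which
  makes the terms geometric from \<open>n0\<close> on.\<close>

lemma tail_bound:
 "\<exists>J K \<zeta>. 0 <= K & 0 < \<zeta> & (\<forall>v. (\<Sum>k. (S ^^ (J + k)) ab v) <= ennreal (K * dist_Z p q (fst v) (snd v)) * epow (W v) \<zeta>)"
proof -
 obtain Cg \<rho> where \<rho>: "0 < Cg" "0 < \<rho>" "\<rho> < 1" "!!n z z' om. dist_Z p q (run T z om n) (run T z' om n) <= Cg * \<rho> ^ n * dist_Z p q z z'"
  using geometric_contraction by blast
 obtain Cm a \<zeta> n0 where a: "0 <= Cm" "0 < a" "a * \<rho> < 1" "0 < \<zeta>" "\<forall>n\<ge>n0. \<forall>v. (Q ^^ n) WXp v <= ennreal (Cm * a ^ n) * epow (W v) \<zeta>"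
  using moment[OF \<rho>(2,3)] by (elim exE conjE) (rule that)
 let ?r = "a * \<rho>"
 have r: "0 <= ?r" "?r < 1" using a \<rho> by simp_all
 have A: "(\<Sum>k. ennreal (?r ^ (n0 + k))) <= ennreal (1 / (1 - ?r))"
 proof -
  have "(\<Sum>k. ennreal (?r ^ (n0 + k))) <= (\<Sum>k. ennreal (?r ^ k))"
   using r by (intro suminf_le ennreal_leI power_decreasing summableI) auto
  also have "... = ennreal (1 / (1 - ?r))" using r by (intro suminf_ennreal_eq geometric_sums) auto
  finally show ?thesis .
 qed
 have "(\<Sum>k. (S ^^ (n0 + k)) ab v) <= ennreal (Cg * Cm * (1 / (1 - ?r)) * dist_Z p q (fst v) (snd v)) * epow (W v) \<zeta>" for v
 proof -
  let ?d = "dist_Z p q (fst v) (snd v)"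
  have d0: "0 <= ?d" by (rule dist_Z_nonneg[OF p1])
  have "(S ^^ (n0 + k)) ab v <= ennreal (Cg * Cm * ?d) * epow (W v) \<zeta> * ennreal (?r ^ (n0 + k))" for k
  proof -
   have "(S ^^ (n0 + k)) ab v <= ennreal (Cg * \<rho> ^ (n0 + k) * ?d) * (Q ^^ (n0 + k)) WXp v" by (rule S_pow_ab_le[OF \<rho>(4)])
   also have "... <= ennreal (Cg * \<rho> ^ (n0 + k) * ?d) * (ennreal (Cm * a ^ (n0 + k)) * epow (W v) \<zeta>)"
    by (intro mult_left_mono a(5)[rule_format, OF le_add1]) simp
   also have "... = ennreal (Cg * \<rho> ^ (n0 + k) * ?d * (Cm * a ^ (n0 + k))) * epow (W v) \<zeta>"
    using \<rho> a d0 by (subst ennreal_mult) (auto simp: mult.assoc)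
   also have "Cg * \<rho> ^ (n0 + k) * ?d * (Cm * a ^ (n0 + k)) = Cg * Cm * ?d * ?r ^ (n0 + k)" by (simp add: power_mult_distrib)
   also have "ennreal (Cg * Cm * ?d * ?r ^ (n0 + k)) * epow (W v) \<zeta> = ennreal (Cg * Cm * ?d) * epow (W v) \<zeta> * ennreal (?r ^ (n0 + k))"
    using \<rho> a d0 by (subst ennreal_mult) (auto simp: ac_simps)
   finally show ?thesis .
  qed
  then have "(\<Sum>k. (S ^^ (n0 + k)) ab v) <= (\<Sum>k. ennreal (Cg * Cm * ?d) * epow (W v) \<zeta> * ennreal (?r ^ (n0 + k)))"
   by (intro suminf_le summableI)
  also have "... = ennreal (Cg * Cm * ?d) * epow (W v) \<zeta> * (\<Sum>k. ennreal (?r ^ (n0 + k)))" by (rule ennreal_suminf_cmult)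
  also have "... <= ennreal (Cg * Cm * ?d) * epow (W v) \<zeta> * ennreal (1 / (1 - ?r))" by (intro mult_left_mono A) auto
  also have "... = ennreal (Cg * Cm * ?d * (1 / (1 - ?r))) * epow (W v) \<zeta>"
   using \<rho> a r d0 by (subst ennreal_mult[of "Cg * Cm * ?d"]) (auto simp: ac_simps)
  finally show ?thesis by (simp only: ac_simps)
 qed
 moreover have "0 <= Cg * Cm * (1 / (1 - ?r))" using \<rho> a r by simp
 ultimately show ?thesis using a(4) by blast
qed

lemma vanishing_le:
 assumes F: "vanishing P F" and le: "!!v. F' v <= F v" shows "vanishing P F'"
 unfolding vanishing_def
proof (intro allI impI)
 fix z and s :: "nat => ('x, 'u) vec2" assume "s \<longlonglongrightarrow> z" "\<forall>i. P z (s i)"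
 then have lim: "(%i. F (z, s i)) \<longlonglongrightarrow> 0" using F unfolding vanishing_def by blast
 show "(%i. F' (z, s i)) \<longlonglongrightarrow> 0"
  by (rule tendsto_sandwich[OF always_eventually always_eventually tendsto_const lim]) (simp_all add: le)
qed

lemma vanishing_add:
 assumes "vanishing P F" "vanishing P F'" shows "vanishing P (%v. F v + F' v)"
 unfolding vanishing_def
proof (intro allI impI)
 fix z and s :: "nat => ('x, 'u) vec2" assume "s \<longlonglongrightarrow> z" "\<forall>i. P z (s i)"
 then have "(%i. F (z, s i)) \<longlonglongrightarrow> 0" "(%i. F' (z, s i)) \<longlonglongrightarrow> 0" using assms unfolding vanishing_def by blast+
 from tendsto_add[OF this] show "(%i. F (z, s i) + F' (z, s i)) \<longlonglongrightarrow> 0" by simp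
qed

lemma vanishing_sum: "finite I ==> (!!i. i \<in> I ==> vanishing P (F i)) ==> vanishing P (%v. \<Sum>i\<in>I. F i v)"
proof (induction I rule: finite_induct)
 case empty
 show ?case by (simp add: vanishing_def)
qed (simp add: vanishing_add)

text \<open>Along the sequence \<open>W\<close> stays bounded: \<open>WX\<close> by local
  boundedness, and the input part because all stored inputs equal those of \<open>z\<close>, with
  finite weight. The distance in \<open>tail_bound\<close> then forces the limit 0.\<close>

lemma tail_vanishing: "\<exists>J. vanishing (merged (q - 1)) (%v. \<Sum>k. (S ^^ (J + k)) ab v)"
proof -
 obtain J K \<zeta> where K: "0 <= K" "0 < \<zeta>" "!!v. (\<Sum>k. (S ^^ (J + k)) ab v) <= ennreal (K * dist_Z p q (fst v) (snd v)) * epow (W v) \<zeta>"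
  using tail_bound by blast
 have "vanishing (merged (q - 1)) (%v. \<Sum>k. (S ^^ (J + k)) ab v)"
  unfolding vanishing_def
 proof (intro allI impI)
  fix z and s :: "nat => ('x, 'u) vec2" assume s: "s \<longlonglongrightarrow> z" and mg: "\<forall>i. merged (q - 1) z (s i)"
  have mg: "snd (s i) l = snd z l" "ennreal (WU (snd z l)) / cW ~= top" if "l \<in> {1..<q}" for i l
  proof -
   have "q - (q - 1) <= l" using that by auto
   then have c: "snd z l = snd (s i) l & ennreal (WU (snd z l)) / cW ~= top"
    using mg[rule_format, of i] that unfolding merged_def by blast
   show "snd (s i) l = snd z l" "ennreal (WU (snd z l)) / cW ~= top"
    by (rule conjunct1[OF c, symmetric], rule conjunct2[OF c])
  qed
  obtain Kf where Kf: "!!k. \<forall>\<^sub>F i in sequentially. WX (fst z k, fst (s i) k) <= Kf k"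
   using WX_seq_bound[OF tendsto_vec2_coord(1)[OF s]] by metis
  define L where "L = (\<Sum>k=1..p. ennreal (Kf k)) + (\<Sum>l\<in>{1..<q}. ennreal (WU (snd z l)) / cW)"
  have Lf: "L < \<infinity>" using mg(2) by (auto simp: L_def less_top[symmetric])
  have "\<forall>\<^sub>F i in sequentially. \<forall>k\<in>{1..p}. WX (fst z k, fst (s i) k) <= Kf k"
   by (intro eventually_ball_finite) (auto intro: Kf)
  then have WL: "\<forall>\<^sub>F i in sequentially. W (z, s i) <= L"
  proof eventually_elim
   case (elim i)
   have "ennreal (WX (fst z k, fst (s i) k)) <= L" if k: "k \<in> {1..p}" for k
   proof -
    have "ennreal (WX (fst z k, fst (s i) k)) <= ennreal (Kf k)" using elim k by (intro ennreal_leI) auto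
    also have "... <= (\<Sum>k=1..p. ennreal (Kf k))" using k by (intro member_le_sum) auto
    finally show ?thesis unfolding L_def by (rule add_increasing2[OF zero_le])
   qed
   moreover have "ennreal (WU (snd z l)) / cW <= L" if "l \<in> {1..<q}" for l
   proof -
    have "ennreal (WU (snd z l)) / cW <= (\<Sum>l\<in>{1..<q}. ennreal (WU (snd z l)) / cW)" using that by (intro member_le_sum) auto
    then show ?thesis unfolding L_def by (rule add_increasing[OF zero_le])
   qed
   ultimately show ?case unfolding W_Z_le_iff using mg(1) by simp
  qed
  have "(%i. epow L \<zeta> * ennreal (K * dist_Z p q z (s i))) \<longlonglongrightarrow> epow L \<zeta> * ennreal (K * 0)"
   using epow_finite[OF Lf, of \<zeta>] by (intro ennreal_tendsto_cmult tendsto_ennrealI tendsto_mult tendsto_const tendsto_dist_Z[OF p1 s]) auto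
  then have lim: "(%i. ennreal (K * dist_Z p q z (s i)) * epow L \<zeta>) \<longlonglongrightarrow> 0" by (simp add: mult.commute)
  have "\<forall>\<^sub>F i in sequentially. (\<Sum>k. (S ^^ (J + k)) ab (z, s i)) <= ennreal (K * dist_Z p q z (s i)) * epow L \<zeta>"
   using WL
  proof eventually_elim
   case (elim i)
   have "(\<Sum>k. (S ^^ (J + k)) ab (z, s i)) <= ennreal (K * dist_Z p q z (s i)) * epow (W (z, s i)) \<zeta>" using K(3)[of "(z, s i)"] by simp
   also have "... <= ennreal (K * dist_Z p q z (s i)) * epow L \<zeta>" by (intro mult_left_mono epow_mono elim K(2)) auto
   finally show ?case .
  qed
  then show "(%i. \<Sum>k. (S ^^ (J + k)) ab (z, s i)) \<longlonglongrightarrow> 0"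
   by (intro tendsto_sandwich[OF always_eventually _ tendsto_const lim]) auto
 qed
 then show ?thesis by blast
qed

text \<open>The inequality between \<open>S\<close> and \<open>B\<close> moves the tail behind
  \<open>q - 1\<close> steps of \<open>B\<close>, after which all stored inputs are shared. The
  finitely many remaining terms vanish one by one, each being at most an iterate of \<open>B\<close>
  on \<open>ab\<close>.\<close>

lemma \<Phi>_vanishing: "vanishing (%_ _. True) \<Phi>"
proof -
 obtain J where J: "vanishing (merged (q - 1)) (%v. \<Sum>k. (S ^^ (J + k)) ab v)" using tail_vanishing by blast
 define \<Psi> where "\<Psi> = (%v. \<Sum>k. (S ^^ (J + k)) ab v)"
 have \<Psi>m[measurable]: "\<Psi> \<in> bm borel" unfolding \<Psi>_def by measurable
 have \<Psi>1: "\<Psi> v <= 1" for v unfolding \<Psi>_def by (rule S_ab_suminf_le_1)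
 \<comment> \<open>Each application of \<open>B\<close> lowers by one the number of inputs that must
   be shared at the start.\<close>
 have "vanishing (merged (q - 1 - i)) ((B ^^ i) \<Psi>)" if "i <= q - 1" for i
  using that
 proof (induction i)
  case 0
  then show ?case using J by (simp add: \<Psi>_def)
 next
  case (Suc i)
  have "(B ^^ i) \<Psi> v <= 1" for v using B.step_pow_mono[of \<Psi> "%_. 1" i v] \<Psi>1 by (simp add: B.step_pow_const)
  moreover have "Suc (q - 1 - Suc i) = q - 1 - i" using Suc.prems by simp
  ultimately show ?case using Suc vanishing_B[of "(B ^^ i) \<Psi>" "merged (q - 1 - i)" "merged (q - 1 - Suc i)"] merged_step[of "q - 1 - Suc i"]
   by simp
 qed
 from this[of "q - 1"] have "vanishing (merged 0) ((B ^^ (q - 1)) \<Psi>)" by simp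
 moreover have "merged 0 = (%_ _. True)" by (auto simp: merged_def fun_eq_iff)
 ultimately have B\<Psi>: "vanishing (%_ _. True) ((B ^^ (q - 1)) \<Psi>)" by simp
 have Sk: "vanishing (%_ _. True) ((S ^^ k) ab)" for k
  by (rule vanishing_le[OF vanishing_B_pow[OF ab_measurable ab_le_1 ab_vanishing] S_pow_le_B[OF ab_measurable]])
 let ?N = "q - 1 + J"
 have "\<Phi> v <= (\<Sum>k<?N. (S ^^ k) ab v) + (B ^^ (q - 1)) \<Psi> v" for v
 proof -
  have "(\<Sum>k. (S ^^ (?N + k)) ab v) = (S ^^ (q - 1)) \<Psi> v"
   unfolding \<Psi>_def by (subst S_pow_suminf) (simp_all add: add.assoc funpow_add)
  also have "... <= (B ^^ (q - 1)) \<Psi> v" by (rule S_pow_le_B[OF \<Psi>m])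
  finally show ?thesis unfolding \<Phi>_def using suminf_split_le[of "%k. (S ^^ k) ab v" ?N] by (meson add_left_mono order_trans)
 qed
 then show ?thesis by (intro vanishing_le[OF vanishing_add[OF vanishing_sum[OF finite_lessThan Sk] B\<Psi>]])
qed

lemma \<Phi>_le_1: "\<Phi> v <= 1" using S_ab_suminf_le_1[of 0 v] by (simp add: \<Phi>_def)

lemma run_merge: assumes "0 < eps" shows "\<exists>N. \<forall>n\<ge>N. \<forall>om. dist (run T z om n) (run T z' om n) < eps"
proof -
 obtain Cg \<rho> where \<rho>: "0 < Cg" "0 < \<rho>" "\<rho> < 1" "!!n z z' om. dist_Z p q (run T z om n) (run T z' om n) <= Cg * \<rho> ^ n * dist_Z p q z z'"
  using geometric_contraction by blast
 have "(%n. 4 * (Cg * \<rho> ^ n * dist_Z p q z z')) \<longlonglongrightarrow> 4 * (Cg * 0 * dist_Z p q z z')"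
  using \<rho> by (intro tendsto_intros LIMSEQ_realpow_zero) auto
 then have "\<forall>\<^sub>F n in sequentially. 4 * (Cg * \<rho> ^ n * dist_Z p q z z') < eps & 0 < n"
  using order_tendstoD(2)[of "%n. 4 * (Cg * \<rho> ^ n * dist_Z p q z z')" 0 sequentially eps] assms eventually_gt_at_top[of 0]
  by (auto intro: eventually_conj)
 then obtain N where N: "!!n. N <= n ==> 4 * (Cg * \<rho> ^ n * dist_Z p q z z') < eps & 0 < n" by (auto simp: eventually_sequentially)
 have "dist (run T z om n) (run T z' om n) < eps" if "N <= n" for n om
 proof -
  have "0 < n" using N[OF that] by simp
  then have "dist (run T z om n) (run T z' om n) <= 4 * dist_Z p q (run T z om n) (run T z' om n)"
   using dist_trunc_le_dist_Z[OF p1, of q "run T z om n" "run T z' om n"] by (simp only: trunc_vec_ident[OF run_in_Zsp])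
  then show ?thesis using \<rho>(4)[of z om n z'] N[OF that] by linarith
 qed
 then show ?thesis by blast
qed

end

subsection \<open>The asymptotic distance\<close>

context od_stable
begin

abbreviation It :: "nat => (('x, 'u) vec2 => real) => ('x, 'u) vec2 => ennreal" where
 "It n f \<equiv> (R ^^ n) (%z. ennreal (f z))"

abbreviation near :: "nat => (('x, 'u) vec2 => real) => ('x, 'u) vec4 => real => bool" where
 "near n f v c \<equiv> It n f (fst v) <= It n f (snd v) + ennreal c & It n f (snd v) <= It n f (fst v) + ennreal c"

text \<open>Inequalities with an added constant replace the absolute difference, since the iterates
  are \<open>ennreal\<close> values. The time from which they hold may depend on \<open>f\<close>
  and \<open>eps\<close>.\<close>

definition asym :: "('x, 'u) vec4 => real => bool" where
 "asym v c \<longleftrightarrow> 0 <= c & (\<forall>f\<in>lip01. \<forall>eps>0. \<forall>\<^sub>F n in sequentially.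
   near n f v (c + eps))"

text \<open>This is the supremum over \<open>f\<close> in \<open>lip01\<close> of the upper limit of
  the absolute differences of \<open>It n f\<close> at the two points.\<close>

definition D :: "('x, 'u) vec4 => real" where "D v = Inf {c. asym v c}"

lemma asymI:
 assumes "0 <= c" "!!f eps. f \<in> lip01 ==> 0 < eps ==> \<forall>\<^sub>F n in sequentially.
   near n f v (c + eps)"
 shows "asym v c"
 using assms unfolding asym_def by blast

lemma asymD:
 assumes "asym v c" "f \<in> lip01" "0 < eps"
 shows "\<forall>\<^sub>F n in sequentially.
   near n f v (c + eps)"
 using assms unfolding asym_def by blast

lemma asym_nonneg: "asym v c ==> 0 <= c"
 by (simp add: asym_def)

lemma lip01_measurable: "f \<in> lip01 ==> (%z::('x, 'u) vec2. ennreal (f z)) \<in> bm borel"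
 using lip01_bcont[of f] bcontD(1)[of f] borel_measurable_continuous_onI[of f] by (auto intro!: mcomp[OF _ measurable_ennreal])

lemma lip01_le_1: "f \<in> lip01 ==> ennreal (f z) <= 1"
 by (auto simp: lip01_def ennreal_le_1)

lemma R_pow_le_1: "(!!z. f z <= 1) ==> (R ^^ n) f z <= 1"
 using step_pow_mono[of f "%_. 1" n z] by (simp add: step_pow_const)

lemma asym_1: "asym v 1"
proof (rule asymI)
 fix f :: "('x, 'u) vec2 => real" and eps :: real assume f: "f \<in> lip01" and eps: "0 < eps"
 have "It n f s <= It n f s' + ennreal (1 + eps)" for s s' n
 proof -
  have "It n f s <= ennreal 1" using R_pow_le_1[of "%z. ennreal (f z)"] lip01_le_1[OF f] by simp
  also have "... <= ennreal (1 + eps)" using eps by (intro ennreal_leI) simp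
  finally show ?thesis by (rule add_increasing[OF zero_le])
 qed
 then show "\<forall>\<^sub>F n in sequentially.
   near n f v (1 + eps)" by simp
qed simp

lemma bdd_below_asym: "bdd_below {c. asym v c}"
 by (rule bdd_belowI[of _ 0]) (auto dest: asym_nonneg)

lemma D_le: "asym v c ==> D v <= c"
 unfolding D_def by (rule cInf_lower[OF _ bdd_below_asym]) simp

lemma D_nonneg: "0 <= D v"
 unfolding D_def using asym_1[of v] by (intro cInf_greatest) (auto dest: asym_nonneg)

lemma D_le_1: "D v <= 1"
 by (rule D_le[OF asym_1])

text \<open>The slack \<open>eps\<close> in \<open>asym\<close> makes the infimum a minimum.\<close>

lemma asym_D: "asym v (D v)"
proof (rule asymI[OF D_nonneg])
 fix f :: "('x, 'u) vec2 => real" and eps :: real assume f: "f \<in> lip01" and eps: "0 < eps"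
 have "\<exists>c\<in>{c. asym v c}. c < D v + eps / 2"
  using asym_1[of v] eps unfolding D_def by (intro cInf_lessD) auto
 then obtain c where c: "asym v c" "c < D v + eps / 2" by blast
 have le: "ennreal (c + eps / 2) <= ennreal (D v + eps)" using c(2) by (intro ennreal_leI) simp
 have "0 < eps / 2" using eps by simp
 from asymD[OF c(1) f this]
 show "\<forall>\<^sub>F n in sequentially.
   near n f v (D v + eps)"
  by eventually_elim (blast intro: order_trans[OF _ add_left_mono[OF le]])
qed

lemma asym_swap: "asym (z, z') c ==> asym (z', z) c"
 by (rule asymI[OF asym_nonneg]) (auto dest!: asymD simp: conj_commute)

lemma D_swap: "D (z, z') = D (z', z)"
 by (rule antisym; rule D_le; rule asym_swap; rule asym_D)

lemma D_triangle: "D (x, z) <= D (x, y) + D (y, z)"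
proof (rule D_le, rule asymI)
 show "0 <= D (x, y) + D (y, z)" using D_nonneg by simp
 fix f :: "('x, 'u) vec2 => real" and eps :: real assume f: "f \<in> lip01" and "0 < eps"
 then have e2: "0 < eps / 2" by simp
 have e: "ennreal (D (x, y) + eps / 2) + ennreal (D (y, z) + eps / 2) = ennreal (D (x, y) + D (y, z) + eps)"
 proof -
  have "ennreal (D (x, y) + eps / 2) + ennreal (D (y, z) + eps / 2) = ennreal ((D (x, y) + eps / 2) + (D (y, z) + eps / 2))"
   using D_nonneg[of "(x, y)"] D_nonneg[of "(y, z)"] e2 by (intro ennreal_plus[symmetric]) linarith+
  also have "(D (x, y) + eps / 2) + (D (y, z) + eps / 2) = D (x, y) + D (y, z) + eps" by simp
  finally show ?thesis .
 qed
 have tr: "a <= b' + c2" if "a <= b + c1" "b <= b' + c3" "c1 + c3 = c2" for a b b' c1 c2 c3 :: ennreal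
 proof -
  have "a <= (b' + c3) + c1" using that(1) add_right_mono[OF that(2), of c1] by (rule order_trans)
  also have "... = b' + c2" unfolding that(3)[symmetric] by (simp only: ac_simps)
  finally show ?thesis .
 qed
 have e': "ennreal (D (y, z) + eps / 2) + ennreal (D (x, y) + eps / 2) = ennreal (D (x, y) + D (y, z) + eps)"
  using e by (simp only: add.commute)
 show "\<forall>\<^sub>F n in sequentially.
   It n f (fst (x, z)) <= It n f (snd (x, z)) + ennreal (D (x, y) + D (y, z) + eps) &
   It n f (snd (x, z)) <= It n f (fst (x, z)) + ennreal (D (x, y) + D (y, z) + eps)"
  using asymD[OF asym_D[of "(x, y)"] f e2] asymD[OF asym_D[of "(y, z)"] f e2]
 proof eventually_elim
  case (elim n)
  then show ?case unfolding fst_conv snd_conv by (blast intro: tr[OF _ _ e] tr[OF _ _ e'])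
 qed
qed

text \<open>Merging brings the two paths within \<open>\<delta>\<close> of each other for all inputs
  at once, a distance at which the Lipschitz function varies by at most \<open>eps\<close>;
  \<open>coupling_bound\<close> adds the failure probability.\<close>

lemma asym_\<Phi>: assumes c: "\<Phi> v <= ennreal c" "0 <= c" shows "asym v c"
proof (rule asymI[OF c(2)])
 fix f :: "('x, 'u) vec2 => real" and eps :: real assume f: "f \<in> lip01" and eps: "0 < eps"
 obtain L where L: "!!x y. \<bar>f x - f y\<bar> <= L * dist x y" using f by (auto simp: lip01_def)
 have f0: "0 <= f x" for x using f unfolding lip01_def by blast
 define \<delta> where "\<delta> = eps / (\<bar>L\<bar> + 1)"
 have \<delta>: "0 < \<delta>" using eps by (simp add: \<delta>_def)
 have L\<delta>: "L * d <= eps" if "d < \<delta>" "0 <= d" for d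
 proof -
  have "L * d <= (\<bar>L\<bar> + 1) * \<delta>" using that by (intro mult_mono) auto
  also have "... = eps" by (simp add: \<delta>_def)
  finally show ?thesis .
 qed
 obtain N where N: "\<forall>n\<ge>N. \<forall>om. dist (run T (fst v) om n) (run T (snd v) om n) < \<delta>" using run_merge[OF \<delta>] by blast
 have le: "ennreal (f x) <= ennreal (f y) + ennreal eps" if "dist x y < \<delta>" for x y
 proof -
  have "f x <= f y + eps" using L[of x y] L\<delta>[OF that] by (simp add: abs_le_iff)
  then have "ennreal (f x) <= ennreal (f y + eps)" by (rule ennreal_leI)
  also have "... = ennreal (f y) + ennreal eps" using f0 eps by (intro ennreal_plus) auto
  finally show ?thesis .
 qed
 have "near n f v (c + eps)" if n: "N <= n" for n
 proof -
  have d: "dist (run T (fst v) om n) (run T (snd v) om n) < \<delta>" "dist (run T (snd v) om n) (run T (fst v) om n) < \<delta>" for om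
   using N n by (simp_all add: dist_commute)
  have "(\<Sum>k<n. (S ^^ k) ab v) + ennreal eps <= \<Phi> v + ennreal eps"
   unfolding \<Phi>_def by (intro add_right_mono sum_le_suminf) auto
  also have "... <= ennreal c + ennreal eps" using c(1) by (rule add_right_mono)
  also have "... = ennreal (c + eps)" using c(2) eps by (intro ennreal_plus[symmetric]) auto
  finally have s: "(\<Sum>k<n. (S ^^ k) ab v) + ennreal eps <= ennreal (c + eps)" .
  have 1: "It n f (fst v) <= It n f (snd v) + ((\<Sum>k<n. (S ^^ k) ab v) + ennreal eps)"
   by (rule coupling_bound(1)[OF lip01_measurable[OF f] lip01_le_1[OF f]]; rule le; rule d)
  have 2: "It n f (snd v) <= It n f (fst v) + ((\<Sum>k<n. (S ^^ k) ab v) + ennreal eps)"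
   by (rule coupling_bound(2)[OF lip01_measurable[OF f] lip01_le_1[OF f]]; rule le; rule d)
  show ?thesis using order_trans[OF 1 add_left_mono[OF s]] order_trans[OF 2 add_left_mono[OF s]] by (rule conjI)
 qed
 then show "\<forall>\<^sub>F n in sequentially.
   near n f v (c + eps)"
  unfolding eventually_sequentially by blast
qed

lemma D_le_\<Phi>: "ennreal (D v) <= \<Phi> v"
proof -
 have "\<Phi> v = ennreal (enn2real (\<Phi> v))" using le_less_trans[OF \<Phi>_le_1 ennreal_one_less_top, of v] by simp
 then have "D v <= enn2real (\<Phi> v)" by (intro D_le asym_\<Phi>) auto
 then show ?thesis using \<open>\<Phi> v = _\<close> ennreal_leI by metis
qed

lemma D_tendsto: assumes "s \<longlonglongrightarrow> z" shows "(%i. D (z, s i)) \<longlonglongrightarrow> 0"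
proof -
 have "(%i. \<Phi> (z, s i)) \<longlonglongrightarrow> 0" using \<Phi>_vanishing assms unfolding vanishing_def by blast
 then have "(%i. ennreal (D (z, s i))) \<longlonglongrightarrow> 0"
  by (rule tendsto_sandwich[OF always_eventually always_eventually tendsto_const, rotated 2]) (simp_all add: D_le_\<Phi>)
 then have "(%i. ennreal (D (z, s i))) \<longlonglongrightarrow> ennreal 0" by simp
 then have "(%i. enn2real (ennreal (D (z, s i)))) \<longlonglongrightarrow> 0" by (rule tendsto_enn2real) simp
 then show ?thesis by (simp add: D_nonneg)
qed

lemma D_diag: "D (z, z) = 0"
 using D_tendsto[of "%_. z" z] by (simp add: LIMSEQ_const_iff)

text \<open>Both arguments are moved by the triangle inequality, at a cost that
  \<open>D_tendsto\<close> sends to 0.\<close>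

lemma D_continuous: "continuous_on UNIV D"
proof (rule continuous_on_sequentiallyI)
 fix u :: "nat => ('x, 'u) vec4" and a assume u: "u \<longlonglongrightarrow> a"
 have "\<bar>D (u n) - D a\<bar> <= D (fst a, fst (u n)) + D (snd a, snd (u n))" for n
 proof -
  have "D (fst (u n), snd (u n)) <= D (fst (u n), fst a) + D (fst a, snd (u n))" by (rule D_triangle)
  moreover have "D (fst a, snd (u n)) <= D (fst a, snd a) + D (snd a, snd (u n))" by (rule D_triangle)
  moreover have "D (fst a, snd a) <= D (fst a, fst (u n)) + D (fst (u n), snd a)" by (rule D_triangle)
  moreover have "D (fst (u n), snd a) <= D (fst (u n), snd (u n)) + D (snd (u n), snd a)" by (rule D_triangle)
  moreover have "D (fst (u n), fst a) = D (fst a, fst (u n))" "D (snd (u n), snd a) = D (snd a, snd (u n))" by (rule D_swap)+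
  ultimately show ?thesis by (simp add: abs_le_iff)
 qed
 moreover have "(%n. D (fst a, fst (u n)) + D (snd a, snd (u n))) \<longlonglongrightarrow> 0 + 0"
  by (intro tendsto_add D_tendsto tendsto_fst tendsto_snd u)
 ultimately have "(%n. D (u n) - D a) \<longlonglongrightarrow> 0"
  by (intro Lim_null_comparison[of "%n. D (u n) - D a" "%n. D (fst a, fst (u n)) + D (snd a, snd (u n))"]) auto
 then show "(%n. D (u n)) \<longlonglongrightarrow> D a" by (simp add: LIM_zero_iff)
qed

lemma D_measurable[measurable]: "D \<in> bm borel"
 by (rule borel_measurable_continuous_onI[OF D_continuous])

text \<open>The truncated difference is the positive excess over the asymptotic bound. Its limit 0
  at each single pair is what dominated convergence can use, as the times in \<open>asym\<close> are
  not uniform over pairs.\<close>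

lemma D_run_tendsto:
 assumes f: "f \<in> lip01"
 shows "(%n. It n f (fst v) - (It n f (snd v) + ennreal (D v))) \<longlonglongrightarrow> 0"
proof (rule ennreal_tendsto_0I)
 fix eps :: real assume eps: "0 < eps"
 show "\<forall>\<^sub>F n in sequentially. It n f (fst v) - (It n f (snd v) + ennreal (D v)) <= ennreal eps"
  using asymD[OF asym_D[of v] f eps]
 proof eventually_elim
  case (elim n)
  then have "It n f (fst v) <= ennreal eps + (It n f (snd v) + ennreal (D v))"
   using ennreal_plus[OF D_nonneg[of v], of eps] eps by (simp add: ac_simps)
  moreover have "It n f (snd v) + ennreal (D v) < top"
   using le_less_trans[OF R_pow_le_1[of "%z. ennreal (f z)" n "snd v"] ennreal_one_less_top] lip01_le_1[OF f] by simp
  ultimately show ?case by (auto simp: ennreal_minus_le_iff add.commute)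
 qed
qed

end

section \<open>Pairs at asymptotic distance 1\<close>

context od_stable
begin

lemma f_run_measurable: "F \<in> bm borel ==> (%y. F (T z y)) \<in> bm \<nu>"
 by (rule mcomp[OF update1])

lemma DT_measurable: "(%y. ennreal (D (T z y, T z' y))) \<in> bm \<nu>"
proof -
 have "(%y. D (T2 (z, z') y)) \<in> bm \<nu>" by (rule mcomp[OF C.update1 D_measurable])
 then show ?thesis by (simp add: upd2_def)
qed

text \<open>A common part \<open>\<mu>\<close> of the two observation laws bounds the asymptotic
  distance by the missing mass plus the integral of \<open>D\<close> after one common step. The
  excess over \<open>D\<close> vanishes in the limit by dominated convergence.\<close>

lemma overlap_one_sided:
 fixes \<mu> :: "'y measure"
 assumes s: "sets \<mu> = sets \<nu>"
  and le: "!!k. k \<in> bm \<nu> ==> (\<integral>\<^sup>+y. k y \<partial>\<mu>) <= (\<integral>\<^sup>+y. k y \<partial>G z)"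
   "!!k. k \<in> bm \<nu> ==> (\<integral>\<^sup>+y. k y \<partial>\<mu>) <= (\<integral>\<^sup>+y. k y \<partial>G z')"
  and f: "f \<in> lip01" and eps: "0 < (eps::real)"
 shows "\<forall>\<^sub>F n in sequentially. It n f z <= It n f z'
  + ((1 - emeasure \<mu> (space \<mu>)) + (\<integral>\<^sup>+y. ennreal (D (T z y, T z' y)) \<partial>\<mu>) + ennreal eps)"
proof -
 let ?F = "%n y. It n f (T z y)" and ?F' = "%n y. It n f (T z' y)"
 let ?D = "%y. ennreal (D (T z y, T z' y))"
 let ?e = "%n y. ?F n y - (?F' n y + ?D y)"
 have bm: "bm \<mu> = bm \<nu>" by (rule mcong[OF s refl])
 have Fm: "?F n \<in> bm \<nu>" "?F' n \<in> bm \<nu>" for n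
  by (intro f_run_measurable step_pow_measurable lip01_measurable f)+
 have F1: "It n f w <= 1" for n w by (rule R_pow_le_1) (rule lip01_le_1[OF f])
 have em: "?e n \<in> bm \<nu>" for n by (intro borel_measurable_minus_ennreal borel_measurable_add Fm DT_measurable)
 have G1: "(\<integral>\<^sup>+y. 1 \<partial>G z) = 1" using prob_space.emeasure_space_1[OF prob_G] by simp
 have "(%n. \<integral>\<^sup>+y. ?e n y \<partial>\<mu>) \<longlonglongrightarrow> (\<integral>\<^sup>+y. 0 \<partial>\<mu>)"
 proof (rule nn_integral_dominated_convergence[where w="%_. 1"])
  show "(\<integral>\<^sup>+y. 1 \<partial>\<mu>) < \<infinity>" using le(1)[of "%_. 1"] G1 by (auto intro: le_less_trans[OF _ ennreal_one_less_top])
  show "AE y in \<mu>. (%n. ?e n y) \<longlonglongrightarrow> 0" using D_run_tendsto[OF f, of "(T z y, T z' y)" for y] by simp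
  show "AE y in \<mu>. ?e n y <= 1" for n by (intro AE_I2 order_trans[OF diff_le_self_ennreal] F1)
 qed (simp_all add: bm em)
 then have "\<forall>\<^sub>F n in sequentially. (\<integral>\<^sup>+y. ?e n y \<partial>\<mu>) < ennreal eps" using eps by (intro order_tendstoD(2)) auto
 then have "\<forall>\<^sub>F n in sequentially. (R ^^ Suc n) (%z. ennreal (f z)) z <= (R ^^ Suc n) (%z. ennreal (f z)) z'
  + ((1 - emeasure \<mu> (space \<mu>)) + (\<integral>\<^sup>+y. ?D y \<partial>\<mu>) + ennreal eps)"
 proof eventually_elim
  case (elim n)
  have pw: "?F n y - ?F' n y <= ?D y + ?e n y" for y
  proof -
   have "?F n y <= (?F' n y + ?D y) + ?e n y" by (cases "?F' n y + ?D y <= ?F n y") (auto simp: add_diff_inverse_ennreal intro: add_increasing2)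
   then have "?F n y <= ?F' n y + (?D y + ?e n y)" by (simp only: add.assoc)
   moreover have "?F' n y ~= top" using le_less_trans[OF F1 ennreal_one_less_top, of n "T z' y"] by simp
   ultimately show ?thesis by (simp only: ennreal_minus_le_iff) simp
  qed
  have "(\<integral>\<^sup>+y. ?F n y - ?F' n y \<partial>\<mu>) <= (\<integral>\<^sup>+y. ?D y + ?e n y \<partial>\<mu>)" by (intro nn_integral_mono pw)
  also have "... = (\<integral>\<^sup>+y. ?D y \<partial>\<mu>) + (\<integral>\<^sup>+y. ?e n y \<partial>\<mu>)" by (rule nn_integral_add) (simp_all only: bm DT_measurable em)
  also have "... <= (\<integral>\<^sup>+y. ?D y \<partial>\<mu>) + ennreal eps" using elim by (intro add_left_mono) simp
  finally have diff: "(\<integral>\<^sup>+y. ?F n y - ?F' n y \<partial>\<mu>) <= (\<integral>\<^sup>+y. ?D y \<partial>\<mu>) + ennreal eps" .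
  have "(R ^^ Suc n) (%z. ennreal (f z)) z = (\<integral>\<^sup>+y. ?F n y \<partial>G z)" by (simp add: step_def)
  also have "... <= (\<integral>\<^sup>+y. ?F' n y \<partial>G z') + (1 - emeasure \<mu> (space \<mu>)) + (\<integral>\<^sup>+y. ?F n y - ?F' n y \<partial>\<mu>)"
   by (rule overlap_coupling) (simp_all add: s bm Fm F1 prob_G le)
  also have "... <= (\<integral>\<^sup>+y. ?F' n y \<partial>G z') + (1 - emeasure \<mu> (space \<mu>)) + ((\<integral>\<^sup>+y. ?D y \<partial>\<mu>) + ennreal eps)"
   by (rule add_left_mono[OF diff])
  also have "(\<integral>\<^sup>+y. ?F' n y \<partial>G z') = (R ^^ Suc n) (%z. ennreal (f z)) z'" by (simp add: step_def)
  finally show ?case by (simp only: add.assoc)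
 qed
 then show ?thesis by (rule eventually_sequentially_Suc[THEN iffD1])
qed

text \<open>The common part is taken as large as possible, with the minimum of the densities. Then
  \<open>D v = 1\<close> leaves no room: the integral of \<open>D\<close> after a common step is the
  full mass of \<open>\<mu>\<close>, so that \<open>D\<close> equals 1 there almost
  everywhere.\<close>

lemma D_step: assumes D1: "D v = 1" shows "AE y in G (fst v). D (T2 v y) = 1"
proof -
 obtain z z' where v: "v = (z, z')" by (cases v)
 let ?x = "fst z p" and ?x' = "fst z' p"
 define \<mu> where "\<mu> = density \<nu> (%y. ennreal (min (g ?x y) (g ?x' y)))"
 have [measurable]: "g x \<in> bm \<nu>" for x by (rule g_measurable)
 have s: "sets \<mu> = sets \<nu>" by (simp add: \<mu>_def)
 have bm: "bm \<mu> = bm \<nu>" by (rule mcong[OF s refl])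
 have le: "(\<integral>\<^sup>+y. k y \<partial>\<mu>) <= (\<integral>\<^sup>+y. k y \<partial>dkernel \<nu> g a)" if [measurable]: "k \<in> bm \<nu>" and a: "a = ?x \<or> a = ?x'" for k a
  unfolding \<mu>_def dkernel_def using a
  by (simp add: nn_integral_density, intro nn_integral_mono mult_right_mono ennreal_leI, auto)
 define M where "M = emeasure \<mu> (space \<mu>)"
 have M: "M = (\<integral>\<^sup>+y. 1 \<partial>\<mu>)" by (simp add: M_def)
 have "M <= 1" using le[of "%_. 1" ?x] prob_space.emeasure_space_1[OF prob_G[of ?x]] by (simp add: M)
 define I where "I = (\<integral>\<^sup>+y. ennreal (D (T z y, T z' y)) \<partial>\<mu>)"
 have IM: "I <= M" unfolding I_def M using D_le_1 by (intro nn_integral_mono) (simp add: ennreal_le_1)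
 have fin: "M < top" "I < top" using \<open>M <= 1\<close> IM by (auto intro: le_less_trans[OF _ ennreal_one_less_top] order_trans)
 have K1: "(1 - M) + I < top" using fin by (simp add: less_top[symmetric])
 then have K: "(1 - M) + I = ennreal (enn2real ((1 - M) + I))" by simp
 \<comment> \<open>The missing mass plus the mean of \<open>D\<close> is an admissible constant for
   \<open>v\<close>; the reverse comparison uses the symmetry of \<open>D\<close>.\<close>
 have "asym v (enn2real ((1 - M) + I))"
 proof (rule asymI)
  fix f :: "('x, 'u) vec2 => real" and eps :: real assume f: "f \<in> lip01" and eps: "0 < eps"
  have e: "ennreal (enn2real ((1 - M) + I) + eps) = (1 - M) + I + ennreal eps"
   using eps by (subst ennreal_plus) (auto simp: K[symmetric])
  have 1: "\<forall>\<^sub>F n in sequentially. It n f z <= It n f z' + ((1 - M) + I + ennreal eps)"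
   unfolding M_def I_def by (rule overlap_one_sided[OF s _ _ f eps]) (rule le; simp)+
  have "I = (\<integral>\<^sup>+y. ennreal (D (T z' y, T z y)) \<partial>\<mu>)" unfolding I_def by (intro nn_integral_cong arg_cong[of _ _ ennreal] D_swap)
  then have 2: "\<forall>\<^sub>F n in sequentially. It n f z' <= It n f z + ((1 - M) + I + ennreal eps)"
   unfolding M_def using overlap_one_sided[OF s _ _ f eps, of z' z] le by simp
  show "\<forall>\<^sub>F n in sequentially.
   near n f v (enn2real ((1 - M) + I) + eps)"
   unfolding v e fst_conv snd_conv by (rule eventually_conj[OF 1 2])
 qed simp
 from D_le[OF this] D1 have "1 <= enn2real ((1 - M) + I)" by simp
 then have "1 <= (1 - M) + I" by (subst K) simp
 then have "(1 - M) + M <= (1 - M) + I" using \<open>M <= 1\<close> by (simp add: diff_add_cancel_ennreal)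
 then have MI: "M <= I" by (simp add: ennreal_add_left_cancel_le)
 define d where "d = (%y. ennreal (D (T z y, T z' y)))"
 have d\<nu>[measurable]: "d \<in> bm \<nu>" unfolding d_def by (rule DT_measurable)
 then have d\<mu>[measurable]: "d \<in> bm \<mu>" by (simp only: bm)
 have d1: "d y <= 1" for y using D_le_1 by (simp add: d_def ennreal_le_1)
 have "(\<integral>\<^sup>+y. 1 - d y \<partial>\<mu>) + I = (\<integral>\<^sup>+y. (1 - d y) + d y \<partial>\<mu>)"
  unfolding I_def d_def[symmetric] by (rule nn_integral_add[symmetric]) measurable
 also have "... = M" unfolding M using d1 by (intro nn_integral_cong) (simp add: diff_add_cancel_ennreal)
 also have "... <= 0 + I" using MI by simp
 finally have "I + (\<integral>\<^sup>+y. 1 - d y \<partial>\<mu>) <= I + 0" by (simp only: add.commute)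
 then have "(\<integral>\<^sup>+y. 1 - d y \<partial>\<mu>) <= 0" using fin(2) by (simp only: ennreal_add_left_cancel_le) auto
 then have "(\<integral>\<^sup>+y. 1 - d y \<partial>\<mu>) = 0" by simp
 then have "AE y in \<mu>. 1 - d y = 0" by (subst (asm) nn_integral_0_iff_AE) measurable
 then have "AE y in \<nu>. 0 < ennreal (min (g ?x y) (g ?x' y)) --> 1 - d y = 0"
  unfolding \<mu>_def by (subst (asm) AE_density) measurable
 then have "AE y in \<nu>. 0 < ennreal (min (g ?x y) (g ?x' y)) --> 1 - ennreal (D (T z y, T z' y)) = 0"
  by (simp only: d_def)
 then have "AE y in \<nu>. 0 < ennreal (g ?x y) --> D (T z y, T z' y) = 1"
  using AE_space
 proof eventually_elim
  case (elim y)
  then have "1 - ennreal (D (T z y, T z' y)) = 0" using g_pos by simp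
  then have "ennreal (1 - D (T z y, T z' y)) = 0" using ennreal_minus[OF D_nonneg, of 1 "(T z y, T z' y)"] by simp
  then show ?case using D_le_1[of "(T z y, T z' y)"] by (simp add: ennreal_eq_0_iff)
 qed
 then show ?thesis unfolding v dkernel_def by (subst AE_density) (simp_all add: upd2_def)
qed

lemma B_fst: "(B ^^ n) (%w. f (fst w)) v = (R ^^ n) f (fst v)"
proof (induction n arbitrary: v)
 case (Suc n)
 have "B (%w. F (fst w)) v = R F (fst v)" for F by (simp add: step_def upd2_def)
 moreover have "(B ^^ n) (%w. f (fst w)) = (%w. (R ^^ n) f (fst w))" using Suc by auto
 ultimately show ?case by simp
qed simp

definition tight :: "('x, 'u) vec2 => bool" where
 "tight z \<longleftrightarrow> (\<forall>eps>0. \<exists>K N. compact K & (\<forall>n\<ge>N. (R ^^ n) (indicator (- K)) z <= ennreal eps))"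

lemma D_near_compact:
 assumes "compact K" shows "\<exists>\<delta>>0. \<forall>a\<in>K. \<forall>b. dist a b < \<delta> --> D (a, b) ~= 1"
proof (rule ccontr)
 assume neg: "\<not> ?thesis"
 have "\<exists>a b. a \<in> K & dist a b < 1 / real (Suc n) & D (a, b) = 1" for n
  using neg by (meson of_nat_0_less_iff zero_less_Suc zero_less_divide_1_iff)
 then obtain a c where ac: "!!n. a n \<in> K" "!!n. dist (a n) (c n) < 1 / real (Suc n)" "!!n. D (a n, c n) = 1" by metis
 from assms ac(1) obtain l r where r: "strict_mono r" "(a \<circ> r) \<longlonglongrightarrow> l"
  unfolding compact_eq_seq_compact_metric seq_compact_def by blast
 have "(%n. dist ((a \<circ> r) n) ((c \<circ> r) n)) \<longlonglongrightarrow> 0"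
 proof (rule tendsto_sandwich[OF always_eventually always_eventually tendsto_const])
  show "(%n. 1 / real (Suc (r n))) \<longlonglongrightarrow> 0"
   using LIMSEQ_subseq_LIMSEQ[OF lim_1_over_n[THEN LIMSEQ_Suc] r(1)] by (simp add: comp_def)
 qed (use ac(2) in \<open>auto intro: less_imp_le\<close>)
 then have "(%n. dist ((a \<circ> r) n) ((c \<circ> r) n) + dist ((a \<circ> r) n) l) \<longlonglongrightarrow> 0 + 0"
  by (rule tendsto_add) (rule tendsto_dist_iff[THEN iffD1, OF r(2)])
 then have lim: "(%n. dist ((a \<circ> r) n) ((c \<circ> r) n) + dist ((a \<circ> r) n) l) \<longlonglongrightarrow> 0" by simp
 have "(c \<circ> r) \<longlonglongrightarrow> l"
 proof (rule tendsto_dist_iff[THEN iffD2], rule tendsto_sandwich[OF always_eventually always_eventually tendsto_const lim])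
  show "\<forall>n. dist ((c \<circ> r) n) l <= dist ((a \<circ> r) n) ((c \<circ> r) n) + dist ((a \<circ> r) n) l"
   by (metis dist_commute dist_triangle)
 qed simp
 then have "(%n. ((a \<circ> r) n, (c \<circ> r) n)) \<longlonglongrightarrow> (l, l)" using r(2) by (intro tendsto_Pair)
 then have "(%n. D ((a \<circ> r) n, (c \<circ> r) n)) \<longlonglongrightarrow> D (l, l)"
  by (rule continuous_on_tendsto_compose[OF D_continuous]) auto
 then show False by (simp add: ac(3) D_diag LIMSEQ_const_iff)
qed

text \<open>Under \<open>B\<close> the event \<open>D = 1\<close> persists almost surely, while the
  copies approach each other along every input sequence. At a late time the first copy is in
  \<open>K\<close> with probability at least 1/2, which contradicts \<open>D_near_compact\<close>;
  \<open>z'\<close> is arbitrary.\<close>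

lemma D_less_1: assumes "tight z" shows "D (z, z') < 1"
proof (rule ccontr)
 assume "\<not> D (z, z') < 1"
 then have D1: "D (z, z') = 1" using D_le_1[of "(z, z')"] by simp
 let ?F = "indicator {v. D v = 1} :: ('x, 'u) vec4 => ennreal"
 have F1: "(B ^^ n) ?F v = 1" if "D v = 1" for n v
  using that
 proof (induction n arbitrary: v)
  case (Suc n)
  have "B ((B ^^ n) ?F) v = (\<integral>\<^sup>+y. (B ^^ n) ?F (T2 v y) \<partial>G (fst v))" by (simp add: step_def)
  also have "... = (\<integral>\<^sup>+y. 1 \<partial>G (fst v))"
  proof (rule nn_integral_cong_AE)
   show "AE y in G (fst v). (B ^^ n) ?F (T2 v y) = 1" using D_step[OF Suc.prems] by eventually_elim (rule Suc.IH)
  qed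
  also have "... = 1" using prob_space.emeasure_space_1[OF prob_G] by simp
  finally show ?case by simp
 qed simp
 obtain K N where K: "compact K" "\<forall>n\<ge>N. (R ^^ n) (indicator (- K)) z <= ennreal (1/2)"
  using assms unfolding tight_def by (meson half_gt_zero_iff zero_less_one)
 obtain \<delta> where \<delta>: "0 < \<delta>" "\<forall>a\<in>K. \<forall>b. dist a b < \<delta> --> D (a, b) ~= 1" using D_near_compact[OF K(1)] by blast
 obtain N' where N': "\<forall>n\<ge>N'. \<forall>om. dist (run T z om n) (run T z' om n) < \<delta>" using run_merge[OF \<delta>(1)] by blast
 let ?n = "max N N'"
 have "1 = (B ^^ ?n) ?F (z, z')" using F1[OF D1] by simp
 \<comment> \<open>On every path the copies are within \<open>\<delta>\<close> of each other at this
   time, so \<open>D = 1\<close> forces the first copy out of \<open>K\<close>.\<close>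
 also have "... <= (B ^^ ?n) (%w. indicator (- K) (fst w)) (z, z')"
 proof (rule B.step_pow_mono_run)
  fix om
  let ?w = "run T2 (z, z') om ?n"
  have "fst ?w \<notin> K" if "D ?w = 1"
  proof
   assume "fst ?w \<in> K"
   moreover have "dist (fst ?w) (snd ?w) < \<delta>" using N' by (simp add: run_upd2)
   ultimately have "D (fst ?w, snd ?w) ~= 1" using \<delta>(2) by blast
   then show False using that by simp
  qed
  then show "?F ?w <= indicator (- K) (fst ?w)" by (simp add: indicator_def)
 qed
 also have "... = (R ^^ ?n) (indicator (- K)) z" by (simp add: B_fst)
 also have "... <= ennreal (1/2)" using K(2) by simp
 also have "... < 1" by (simp only: ennreal_1[symmetric], rule ennreal_lessI) auto
 finally show False by simp
qed

end

subsection \<open>Tightness and existence\<close>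

lemma compact_coords:
 fixes K :: "'a::topological_space set"
 assumes "compact K" shows "compact {f::nat => 'a. (\<forall>k\<in>I. f k \<in> K) & (\<forall>k. k \<notin> I --> f k = undefined)}"
proof -
 have "{f::nat => 'a. (\<forall>k\<in>I. f k \<in> K) & (\<forall>k. k \<notin> I --> f k = undefined)} = PiE UNIV (%k. if k \<in> I then K else {undefined})"
  by (auto simp: PiE_def Pi_def split: if_splits)
 moreover have "compactin (product_topology (%_. euclidean) UNIV) (PiE UNIV (%k. if k \<in> I then K else {undefined :: 'a}))"
  unfolding compactin_PiE using assms by (auto simp: compactin_euclidean_iff)
 ultimately show ?thesis by (simp add: euclidean_product_topology compactin_euclidean_iff)
qed

context od_stable
begin

text \<open>A single law on a Polish space is tight, \<open>total_variation\<close> transfers its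
  compact set to a whole neighbourhood of \<open>x\<close>, and finitely many neighbourhoods cover
  \<open>K\<close>.\<close>

lemma input_tight:
 assumes K: "compact K" and e: "0 < (e::real)"
 shows "\<exists>L. compact L & (\<forall>x\<in>K. (\<integral>\<^sup>+y. indicator (- L) (ups y) \<partial>dkernel \<nu> g x) <= ennreal e)"
proof -
 have e2: "0 < e / 2" using e by simp
 have "\<exists>L r. compact L & 0 < r & (\<forall>x'. dist x x' < r --> (\<integral>\<^sup>+y. indicator (- L) (ups y) \<partial>dkernel \<nu> g x') <= ennreal e)" for x
 proof -
  interpret G: prob_space "dkernel \<nu> g x" by (rule prob_G)
  have Ym: "ups \<in> dkernel \<nu> g x \<rightarrow>\<^sub>M borel" by (simp add: dkernel_def)
  interpret N: prob_space "distr (dkernel \<nu> g x) borel ups" by (rule G.prob_space_distr[OF Ym])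
  have "emeasure (distr (dkernel \<nu> g x) borel ups) UNIV = (SUP L\<in>{L. L \<subseteq> UNIV & compact L}. emeasure (distr (dkernel \<nu> g x) borel ups) L)"
   by (rule inner_regular) (simp_all add: N.emeasure_finite)
  moreover have "emeasure (distr (dkernel \<nu> g x) borel ups) UNIV = 1" using N.emeasure_space_1 by simp
  ultimately have "ennreal (1 - e / 2) < (SUP L\<in>{L. L \<subseteq> UNIV & compact L}. emeasure (distr (dkernel \<nu> g x) borel ups) L)"
   using e2 by (simp only: ennreal_1[symmetric]) (simp add: ennreal_less_one_iff)
  then obtain L where L: "compact L" "ennreal (1 - e / 2) < emeasure (distr (dkernel \<nu> g x) borel ups) L" unfolding less_SUP_iff by blast
  have LC: "L \<in> sets borel" using compact_imp_closed[OF L(1)] by simp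
  have Lm[measurable]: "L \<in> sets borel" "- L \<in> sets borel" using LC by auto
  have "(\<integral>\<^sup>+y. indicator (- L) (ups y) \<partial>dkernel \<nu> g x) = (\<integral>\<^sup>+u. indicator (- L) u \<partial>distr (dkernel \<nu> g x) borel ups)"
   by (rule nn_integral_distr[symmetric, OF Ym]) measurable
  also have "... = emeasure (distr (dkernel \<nu> g x) borel ups) (- L)" by simp
  also have "... = ennreal (1 - N.prob L)"
   using N.prob_compl[of L] LC by (simp add: N.emeasure_eq_measure Compl_eq_Diff_UNIV)
  also have "... <= ennreal (e / 2)"
  proof (rule ennreal_leI)
   have "ennreal (1 - e / 2) < ennreal (N.prob L)" using L(2) by (simp only: N.emeasure_eq_measure)
   then have "1 - e / 2 < N.prob L" by (meson ennreal_leI leI not_le)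
   then show "1 - N.prob L <= e / 2" by simp
  qed
  finally have Le: "(\<integral>\<^sup>+y. indicator (- L) (ups y) \<partial>dkernel \<nu> g x) <= ennreal (e / 2)" .
  obtain r0 M where M: "0 < r0" "!!x'. dist x' x < r0 ==> WX (x, x') <= M" using WX_bound by blast
  \<comment> \<open>Within this radius \<open>1 - \<alpha>\<close> is at most \<open>e / 2\<close>;
    the added one keeps the denominator positive.\<close>
  define r where "r = min r0 (e / 2 / (\<bar>M\<bar> + 1))"
  have r: "0 < r" using M(1) e2 by (simp add: r_def)
  have "(\<integral>\<^sup>+y. indicator (- L) (ups y) \<partial>dkernel \<nu> g x') <= ennreal e" if x': "dist x x' < r" for x'
  proof -
   have "1 - \<alpha> (x, x') <= dist x x' * WX (x, x')" by (rule \<alpha>_WX)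
   also have "... <= (e / 2 / (\<bar>M\<bar> + 1)) * (\<bar>M\<bar> + 1)"
   proof (rule mult_mono)
    show "dist x x' <= e / 2 / (\<bar>M\<bar> + 1)" using x' by (simp add: r_def)
    have "WX (x, x') <= M" using x' by (intro M(2)) (simp add: r_def dist_commute)
    then show "WX (x, x') <= \<bar>M\<bar> + 1" by linarith
    show "0 <= WX (x, x')" using WX1[of "(x, x')"] by linarith
   qed (use e2 in simp)
   also have "... = e / 2" by (rule nonzero_eq_divide_eq[THEN iffD1, OF _ refl]) linarith
   finally have a: "1 - \<alpha> (x, x') <= e / 2" .
   have "(\<integral>\<^sup>+y. indicator (- L) (ups y) \<partial>dkernel \<nu> g x') <= (\<integral>\<^sup>+y. indicator (- L) (ups y) \<partial>dkernel \<nu> g x) + ennreal (1 - \<alpha> (x, x'))"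
    by (rule total_variation) (auto simp: indicator_def)
   also have "... <= ennreal (e / 2) + ennreal (e / 2)" by (intro add_mono Le ennreal_leI a)
   also have "... = ennreal e" using e2 by (subst ennreal_plus[symmetric]) auto
   finally show ?thesis .
  qed
  then show ?thesis using L(1) r by blast
 qed
 then obtain L r where L: "!!x. compact (L x)" "!!x. 0 < r x"
  "!!x x'. dist x x' < r x ==> (\<integral>\<^sup>+y. indicator (- L x) (ups y) \<partial>dkernel \<nu> g x') <= ennreal e" by metis
 have "K \<subseteq> (\<Union>x\<in>K. ball x (r x))" using L(2) by force
 then obtain A where A: "A \<subseteq> K" "finite A" "K \<subseteq> (\<Union>x\<in>A. ball x (r x))"
  using compactE_image[OF K, of K "%x. ball x (r x)"] by auto
 have "(\<integral>\<^sup>+y. indicator (- (\<Union>a\<in>A. L a)) (ups y) \<partial>dkernel \<nu> g x) <= ennreal e" if xK: "x \<in> K" for x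
 proof -
  obtain a where a: "a \<in> A" "dist a x < r a" using A(3) xK by auto
  have "(\<integral>\<^sup>+y. indicator (- (\<Union>a\<in>A. L a)) (ups y) \<partial>dkernel \<nu> g x) <= (\<integral>\<^sup>+y. indicator (- L a) (ups y) \<partial>dkernel \<nu> g x)"
   using a(1) by (intro nn_integral_mono) (auto simp: indicator_def)
  also have "... <= ennreal e" by (rule L(3)[OF a(2)])
  finally show ?thesis .
 qed
 then show ?thesis using A(2) L(1) by (intro exI[of _ "\<Union>a\<in>A. L a"] conjI compact_UN) auto
qed

lemma tightness:
 assumes Vz: "V z < \<infinity>" and eps: "0 < (eps::real)"
 shows "\<exists>K. compact K & (\<forall>n\<ge>p + q + m. (R ^^ n) (indicator (- K)) z <= ennreal eps)"
proof -
 \<comment> \<open>The number of functions in the bound \<open>cover\<close>: one for vectors that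
   are not extensional, \<open>p\<close> for states and \<open>q - 1\<close> for inputs.\<close>
 define N where "N = Suc 0 + (p * Suc 0 + (q - 1) * Suc 0)"
 \<comment> \<open>The final bound has \<open>N * (p + q + 1)\<close> terms of size
   \<open>2 * e\<close>, which then add up to \<open>eps\<close>.\<close>
 define e where "e = eps / (2 * (real N * real (p + q + 1)))"
 have Ne: "0 < real N * real (p + q + 1)" by (simp add: N_def)
 have e: "0 < e" using eps Ne by (simp add: e_def)
 have eN: "real N * (real (p + q + 1) * (e + e)) = eps"
 proof -
  let ?Z = "2 * (real N * real (p + q + 1))"
  have "real N * (real (p + q + 1) * (e + e)) = ?Z * e" by (simp only: distrib_left distrib_right mult_2 mult.assoc)
  also have "... = eps"
   unfolding e_def times_divide_eq_right by (rule nonzero_mult_div_cancel_left) (use Ne in linarith)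
  finally show ?thesis .
 qed
 define v0 where "v0 = enn2real (V z)"
 have v0: "V z = ennreal v0" "0 <= v0" using Vz by (simp_all add: v0_def)
 \<comment> \<open>By Markov's inequality and \<open>VX_moment\<close> this level is exceeded with
   probability at most \<open>e\<close>; the added one makes \<open>M\<close> positive.\<close>
 define M where "M = C * (1 + v0) / e + 1"
 have M: "0 < M" "C * (1 + v0) / M <= e"
 proof -
  have c: "0 <= C * (1 + v0)" using mbC v0(2) by simp
  then show M0: "0 < M" using e by (simp add: M_def add_nonneg_pos)
  have "e * (C * (1 + v0) / e) = C * (1 + v0)" unfolding times_divide_eq_right using e by (intro nonzero_mult_div_cancel_left) simp
  then have "C * (1 + v0) <= e * M" using e unfolding M_def distrib_left[of e "_ / _"] by simp
  then show "C * (1 + v0) / M <= e" using M0 by (simp add: pos_divide_le_eq mult.commute)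
 qed
 define Kx where "Kx = {x. VX x <= M}"
 have Kx: "compact Kx" unfolding Kx_def by (rule VX_compact[OF M(1)])
 obtain Ku where Ku: "compact Ku" "\<forall>x\<in>Kx. (\<integral>\<^sup>+y. indicator (- Ku) (ups y) \<partial>dkernel \<nu> g x) <= ennreal e"
  using input_tight[OF Kx e] by blast
 have [measurable]: "- Kx \<in> sets borel" "- Ku \<in> sets borel" using compact_imp_closed[OF Kx] compact_imp_closed[OF Ku(1)] by auto
 \<comment> \<open>Dominates both the event that the current state is outside of \<open>Kx\<close>
   and the probability that its reduced observation is outside of \<open>Ku\<close>: inside
   \<open>Kx\<close> the latter is at most \<open>e\<close>, and elsewhere the first summand is
   1.\<close>
 define f where "f = (%z::('x, 'u) vec2. indicator (- Kx) (fst z p) + ennreal e)"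
 define K where "K = {f. (\<forall>k\<in>{1..p}. f k \<in> Kx) & (\<forall>k. k \<notin> {1..p} --> f k = undefined)} \<times> {f. (\<forall>k\<in>{1..<q}. f k \<in> Ku) & (\<forall>k. k \<notin> {1..<q} --> f k = undefined)}"
 have cK: "compact K" unfolding K_def by (intro compact_Times compact_coords Kx Ku(1))
 let ?O = "space (Zsp p q) :: ('x, 'u) vec2 set"
 have Om: "?O \<in> sets borel"
 proof -
  have "?O = (\<Inter>k\<in>-{1..p}. {z. fst z k = undefined}) \<inter> (\<Inter>k\<in>-{1..<q}. {z. snd z k = undefined})"
   by (auto simp: space_Zsp PiE_def extensional_def)
  also have "closed ..."
   by (intro closed_Int closed_INT ballI closed_Collect_eq vec2_coord_continuous continuous_on_const)
  finally show ?thesis by (rule borel_closed)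
 qed
 let ?A = "%z. indicator (- ?O) z :: ennreal"
 let ?X = "%k (z::('x, 'u) vec2). indicator (- Kx) (fst z k) :: ennreal" and ?U = "%l (z::('x, 'u) vec2). indicator (- Ku) (snd z l) :: ennreal"
 have Am: "?A \<in> bm borel" using Om by measurable
 have Xm: "?X k \<in> bm borel" for k by (rule x_fun_measurable[of "indicator (- Kx)"]) measurable
 have Um: "?U l \<in> bm borel" for l by (rule u_fun_measurable[of "indicator (- Ku)"]) measurable
 have A: "delayed (p + q) (Suc 0) f ?A"
  using delayed_step[of 1 "p + q" ?A f] p1 by (simp add: step_def indicator_def)
 have X: "delayed (p + q) (Suc 0) f (?X k)" if "k \<in> {1..p}" for k
  using delayed_step[of "p - k" "p + q" "?X k" f] step_x_coord[OF that, of "indicator (- Kx)"] by (simp add: f_def)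
 have U: "delayed (p + q) (Suc 0) f (?U l)" if l: "l \<in> {1..<q}" for l
 proof -
  have "(\<integral>\<^sup>+y. indicator (- Ku) (ups y) \<partial>G z) <= f z" for z
  proof (cases "fst z p \<in> Kx")
   case True
   then show ?thesis using Ku(2) by (simp add: f_def)
  next
   case False
   have "(\<integral>\<^sup>+y. indicator (- Ku) (ups y) \<partial>G z) <= (\<integral>\<^sup>+y. 1 \<partial>G z)" by (intro nn_integral_mono) (simp add: indicator_def)
   also have "... = 1" using prob_space.emeasure_space_1[OF prob_G] by simp
   also have "... <= f z" using False by (simp add: f_def)
   finally show ?thesis .
  qed
  then show ?thesis using delayed_step[of "q - l" "p + q" "?U l" f] step_u_coord[OF l, of "indicator (- Ku)" f] by simp
 qed
 have cover: "indicator (- K) z <= ?A z + ((\<Sum>k\<in>{1..p}. ?X k z) + (\<Sum>l\<in>{1..<q}. ?U l z))" for z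
 proof (cases "z \<in> - K")
  case True
  consider "z \<notin> ?O" | k where "k \<in> {1..p}" "fst z k \<notin> Kx" | l where "l \<in> {1..<q}" "snd z l \<notin> Ku"
   using True unfolding K_def by (cases z) (auto simp: space_Zsp PiE_def extensional_def)
  then have "1 <= ?A z + ((\<Sum>k\<in>{1..p}. ?X k z) + (\<Sum>l\<in>{1..<q}. ?U l z))"
  proof cases
   case 1
   then show ?thesis by (simp add: add_increasing2)
  next
   case (2 k)
   have "1 <= (\<Sum>k\<in>{1..p}. ?X k z)" using member_le_sum[of k "{1..p}" "%k. ?X k z"] 2 by simp
   then show ?thesis by (intro add_increasing[OF zero_le] add_increasing2[OF zero_le])
  next
   case (3 l)
   have "1 <= (\<Sum>l\<in>{1..<q}. ?U l z)" using member_le_sum[of l "{1..<q}" "%l. ?U l z"] 3 by simp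
   then show ?thesis by (intro add_increasing[OF zero_le] add_increasing[OF zero_le])
  qed
  then show ?thesis using True by simp
 qed simp
 have XS: "delayed (p + q) (p * Suc 0) f (%z. \<Sum>k\<in>{1..p}. ?X k z)"
  using delayed_sum[of "{1..p}" "p + q" "Suc 0" f ?X] X Xm by simp
 have US: "delayed (p + q) ((q - 1) * Suc 0) f (%z. \<Sum>l\<in>{1..<q}. ?U l z)"
  using delayed_sum[of "{1..<q}" "p + q" "Suc 0" f ?U] U Um by simp
 have XSm: "(%z. \<Sum>k\<in>{1..p}. ?X k z) \<in> bm borel" "(%z. \<Sum>l\<in>{1..<q}. ?U l z) \<in> bm borel"
  by (intro borel_measurable_sum Xm Um)+
 have "delayed (p + q) N f (indicator (- K))"
  unfolding N_def by (rule delayed_mono[OF delayed_add[OF A delayed_add[OF XS US XSm] Am borel_measurable_add[OF XSm]] cover])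
 note dom = this[unfolded delayed_def, rule_format]
 have fk: "(R ^^ k) f z <= ennreal (e + e)" if k: "m <= k" for k
 proof -
  let ?v = "%z::('x, 'u) vec2. ennreal (VX (fst z p))"
  have vm: "?v \<in> bm borel" by (rule x_fun_measurable) measurable
  have "(R ^^ k) f z = (R ^^ k) (?X p) z + ennreal e"
   unfolding f_def by (subst step_pow_add[OF Xm]) (simp_all add: step_pow_const)
  also have "(R ^^ k) (?X p) z <= (R ^^ k) (%z. ennreal (1 / M) * ?v z) z"
  proof (rule step_pow_mono)
   fix z :: "('x, 'u) vec2"
   have "1 <= 1 / M * VX (fst z p)" if "fst z p \<notin> Kx" using that M(1) by (simp add: Kx_def)
   then show "?X p z <= ennreal (1 / M) * ?v z"
    using M(1) by (auto simp: indicator_def ennreal_mult'[symmetric] ennreal_leI simp flip: ennreal_1)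
  qed
  also have "... = ennreal (1 / M) * (R ^^ k) ?v z" by (simp only: step_pow_cmult[OF vm])
  also have "... <= ennreal (1 / M) * (ennreal C * (1 + V z))" by (intro mult_left_mono VX_moment[OF k]) simp
  also have "... = ennreal (1 / M * (C * (1 + v0)))"
  proof -
   have "ennreal (1 / M * (C * (1 + v0))) = ennreal (1 / M) * ennreal (C * (1 + v0))" using v0 mbC M(1) by (intro ennreal_mult) auto
   also have "ennreal (C * (1 + v0)) = ennreal C * ennreal (1 + v0)" using v0 mbC by (intro ennreal_mult) auto
   also have "ennreal (1 + v0) = 1 + V z" using v0 by simp
   finally show ?thesis by (rule sym)
  qed
  also have "... <= ennreal e" using M(2) by (intro ennreal_leI) simp
  finally have "(R ^^ k) f z <= ennreal e + ennreal e" by (simp only: add_right_mono)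
  then show ?thesis using ennreal_plus[of e e] e by (simp only: less_imp_le)
 qed
 have "(R ^^ n) (indicator (- K)) z <= ennreal eps" if n: "p + q + m <= n" for n
 proof -
  have "(R ^^ n) (indicator (- K)) z <= of_nat N * (\<Sum>i\<le>p + q. (R ^^ (n - i)) f z)" using n by (intro dom) simp
  also have "... <= of_nat N * (\<Sum>i\<le>p + q. ennreal (e + e))" using n by (intro mult_left_mono sum_mono fk) auto
  also have "... = ennreal (real N * (real (p + q + 1) * (e + e)))"
   using e by (simp add: ennreal_mult ennreal_of_nat_eq_real_of_nat del: ennreal_plus of_nat_add of_nat_Suc)
  also have "... = ennreal eps" by (simp only: eN)
  finally show ?thesis .
 qed
 then show ?thesis using cK by blast
qed

lemma tight_V: "V z < \<infinity> ==> tight z"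
 unfolding tight_def using tightness by blast

lemma VU_finite: "AE y in dkernel \<nu> g x. ennreal (VU (ups y)) / cV ~= top"
proof -
 have um: "(%y. ennreal (VU (ups y)) / cV) \<in> bm (dkernel \<nu> g x)" unfolding borel_dkernel by measurable
 have "(\<integral>\<^sup>+y. ennreal (VU (ups y)) / cV \<partial>dkernel \<nu> g x) ~= top" using VU_bound[of x] by (auto simp: top_unique)
 then show ?thesis using nn_integral_PInf_AE[OF um] by simp
qed

text \<open>Inputs may have infinite weight, but almost surely an observation has finite weight;
  constant vectors built from one of these give a starting point with tight laws.\<close>

lemma ex_V_finite: "\<exists>z. V z < \<infinity>"
proof -
 fix x :: 'x
 obtain y where y: "ennreal (VU (ups y)) / cV ~= top"
  using eventually_happens'[OF prob_space.ae_filter_bot[OF prob_G[of x]] VU_finite] by blast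
 have "V (%_. x, %_. ups y) <= (\<Sum>k=1..p. ennreal (VX x)) + (\<Sum>l\<in>{1..<q}. ennreal (VU (ups y)) / cV)"
  using V_Z_le_sum[of VX VU cV "(%_. x, %_. ups y)"] by simp
 also have "... < \<infinity>" using y by (simp add: less_top[symmetric] ennreal_mult_eq_top_iff)
 finally show ?thesis by blast
qed

end

section \<open>Existence of an invariant law and its moment\<close>

context od_stable
begin

definition Kern :: "('x, 'u) vec2 => ('x, 'u) vec2 measure" where
 "Kern z = distr (G z) borel (T z)"

lemma T_measurable_G: "T z \<in> G z \<rightarrow>\<^sub>M borel"
 using update1[of z] by (simp add: dkernel_def)

lemma Kern_prob: "prob_space (Kern z)"
 unfolding Kern_def by (rule prob_space.prob_space_distr[OF prob_G T_measurable_G])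

lemma Kern_measurable: "Kern \<in> borel \<rightarrow>\<^sub>M prob_algebra borel"
proof (rule measurable_prob_algebraI)
 show "Kern \<in> borel \<rightarrow>\<^sub>M subprob_algebra borel"
  unfolding Kern_def by (rule measurable_distr2[OF update kernel_sub])
qed (rule Kern_prob)

lemma nn_integral_Kern: "F \<in> bm borel ==> (\<integral>\<^sup>+w. F w \<partial>Kern z) = R F z"
 unfolding Kern_def step_def by (rule nn_integral_distr[OF T_measurable_G]) simp

text \<open>For continuous \<open>f\<close> the change of \<open>R f\<close> is at most the failure
  probability \<open>ab\<close> plus the mean change of \<open>f\<close> under common observations
  of law \<open>G z\<close>; both vanish at the diagonal.\<close>

lemma R_feller:
 assumes f: "continuous_on UNIV f" "!!z. 0 <= f z & f z <= (1::real)"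
 shows "continuous_on UNIV (%z. \<integral>w. f w \<partial>Kern z)"
proof (rule continuous_on_sequentiallyI)
 fix s :: "nat => ('x, 'u) vec2" and z assume s: "s \<longlonglongrightarrow> z"
 let ?f = "%z. ennreal (f z)"
 let ?\<Delta> = "%v. ennreal \<bar>f (fst v) - f (snd v)\<bar>"
 have fm[measurable]: "f \<in> bm borel" by (rule borel_measurable_continuous_onI[OF f(1)])
 have fm'[measurable]: "?f \<in> bm borel" by measurable
 have \<Delta>m: "?\<Delta> \<in> bm borel"
  by (intro mcomp[OF _ measurable_ennreal] borel_measurable_continuous_onI continuous_on_rabs continuous_on_diff
    continuous_on_compose2[OF f(1)] continuous_on_fst continuous_on_snd continuous_on_id) auto
 have \<Delta>1: "?\<Delta> v <= 1" for v using f(2)[of "fst v"] f(2)[of "snd v"] by (simp add: ennreal_le_1 abs_le_iff)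
 have "vanishing (%_ _. True) ?\<Delta>"
  unfolding vanishing_def
 proof (intro allI impI)
  fix z and s :: "nat => ('x, 'u) vec2" assume "s \<longlonglongrightarrow> z"
  then have "(%i. f (s i)) \<longlonglongrightarrow> f z" by (rule continuous_on_tendsto_compose[OF f(1)]) auto
  then have "(%i. ennreal \<bar>f z - f (s i)\<bar>) \<longlonglongrightarrow> ennreal \<bar>f z - f z\<bar>"
   by (intro tendsto_ennrealI tendsto_rabs tendsto_diff tendsto_const)
  then show "(%i. ?\<Delta> (z, s i)) \<longlonglongrightarrow> 0" by simp
 qed
 from vanishing_B[OF \<Delta>m \<Delta>1 this, of "%_ _. True"] have "vanishing (%_ _. True) (B ?\<Delta>)" by simp
 from vanishing_add[OF ab_vanishing this] s
 have e0: "(%i. ab (z, s i) + B ?\<Delta> (z, s i)) \<longlonglongrightarrow> 0" unfolding vanishing_def by blast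
 let ?e = "%i. enn2real (ab (z, s i) + B ?\<Delta> (z, s i))"
 have B1: "B ?\<Delta> v <= 1" for v using B.step_mono[of ?\<Delta> "%_. 1" v] \<Delta>1 by (simp add: B.step_const)
 have ef: "ab (z, s i) + B ?\<Delta> (z, s i) < top" for i
  using le_less_trans[OF ab_le_1 ennreal_one_less_top] le_less_trans[OF B1 ennreal_one_less_top] by simp
 have e0': "?e \<longlonglongrightarrow> 0" by (rule tendsto_enn2real) (use e0 in simp_all)
 \<comment> \<open>Both directions use the pair \<open>(z, w)\<close> in this order, so that the
   error is an integral over observations of the fixed point \<open>z\<close>.\<close>
 have cmp: "R ?f a <= R ?f c + (ab (z, w) + B ?\<Delta> (z, w))" if ac: "a = z & c = w \<or> a = w & c = z" for a c w
 proof -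
  let ?x = "fst z p" and ?x' = "fst w p"
  have F1: "ennreal (f u) <= 1" for u using f(2) by (simp add: ennreal_le_1)
  have "R ?f a = (\<integral>\<^sup>+y. ?f (T a y) \<partial>dkernel \<nu> g (fst a p))" by (simp add: step_def)
  also have "... <= (\<integral>\<^sup>+y. ?f (T c y) \<partial>dkernel \<nu> g (fst c p)) + ennreal (1 - \<alpha> (?x, ?x'))
    + ennreal (\<alpha> (?x, ?x')) * (\<integral>\<^sup>+y. ?f (T a y) - ?f (T c y) \<partial>dkernel \<nu> h (?x, ?x'))"
   by (rule alpha_coupling[OF f_run_measurable[OF fm'] f_run_measurable[OF fm'] F1]) (use ac in auto)
  also have "(\<integral>\<^sup>+y. ?f (T a y) - ?f (T c y) \<partial>dkernel \<nu> h (?x, ?x')) <= (\<integral>\<^sup>+y. ?\<Delta> (T2 (z, w) y) \<partial>dkernel \<nu> h (?x, ?x'))"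
  proof (rule nn_integral_mono)
   fix y
   have "?f (T a y) - ?f (T c y) = ennreal (f (T a y) - f (T c y))" using f(2) by (intro ennreal_minus) simp
   also have "... <= ?\<Delta> (T2 (z, w) y)" using ac by (intro ennreal_leI) (auto simp: upd2_def)
   finally show "?f (T a y) - ?f (T c y) <= ?\<Delta> (T2 (z, w) y)" .
  qed
  also have "ennreal (\<alpha> (?x, ?x')) * (\<integral>\<^sup>+y. ?\<Delta> (T2 (z, w) y) \<partial>dkernel \<nu> h (?x, ?x')) <= (\<integral>\<^sup>+y. ?\<Delta> (T2 (z, w) y) \<partial>dkernel \<nu> g ?x)"
   by (rule alpha_h_le(1)) (rule mcomp[OF C.update1 \<Delta>m])
  finally show ?thesis by (simp add: step_def ab_def pairp_def add.assoc add_left_mono mult_left_mono)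
 qed
 have R1: "R ?f w <= 1" for w using step_mono[of ?f "%_. 1" w] f(2) by (simp add: step_const ennreal_le_1)
 have Rf: "R ?f w = ennreal (enn2real (R ?f w))" for w using le_less_trans[OF R1 ennreal_one_less_top, of w] by simp
 have int: "(\<integral>w. f w \<partial>Kern u) = enn2real (R ?f u)" for u
 proof -
  have "(\<integral>w. f w \<partial>Kern u) = enn2real (\<integral>\<^sup>+w. ?f w \<partial>Kern u)"
   using f(2) by (intro integral_eq_nn_integral) (auto simp: Kern_def)
  then show ?thesis by (simp only: nn_integral_Kern[OF fm'])
 qed
 have rcmp: "enn2real (R ?f a) <= enn2real (R ?f c) + ?e i" if "R ?f a <= R ?f c + (ab (z, s i) + B ?\<Delta> (z, s i))" for a c i
 proof -
  have "ennreal (enn2real (R ?f a)) <= ennreal (enn2real (R ?f c)) + ennreal (?e i)"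
   using that ef[of i] by (simp only: Rf[symmetric] ennreal_enn2real)
  also have "... = ennreal (enn2real (R ?f c) + ?e i)" by (rule ennreal_plus[symmetric]) auto
  finally show ?thesis by (subst (asm) ennreal_le_iff) auto
 qed
 have "\<bar>enn2real (R ?f (s i)) - enn2real (R ?f z)\<bar> <= ?e i" for i
  using rcmp[OF cmp, of "s i" z i] rcmp[OF cmp, of z "s i" i] by (simp add: abs_le_iff)
 then have "(%i. enn2real (R ?f (s i)) - enn2real (R ?f z)) \<longlonglongrightarrow> 0"
  by (intro Lim_null_comparison[OF always_eventually e0']) auto
 then show "(%i. \<integral>w. f w \<partial>Kern (s i)) \<longlonglongrightarrow> (\<integral>w. f w \<partial>Kern z)" by (simp add: int LIM_zero_iff)
qed

lemma bind_Kern: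
 assumes "M \<in> space (prob_algebra borel)"
 shows "M \<bind> Kern \<in> space (prob_algebra borel)"
  and "F \<in> bm borel ==> (\<integral>\<^sup>+w. F w \<partial>(M \<bind> Kern)) = (\<integral>\<^sup>+z. R F z \<partial>M)"
proof -
 have M: "prob_space M" and s: "sets M = sets borel" using assms by (auto simp: space_prob_algebra)
 interpret M: prob_space M by (rule M)
 have K: "Kern \<in> M \<rightarrow>\<^sub>M subprob_algebra borel"
  using measurable_prob_algebraD[OF Kern_measurable] mcong[OF s refl, of "subprob_algebra borel"] by blast
 have "prob_space (M \<bind> Kern)" by (rule M.prob_space_bind[OF _ K]) (simp add: Kern_prob)
 moreover have "sets (M \<bind> Kern) = sets borel" by (rule sets_bind) (simp_all add: Kern_def M.not_empty)
 ultimately show "M \<bind> Kern \<in> space (prob_algebra borel)" by (simp add: space_prob_algebra)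
 show "(\<integral>\<^sup>+w. F w \<partial>(M \<bind> Kern)) = (\<integral>\<^sup>+z. R F z \<partial>M)" if "F \<in> bm borel"
  using nn_integral_bind[OF that K] nn_integral_Kern[OF that] by simp
qed

theorem ex_invariant: "\<exists>\<pi>. \<pi> \<in> space (prob_algebra borel) & invariant \<pi>"
proof -
 obtain z where z: "V z < \<infinity>" using ex_V_finite by blast
 define \<mu> where "\<mu> n = ((%M. M \<bind> Kern) ^^ n) (return borel z)" for n
 have \<mu>P: "\<mu> n \<in> space (prob_algebra borel)" for n
 proof (induction n)
  case 0
  show ?case by (simp add: \<mu>_def space_prob_algebra prob_space_return)
 next
  case (Suc n)
  then show ?case using bind_Kern(1) by (simp add: \<mu>_def)
 qed
 have \<mu>R: "(\<integral>\<^sup>+w. F w \<partial>\<mu> n) = (R ^^ n) F z" if "F \<in> bm borel" for F n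
  using that
 proof (induction n arbitrary: F)
  case 0
  then show ?case by (simp add: \<mu>_def nn_integral_return)
 next
  case (Suc n)
  have "(\<integral>\<^sup>+w. F w \<partial>\<mu> (Suc n)) = (\<integral>\<^sup>+w. F w \<partial>(\<mu> n \<bind> Kern))" by (simp add: \<mu>_def)
  also have "... = (\<integral>\<^sup>+w. R F w \<partial>\<mu> n)" by (rule bind_Kern(2)[OF \<mu>P Suc.prems])
  also have "... = (R ^^ n) (R F) z" by (rule Suc.IH[OF step_measurable[OF Suc.prems]])
  finally show ?case by (simp add: funpow_swap1)
 qed
 \<comment> \<open>The tightness estimate holds from this time on, so the averaged sequence of laws
   starts there.\<close>
 let ?N = "p + q + m"
 have "\<exists>\<pi>\<in>space (prob_algebra borel). \<pi> \<bind> Kern = \<pi>"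
 proof (rule krylov_bogoliubov[OF Kern_measurable, of "%n. \<mu> (?N + n)"])
  show "continuous_on UNIV (%z. \<integral>w. f w \<partial>Kern z)" if "f \<in> bcont" "!!x. 0 <= f x & f x <= 1" for f
   by (rule R_feller[OF bcontD(1)[OF that(1)] that(2)])
  show "\<mu> (?N + n) \<in> space (prob_algebra borel)" for n by (rule \<mu>P)
  show "\<mu> (?N + Suc n) = \<mu> (?N + n) \<bind> Kern" for n by (simp add: \<mu>_def)
  fix e :: real assume e: "0 < e"
  obtain K where K: "compact K" "\<forall>n\<ge>?N. (R ^^ n) (indicator (- K)) z <= ennreal e" using tightness[OF z e] by blast
  have Km: "- K \<in> sets borel" using compact_imp_closed[OF K(1)] by auto
  have "measure (\<mu> (?N + n)) (- K) <= e" for n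
  proof -
   have s: "sets (\<mu> (?N + n)) = sets borel" using \<mu>P[of "?N + n"] by (simp add: space_prob_algebra)
   have "emeasure (\<mu> (?N + n)) (- K) = (\<integral>\<^sup>+w. indicator (- K) w \<partial>\<mu> (?N + n))"
    using Km s by (intro nn_integral_indicator[symmetric]) simp
   also have "... = (R ^^ (?N + n)) (indicator (- K)) z" by (intro \<mu>R borel_measurable_indicator Km)
   also have "... <= ennreal e" using K(2) by simp
   finally show ?thesis using e unfolding measure_def by (intro enn2real_leI) auto
  qed
  then show "\<exists>C. compact C & (\<forall>n. measure (\<mu> (?N + n)) (- C) <= e)" using K(1) by blast
 qed
 then obtain \<pi> where \<pi>: "\<pi> \<in> space (prob_algebra borel)" "\<pi> \<bind> Kern = \<pi>" by blast
 have "invariant \<pi>"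
  unfolding invariant_def
 proof
  fix f :: "('x, 'u) vec2 => ennreal" assume "f \<in> bm borel"
  from bind_Kern(2)[OF \<pi>(1) this] show "(\<integral>\<^sup>+s. R f s \<partial>\<pi>) = (\<integral>\<^sup>+s. f s \<partial>\<pi>)" unfolding \<pi>(2) by (rule sym)
 qed
 then show ?thesis using \<pi>(1) by blast
qed

text \<open>The mean weight of an input is at most a finite value of \<open>VX\<close>, so after
  \<open>q - l\<close> steps an infinite weight in place \<open>l\<close> has probability 0 from
  every state. Invariance carries this over to the initial law.\<close>

lemma AE_V_finite:
 assumes \<pi>: "\<pi> \<in> space (prob_algebra borel)" and inv: "invariant \<pi>"
 shows "AE z in \<pi>. V z < \<infinity>"
proof -
 have s: "sets \<pi> = sets borel" using \<pi> by (simp add: space_prob_algebra)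
 have bm: "bm \<pi> = (bm borel :: (('x, 'u) vec2 => ennreal) set)" by (rule mcong[OF s refl])
 have fin: "AE z in \<pi>. ennreal (VU (snd z l)) / cV ~= top" if l: "l \<in> {1..<q}" for l
 proof -
  let ?\<phi> = "%z::('x, 'u) vec2. ennreal (VU (snd z l)) / cV"
  let ?i = "%z::('x, 'u) vec2. indicator {u. ennreal (VU u) / cV = top} (snd z l) :: ennreal"
  have im: "?i \<in> bm borel" by (rule u_fun_measurable[of "indicator {u. ennreal (VU u) / cV = top}"]) measurable
  have "(R ^^ (q - l)) ?i z = 0" for z
  proof -
   \<comment> \<open>Infinity times a positive number would exceed the finite bound
     \<open>VX\<close>.\<close>
   have "top * (R ^^ (q - l)) ?i z = (R ^^ (q - l)) (%z. top * ?i z) z" by (simp only: step_pow_cmult[OF im])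
   also have "... <= (R ^^ (q - l)) ?\<phi> z" by (rule step_pow_mono) (simp add: indicator_def)
   also have "... <= ennreal (VX (fst z p))" by (rule step_u_coord[OF l, of "%u. ennreal (VU u) / cV"]) (rule VU_bound)
   finally show ?thesis by (auto simp: ennreal_top_mult top_unique split: if_splits)
  qed
  then have "(\<integral>\<^sup>+z. ?i z \<partial>\<pi>) = 0" using invariant_pow[OF inv im, of "q - l"] by simp
  then have "AE z in \<pi>. ?i z = 0" using im by (subst (asm) nn_integral_0_iff_AE) (simp_all only: bm)
  then show ?thesis by eventually_elim (auto simp: indicator_def split: if_splits)
 qed
 have "AE z in \<pi>. \<forall>l\<in>{1..<q}. ennreal (VU (snd z l)) / cV ~= top"
  by (rule AE_finite_allI) (auto intro: fin)
 then show ?thesis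
 proof eventually_elim
  case (elim z)
  then have "(\<Sum>k=1..p. ennreal (VX (fst z k))) + (\<Sum>l\<in>{1..<q}. ennreal (VU (snd z l)) / cV) < top"
   by (auto simp: less_top[symmetric])
  then show ?case using V_Z_le_sum[of VX VU cV z] by (simp add: le_less_trans)
 qed
qed

text \<open>The additive constant \<open>2 * b\<close> is the fixed point of the drift recursion
  with factor 1/2 and constant \<open>b\<close>.\<close>

lemma R_pow_V: "(R ^^ (m * j)) V z <= ennreal ((1/2) ^ j) * V z + ennreal (2 * b)"
proof (induction j arbitrary: z)
 case (Suc j)
 have Vm: "V \<in> bm borel" by (rule V_Z_measurable) measurable
 have hV: "(%z. ennreal (1/2) * V z) \<in> bm borel" using Vm by measurable
 have "(R ^^ (m * Suc j)) V z = (R ^^ (m * j)) ((R ^^ m) V) z"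
  using funpow_add[of "m * j" m R] by (simp add: add.commute)
 also have "... <= (R ^^ (m * j)) (%z. ennreal (1/2) * V z + ennreal b) z" by (rule step_pow_mono) (rule drift)
 also have "... = ennreal (1/2) * (R ^^ (m * j)) V z + ennreal b"
  by (simp only: step_pow_add[OF hV borel_measurable_const] step_pow_cmult[OF Vm] step_pow_const)
 also have "... <= ennreal (1/2) * (ennreal ((1/2) ^ j) * V z + ennreal (2 * b)) + ennreal b"
  by (intro add_right_mono mult_left_mono Suc) simp
 also have "... = (ennreal (1/2) * ennreal ((1/2) ^ j)) * V z + (ennreal (1/2) * ennreal (2 * b) + ennreal b)"
  by (simp only: distrib_left mult.assoc add.assoc)
 also have "ennreal (1/2) * ennreal ((1/2) ^ j) = ennreal ((1/2) ^ Suc j)" by (subst ennreal_mult[symmetric]) simp_all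
 also have "ennreal (1/2) * ennreal (2 * b) + ennreal b = ennreal (1/2 * (2 * b) + b)"
 proof -
  have "ennreal (1/2 * (2 * b) + b) = ennreal (1/2 * (2 * b)) + ennreal b" using mbC(2) by (intro ennreal_plus) auto
  also have "ennreal (1/2 * (2 * b)) = ennreal (1/2) * ennreal (2 * b)" using mbC(2) by (intro ennreal_mult) auto
  finally show ?thesis by (rule sym)
 qed
 also have "1/2 * (2 * b) + b = 2 * b" by simp
 finally show ?case .
qed simp

text \<open>Integrability of \<open>V\<close> is not known in advance, so \<open>V\<close> is cut
  off at \<open>N\<close>. Iterating the drift under the invariant law removes the initial value,
  since \<open>V\<close> is finite almost everywhere, and leaves the bound \<open>2 * b\<close> for
  every \<open>N\<close>.\<close>

theorem VX_expectation:
 assumes \<pi>: "\<pi> \<in> space (prob_algebra borel)" and inv: "invariant \<pi>"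
 shows "(\<integral>\<^sup>+z. ennreal (VX (fst z p)) \<partial>\<pi>) < \<infinity>"
proof -
 interpret \<pi>: prob_space \<pi> using \<pi> by (simp add: space_prob_algebra)
 have s: "sets \<pi> = sets borel" using \<pi> by (simp add: space_prob_algebra)
 have bm: "bm \<pi> = (bm borel :: (('x, 'u) vec2 => ennreal) set)" by (rule mcong[OF s refl])
 have Vm[measurable]: "V \<in> bm borel" by (rule V_Z_measurable) measurable
 have le: "(\<integral>\<^sup>+z. inf (V z) (of_nat N) \<partial>\<pi>) <= ennreal (2 * b)" for N :: nat
 proof -
  let ?f = "%j z. inf (ennreal ((1/2) ^ j) * V z + ennreal (2 * b)) (of_nat N)"
  have im: "(%z. inf (V z) (of_nat N)) \<in> bm borel" by measurable
  have "(\<integral>\<^sup>+z. inf (V z) (of_nat N) \<partial>\<pi>) <= (\<integral>\<^sup>+z. ?f j z \<partial>\<pi>)" for j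
  proof -
   have "(\<integral>\<^sup>+z. inf (V z) (of_nat N) \<partial>\<pi>) = (\<integral>\<^sup>+z. (R ^^ (m * j)) (%z. inf (V z) (of_nat N)) z \<partial>\<pi>)"
    by (rule invariant_pow[OF inv im, symmetric])
   also have "... <= (\<integral>\<^sup>+z. ?f j z \<partial>\<pi>)"
   proof (intro nn_integral_mono le_infI)
    fix z
    show "(R ^^ (m * j)) (%z. inf (V z) (of_nat N)) z <= ennreal ((1/2) ^ j) * V z + ennreal (2 * b)"
     by (rule order_trans[OF step_pow_mono R_pow_V]) simp
    show "(R ^^ (m * j)) (%z. inf (V z) (of_nat N)) z <= of_nat N"
     using step_pow_mono[of "%z. inf (V z) (of_nat N)" "%_. of_nat N" "m * j" z] by (simp add: step_pow_const)
   qed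
   finally show ?thesis .
  qed
  moreover have "(%j. \<integral>\<^sup>+z. ?f j z \<partial>\<pi>) \<longlonglongrightarrow> (\<integral>\<^sup>+z. inf (ennreal (2 * b)) (of_nat N) \<partial>\<pi>)"
  proof (rule nn_integral_dominated_convergence[where w="%_. of_nat N"])
   show "(\<integral>\<^sup>+z. of_nat N \<partial>\<pi>) < \<infinity>" by (simp add: \<pi>.emeasure_space_1 of_nat_less_top)
   show "AE z in \<pi>. (%j. ?f j z) \<longlonglongrightarrow> inf (ennreal (2 * b)) (of_nat N)"
    using AE_V_finite[OF \<pi> inv]
   proof eventually_elim
    case (elim z)
    have "(%j. V z * ennreal ((1/2) ^ j) + ennreal (2 * b)) \<longlonglongrightarrow> V z * ennreal 0 + ennreal (2 * b)"
     using elim by (intro tendsto_add ennreal_tendsto_cmult tendsto_ennrealI LIMSEQ_realpow_zero tendsto_const) auto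
    then have "(%j. ennreal ((1/2) ^ j) * V z + ennreal (2 * b)) \<longlonglongrightarrow> ennreal (2 * b)" by (simp add: mult.commute)
    then show ?case unfolding inf_min by (intro tendsto_min tendsto_const)
   qed
  qed (simp_all add: bm)
  ultimately have "(\<integral>\<^sup>+z. inf (V z) (of_nat N) \<partial>\<pi>) <= (\<integral>\<^sup>+z. inf (ennreal (2 * b)) (of_nat N) \<partial>\<pi>)"
   by (intro LIMSEQ_le_const) auto
  also have "... <= (\<integral>\<^sup>+z. ennreal (2 * b) \<partial>\<pi>)" by (intro nn_integral_mono) simp
  also have "... = ennreal (2 * b)" by (simp add: \<pi>.emeasure_space_1)
  finally show ?thesis .
 qed
 have "(\<integral>\<^sup>+z. ennreal (VX (fst z p)) \<partial>\<pi>) <= (\<integral>\<^sup>+z. V z \<partial>\<pi>)" using p1 by (intro nn_integral_mono V_Z_ge) simp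
 also have "... = (\<integral>\<^sup>+z. (SUP N. inf (V z) (of_nat N)) \<partial>\<pi>)"
  by (simp add: inf_SUP[symmetric] ennreal_SUP_of_nat_eq_top)
 also have "... = (SUP N. \<integral>\<^sup>+z. inf (V z) (of_nat N) \<partial>\<pi>)"
  by (rule nn_integral_monotone_convergence_SUP) (auto simp: bm incseq_def le_fun_def intro!: le_infI2)
 also have "... <= ennreal (2 * b)" by (intro SUP_least le)
 also have "... < \<infinity>" by simp
 finally show ?thesis .
qed

end

subsection \<open>Uniqueness\<close>

text \<open>Dominates both measures, which provides densities, and controls approximation errors
  under both at once at the price of a factor 2.\<close>

definition mixture :: "'a measure => 'a measure => 'a measure" where
 "mixture M N = measure_pmf (bernoulli_pmf (1/2)) \<bind> (%b. if b then M else N)"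

lemma mixture:
 assumes M: "M \<in> space (prob_algebra S)" and N: "N \<in> space (prob_algebra S)"
 shows "sets (mixture M N) = sets S" "prob_space (mixture M N)"
  and "f \<in> bm S ==> (\<integral>\<^sup>+x. f x \<partial>mixture M N) = ennreal (1/2) * (\<integral>\<^sup>+x. f x \<partial>M) + ennreal (1/2) * (\<integral>\<^sup>+x. f x \<partial>N)"
proof -
 have s: "sets M = sets S" "sets N = sets S" "prob_space M" "prob_space N" using M N by (auto simp: space_prob_algebra)
 have K: "(%b. if b then M else N) \<in> measure_pmf (bernoulli_pmf (1/2)) \<rightarrow>\<^sub>M subprob_algebra S"
  by (simp add: Pi_def space_subprob_algebra prob_space_imp_subprob_space s)
 show "sets (mixture M N) = sets S" unfolding mixture_def by (rule sets_bind) (simp_all add: s)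
 show "prob_space (mixture M N)" unfolding mixture_def
  by (rule prob_space.prob_space_bind[OF measure_pmf.prob_space_axioms AE_I2 K]) (simp add: s)
 assume f: "f \<in> bm S"
 have "(\<integral>\<^sup>+x. f x \<partial>mixture M N) = (\<integral>\<^sup>+b. \<integral>\<^sup>+x. f x \<partial>(if b then M else N) \<partial>measure_pmf (bernoulli_pmf (1/2)))"
  unfolding mixture_def by (rule nn_integral_bind[OF f K])
 also have "... = (\<integral>\<^sup>+x. f x \<partial>(if True then M else N)) * ennreal (1/2) + (\<integral>\<^sup>+x. f x \<partial>(if False then M else N)) * ennreal (1 - 1/2)"
  by (rule nn_integral_bernoulli_pmf) simp_all
 also have "... = ennreal (1/2) * (\<integral>\<^sup>+x. f x \<partial>M) + ennreal (1/2) * (\<integral>\<^sup>+x. f x \<partial>N)"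
 proof -
  have "1 - 1/2 = (1/2::real)" by simp
  then show ?thesis by (simp only: if_True if_False mult.commute)
 qed
 finally show "(\<integral>\<^sup>+x. f x \<partial>mixture M N) = ennreal (1/2) * (\<integral>\<^sup>+x. f x \<partial>M) + ennreal (1/2) * (\<integral>\<^sup>+x. f x \<partial>N)" .
qed

lemma mixture_le:
 assumes M: "M \<in> space (prob_algebra S)" and N: "N \<in> space (prob_algebra S)" and f: "f \<in> bm S"
  and le: "(\<integral>\<^sup>+x. f x \<partial>mixture M N) <= ennreal e" and e: "0 <= e"
 shows "(\<integral>\<^sup>+x. f x \<partial>M) <= ennreal (2 * e)" "(\<integral>\<^sup>+x. f x \<partial>N) <= ennreal (2 * e)"
proof -
 have h: "I <= ennreal (2 * e)" if "ennreal (1/2) * I <= ennreal e" for I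
 proof -
  have "I = (ennreal 2 * ennreal (1/2)) * I" by (subst ennreal_mult[symmetric]) simp_all
  also have "... = ennreal 2 * (ennreal (1/2) * I)" by (rule mult.assoc)
  also have "... <= ennreal 2 * ennreal e" using that by (rule mult_left_mono) simp
  also have "... = ennreal (2 * e)" using e by (intro ennreal_mult[symmetric]) auto
  finally show ?thesis .
 qed
 show "(\<integral>\<^sup>+x. f x \<partial>M) <= ennreal (2 * e)"
  by (rule h, rule order_trans[OF _ le], unfold mixture(3)[OF M N f], rule add_increasing2[OF zero_le order_refl])
 show "(\<integral>\<^sup>+x. f x \<partial>N) <= ennreal (2 * e)"
  by (rule h, rule order_trans[OF _ le], unfold mixture(3)[OF M N f], rule add_increasing[OF zero_le order_refl])
qed

text \<open>With respect to the mixture, \<open>P\<close> and \<open>Q\<close> have as densities the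
  positive and the negative part of the difference of the densities of \<open>M\<close> and
  \<open>N\<close>. The identity is stated with sums because the integrals may be infinite. As
  \<open>P\<close> is below \<open>M\<close>, it inherits almost sure properties.\<close>

lemma jordan_decomposition:
 fixes M N :: "'a measure"
 assumes M: "M \<in> space (prob_algebra S)" and N: "N \<in> space (prob_algebra S)"
 shows "\<exists>P Q A. sets P = sets S & sets Q = sets S & A \<in> sets S & emeasure Q A = 0 & emeasure P (space S - A) = 0 &
  (\<forall>R. (AE x in M. R x) --> (AE x in P. R x)) & emeasure P (space S) <= 1 &
  (\<forall>f\<in>bm S. (\<integral>\<^sup>+x. f x \<partial>M) + (\<integral>\<^sup>+x. f x \<partial>Q) = (\<integral>\<^sup>+x. f x \<partial>N) + (\<integral>\<^sup>+x. f x \<partial>P))"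
proof -
 define \<mu> where "\<mu> = mixture M N"
 note mix = mixture[OF M N, folded \<mu>_def]
 have s: "sets M = sets S" "sets N = sets S" "prob_space M" using M N by (auto simp: space_prob_algebra)
 interpret \<mu>: prob_space \<mu> by (rule mix(2))
 have sp: "space \<mu> = space S" by (rule sets_eq_imp_space_eq[OF mix(1)])
 have bm: "bm \<mu> = (bm S :: ('a => ennreal) set)" by (rule mcong[OF mix(1) refl])
 have null: "emeasure M B = 0 & emeasure N B = 0" if "B \<in> null_sets \<mu>" for B
 proof -
  have B: "B \<in> sets S" "emeasure \<mu> B = 0" using that mix(1) by (auto simp: null_sets_def)
  have "(\<integral>\<^sup>+x. indicator B x \<partial>\<mu>) = 0" using B mix(1) by simp
  then have "ennreal (1/2) * (\<integral>\<^sup>+x. indicator B x \<partial>M) + ennreal (1/2) * (\<integral>\<^sup>+x. indicator B x \<partial>N) = 0"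
   using mix(3)[of "indicator B"] B(1) by (simp only: borel_measurable_indicator)
  then have "(\<integral>\<^sup>+x. indicator B x \<partial>M) = 0 & (\<integral>\<^sup>+x. indicator B x \<partial>N) = 0" by (simp del: nn_integral_indicator)
  then show ?thesis using B(1) s by simp
 qed
 have ac: "absolutely_continuous \<mu> M" "absolutely_continuous \<mu> N"
  unfolding absolutely_continuous_def using null mix(1) s by (auto simp: null_sets_def)
 define a c where "a = RN_deriv \<mu> M" and "c = RN_deriv \<mu> N"
 have da: "density \<mu> a = M" and dc: "density \<mu> c = N"
  unfolding a_def c_def by (rule \<mu>.density_RN_deriv; use ac s mix(1) in simp)+
 have am[measurable]: "a \<in> bm \<mu>" "c \<in> bm \<mu>" unfolding a_def c_def by simp_all
 define u v where "u x = (if c x < a x then a x - c x else 0)" and "v x = (if a x < c x then c x - a x else 0)" for x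
 have um[measurable]: "u \<in> bm \<mu>" "v \<in> bm \<mu>" unfolding u_def[abs_def] v_def[abs_def] by measurable
 have uv: "a x + v x = c x + u x" for x
 proof (cases "a x" "c x" rule: linorder_cases)
  case less
  then have "u x = 0" "v x = c x - a x" by (simp_all add: u_def v_def)
  then show ?thesis using add_diff_inverse_ennreal[OF less_imp_le[OF less]] by (simp only: add_0_right)
 next
  case greater
  then have "v x = 0" "u x = a x - c x" by (simp_all add: u_def v_def)
  then show ?thesis using add_diff_inverse_ennreal[OF less_imp_le[OF greater]] by (simp only: add_0_right)
 qed (simp add: u_def v_def)
 have ua: "u x <= a x" for x by (simp add: u_def)
 define A where "A = {x \<in> space \<mu>. c x < a x}"
 have A: "A \<in> sets \<mu>" unfolding A_def by measurable
 have r1: "emeasure (density \<mu> v) A = 0"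
 proof -
  have "(\<integral>\<^sup>+x. v x * indicator A x \<partial>\<mu>) = (\<integral>\<^sup>+x. 0 \<partial>\<mu>)"
   by (intro nn_integral_cong) (auto simp: v_def A_def indicator_def)
  then show ?thesis using A by (simp add: emeasure_density)
 qed
 have r2: "emeasure (density \<mu> u) (space S - A) = 0"
 proof -
  have "(\<integral>\<^sup>+x. u x * indicator (space S - A) x \<partial>\<mu>) = (\<integral>\<^sup>+x. 0 \<partial>\<mu>)"
   by (intro nn_integral_cong) (auto simp: u_def A_def indicator_def)
  then show ?thesis using A by (simp add: emeasure_density sp[symmetric])
 qed
 have r3: "AE x in density \<mu> u. R x" if "AE x in M. R x" for R
 proof -
  have "AE x in density \<mu> a. R x" using that unfolding da .
  then have "AE x in \<mu>. 0 < a x --> R x" by (simp add: AE_density)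
  then have "AE x in \<mu>. 0 < u x --> R x" by eventually_elim (use ua in \<open>auto intro: less_le_trans\<close>)
  then show ?thesis by (simp add: AE_density)
 qed
 have r4: "emeasure (density \<mu> u) (space S) <= 1"
 proof -
  have "emeasure (density \<mu> u) (space S) = (\<integral>\<^sup>+x. u x \<partial>\<mu>)"
   by (simp add: emeasure_density sp[symmetric])
  also have "... <= (\<integral>\<^sup>+x. a x \<partial>\<mu>)" by (intro nn_integral_mono ua)
  also have "... = emeasure (density \<mu> a) (space \<mu>)" by (simp add: emeasure_density)
  also have "... = 1" using prob_space.emeasure_space_1[OF s(3)] sets_eq_imp_space_eq[OF s(1)] by (simp add: da sp)
  finally show ?thesis .
 qed
 have r5: "(\<integral>\<^sup>+x. f x \<partial>M) + (\<integral>\<^sup>+x. f x \<partial>density \<mu> v) = (\<integral>\<^sup>+x. f x \<partial>N) + (\<integral>\<^sup>+x. f x \<partial>density \<mu> u)"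
  if "f \<in> bm S" for f
 proof -
  have f[measurable]: "f \<in> bm \<mu>" using that bm by simp
  have "(\<integral>\<^sup>+x. f x \<partial>M) + (\<integral>\<^sup>+x. f x \<partial>density \<mu> v) = (\<integral>\<^sup>+x. f x \<partial>density \<mu> a) + (\<integral>\<^sup>+x. f x \<partial>density \<mu> v)" by (simp only: da)
  also have "... = (\<integral>\<^sup>+x. (a x + v x) * f x \<partial>\<mu>)" by (simp add: nn_integral_density nn_integral_add distrib_right)
  also have "... = (\<integral>\<^sup>+x. (c x + u x) * f x \<partial>\<mu>)" by (simp only: uv)
  also have "... = (\<integral>\<^sup>+x. f x \<partial>density \<mu> c) + (\<integral>\<^sup>+x. f x \<partial>density \<mu> u)" by (simp add: nn_integral_density nn_integral_add distrib_right)
  finally show ?thesis by (simp only: dc)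
 qed
 have r6: "sets (density \<mu> u) = sets S" "sets (density \<mu> v) = sets S" "A \<in> sets S" using mix(1) A by simp_all
 show ?thesis
  by (rule exI[of _ "density \<mu> u"], rule exI[of _ "density \<mu> v"], rule exI[of _ A])
   (intro conjI allI impI ballI r1 r2 r3 r4 r5 r6; assumption)
qed

lemma AE_False_emeasure: "AE x in M. False ==> emeasure M (space M) = 0"
 using AE_iff_measurable[of "space M" M "%_. False"] by simp

context od_stable
begin

text \<open>Invariance replaces \<open>f\<close> by its \<open>n\<close>-th iterate, so the
  difference of the two integrals is that of the integrals of the iterate under \<open>P\<close> and
  \<open>N\<close>. Multiplied by the common mass \<open>kap\<close> it becomes an integral of
  differences over \<open>P \<Otimes>\<^sub>M N\<close>, for which \<open>D\<close> is the limiting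
  bound.\<close>

lemma invariant_difference:
 assumes inv: "invariant \<pi>1" "invariant \<pi>2"
  and P: "sets P = sets borel" and N: "sets N = sets borel" and kap: "emeasure P UNIV = kap" "emeasure N UNIV = kap" "kap <= 1"
  and eq: "!!f. f \<in> bm borel ==> (\<integral>\<^sup>+z. f z \<partial>\<pi>1) + (\<integral>\<^sup>+z. f z \<partial>N) = (\<integral>\<^sup>+z. f z \<partial>\<pi>2) + (\<integral>\<^sup>+z. f z \<partial>P)"
  and f: "f \<in> lip01"
 shows "kap * (\<integral>\<^sup>+z. ennreal (f z) \<partial>\<pi>1) <= kap * (\<integral>\<^sup>+z. ennreal (f z) \<partial>\<pi>2) + (\<integral>\<^sup>+w. ennreal (D w) \<partial>(P \<Otimes>\<^sub>M N))"
proof -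
 have spP: "space P = UNIV" and spQ: "space N = UNIV" using sets_eq_imp_space_eq[OF P] sets_eq_imp_space_eq[OF N] by simp_all
 have kapf: "kap < top" using kap(3) by (rule le_less_trans) simp
 interpret P: finite_measure P by (rule finite_measureI) (use kap kapf in \<open>simp add: spP\<close>)
 interpret N: finite_measure N by (rule finite_measureI) (use kap kapf in \<open>simp add: spQ\<close>)
 interpret PQ: pair_sigma_finite P N ..
 let ?F = "%n. It n f"
 let ?I1 = "\<integral>\<^sup>+z. ennreal (f z) \<partial>\<pi>1" and ?I2 = "\<integral>\<^sup>+z. ennreal (f z) \<partial>\<pi>2" and ?X = "\<integral>\<^sup>+w. ennreal (D w) \<partial>(P \<Otimes>\<^sub>M N)"
 have sPQ: "sets (P \<Otimes>\<^sub>M N) = sets borel"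
  unfolding sets_pair_measure_cong[OF P N] by (subst borel_prod) (rule refl)
 have bm: "bm (P \<Otimes>\<^sub>M N) = (bm borel :: (('x, 'u) vec4 => ennreal) set)"
  by (rule mcong[OF sPQ refl])
 have bmP: "bm P = (bm borel :: (('x, 'u) vec2 => ennreal) set)" and bmQ: "bm N = (bm borel :: (('x, 'u) vec2 => ennreal) set)"
  by (rule mcong[OF P refl], rule mcong[OF N refl])
 have fm: "(%z. ennreal (f z)) \<in> bm borel" by (rule lip01_measurable[OF f])
 have Fm: "?F n \<in> bm borel" for n by (rule step_pow_measurable[OF fm])
 have F1: "?F n z <= 1" for n z by (rule R_pow_le_1) (rule lip01_le_1[OF f])
 have Ffst: "(%w::('x, 'u) vec4. ?F n (fst w)) \<in> bm borel" for n
  by (rule mcomp[OF borel_fst_snd_measurable(1) Fm])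
 have Fsnd: "(%w::('x, 'u) vec4. ?F n (snd w)) \<in> bm borel" for n
  by (rule mcomp[OF borel_fst_snd_measurable(2) Fm])
 have Dm: "(%w. ennreal (D w)) \<in> bm borel" by measurable
 let ?e = "%n w. ?F n (fst w) - (?F n (snd w) + ennreal (D w))"
 have em: "?e n \<in> bm borel" for n by (intro borel_measurable_minus_ennreal borel_measurable_add Ffst Fsnd Dm)
 have emPQ: "emeasure (P \<Otimes>\<^sub>M N) (space (P \<Otimes>\<^sub>M N)) < top"
  using N.emeasure_pair_measure_Times[of UNIV P UNIV] P N kap kapf by (simp add: space_pair_measure spP spQ ennreal_mult_less_top)
 \<comment> \<open>The product measure is finite, so the excess over \<open>D\<close> vanishes in
   the mean by dominated convergence.\<close>
 have E0: "(%n. \<integral>\<^sup>+w. ?e n w \<partial>(P \<Otimes>\<^sub>M N)) \<longlonglongrightarrow> (\<integral>\<^sup>+w. 0 \<partial>(P \<Otimes>\<^sub>M N))"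
 proof (rule nn_integral_dominated_convergence[where w="%_. 1"])
  show "(\<integral>\<^sup>+w. 1 \<partial>(P \<Otimes>\<^sub>M N)) < \<infinity>" using emPQ by simp
  show "AE w in P \<Otimes>\<^sub>M N. (%n. ?e n w) \<longlonglongrightarrow> 0" by (intro AE_I2 D_run_tendsto[OF f])
  show "AE w in P \<Otimes>\<^sub>M N. ?e n w <= 1" for n by (intro AE_I2 order_trans[OF diff_le_self_ennreal] F1)
 qed (simp_all add: bm em)
 have ineq: "kap * ?I1 <= kap * ?I2 + ?X + (\<integral>\<^sup>+w. ?e n w \<partial>(P \<Otimes>\<^sub>M N))" for n
 proof -
  let ?a = "\<integral>\<^sup>+z. ?F n z \<partial>P" and ?b = "\<integral>\<^sup>+z. ?F n z \<partial>N"
  have fstI: "(\<integral>\<^sup>+w. ?F n (fst w) \<partial>(P \<Otimes>\<^sub>M N)) = kap * ?a"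
  proof -
   have "(\<integral>\<^sup>+w. ?F n (fst w) \<partial>(P \<Otimes>\<^sub>M N)) = (\<integral>\<^sup>+z. \<integral>\<^sup>+z'. ?F n (fst (z, z')) \<partial>N \<partial>P)"
    by (rule N.nn_integral_fst[symmetric]) (simp only: bm Ffst)
   also have "... = (\<integral>\<^sup>+z. kap * ?F n z \<partial>P)" by (simp add: spQ kap(2) mult.commute)
   also have "... = kap * ?a" by (rule nn_integral_cmult) (simp only: bmP Fm)
   finally show ?thesis .
  qed
  have sndI: "(\<integral>\<^sup>+w. ?F n (snd w) \<partial>(P \<Otimes>\<^sub>M N)) = kap * ?b"
  proof -
   have "(\<integral>\<^sup>+w. ?F n (snd w) \<partial>(P \<Otimes>\<^sub>M N)) = (\<integral>\<^sup>+z. \<integral>\<^sup>+z'. ?F n (snd (z, z')) \<partial>N \<partial>P)"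
    by (rule N.nn_integral_fst[symmetric]) (simp only: bm Fsnd)
   also have "... = kap * ?b" by (simp add: spP kap(1) mult.commute)
   finally show ?thesis .
  qed
  have "kap * ?a <= (\<integral>\<^sup>+w. (?F n (snd w) + ennreal (D w)) + ?e n w \<partial>(P \<Otimes>\<^sub>M N))"
   unfolding fstI[symmetric]
  proof (rule nn_integral_mono)
   fix w
   show "?F n (fst w) <= (?F n (snd w) + ennreal (D w)) + ?e n w"
    by (cases "?F n (snd w) + ennreal (D w) <= ?F n (fst w)") (auto simp: add_diff_inverse_ennreal intro: add_increasing2)
  qed
  also have "... = (\<integral>\<^sup>+w. ?F n (snd w) + ennreal (D w) \<partial>(P \<Otimes>\<^sub>M N)) + (\<integral>\<^sup>+w. ?e n w \<partial>(P \<Otimes>\<^sub>M N))"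
   by (rule nn_integral_add) (simp_all only: bm em, intro borel_measurable_add Fsnd Dm)
  also have "(\<integral>\<^sup>+w. ?F n (snd w) + ennreal (D w) \<partial>(P \<Otimes>\<^sub>M N)) = kap * ?b + ?X"
   unfolding sndI[symmetric] by (rule nn_integral_add) (simp_all only: bm Fsnd Dm)
  finally have ab: "kap * ?a <= kap * ?b + ?X + (\<integral>\<^sup>+w. ?e n w \<partial>(P \<Otimes>\<^sub>M N))" .
  have "?I1 + ?b = ?I2 + ?a"
   using eq[OF Fm[of n]] by (simp only: invariant_pow[OF inv(1) fm] invariant_pow[OF inv(2) fm])
  then have "kap * (?I1 + ?b) = kap * (?I2 + ?a)" by (rule arg_cong)
  then have "kap * ?b + kap * ?I1 = kap * ?I2 + kap * ?a" unfolding distrib_left by (simp only: add.commute[of _ "kap * ?b"])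
  also have "... <= kap * ?I2 + (kap * ?b + ?X + (\<integral>\<^sup>+w. ?e n w \<partial>(P \<Otimes>\<^sub>M N)))" by (rule add_left_mono[OF ab])
  also have "... = kap * ?b + (kap * ?I2 + ?X + (\<integral>\<^sup>+w. ?e n w \<partial>(P \<Otimes>\<^sub>M N)))" by (simp only: ac_simps)
  finally have "kap * ?b + kap * ?I1 <= kap * ?b + (kap * ?I2 + ?X + (\<integral>\<^sup>+w. ?e n w \<partial>(P \<Otimes>\<^sub>M N)))" .
  moreover have "kap * ?b < top"
  proof -
   have "?b <= (\<integral>\<^sup>+z. 1 \<partial>N)" by (intro nn_integral_mono F1)
   also have "... = kap" by (simp add: spQ kap(2))
   finally show ?thesis using kapf by (intro ennreal_mult_less_top[THEN iffD2]) (auto intro: le_less_trans)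
  qed
  ultimately show ?thesis by (simp only: ennreal_add_left_cancel_le) auto
 qed
 have "(%n. kap * ?I2 + ?X + (\<integral>\<^sup>+w. ?e n w \<partial>(P \<Otimes>\<^sub>M N))) \<longlonglongrightarrow> kap * ?I2 + ?X + 0"
  using E0 by (intro tendsto_add tendsto_const) simp
 then show ?thesis using ineq by (intro LIMSEQ_le_const) auto
qed

text \<open>On the Hahn set \<open>A\<close> the two laws differ by exactly \<open>kap\<close>;
  approximating its indicator by Lipschitz functions compares \<open>kap * kap\<close> with the
  integral of \<open>D\<close>. As \<open>D \<le> 1\<close>, it must equal 1 almost everywhere,
  against \<open>D_less_1\<close> at a point of finite \<open>V\<close>.\<close>

theorem invariant_unique:
 assumes \<pi>1: "\<pi>1 \<in> space (prob_algebra borel)" "invariant \<pi>1" and \<pi>2: "\<pi>2 \<in> space (prob_algebra borel)" "invariant \<pi>2"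
 shows "\<pi>1 = \<pi>2"
proof -
 obtain P N A where P: "sets P = sets borel" and N: "sets N = sets borel" and A: "A \<in> sets borel" "emeasure N A = 0" "emeasure P (UNIV - A) = 0"
  and ae: "!!R. (AE x in \<pi>1. R x) ==> (AE x in P. R x)" and P1: "emeasure P UNIV <= 1"
  and eq: "!!f. f \<in> bm borel ==> (\<integral>\<^sup>+x. f x \<partial>\<pi>1) + (\<integral>\<^sup>+x. f x \<partial>N) = (\<integral>\<^sup>+x. f x \<partial>\<pi>2) + (\<integral>\<^sup>+x. f x \<partial>P)"
  using jordan_decomposition[OF \<pi>1(1) \<pi>2(1)] unfolding space_borel by blast
 have s: "sets \<pi>1 = sets borel" "sets \<pi>2 = sets borel" using \<pi>1(1) \<pi>2(1) by (simp_all add: space_prob_algebra)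
 interpret \<pi>1: prob_space \<pi>1 using \<pi>1 by (simp add: space_prob_algebra)
 interpret \<pi>2: prob_space \<pi>2 using \<pi>2 by (simp add: space_prob_algebra)
 have sp: "space P = UNIV" "space N = UNIV" "space \<pi>1 = UNIV" "space \<pi>2 = UNIV"
  using sets_eq_imp_space_eq[OF P] sets_eq_imp_space_eq[OF N] sets_eq_imp_space_eq[OF s(1)] sets_eq_imp_space_eq[OF s(2)] by simp_all
 define kap where "kap = emeasure P UNIV"
 have kap1: "kap <= 1" using P1 by (simp add: kap_def)
 have kapf: "kap < top" using kap1 by (rule le_less_trans) simp
 have Nkap: "emeasure N UNIV = kap"
 proof -
  have "1 + emeasure N UNIV = 1 + kap"
   using eq[of "%_. 1"] \<pi>1.emeasure_space_1 \<pi>2.emeasure_space_1 by (simp add: sp kap_def)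
  then show ?thesis by (simp add: ennreal_add_left_cancel)
 qed
 interpret P: finite_measure P by (rule finite_measureI) (use kapf in \<open>simp add: sp kap_def\<close>)
 interpret N: finite_measure N by (rule finite_measureI) (use kapf in \<open>simp add: sp Nkap\<close>)
 interpret PQ: pair_sigma_finite P N ..
 have kap0: "kap = 0"
 proof (rule ccontr)
  assume kap0: "kap ~= 0"
  define X where "X = (\<integral>\<^sup>+w. ennreal (D w) \<partial>(P \<Otimes>\<^sub>M N))"
  have approx: "kap * emeasure \<pi>1 A <= (kap * emeasure \<pi>2 A + X) + ennreal e" if e: "0 < e" for e :: real
  proof -
   \<comment> \<open>The mixture doubles the error to \<open>e / 2\<close>, and it occurs twice,
     once for each law.\<close>
   have e4: "0 < e / 4" using e by simp
   let ?\<mu> = "mixture \<pi>1 \<pi>2"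
   interpret \<mu>: prob_space ?\<mu> by (rule mixture(2)[OF \<pi>1(1) \<pi>2(1)])
   obtain f where f: "f \<in> lip01" "(\<integral>\<^sup>+x. ennreal \<bar>f x - indicator A x\<bar> \<partial>?\<mu>) <= ennreal (e / 4)"
    using lip01_approx[OF mixture(1)[OF \<pi>1(1) \<pi>2(1)] _ A(1) e4] \<mu>.emeasure_finite by auto
   have fm: "f \<in> bm borel" using borel_measurable_continuous_onI[OF bcontD(1)[OF lip01_bcont[OF f(1)]]] .
   have im: "(%x. indicator A x :: real) \<in> bm borel" using A(1) by measurable
   have dm: "(%x. ennreal \<bar>f x - indicator A x\<bar>) \<in> bm borel" using fm im by measurable
   note d = mixture_le[OF \<pi>1(1) \<pi>2(1) dm f(2) less_imp_le[OF e4]]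
   have f0: "0 <= f x" for x using f(1) unfolding lip01_def by blast
   have fm': "(%x. ennreal (f x)) \<in> bm borel" using fm by measurable
   have i1: "indicator A x <= ennreal (f x) + ennreal \<bar>f x - indicator A x\<bar>" for x
   proof -
    have "indicator A x <= f x + \<bar>f x - indicator A x\<bar>" by linarith
    then have "ennreal (indicator A x) <= ennreal (f x + \<bar>f x - indicator A x\<bar>)" by (rule ennreal_leI)
    then show ?thesis using ennreal_plus[OF f0[of x] abs_ge_zero[of "f x - indicator A x"]] by (simp add: ennreal_indicator)
   qed
   have i2: "ennreal (f x) <= indicator A x + ennreal \<bar>f x - indicator A x\<bar>" for x
   proof -
    have "f x <= indicator A x + \<bar>f x - indicator A x\<bar>" by linarith
    then have "ennreal (f x) <= ennreal (indicator A x + \<bar>f x - indicator A x\<bar>)" by (rule ennreal_leI)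
    also have "... = ennreal (indicator A x) + ennreal \<bar>f x - indicator A x\<bar>" by (rule ennreal_plus) auto
    finally show ?thesis by (simp add: ennreal_indicator)
   qed
   have bm1: "bm \<pi>1 = (bm borel :: (('x, 'u) vec2 => ennreal) set)" by (rule mcong[OF s(1) refl])
   have bm2: "bm \<pi>2 = (bm borel :: (('x, 'u) vec2 => ennreal) set)" by (rule mcong[OF s(2) refl])
   have Im: "indicator A \<in> bm (borel :: ('x, 'u) vec2 measure)" by (rule borel_measurable_indicator[OF A(1)])
   have "emeasure \<pi>1 A = (\<integral>\<^sup>+x. indicator A x \<partial>\<pi>1)" using A(1) s by simp
   also have "... <= (\<integral>\<^sup>+x. ennreal (f x) + ennreal \<bar>f x - indicator A x\<bar> \<partial>\<pi>1)" by (intro nn_integral_mono i1)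
   also have "... = (\<integral>\<^sup>+x. ennreal (f x) \<partial>\<pi>1) + (\<integral>\<^sup>+x. ennreal \<bar>f x - indicator A x\<bar> \<partial>\<pi>1)"
    by (rule nn_integral_add) (simp_all only: bm1 fm' dm)
   also have "... <= (\<integral>\<^sup>+x. ennreal (f x) \<partial>\<pi>1) + ennreal (2 * (e / 4))" by (rule add_left_mono[OF d(1)])
   finally have 1: "kap * emeasure \<pi>1 A <= kap * (\<integral>\<^sup>+x. ennreal (f x) \<partial>\<pi>1) + kap * ennreal (2 * (e / 4))"
    unfolding distrib_left[symmetric] by (rule mult_left_mono) simp
   have "(\<integral>\<^sup>+x. ennreal (f x) \<partial>\<pi>2) <= (\<integral>\<^sup>+x. indicator A x + ennreal \<bar>f x - indicator A x\<bar> \<partial>\<pi>2)" by (intro nn_integral_mono i2)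
   also have "... = (\<integral>\<^sup>+x. indicator A x \<partial>\<pi>2) + (\<integral>\<^sup>+x. ennreal \<bar>f x - indicator A x\<bar> \<partial>\<pi>2)"
    by (rule nn_integral_add) (simp_all only: bm2 Im dm)
   also have "... <= emeasure \<pi>2 A + ennreal (2 * (e / 4))" using d(2) A(1) s by (intro add_mono) simp_all
   finally have 2: "kap * (\<integral>\<^sup>+x. ennreal (f x) \<partial>\<pi>2) <= kap * emeasure \<pi>2 A + kap * ennreal (2 * (e / 4))"
    unfolding distrib_left[symmetric] by (rule mult_left_mono) simp
   have 3: "kap * (\<integral>\<^sup>+x. ennreal (f x) \<partial>\<pi>1) <= kap * (\<integral>\<^sup>+x. ennreal (f x) \<partial>\<pi>2) + X"
    unfolding X_def by (rule invariant_difference[OF \<pi>1(2) \<pi>2(2) P N _ Nkap kap1 eq f(1)]) (simp_all add: kap_def)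
   have 4: "kap * ennreal (2 * (e / 4)) <= ennreal (2 * (e / 4))" using mult_right_mono[OF kap1, of "ennreal (2 * (e / 4))"] by simp
   have "kap * emeasure \<pi>1 A <= (kap * emeasure \<pi>2 A + kap * ennreal (2 * (e / 4)) + X) + kap * ennreal (2 * (e / 4))"
    using 1 add_right_mono[OF order_trans[OF 3 add_right_mono[OF 2]]] by (rule order_trans)
   also have "... = (kap * emeasure \<pi>2 A + X) + (kap * ennreal (2 * (e / 4)) + kap * ennreal (2 * (e / 4)))" by (simp only: ac_simps)
   also have "... <= (kap * emeasure \<pi>2 A + X) + (ennreal (2 * (e / 4)) + ennreal (2 * (e / 4)))" by (intro add_left_mono add_mono 4)
   also have "ennreal (2 * (e / 4)) + ennreal (2 * (e / 4)) = ennreal (2 * (e / 4) + 2 * (e / 4))" using e4 by (intro ennreal_plus[symmetric]) auto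
   also have "2 * (e / 4) + 2 * (e / 4) = e" by simp
   finally show ?thesis .
  qed
  \<comment> \<open>\<open>P\<close> is carried by \<open>A\<close> and \<open>N\<close> by its
    complement.\<close>
  have \<pi>A: "emeasure \<pi>1 A = emeasure \<pi>2 A + kap"
  proof -
   have "emeasure P A = kap"
    using emeasure_Un_null_set[of A P "UNIV - A"] A P by (simp add: null_sets_def kap_def)
   moreover have "emeasure \<pi>1 A + emeasure N A = emeasure \<pi>2 A + emeasure P A"
    using eq[OF borel_measurable_indicator[OF A(1)]] A(1) s P N by simp
   ultimately show ?thesis using A(2) by simp
  qed
  have "kap * emeasure \<pi>1 A <= kap * emeasure \<pi>2 A + X" by (rule ennreal_le_epsilon) (rule approx)
  then have "kap * emeasure \<pi>2 A + kap * kap <= kap * emeasure \<pi>2 A + X" by (simp only: \<pi>A distrib_left)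
  moreover have "kap * emeasure \<pi>2 A < top"
   using kapf le_less_trans[OF \<pi>2.emeasure_le_1 ennreal_one_less_top, of A] by (simp add: ennreal_mult_less_top)
  ultimately have kapX: "kap * kap <= X" by (simp only: ennreal_add_left_cancel_le) auto
  have sPQ: "sets (P \<Otimes>\<^sub>M N) = sets borel"
  unfolding sets_pair_measure_cong[OF P N] by (subst borel_prod) (rule refl)
  have bm: "bm (P \<Otimes>\<^sub>M N) = (bm borel :: (('x, 'u) vec4 => ennreal) set)"
   by (rule mcong[OF sPQ refl])
  have Dm: "(%w. ennreal (D w)) \<in> bm borel" "(%w. 1 - ennreal (D w)) \<in> bm borel" by measurable
  have em: "emeasure (P \<Otimes>\<^sub>M N) (space (P \<Otimes>\<^sub>M N)) = kap * kap"
   using N.emeasure_pair_measure_Times[of UNIV P UNIV] P N Nkap by (simp add: space_pair_measure sp kap_def)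
  have "(\<integral>\<^sup>+w. 1 - ennreal (D w) \<partial>(P \<Otimes>\<^sub>M N)) + X = (\<integral>\<^sup>+w. (1 - ennreal (D w)) + ennreal (D w) \<partial>(P \<Otimes>\<^sub>M N))"
   unfolding X_def by (rule nn_integral_add[symmetric]) (simp_all only: bm Dm)
  also have "... = (\<integral>\<^sup>+w. 1 \<partial>(P \<Otimes>\<^sub>M N))" using D_le_1 by (intro nn_integral_cong) (simp add: diff_add_cancel_ennreal ennreal_le_1)
  also have "... <= 0 + X" using kapX em by simp
  \<comment> \<open>The integral \<open>X\<close> already reaches the full mass
    \<open>kap * kap\<close>, which leaves nothing for \<open>1 - D\<close>.\<close>
  finally have XX: "X + (\<integral>\<^sup>+w. 1 - ennreal (D w) \<partial>(P \<Otimes>\<^sub>M N)) <= X + 0" by (simp only: add.commute)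
  have "X <= (\<integral>\<^sup>+w. 1 \<partial>(P \<Otimes>\<^sub>M N))" unfolding X_def using D_le_1 by (intro nn_integral_mono) (simp add: ennreal_le_1)
  then have "X < top" using em kapf by (auto intro: le_less_trans simp: ennreal_mult_less_top)
  then have "(\<integral>\<^sup>+w. 1 - ennreal (D w) \<partial>(P \<Otimes>\<^sub>M N)) = 0" using XX by (simp only: ennreal_add_left_cancel_le) auto
  then have "(\<integral>\<^sup>+z. \<integral>\<^sup>+z'. 1 - ennreal (D (z, z')) \<partial>N \<partial>P) = 0"
   by (subst N.nn_integral_fst) (simp_all only: bm Dm)
  moreover have m1: "(%z. \<integral>\<^sup>+z'. 1 - ennreal (D (z, z')) \<partial>N) \<in> bm P"
   by (rule N.borel_measurable_nn_integral_fst) (simp only: bm Dm)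
  ultimately have "AE z in P. (\<integral>\<^sup>+z'. 1 - ennreal (D (z, z')) \<partial>N) = 0" by (simp only: nn_integral_0_iff_AE)
  moreover have "AE z in P. V z < \<infinity>" by (rule ae[OF AE_V_finite[OF \<pi>1]])
  ultimately have aeP: "AE z in P. (\<integral>\<^sup>+z'. 1 - ennreal (D (z, z')) \<partial>N) = 0 & V z < \<infinity>" by eventually_elim simp
  \<comment> \<open>As the mass \<open>kap\<close> of \<open>P\<close> is positive, an almost sure
    property under \<open>P\<close> holds at some point.\<close>
  have "\<exists>z. (\<integral>\<^sup>+z'. 1 - ennreal (D (z, z')) \<partial>N) = 0 & V z < \<infinity>"
  proof (rule ccontr)
   assume neg: "\<not> ?thesis"
   have "AE z in P. False" using aeP by eventually_elim (use neg in blast)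
   from AE_False_emeasure[OF this] show False using kap0 by (simp add: sp kap_def)
  qed
  then obtain z where z: "(\<integral>\<^sup>+z'. 1 - ennreal (D (z, z')) \<partial>N) = 0" "V z < \<infinity>" by blast
  have Dz: "(%z'. 1 - ennreal (D (z, z'))) \<in> bm N"
   using mcomp[OF measurable_Pair1'[of z P N], of "%w. 1 - ennreal (D w)" borel] by (simp add: sp bm Dm(2))
  have "AE z' in N. 1 - ennreal (D (z, z')) = 0" using z(1) nn_integral_0_iff_AE[OF Dz] by simp
  then have "AE z' in N. False"
  proof eventually_elim
   case (elim z')
   have "1 - ennreal (D (z, z')) = ennreal (1 - D (z, z'))" using ennreal_minus[OF D_nonneg, of 1 "(z, z')"] by simp
   then show ?case using elim D_less_1[OF tight_V[OF z(2)], of z'] by (simp add: ennreal_eq_0_iff)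
  qed
  from AE_False_emeasure[OF this] show False using kap0 Nkap by (simp add: sp)
 qed
 show ?thesis
 proof (rule measure_eqI)
  fix B assume "B \<in> sets \<pi>1"
  then have B: "B \<in> sets borel" using s by simp
  have "emeasure P B = 0" "emeasure N B = 0"
   using emeasure_space[of P B] emeasure_space[of N B] kap0 Nkap by (simp_all add: sp kap_def)
  then show "emeasure \<pi>1 B = emeasure \<pi>2 B"
   using eq[OF borel_measurable_indicator[OF B]] B s P N by simp
 qed (simp add: s)
qed

theorem ex1_invariant: "\<exists>!\<pi>. \<pi> \<in> space (prob_algebra borel) & invariant \<pi>"
 using ex_invariant invariant_unique by blast

theorem stationarity:
 shows "\<exists>!\<pi>. \<pi> \<in> space (prob_algebra (Zsp p q)) & shift_invariant p q \<nu> (model_law p q \<nu> ups \<psi> g \<pi>)"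
  and "\<pi> \<in> space (prob_algebra (Zsp p q)) ==> shift_invariant p q \<nu> (model_law p q \<nu> ups \<psi> g \<pi>) ==>
   expect_from p q \<nu> ups \<psi> g \<pi> VX 0 < \<infinity>"
  and "\<exists>!P. is_stationary_solution_law p q \<nu> ups \<psi> g P"
  and "is_stationary_solution_law p q \<nu> ups \<psi> g P ==> (\<integral>\<^sup>+x. ennreal (VX x) \<partial>law_X0 P) < \<infinity>"
proof -
 show "\<exists>!\<pi>. \<pi> \<in> space (prob_algebra (Zsp p q)) & shift_invariant p q \<nu> (model_law p q \<nu> ups \<psi> g \<pi>)"
  by (rule shift_invariant_ex1[OF ex1_invariant])
 show "\<exists>!P. is_stationary_solution_law p q \<nu> ups \<psi> g P"
  by (rule stationary_solution_ex1[OF ex1_invariant])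
 have vm: "(%z::('x, 'u) vec2. ennreal (VX (fst z p))) \<in> bm borel" by (rule x_fun_measurable) measurable
 show "expect_from p q \<nu> ups \<psi> g \<pi> VX 0 < \<infinity>" if \<pi>: "\<pi> \<in> space (prob_algebra (Zsp p q))"
  and inv: "shift_invariant p q \<nu> (model_law p q \<nu> ups \<psi> g \<pi>)"
 proof -
  have s: "sets \<pi> = sets (Zsp p q)" using \<pi> by (simp add: space_prob_algebra)
  have id: "(%z. z) \<in> \<pi> \<rightarrow>\<^sub>M borel"
   using Zsp_into_borel[of p q] mcong[OF s refl, of borel] by blast
  have "expect_from p q \<nu> ups \<psi> g \<pi> VX 0 = (\<integral>\<^sup>+z. ennreal (VX (fst z p)) \<partial>\<pi>)"
   using expect_from_eq[OF \<pi> VX_measurable, of 0] by simp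
  also have "... = (\<integral>\<^sup>+z. ennreal (VX (fst z p)) \<partial>distr \<pi> borel (%z. z))"
   by (rule nn_integral_distr[OF id, symmetric]) (use vm in simp)
  also have "... < \<infinity>"
   by (rule VX_expectation[OF borel_of_Zsp_prob[OF \<pi>] shift_invariant_iff[OF \<pi>, THEN iffD1, OF inv]])
  finally show ?thesis .
 qed
 show "(\<integral>\<^sup>+x. ennreal (VX x) \<partial>law_X0 P) < \<infinity>" if st: "is_stationary_solution_law p q \<nu> ups \<psi> g P"
 proof -
  note d = stationary_solution_eq(2,3)[OF st]
  have "distr P borel S1 \<in> space (prob_algebra borel)"
   using prob_space.prob_space_distr[OF drivenD(1,2)[OF d(1)]] by (simp add: space_prob_algebra)
  from VX_expectation[OF this d(2)] show ?thesis
   by (simp only: stationary_solution_expectation[OF st VX_measurable])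
 qed
qed

end

section \<open>From the model conditions to the stability hypotheses\<close>

lemma model_conditions_od_stable:
 fixes \<psi> :: "('x::polish_space, 'u::polish_space) upd"
 assumes pq: "1 <= p" "1 <= q" and od: "od_model p q \<nu> ups \<psi> g" and mc: "model_conditions p q \<nu> TY ups \<psi> g VX"
 shows "\<exists>h \<alpha> WX WU cW VU cV m b C. od_stable p q \<nu> ups \<psi> g h \<alpha> WX WU cW VX VU cV m b C"
proof -
 have A: "cond_A4 p q \<psi>" "cond_A6 p q \<nu> TY ups \<psi> g VX" "cond_A7 p q \<nu> \<psi> g" "cond_A8 p q \<nu> ups \<psi> g"
  using mc by (simp_all add: model_conditions_def)
 obtain \<alpha> WX :: "'x \<times> 'x => real" and WU :: "'u => real" and h c where
  \<alpha>m: "\<alpha> \<in> bm (borel \<Otimes>\<^sub>M borel)" and WXm: "WX \<in> bm (borel \<Otimes>\<^sub>M borel)" and WUm: "WU \<in> bm borel"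
  and \<alpha>: "!!w. 0 <= \<alpha> w" "!!w. \<alpha> w <= 1" and WX1: "!!w. 1 <= WX w"
  and h: "is_dkernel (borel \<Otimes>\<^sub>M borel) \<nu> h"
  and mino: "!!x x' y. y \<in> space \<nu> ==> \<alpha> (x, x') * h (x, x') y <= min (g x y) (g x' y)"
  and WXb: "!!x. locally_bdd (%x'. WX (x, x'))" and \<alpha>W: "!!x x'. 1 - \<alpha> (x, x') <= dist x x' * WX (x, x')"
  and c: "c = rel_sup (%w. \<integral>\<^sup>+y. ennreal (WU (ups y)) \<partial>dkernel \<nu> h w) WX" "c < \<infinity>"
  and alt: "(\<exists>l\<le>0. ((%\<zeta>::real. limsup (%n. ereal (1 / real n) *
            eln (SUP v\<in>space (Zsp p q) \<times> space (Zsp p q). coupled_expect p q \<nu> ups \<psi> h v WX n / epow (W_Z p q WX WU c v) \<zeta>))) \<longlongrightarrow> l) at_top) \<or>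
       (\<exists>L. (\<forall>n. ((%M::real. SUP v\<in>space (Zsp p q) \<times> space (Zsp p q). coupled_expect p q \<nu> ups \<psi> h v WX n / (ennreal M + W_Z p q WX WU c v)) \<longlongrightarrow> L n) at_top) & L \<longlonglongrightarrow> 0)"
  using A(4) unfolding cond_A8_def Let_def
  by (elim bexE exE conjE, intro that[OF _ _ _ _ _ _ _ _ _ _ refl])
   (assumption | (erule disjE, erule disjI1, erule conjE, erule disjI2) | (erule allE, erule conjunct1) | (erule allE, erule conjunct2)
    | erule spec | (erule allE, erule allE, erule bspec, assumption) | (erule allE, erule spec))+
 interpret A8: od_A8 p q \<nu> ups \<psi> g h \<alpha> WX
  by unfold_locales (fact pq od A(1) h \<alpha>m \<alpha> mino WXm WX1 WXb \<alpha>W)+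
 have U: "(\<integral>\<^sup>+y. ennreal (WU (ups y)) / c \<partial>dkernel \<nu> h w) <= ennreal (WX w)" for w
 proof -
  have upsm: "ups \<in> \<nu> \<rightarrow>\<^sub>M borel" using od by (simp add: od_model_def)
  have "(%y. ennreal (WU (ups y))) \<in> bm \<nu>" using upsm WUm by measurable
  then have "(%y. ennreal (WU (ups y))) \<in> bm (dkernel \<nu> h w)" by (simp add: dkernel_def)
  from nn_integral_divide[OF this, of c] show ?thesis
   using rel_sup_divide_le[of "%w. \<integral>\<^sup>+y. ennreal (WU (ups y)) \<partial>dkernel \<nu> h w" WX w] c by simp
 qed
 obtain VU cV m b C where D: "VU \<in> bm borel" "\<forall>x. (\<integral>\<^sup>+y. ennreal (VU (ups y)) / cV \<partial>dkernel \<nu> g x) <= ennreal (VX x)"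
  "0 < m" "0 <= (b::real)" "0 <= (C::real)"
  "\<forall>z. (A8.R ^^ m) (V_Z p q VX VU cV) z <= ennreal (1/2) * V_Z p q VX VU cV z + ennreal b"
  "\<forall>n\<ge>m. \<forall>z. (A8.R ^^ n) (%z. ennreal (VX (fst z p))) z <= ennreal C * (1 + V_Z p q VX VU cV z)"
  using A8.drift_A6[OF A(2)] by (elim exE conjE) (rule that)
 have VX: "VX \<in> bm borel" "!!M. 0 < M ==> compact {x. VX x <= M}" using A(2) by (auto simp: cond_A6_def)
 have g: "!!x y. y \<in> space \<nu> ==> 0 < g x y" using A(3) by (auto simp: cond_A7_def)
 have "od_stable p q \<nu> ups \<psi> g h \<alpha> WX WU c VX VU cV m b C"
  by unfold_locales (fact WUm U A8.moment_A8[OF WUm U alt] VX D g D[rule_format])+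
 then show ?thesis by blast
qed

lemma model_conditions_stationarity:
 fixes \<psi> :: "('x::polish_space, 'u::polish_space) upd"
 assumes pq: "1 <= p" "1 <= q" and od: "od_model p q \<nu> ups \<psi> g" and mc: "model_conditions p q \<nu> TY ups \<psi> g VX"
 shows "\<exists>!\<pi>. \<pi> \<in> space (prob_algebra (Zsp p q)) & shift_invariant p q \<nu> (model_law p q \<nu> ups \<psi> g \<pi>)"
  and "\<pi> \<in> space (prob_algebra (Zsp p q)) ==> shift_invariant p q \<nu> (model_law p q \<nu> ups \<psi> g \<pi>) ==>
   expect_from p q \<nu> ups \<psi> g \<pi> VX 0 < \<infinity>"
  and "\<exists>!P. is_stationary_solution_law p q \<nu> ups \<psi> g P"
  and "is_stationary_solution_law p q \<nu> ups \<psi> g P ==> (\<integral>\<^sup>+x. ennreal (VX x) \<partial>law_X0 P) < \<infinity>"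
proof -
 from model_conditions_od_stable[OF assms] obtain h \<alpha> WX WU cW VU cV m b C
  where S: "od_stable p q \<nu> ups \<psi> g h \<alpha> WX WU cW VX VU cV m b C" by (elim exE) (rule that)
 show "\<exists>!\<pi>. \<pi> \<in> space (prob_algebra (Zsp p q)) & shift_invariant p q \<nu> (model_law p q \<nu> ups \<psi> g \<pi>)"
  by (rule od_stable.stationarity(1)[OF S])
 show "expect_from p q \<nu> ups \<psi> g \<pi> VX 0 < \<infinity>" if "\<pi> \<in> space (prob_algebra (Zsp p q))" "shift_invariant p q \<nu> (model_law p q \<nu> ups \<psi> g \<pi>)"
  by (rule od_stable.stationarity(2)[OF S that])
 show "\<exists>!P. is_stationary_solution_law p q \<nu> ups \<psi> g P"
  by (rule od_stable.stationarity(3)[OF S])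
 show "(\<integral>\<^sup>+x. ennreal (VX x) \<partial>law_X0 P) < \<infinity>" if "is_stationary_solution_law p q \<nu> ups \<psi> g P"
  by (rule od_stable.stationarity(4)[OF S that])
qed

theorem theorem8:
  fixes p q :: nat
    and \<Theta> :: "'t::metric_space set"
    and \<nu> :: "'y measure"
    and TY :: "'y topology"
    and \<Upsilon> :: "'y \<Rightarrow> 'u::polish_space"
    and \<psi> :: "'t \<Rightarrow> ('x::polish_space, 'u) upd"
    and g :: "'t \<Rightarrow> 'x \<Rightarrow> 'y \<Rightarrow> real"
    and VX :: "'x \<Rightarrow> real"
  assumes "p \<ge> 1" and "q \<ge> 1" and "compact \<Theta>"
    and "compatible_topology \<nu> TY"
    and "\<And>\<theta>. \<theta> \<in> \<Theta> \<Longrightarrow> od_model p q \<nu> \<Upsilon> (\<psi> \<theta>) (g \<theta>)"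
  shows
    "(\<forall>\<theta>\<in>\<Theta>. model_conditions p q \<nu> TY \<Upsilon> (\<psi> \<theta>) (g \<theta>) VX \<longrightarrow>
        (\<exists>!\<pi>. \<pi> \<in> space (prob_algebra (Zsp p q)) \<and>
              shift_invariant p q \<nu> (model_law p q \<nu> \<Upsilon> (\<psi> \<theta>) (g \<theta>) \<pi>)) \<and>
        (\<forall>\<pi> \<in> space (prob_algebra (Zsp p q)).
              shift_invariant p q \<nu> (model_law p q \<nu> \<Upsilon> (\<psi> \<theta>) (g \<theta>) \<pi>) \<longrightarrow>
              expect_from p q \<nu> \<Upsilon> (\<psi> \<theta>) (g \<theta>) \<pi> VX 0 < \<infinity>)) \<and>
     ((\<forall>\<theta>\<in>\<Theta>. model_conditions p q \<nu> TY \<Upsilon> (\<psi> \<theta>) (g \<theta>) VX) \<longrightarrow>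
        (\<forall>\<theta>\<in>\<Theta>.
           (\<exists>!P. is_stationary_solution_law p q \<nu> \<Upsilon> (\<psi> \<theta>) (g \<theta>) P) \<and>
           (\<forall>P. is_stationary_solution_law p q \<nu> \<Upsilon> (\<psi> \<theta>) (g \<theta>) P \<longrightarrow>
                (\<integral>\<^sup>+x. ennreal (VX x) \<partial>law_X0 P) < \<infinity>)))"
proof (intro conjI ballI impI allI)
  note R = model_conditions_stationarity[OF assms(1,2) assms(5)]
  fix \<theta> assume \<theta>: "\<theta> \<in> \<Theta>"
  show "\<exists>!\<pi>. \<pi> \<in> space (prob_algebra (Zsp p q)) \<and> shift_invariant p q \<nu> (model_law p q \<nu> \<Upsilon> (\<psi> \<theta>) (g \<theta>) \<pi>)"
    if "model_conditions p q \<nu> TY \<Upsilon> (\<psi> \<theta>) (g \<theta>) VX"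
    by (rule R(1)[OF \<theta> that])
  show "expect_from p q \<nu> \<Upsilon> (\<psi> \<theta>) (g \<theta>) \<pi> VX 0 < \<infinity>"
    if "model_conditions p q \<nu> TY \<Upsilon> (\<psi> \<theta>) (g \<theta>) VX" "\<pi> \<in> space (prob_algebra (Zsp p q))"
      "shift_invariant p q \<nu> (model_law p q \<nu> \<Upsilon> (\<psi> \<theta>) (g \<theta>) \<pi>)" for \<pi>
    by (rule R(2)[OF \<theta> that])
  assume mc: "\<forall>\<theta>\<in>\<Theta>. model_conditions p q \<nu> TY \<Upsilon> (\<psi> \<theta>) (g \<theta>) VX"
  show "\<exists>!P. is_stationary_solution_law p q \<nu> \<Upsilon> (\<psi> \<theta>) (g \<theta>) P"
    by (rule R(3)[OF \<theta> bspec[OF mc \<theta>]])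
  show "(\<integral>\<^sup>+x. ennreal (VX x) \<partial>law_X0 P) < \<infinity>" if "is_stationary_solution_law p q \<nu> \<Upsilon> (\<psi> \<theta>) (g \<theta>) P" for P
    by (rule R(4)[OF \<theta> bspec[OF mc \<theta>] that])
qed

end
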